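(* Let $d\ge2$ and $s>0$. The estimate $$\big\||\square|^{\frac{2-d}{4}}|e^{it\phi_s(D)}f|^2\big\|_{L^2(\mathbb{R}^{d+1})}\le C\,\|\phi_s(D)^{\frac12} f\|_{L^2(\mathbb R^d)}^2$$ holds with the optimal constant $$C=\left(\frac{2^{-d+1}\pi^{\frac{-d+2}{2}}}{s\,\Gamma(\frac d2)}\right)^{\frac12},$$ but there are no extremisers. Furthermore, we have the refined Strichartz estimate $$\big\||\square|^{\frac{4-d}{4}}|e^{it\phi_s(D)}f|^2\big\|_{L^2(\mathbb{R}^{d+1})}\le\left(\frac{2^{-d+1}\pi^{\frac{-d+2}{2}}}{s\,\Gamma(\frac{d+2}{2})}\right)^{\frac12}\left(\|\phi_s(D)f\|_{L^2(\mathbb R^d)}^4-s^2\|\phi_s(D)^{\frac12}f\|_{L^2(\mathbb R^d)}^4\right)^{\frac12},$$ where the constant is optimal and there are no extremisers.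
   Context: For $s>0$ and $r\ge0$, $\phi_s(r)=\sqrt{s^2+r^2}$. Spatial Fourier transform: $\widehat f(\xi)=\int_{\mathbb R^d}e^{-ix\cdot\xi}f(x)\,\mathrm dx$. $D=\sqrt{-\Delta_x}$; $\phi_s(D)^\alpha$ is the Fourier multiplier with symbol $\phi_s(|\xi|)^\alpha$; the Klein--Gordon propagator is $e^{it\phi_s(D)}f(x)=(2\pi)^{-d}\int_{\mathbb R^d}e^{i(x\cdot\xi+t\phi_s(|\xi|))}\widehat f(\xi)\,\mathrm d\xi$. The operator $|\square|^\beta$ is the space-time Fourier multiplier with symbol $\big|\tau^2-|\xi|^2\big|^\beta$, $(\tau,\xi)$ dual to $(t,x)\in\mathbb R\times\mathbb R^d$. $f$ ranges over functions for which the right-hand side is finite. An extremiser is a non-trivial (not a.e. zero) $f$ attaining equality with the optimal constant. $\Gamma$ is the gamma function. *)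

theory Defs
  imports "HOL-Analysis.Analysis"
begin

text \<open>
  Elements of L2 are represented by Borel functions; L2 spaces and norms are taken with respect to
  Lebesgue measure.  Space-time is the Euclidean space of type \<open>real \<times> 'a\<close>, whose inner product
  is \<open>(t, x) \<bullet> (\<tau>, \<xi>) = t * \<tau> + x \<bullet> \<xi>\<close>, so the definitions on a general
  Euclidean space below serve both for functions of x and for functions of (t, x).
\<close>

definition in_L2 :: "('a::euclidean_space \<Rightarrow> complex) \<Rightarrow> bool" where
  "in_L2 f \<longleftrightarrow> f \<in> borel_measurable borel \<and> integrable lborel (\<lambda>x. (cmod (f x))\<^sup>2)"

definition L2_norm :: "('a::euclidean_space \<Rightarrow> complex) \<Rightarrow> real" where
  "L2_norm f = sqrt (LINT x|lborel. (cmod (f x))\<^sup>2)"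

fun iterated_partial ::
    "'a::euclidean_space list \<Rightarrow> ('a \<Rightarrow> complex) \<Rightarrow> 'a \<Rightarrow> complex" where
  "iterated_partial [] f = f"
| "iterated_partial (b # bs) f = (\<lambda>x. frechet_derivative (iterated_partial bs f) (at x) b)"

definition schwartz :: "('a::euclidean_space \<Rightarrow> complex) \<Rightarrow> bool" where
  "schwartz f \<longleftrightarrow> (\<forall>bs \<in> lists Basis.
     (\<forall>x. iterated_partial bs f differentiable at x) \<and>
     (\<forall>k::nat. bounded (range (\<lambda>x. norm x ^ k *\<^sub>R iterated_partial bs f x))))"

definition fourier_integral ::
    "('a::euclidean_space \<Rightarrow> complex) \<Rightarrow> 'a \<Rightarrow> complex" where
  "fourier_integral f \<xi> = (LINT x|lborel. exp (- (\<i> * of_real (x \<bullet> \<xi>))) * f x)"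

text \<open>
  The Fourier integral does not converge for general L2 functions, nor for the space-time
  functions occurring here, so the Fourier transform is extended as usual by duality with
  Schwartz functions: g is the Fourier transform of f as a tempered distribution.  It
  is determined by f up to null sets, and is \<open>fourier_integral f\<close> for integrable f.
\<close>

definition is_fourier_transform ::
    "('a::euclidean_space \<Rightarrow> complex) \<Rightarrow> ('a \<Rightarrow> complex) \<Rightarrow> bool" where
  "is_fourier_transform f g \<longleftrightarrow>
     f \<in> borel_measurable borel \<and> g \<in> borel_measurable borel \<and>
     (\<forall>\<psi>. schwartz \<psi> \<longrightarrow>
        integrable lborel (\<lambda>\<xi>. g \<xi> * \<psi> \<xi>) \<and>
        integrable lborel (\<lambda>x. f x * fourier_integral \<psi> x) \<and>
        (LINT \<xi>|lborel. g \<xi> * \<psi> \<xi>) = (LINT x|lborel. f x * fourier_integral \<psi> x))"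

definition is_multiplier_image ::
    "('a::euclidean_space \<Rightarrow> complex) \<Rightarrow> ('a \<Rightarrow> complex) \<Rightarrow> ('a \<Rightarrow> complex) \<Rightarrow> bool" where
  "is_multiplier_image m f h \<longleftrightarrow>
     (\<exists>g. is_fourier_transform f g \<and> is_fourier_transform h (\<lambda>\<xi>. m \<xi> * g \<xi>))"

text \<open>
  The multiplier operator with symbol m as an operator with values in L2.  Its value is
  meaningful (and then unique up to null sets) only on the domain \<open>multiplier_dom m\<close>, that is,
  where the L2 norm of the image is finite.
\<close>

definition multiplier_dom ::
    "('a::euclidean_space \<Rightarrow> complex) \<Rightarrow> ('a \<Rightarrow> complex) \<Rightarrow> bool" where
  "multiplier_dom m f \<longleftrightarrow> (\<exists>h. in_L2 h \<and> is_multiplier_image m f h)"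

definition multiplier ::
    "('a::euclidean_space \<Rightarrow> complex) \<Rightarrow> ('a \<Rightarrow> complex) \<Rightarrow> 'a \<Rightarrow> complex" where
  "multiplier m f = (SOME h. in_L2 h \<and> is_multiplier_image m f h)"

definition phi :: "real \<Rightarrow> real \<Rightarrow> real" where
  "phi s r = sqrt (s\<^sup>2 + r\<^sup>2)"

definition phi_symbol :: "real \<Rightarrow> real \<Rightarrow> 'a::euclidean_space \<Rightarrow> complex" where
  "phi_symbol s \<alpha> \<xi> = of_real (phi s (norm \<xi>) powr \<alpha>)"

text \<open>
  On the light cone, a null set, the value of \<open>powr\<close> at 0 is irrelevant.
\<close>

definition box_symbol :: "real \<Rightarrow> real \<times> 'a::euclidean_space \<Rightarrow> complex" where
  "box_symbol \<beta> = (\<lambda>(\<tau>, \<xi>). of_real (\<bar>\<tau>\<^sup>2 - (norm \<xi>)\<^sup>2\<bar> powr \<beta>))"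

text \<open>
  u is a Borel representative on space-time of the Klein--Gordon propagation of f:
  at each time t, the spatial Fourier transform of u(t, .) is that of f times
  \<open>exp (\<i> * t * phi s (norm \<xi>))\<close>, which is the defining oscillatory integral read for
  L2 functions.
\<close>

definition is_klein_gordon ::
    "real \<Rightarrow> ('a::euclidean_space \<Rightarrow> complex) \<Rightarrow> (real \<times> 'a \<Rightarrow> complex) \<Rightarrow> bool" where
  "is_klein_gordon s f u \<longleftrightarrow> u \<in> borel_measurable borel \<and>
     (\<forall>t. is_multiplier_image (\<lambda>\<xi>. exp (\<i> * of_real (t * phi s (norm \<xi>)))) f (\<lambda>x. u (t, x)))"

definition klein_gordon ::
    "real \<Rightarrow> ('a::euclidean_space \<Rightarrow> complex) \<Rightarrow> real \<times> 'a \<Rightarrow> complex" where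
  "klein_gordon s f = (SOME u. is_klein_gordon s f u)"

definition kg_density ::
    "real \<Rightarrow> ('a::euclidean_space \<Rightarrow> complex) \<Rightarrow> real \<times> 'a \<Rightarrow> complex" where
  "kg_density s f z = of_real ((cmod (klein_gordon s f z))\<^sup>2)"

end

theory Submission
  imports Defs "HOL-Probability.Probability"
begin

text \<open>
  Let F be the Fourier transform of f and write E for the energy, phi_s(|eta|).  The Fourier transform of
  |u|^2 at (tau, xi) is, up to a constant, the integral of F(eta) cnj (F(eta - xi)) over the fibre
  E(eta) - E(eta - xi) = tau, which is non-empty only for |tau| < |xi|.  The Cauchy--Schwarz
  inequality on this fibre, applied to F(eta) and F(eta - xi) separately, bounds the square of the
  left-hand side by an integral over pairs of points (eta, eta') of the same fibre.  In the variables
  a = eta, b = eta' - xi this integral becomes the integral of E(a)|F(a)|^2 E(b)|F(b)|^2 against an explicit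
  kernel, which is computed by passing to the centre-of-mass frame of the two particles a and b.
  The kernel is a constant divided by the invariant mass of the pair (times the squared relative
  momentum for the second estimate).  The invariant mass is at least 2s, with equality only for
  a = b; this gives both estimates and excludes extremisers.

  For F = exp (- n E) the conservation law E(eta) + E(eta' - xi) = E(eta') + E(eta - xi) makes the
  Cauchy--Schwarz step lossless up to the factor E(eta') E(eta - xi) >= s^2, and as n grows the mass
  concentrates at the origin, where the invariant mass tends to 2s.  So the constants are optimal.
\<close>

section \<open>Lebesgue integration on Euclidean spaces\<close>

text \<open>The split in the Cauchy-Schwarz step is dictated by Lorentz invariance. The fibre
  measure is E(eta) E(eta - xi) times an invariant weight; one energy goes to each factor, so that
  E^2 |F|^2 stands at both points, and one power of each energy is absorbed by the invariant measure
  da/E(a) db/E(b). What remains as kernel depends on the invariant mass alone, but only after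
  averaging over the direction of xi.

  The fibres are hypersurfaces varying with (tau, xi). They are parametrised over the hyperplane
  orthogonal to xi; integrals over hyperplanes and spheres are written as Lebesgue integrals that
  average over a redundant variable, so that exchanging them is Tonelli's theorem.

  As |u|^2 is only known to be integrable in x at each time, its Fourier transform is identified by
  testing against Schwartz functions.

  In the second estimate the squared relative momentum is (E(a) E(b) - a.b - s^2)/2. Integrated over
  pairs, its terms give the two fourth powers of norms and the square of a total momentum; the
  latter is dropped in the upper bound and vanishes for even F, so the constant stays sharp.\<close>

abbreviation lborel_nn_integral :: "('a::euclidean_space \<Rightarrow> ennreal) \<Rightarrow> ennreal" (binder "NN " 10) where
  "NN x. f x \<equiv> nn_integral lborel f"

abbreviation lborel_integral :: "('a::euclidean_space \<Rightarrow> 'b::{banach, second_countable_topology}) \<Rightarrow> 'b" (binder "LB " 10) where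
  "LB x. f x \<equiv> integral\<^sup>L lborel f"

abbreviation lborel2 :: "('a::euclidean_space \<times> 'b::euclidean_space) measure" where
  "lborel2 \<equiv> lborel \<Otimes>\<^sub>M lborel"

abbreviation borel_fun :: "('a::topological_space \<Rightarrow> 'b::topological_space) \<Rightarrow> bool" where
  "borel_fun f \<equiv> f \<in> borel_measurable borel"

abbreviation nsq :: "complex \<Rightarrow> real" where
  "nsq z \<equiv> (cmod z)\<^sup>2"

abbreviation L2sq :: "('a::euclidean_space \<Rightarrow> complex) \<Rightarrow> ennreal" where
  "L2sq f \<equiv> (NN x. ennreal (nsq (f x)))"

lemmas LB_cong = Bochner_Integration.integral_cong[OF refl]
lemmas integrable_dominated = Bochner_Integration.integrable_bound

lemma measurable_uncurry:
  assumes "case_prod H \<in> borel_measurable (borel \<Otimes>\<^sub>M borel)" "f \<in> borel_measurable N" "g \<in> borel_measurable N"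
  shows "(\<lambda>x. H (f x) (g x)) \<in> borel_measurable N"
  using measurable_compose[OF measurable_Pair[OF assms(2,3)] assms(1)] by simp

lemma nn_integral_cong_nonzero:
  assumes "\<And>x::'a::euclidean_space. x \<noteq> 0 \<Longrightarrow> f x = g x"
  shows "(NN x. f x) = (NN x. g x)"
  using AE_lborel_singleton[of "0::'a"] by (intro nn_integral_cong_AE) (auto elim!: eventually_mono intro: assms)

section \<open>Lebesgue measure under translations, dilations and coordinate products\<close>

lemma nn_integral_lborel_shift:
  fixes f :: "'a::euclidean_space \<Rightarrow> ennreal"
  assumes [measurable]: "borel_fun f"
  shows "(NN x. f (c + x)) = (NN x. f x)"
proof -
  have "(NN x. f x) = (\<integral>\<^sup>+x. f x \<partial>distr lborel borel ((+) c))"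
    by (simp add: lborel_distr_plus)
  also have "\<dots> = (NN x. f (c + x))"
    by (subst nn_integral_distr) auto
  finally show ?thesis ..
qed

lemma nn_integral_lborel_scale:
  fixes f :: "'a::euclidean_space \<Rightarrow> ennreal"
  assumes [measurable]: "borel_fun f" and c: "c \<noteq> 0"
  shows "(NN x. f x) = ennreal (\<bar>c\<bar> ^ DIM('a)) * (NN x. f (c *\<^sub>R x))"
proof -
  have "(NN x. f x)
    = (\<integral>\<^sup>+x. f x \<partial>density (distr lborel borel (\<lambda>x. 0 + c *\<^sub>R x)) (\<lambda>_. \<bar>c\<bar> ^ DIM('a)))"
    using lborel_affine[OF c, of "0::'a"] by (rule arg_cong)
  also have "\<dots> = ennreal (\<bar>c\<bar> ^ DIM('a)) * (NN x. f (c *\<^sub>R x))"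
    by (simp add: nn_integral_density nn_integral_distr nn_integral_cmult)
  finally show ?thesis .
qed

lemma nn_integral_lborel_uminus:
  fixes f :: "'a::euclidean_space \<Rightarrow> ennreal"
  assumes "borel_fun f"
  shows "(NN x. f (- x)) = (NN x. f x)"
  using nn_integral_lborel_scale[OF assms, of "-1"] by simp

lemma lborel_distr_uminus_euclidean: "distr lborel borel uminus = (lborel :: 'a::euclidean_space measure)"
  by (subst (2) lborel_affine[of "-1" 0]) (auto simp: density_1)

lemma integrable_lborel_shift:
  fixes f :: "'a::euclidean_space \<Rightarrow> 'b::{banach, second_countable_topology}"
  assumes "integrable lborel f"
  shows "integrable lborel (\<lambda>x. f (c + x))"
proof -
  have "integrable (distr lborel borel ((+) c)) f"
    using assms by (simp add: lborel_distr_plus)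
  then show ?thesis by (subst (asm) integrable_distr_eq) (use assms in auto)
qed

lemma integral_lborel_shift:
  assumes [measurable]: "borel_fun f"
  shows "(LB x. f (c + x)) = (LB x. f x)"
proof -
  have "(LB x. f x) = (LINT x|distr lborel borel ((+) c). f x)"
    by (simp add: lborel_distr_plus)
  then show ?thesis by (subst (asm) integral_distr) auto
qed

lemma integrable_lborel_uminus:
  fixes f :: "'a::euclidean_space \<Rightarrow> 'b::{banach, second_countable_topology}"
  assumes "integrable lborel f"
  shows "integrable lborel (\<lambda>x. f (- x))"
proof -
  have "integrable (distr lborel borel uminus) f"
    using assms by (simp add: lborel_distr_uminus_euclidean)
  then show ?thesis by (subst (asm) integrable_distr_eq) (use assms in auto)
qed

lemma integral_lborel_uminus:
  assumes [measurable]: "borel_fun f"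
  shows "(LB x. f (- x)) = (LB x. f x)"
proof -
  have "(LB x. f x) = (LINT x|distr lborel borel uminus. f x)"
    by (simp add: lborel_distr_uminus_euclidean)
  then show ?thesis by (subst (asm) integral_distr) auto
qed

lemma integral_lborel_scale:
  fixes f :: "'a::euclidean_space \<Rightarrow> 'b::{banach, second_countable_topology}"
  assumes [measurable]: "borel_fun f" and c: "c \<noteq> 0"
  shows "(LB x. f x) = (\<bar>c\<bar> ^ DIM('a)) *\<^sub>R (LB x. f (c *\<^sub>R x))"
proof -
  have "(LB x. f x)
    = (LINT x|density (distr lborel borel (\<lambda>x. 0 + c *\<^sub>R x)) (\<lambda>_. \<bar>c\<bar> ^ DIM('a)). f x)"
    using lborel_affine[OF c, of "0::'a"] by (rule arg_cong)
  also have "\<dots> = (\<bar>c\<bar> ^ DIM('a)) *\<^sub>R (LB x. f (c *\<^sub>R x))"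
    by (subst integral_density) (auto simp: integral_distr)
  finally show ?thesis .
qed

lemma lborel_eq_PiM_distr:
  "(lborel :: 'a::euclidean_space measure)
    = distr (\<Pi>\<^sub>M b\<in>(Basis::'a set). (lborel::real measure)) borel (\<lambda>f. \<Sum>b\<in>Basis. f b *\<^sub>R b)"
  by (rule lborel_eq)

interpretation PL: product_sigma_finite "\<lambda>b. (lborel :: real measure)" ..

lemma integrable_lborel_prod_Basis:
  fixes f :: "'a::euclidean_space \<Rightarrow> real \<Rightarrow> 'b::{real_normed_field, banach, second_countable_topology}"
  assumes "\<And>b. b \<in> Basis \<Longrightarrow> integrable lborel (f b)"
  shows "integrable lborel (\<lambda>x::'a. \<Prod>b\<in>Basis. f b (x \<bullet> b))"
proof -
  have [measurable]: "\<And>b. b \<in> Basis \<Longrightarrow> f b \<in> borel_measurable borel"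
    using assms by auto
  have "integrable (Pi\<^sub>M (Basis::'a set) (\<lambda>b. (lborel :: real measure))) (\<lambda>x. \<Prod>b\<in>Basis. f b (x b))"
    using assms by (intro PL.product_integrable_prod) auto
  then show ?thesis
    by (subst lborel_eq_PiM_distr) (simp add: integrable_distr_eq)
qed

lemma integral_lborel_prod_Basis:
  fixes f :: "'a::euclidean_space \<Rightarrow> real \<Rightarrow> 'b::{real_normed_field, banach, second_countable_topology}"
  assumes "\<And>b. b \<in> Basis \<Longrightarrow> integrable lborel (f b)"
  shows "(LB x. (\<Prod>b\<in>Basis. f b (x \<bullet> b))) = (\<Prod>b\<in>Basis. (LB t. f b t))"
proof -
  have [measurable]: "\<And>b. b \<in> Basis \<Longrightarrow> f b \<in> borel_measurable borel"
    using assms by auto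
  show ?thesis
    using assms
    by (subst lborel_eq_PiM_distr) (simp add: integral_distr PL.product_integral_prod)
qed

lemma norm_minus_inner_le: "b \<in> Basis \<Longrightarrow> 1 + (x \<bullet> b)\<^sup>2 \<le> (1 + norm (x::'a::euclidean_space))\<^sup>2"
proof -
  assume "b \<in> Basis"
  then have "(x \<bullet> b)\<^sup>2 \<le> (norm x)\<^sup>2"
    using Basis_le_norm[of b x] by (metis abs_le_square_iff abs_norm_cancel)
  moreover have "(1 + norm x)\<^sup>2 = 1 + (norm x)\<^sup>2 + 2 * norm x"
    by (simp add: power2_eq_square algebra_simps)
  ultimately show ?thesis using norm_ge_zero[of x] by linarith
qed

lemma integrable_inverse_1_plus_square:
  "integrable lborel (\<lambda>t::real. 1 / (1 + t\<^sup>2))"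
proof -
  have *: "set_integrable lborel (einterval (-\<infinity>) \<infinity>) (\<lambda>t. 1 / (1 + t\<^sup>2))"
  proof (rule interval_integral_FTC_nonneg(1)[where F=arctan and A="-(pi/2)" and B="pi/2"])
    show "((arctan \<circ> real_of_ereal) \<longlongrightarrow> - (pi/2)) (at_right (-\<infinity>))"
      unfolding ereal_tendsto_simps using tendsto_arctan_at_bot by auto
    show "((arctan \<circ> real_of_ereal) \<longlongrightarrow> pi/2) (at_left \<infinity>)"
      unfolding ereal_tendsto_simps using tendsto_arctan_at_top by auto
    show "DERIV arctan x :> 1 / (1 + x\<^sup>2)" for x
      using DERIV_arctan[of x] by (simp add: inverse_eq_divide)
    show "isCont (\<lambda>t. 1 / (1 + t\<^sup>2)) x" for x :: real
      by (intro continuous_intros) (smt (verit) zero_le_power2)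
  qed auto
  then show ?thesis by (simp add: set_integrable_def)
qed

text \<open>Since 1 + x_b^2 <= (1 + |x|)^2 in every coordinate, the product of the integrable
  functions 1/(1 + x_b^2) dominates. This is the origin of the exponent \<open>2 * DIM('a)\<close>
  that serves as decay rate below.\<close>

lemma integrable_inverse_1_plus_norm:
  assumes "n \<ge> 2 * DIM('a)"
  shows "integrable lborel (\<lambda>x::'a::euclidean_space. 1 / (1 + norm x) ^ n)"
proof (rule integrable_dominated)
  show "integrable lborel (\<lambda>x::'a. \<Prod>b\<in>Basis. 1 / (1 + (x \<bullet> b)\<^sup>2))"
    using integrable_lborel_prod_Basis[of "\<lambda>_ t. 1 / (1 + t\<^sup>2)"] integrable_inverse_1_plus_square
    by blast
  show "AE x in lborel. norm (1 / (1 + norm x) ^ n) \<le> norm (\<Prod>b\<in>Basis. 1 / (1 + ((x::'a) \<bullet> b)\<^sup>2))" (is "AE x in _. ?P x")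
  proof (rule AE_I2)
    fix x :: 'a
    have "(\<Prod>b\<in>Basis. 1 + (x \<bullet> b)\<^sup>2) \<le> (\<Prod>b\<in>(Basis::'a set). (1 + norm x)\<^sup>2)"
      by (intro prod_mono) (auto simp: norm_minus_inner_le)
    also have "\<dots> = (1 + norm x) ^ (2 * DIM('a))"
      by (simp add: power_mult)
    also have "\<dots> \<le> (1 + norm x) ^ n"
      using assms by (intro power_increasing) auto
    finally have le: "(\<Prod>b\<in>Basis. 1 + (x \<bullet> b)\<^sup>2) \<le> (1 + norm x) ^ n" .
    have "(\<Prod>b\<in>Basis. 1 + (x \<bullet> b)\<^sup>2) > 0"
      by (intro prod_pos) (auto simp: add_pos_nonneg)
    then show "?P x"
      using le by (simp add: prod_dividef frac_le abs_prod add_pos_nonneg)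
  qed
qed simp

section \<open>Monotone substitution on the real line\<close>

lemma range_nondecreasing_eq_UN:
  fixes g g' :: "real \<Rightarrow> real"
  assumes deriv: "\<And>x. (g has_real_derivative g' x) (at x)" and nonneg: "\<And>x. g' x \<ge> 0"
  shows "mono g" and "range g = (\<Union>n. {g (- real n)..g (real n)})"
proof -
  show mono: "mono g"
  proof (rule monoI)
    fix x y :: real assume "x \<le> y"
    then show "g x \<le> g y"
      using deriv nonneg by (intro DERIV_nonneg_imp_nondecreasing[of x y g]) blast+
  qed
  show range_eq: "range g = (\<Union>n. {g (- real n)..g (real n)})"
  proof (intro set_eqI iffI)
    fix y assume "y \<in> range g"
    then obtain x where y: "y = g x" by auto
    obtain n where "\<bar>x\<bar> \<le> real n" using real_arch_simple by blast
    then show "y \<in> (\<Union>n. {g (- real n)..g (real n)})"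
      unfolding y by (intro UN_I[of n]) (auto intro!: monoD[OF mono])
  next
    fix y assume "y \<in> (\<Union>n. {g (- real n)..g (real n)})"
    then obtain n where n: "g (- real n) \<le> y" "y \<le> g (real n)" by auto
    then have "\<exists>x\<ge>- real n. x \<le> real n \<and> g x = y"
      by (intro IVT) (use deriv DERIV_isCont in auto)
    then show "y \<in> range g" by auto
  qed
qed

text \<open>Substitution on [-n, n] followed by monotone convergence in n. The range of g may be a
  bounded interval, as for tanh, so the image is Lebesgue measure restricted to
  \<open>range g\<close>, which the intervals [g(-n), g(n)] exhaust.\<close>

lemma lborel_substitution:
  fixes g g' :: "real \<Rightarrow> real"
  assumes deriv: "\<And>x. (g has_real_derivative g' x) (at x)"
    and cont: "continuous_on UNIV g'" and nonneg: "\<And>x. g' x \<ge> 0" 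
  shows "distr (density lborel (\<lambda>x. ennreal (g' x))) borel g
    = density lborel (indicator (range g))"
proof (rule measure_eqI)
  have contg: "continuous_on UNIV g"
    using deriv by (auto intro!: continuous_at_imp_continuous_on DERIV_isCont)
  have [measurable]: "borel_fun g" "borel_fun g'"
    using contg cont by (auto intro: borel_measurable_continuous_onI)
  have mono: "mono g" and range_eq: "range g = (\<Union>n. {g (- real n)..g (real n)})"
    using range_nondecreasing_eq_UN[OF deriv nonneg] by auto
  from range_eq have [measurable]: "range g \<in> sets borel" by simp
  fix A assume "A \<in> sets (distr (density lborel (\<lambda>x. ennreal (g' x))) borel g)"
  then have [measurable]: "A \<in> sets borel" by simp
  have inc1: "incseq (\<lambda>n. {g (- real n)..g (real n)})"
  proof (rule incseq_SucI)
    fix n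
    have "g (- real (Suc n)) \<le> g (- real n)" "g (real n) \<le> g (real (Suc n))"
      by (auto intro!: monoD[OF mono])
    then show "{g (- real n)..g (real n)} \<le> {g (- real (Suc n))..g (real (Suc n))}"
      by auto
  qed
  have [measurable]: "g -` A \<in> sets borel"
    using measurable_sets[of g borel borel A] by simp
  have step: "(NN x. indicator A x * indicator {g (- real n)..g (real n)} x)
    = (NN x. indicator A (g x) * ennreal (g' x) * indicator {- real n..real n} x)" for n
  proof -
    have "(NN x. ennreal (indicator A x * indicator {g (- real n)..g (real n)} x))
      = (NN x. ennreal (indicator A (g x) * g' x * indicator {- real n..real n} x))"
      by (rule nn_integral_substitution)
         (use deriv nonneg continuous_on_subset[OF cont] in \<open>auto simp: set_borel_measurable_def\<close>)
    then show ?thesis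
      by (simp add: ennreal_mult ennreal_indicator nonneg)
  qed
  have "emeasure (density lborel (indicator (range g))) A
    = (NN x. (SUP n. indicator A x * indicator {g (- real n)..g (real n)} x))"
  proof (subst emeasure_density; (intro nn_integral_cong)?)
    fix x
    have "x \<in> {g (- real n)..g (real n)} \<Longrightarrow> x \<in> range g" for n
      using range_eq by blast
    moreover have "\<exists>n. x \<in> {g (- real n)..g (real n)}" if "x \<in> range g"
      using that range_eq by blast
    ultimately show "indicator (range g) x * indicator A x
      = (SUP n. indicator A x * (indicator {g (- real n)..g (real n)} x :: ennreal))"
    proof (cases "x \<in> range g")
      case True
      then obtain n where "x \<in> {g (- real n)..g (real n)}"
        using \<open>x \<in> range g \<Longrightarrow> \<exists>n. x \<in> {g (- real n)..g (real n)}\<close> by blast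
      with True show ?thesis
        by (intro antisym SUP_least SUP_upper2[of n]) (auto split: split_indicator)
    next
      case False
      then have "x \<notin> {g (- real n)..g (real n)}" for n
        using \<open>\<And>n. x \<in> {g (- real n)..g (real n)} \<Longrightarrow> x \<in> range g\<close> by blast
      with False show ?thesis by simp
    qed
  qed auto
  also have "\<dots> = (SUP n. NN x. indicator A x * indicator {g (- real n)..g (real n)} x)"
  proof (intro nn_integral_monotone_convergence_SUP)
    have "{g (- real m)..g (real m)} \<subseteq> {g (- real n)..g (real n)}" if "m \<le> n" for m n
      using inc1 that by (simp add: incseq_def del: atLeastatMost_subset_iff)
    then show "incseq (\<lambda>n x. indicator A x * indicator {g (- real n)..g (real n)} x :: ennreal)"
      unfolding incseq_def le_fun_def
      by (intro allI impI mult_left_mono indicator_leI) (blast, simp)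
  qed measurable
  also have "\<dots> = (SUP n. NN x. indicator A (g x) * ennreal (g' x) * indicator {- real n..real n} x)"
    by (simp add: step)
  also have "\<dots> = (NN x. (SUP n. indicator A (g x) * ennreal (g' x) * indicator {- real n..real n} x))"
    by (intro nn_integral_monotone_convergence_SUP[symmetric])
      (auto simp: incseq_def le_fun_def intro!: mult_left_mono split: split_indicator)
  also have "\<dots> = (NN x. indicator A (g x) * ennreal (g' x))" (is "(NN x. ?f x) = (NN x. ?g x)")
  proof (intro nn_integral_cong)
    fix x :: real
    obtain n where n: "\<bar>x\<bar> \<le> real n" using real_arch_simple by blast
    show "?f x = ?g x"
      by (intro antisym SUP_least SUP_upper2[of n])
         (use n in \<open>auto split: split_indicator\<close>)
  qed
  also have "\<dots> = emeasure (distr (density lborel (\<lambda>x. ennreal (g' x))) borel g) A"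
    by (simp add: emeasure_distr emeasure_density)
       (auto intro!: nn_integral_cong split: split_indicator)
  finally show "emeasure (distr (density lborel (\<lambda>x. ennreal (g' x))) borel g) A
    = emeasure (density lborel (indicator (range g))) A" ..
qed simp

lemma nn_integral_lborel_substitution:
  fixes g g' :: "real \<Rightarrow> real"
  assumes deriv: "\<And>x. (g has_real_derivative g' x) (at x)"
    and cont: "continuous_on UNIV g'" and nonneg: "\<And>x. g' x \<ge> 0"
    and [measurable]: "borel_fun h"
  shows "(NN x. h (g x) * ennreal (g' x)) = (NN y. h y * indicator (range g) y)"
proof -
  have contg: "continuous_on UNIV g"
    using deriv by (auto intro!: continuous_at_imp_continuous_on DERIV_isCont)
  have [measurable]: "borel_fun g" "borel_fun g'"
    using contg cont by (auto intro: borel_measurable_continuous_onI)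
  have [measurable]: "range g \<in> sets borel"
    unfolding range_nondecreasing_eq_UN(2)[OF deriv nonneg] by simp
  have "(NN x. h (g x) * ennreal (g' x))
    = (\<integral>\<^sup>+y. h y \<partial>distr (density lborel (\<lambda>x. ennreal (g' x))) borel g)"
    by (simp add: nn_integral_distr nn_integral_density mult.commute)
  also have "\<dots> = (NN y. h y * indicator (range g) y)"
    by (simp add: lborel_substitution[OF deriv cont nonneg] nn_integral_density mult.commute)
  finally show ?thesis .
qed

section \<open>Integration along lines and in polar coordinates\<close>

definition theta :: "real \<Rightarrow> real" where
  "theta t = indicat_real {-(1/2)..1/2} t"

lemma theta_measurable [measurable]: "borel_fun theta"
  unfolding theta_def by measurable

lemma theta_nonneg [simp]: "theta t \<ge> 0"
  by (simp add: theta_def)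

lemma theta_minus [simp]: "theta (- t) = theta t"
  by (auto simp: theta_def split: split_indicator)

lemma nn_integral_theta_shift: "(NN x. ennreal (theta (c - x))) = 1"
proof -
  have "(NN x. ennreal (theta (c - x))) = (NN x. indicator {c-1/2..c+1/2} x)"
    by (intro nn_integral_cong) (auto simp: theta_def split: split_indicator)
  then show ?thesis by simp
qed

text \<open>Integration over the hyperplane orthogonal to w and along w. The inner integral depends
  only on the component of eta orthogonal to w, and \<open>theta\<close> has integral 1 in the
  direction of w, so the outer Lebesgue integral is one over the hyperplane. In the proof a shift of
  eta along w moves x from H into \<open>theta\<close>, where it is integrated out.\<close>

lemma nn_integral_line:
  fixes H :: "'a::euclidean_space \<Rightarrow> ennreal"
  assumes w: "norm w = 1" and [measurable]: "borel_fun H"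
  shows "(NN \<eta>. H \<eta>) =
    (NN \<eta>. ennreal (theta (\<eta> \<bullet> w)) * (NN x. H (\<eta> - (\<eta> \<bullet> w) *\<^sub>R w + x *\<^sub>R w)))"
proof -
  have ww: "w \<bullet> w = 1" using w by (simp add: dot_square_norm)
  have "(NN \<eta>. ennreal (theta (\<eta> \<bullet> w)) * (NN x. H (\<eta> - (\<eta> \<bullet> w) *\<^sub>R w + x *\<^sub>R w)))
    = (NN \<eta>. ennreal (theta (\<eta> \<bullet> w)) * (NN x. H (\<eta> + x *\<^sub>R w)))"
  proof (rule nn_integral_cong, rule arg_cong2[where f="(*)"], rule refl)
    fix \<eta> :: 'a
    show "(NN x. H (\<eta> - (\<eta> \<bullet> w) *\<^sub>R w + x *\<^sub>R w)) = (NN x. H (\<eta> + x *\<^sub>R w))"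
      using nn_integral_lborel_shift[of "\<lambda>x. H (\<eta> + x *\<^sub>R w)" "- (\<eta> \<bullet> w)"]
      by (simp add: scaleR_left_diff_distrib add_diff_eq diff_add_eq)
  qed
  also have "\<dots> = (NN \<eta>. (NN x. ennreal (theta (\<eta> \<bullet> w)) * H (\<eta> + x *\<^sub>R w)))"
    by (simp add: nn_integral_cmult)
  also have "\<dots> = (NN x. (NN \<eta>. ennreal (theta (\<eta> \<bullet> w)) * H (\<eta> + x *\<^sub>R w)))"
    by (rule lborel_pair.Fubini') simp
  also have "\<dots> = (NN x. (NN \<eta>. ennreal (theta (\<eta> \<bullet> w - x)) * H \<eta>))" (is "(NN x. ?f x) = (NN x. ?g x)")
  proof (rule nn_integral_cong)
    fix x :: real
    show "?f x = ?g x"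
      using nn_integral_lborel_shift[of "\<lambda>\<eta>. ennreal (theta (\<eta> \<bullet> w - x)) * H \<eta>" "x *\<^sub>R w"]
      by (simp add: inner_add_left ww add.commute)
  qed
  also have "\<dots> = (NN \<eta>. (NN x. ennreal (theta (\<eta> \<bullet> w - x)) * H \<eta>))"
    by (rule lborel_pair.Fubini') simp
  also have "\<dots> = (NN \<eta>. H \<eta>)"
    by (simp add: nn_integral_multc nn_integral_theta_shift)
  finally show ?thesis ..
qed

text \<open>The map multiplies the component along e by c and fixes the orthogonal complement; on
  each line parallel to e it is a dilation of the real line. For c = -1 it is a reflection, the
  source of rotational symmetry below.\<close>

lemma nn_integral_stretch:
  fixes H :: "'a::euclidean_space \<Rightarrow> ennreal"
  assumes e: "norm e = 1" and c: "c \<noteq> 0" and [measurable]: "borel_fun H"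
  shows "(NN \<eta>. H \<eta>) = ennreal \<bar>c\<bar> * (NN \<eta>. H (\<eta> + ((c - 1) * (\<eta> \<bullet> e)) *\<^sub>R e))"
proof -
  have ee: "e \<bullet> e = 1" using e by (simp add: dot_square_norm)
  have eq: "\<eta> - (\<eta> \<bullet> e) *\<^sub>R e + x *\<^sub>R e
    + ((c - 1) * ((\<eta> - (\<eta> \<bullet> e) *\<^sub>R e + x *\<^sub>R e) \<bullet> e)) *\<^sub>R e
    = \<eta> - (\<eta> \<bullet> e) *\<^sub>R e + (c * x) *\<^sub>R e" for \<eta> x
    by (simp add: inner_diff_left inner_add_left ee algebra_simps)
  have "(NN \<eta>. H (\<eta> + ((c - 1) * (\<eta> \<bullet> e)) *\<^sub>R e))
    = (NN \<eta>. ennreal (theta (\<eta> \<bullet> e)) *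
    (NN x. H (\<eta> - (\<eta> \<bullet> e) *\<^sub>R e + (c * x) *\<^sub>R e)))"
    by (subst nn_integral_line[OF e]) (simp_all only: eq, measurable)
  then have "ennreal \<bar>c\<bar> * (NN \<eta>. H (\<eta> + ((c - 1) * (\<eta> \<bullet> e)) *\<^sub>R e))
    = (NN \<eta>. ennreal (theta (\<eta> \<bullet> e)) *
    (ennreal \<bar>c\<bar> * (NN x. H (\<eta> - (\<eta> \<bullet> e) *\<^sub>R e + (c * x) *\<^sub>R e))))"
    by (simp add: nn_integral_cmult[symmetric] mult.left_commute)
  also have "\<dots> = (NN \<eta>. ennreal (theta (\<eta> \<bullet> e)) *
    (NN x. H (\<eta> - (\<eta> \<bullet> e) *\<^sub>R e + x *\<^sub>R e)))"
  proof (intro nn_integral_cong arg_cong2[where f="(*)"] refl)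
    fix \<eta> :: 'a
    show "ennreal \<bar>c\<bar> * (NN x. H (\<eta> - (\<eta> \<bullet> e) *\<^sub>R e + (c * x) *\<^sub>R e))
      = (NN x. H (\<eta> - (\<eta> \<bullet> e) *\<^sub>R e + x *\<^sub>R e))"
      using nn_integral_lborel_scale[OF _ c, of "\<lambda>x. H (\<eta> - (\<eta> \<bullet> e) *\<^sub>R e + x *\<^sub>R e)"]
      by simp
  qed
  also have "\<dots> = (NN \<eta>. H \<eta>)"
    by (rule nn_integral_line[OF e, symmetric]) simp
  finally show ?thesis ..
qed

lemma nn_integral_power_symmetric:
  assumes "R \<ge> 0" "n \<ge> 1"
  shows "(NN r. ennreal (\<bar>r\<bar> ^ (n - 1)) * indicator {-R..R} r) = ennreal (2 * R ^ n / n)"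
proof -
  have h: "(NN r. ennreal (r ^ (n - 1)) * indicator {0..R} r) = ennreal (R ^ n / n - 0 ^ n / n)"
    using assms by (intro nn_integral_FTC_Icc) (auto intro!: derivative_eq_intros)
  have "(NN r. ennreal (\<bar>r\<bar> ^ (n - 1)) * indicator {-R..R} r)
    = (NN r. ennreal (r ^ (n - 1)) * indicator {0..R} r
    + ennreal ((- r) ^ (n - 1)) * indicator {0..R} (- r))"
  by (rule nn_integral_cong_nonzero) (auto split: split_indicator)
  also have "\<dots> = (NN r. ennreal (r ^ (n - 1)) * indicator {0..R} r)
    + (NN r. ennreal ((- r) ^ (n - 1)) * indicator {0..R} (- r))"
    by (rule nn_integral_add) auto
  also have "\<dots> = (NN r. ennreal (r ^ (n - 1)) * indicator {0..R} r)
    + (NN r. ennreal (r ^ (n - 1)) * indicator {0..R} r)"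
    by (subst (2) nn_integral_lborel_uminus[symmetric]) auto
  finally have "(NN r. ennreal (\<bar>r\<bar> ^ (n - 1)) * indicator {-R..R} r)
    = ennreal (R ^ n / n) + ennreal (R ^ n / n)"
    using assms h by (simp add: power_0_left)
  then show ?thesis using assms by (simp flip: ennreal_plus)
qed

lemma nn_integral_inverse_power_tail:
  assumes a: "a > 0" and n: "n \<ge> 1"
  shows "(NN r. ennreal (1 / \<bar>r\<bar> ^ Suc n) * indicator {r. a \<le> \<bar>r\<bar>} r) = ennreal (2 / (n * a ^ n))"
proof -
  have h: "(NN r. ennreal (1 / r ^ Suc n) * indicator {a..} r) = ennreal (0 - (- (1 / (n * a ^ n))))"
  proof (rule nn_integral_FTC_atLeast)
    show "DERIV (\<lambda>r. - (1 / (n * r ^ n))) r :> 1 / r ^ Suc n" if "a \<le> r" for r :: real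
    proof -
      have r: "r > 0" using that a by simp
      have "((\<lambda>r. - (1 / n) * inverse (r ^ n)) has_real_derivative 
        - (1 / n) * (- (inverse (r ^ n) * (real n * r ^ (n - 1) * 1) * inverse (r ^ n)))) (at r)"
        using r by (auto intro!: derivative_eq_intros)
      also have "- (1 / n) * (- (inverse (r ^ n) * (real n * r ^ (n - 1) * 1) * inverse (r ^ n))) = 1 / r ^ Suc n"
      proof -
        have p: "r ^ n = r * r ^ (n - 1)" using n by (cases n) auto
        have "r ^ (n - 1) \<noteq> 0" "real n \<noteq> 0" using r n by auto
        then show ?thesis using r by (simp add: p field_simps)
      qed
      finally show ?thesis by (simp add: field_simps)
    qed
    show "((\<lambda>r::real. - (1 / (n * r ^ n))) \<longlongrightarrow> 0) at_top"
    proof -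
      have "((\<lambda>r::real. inverse (r ^ n)) \<longlongrightarrow> 0) at_top"
        using n by (intro tendsto_inverse_0_at_top filterlim_pow_at_top filterlim_ident) auto
      then have "((\<lambda>r::real. - (1 / n) * inverse (r ^ n)) \<longlongrightarrow> - (1/n) * 0) at_top"
        by (intro tendsto_intros)
      then show ?thesis by (simp add: field_simps)
    qed
  qed (use a in auto)
  have "(NN r. ennreal (1 / \<bar>r\<bar> ^ Suc n) * indicator {r. a \<le> \<bar>r\<bar>} r)
    = (NN r. ennreal (1 / r ^ Suc n) * indicator {a..} r
    + ennreal (1 / (- r) ^ Suc n) * indicator {a..} (- r))"
    using a by (intro nn_integral_cong) (auto split: split_indicator)
  also have "\<dots> = (NN r. ennreal (1 / r ^ Suc n) * indicator {a..} r)
    + (NN r. ennreal (1 / (- r) ^ Suc n) * indicator {a..} (- r))"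
    by (rule nn_integral_add) auto
  also have "\<dots> = (NN r. ennreal (1 / r ^ Suc n) * indicator {a..} r)
    + (NN r. ennreal (1 / r ^ Suc n) * indicator {a..} r)"
    by (subst (2) nn_integral_lborel_uminus[symmetric]) auto
  finally show ?thesis using a n h by (simp flip: ennreal_plus)
qed

lemma sgn_measurable_euclidean [measurable]:
  "borel_fun (sgn :: 'a::euclidean_space \<Rightarrow> 'a)"
  unfolding sgn_div_norm by measurable

lemma ennreal_mult3:
  "0 \<le> a \<Longrightarrow> 0 \<le> b \<Longrightarrow> 0 \<le> c \<Longrightarrow> ennreal a * (ennreal b * ennreal c) = ennreal (a * b * c)"
  by (simp add: ennreal_mult mult.assoc)

text \<open>The unit ball stands for the sphere: the integrand depends on z through its direction
  only, and then the integral over the ball is 1/d of that over the sphere. As r takes both signs,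
  every point is reached from z and from -z. Together this is the factor d/2.\<close>

lemma nn_integral_polar:
  fixes H :: "'a::euclidean_space \<Rightarrow> ennreal"
  assumes [measurable]: "borel_fun H"
  shows "(NN \<xi>. H \<xi>) = ennreal (DIM('a) / 2) *
    (NN z. indicator (cball 0 1) z *
    (NN r. ennreal (\<bar>r\<bar> ^ (DIM('a) - 1)) * H (r *\<^sub>R sgn z)))"
proof -
  let ?d = "DIM('a)"
  have [measurable]: "cball (0::'a) 1 \<in> sets borel" by simp
  have d: "?d \<ge> 1" using DIM_positive[where 'a='a] by simp
  have "(NN z. indicator (cball 0 1) z *
    (NN r. ennreal (\<bar>r\<bar> ^ (?d - 1)) * H (r *\<^sub>R sgn z)))
    = (NN z. (NN r. indicator (cball 0 1) z * ennreal (norm z ^ ?d) *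
    ennreal (\<bar>r\<bar> ^ (?d - 1)) * H (r *\<^sub>R z)))"
  proof (rule nn_integral_cong_nonzero, goal_cases)
    case (1 z)
    have "(NN r. ennreal (\<bar>r\<bar> ^ (?d - 1)) * H (r *\<^sub>R sgn z))
      = ennreal (norm z) * (NN r. ennreal (\<bar>norm z * r\<bar> ^ (?d - 1)) * H ((norm z * r) *\<^sub>R sgn z))"
      using nn_integral_lborel_scale[of "\<lambda>r. ennreal (\<bar>r\<bar> ^ (?d - 1)) * H (r *\<^sub>R sgn z)" "norm z"] 1
      by simp
    also have "\<dots> = (NN r. ennreal (norm z) * (ennreal (\<bar>norm z * r\<bar> ^ (?d - 1)) * H ((norm z * r) *\<^sub>R sgn z)))"
      by (simp add: nn_integral_cmult)
    also have "\<dots> = (NN r. ennreal (norm z ^ ?d) * ennreal (\<bar>r\<bar> ^ (?d - 1)) * H (r *\<^sub>R z))" (is "(NN r. ?f r) = (NN r. ?g r)")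
    proof (intro nn_integral_cong)
      fix r :: real
      have "(norm z * r) *\<^sub>R sgn z = r *\<^sub>R z"
        using 1 by (simp add: sgn_div_norm)
      moreover have "norm z * \<bar>norm z * r\<bar> ^ (?d - 1) = norm z ^ ?d * \<bar>r\<bar> ^ (?d - 1)"
        using d by (cases ?d) (auto simp: abs_mult power_mult_distrib)
      ultimately show "?f r = ?g r"
        by (simp add: mult.assoc[symmetric] ennreal_mult[symmetric])
    qed
    finally show ?case by (simp add: nn_integral_cmult mult.assoc)
  qed
  also have "\<dots> = (NN r. (NN z. indicator (cball 0 1) z * ennreal (norm z ^ ?d) *
    ennreal (\<bar>r\<bar> ^ (?d - 1)) * H (r *\<^sub>R z)))"
    by (rule lborel_pair.Fubini') simp
  \<comment> \<open>For fixed r the substitution xi = r z turns the ball into |xi| <= |r|. What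
    remains in r is |r|^(-d-1) on |r| >= |xi|, whose integral 2/(d |xi|^d) cancels the factor
    |xi|^d.\<close>
  also have "\<dots> = (NN r. (NN \<xi>. (ennreal (1 / \<bar>r\<bar> ^ Suc ?d) * indicator {r. norm \<xi> \<le> \<bar>r\<bar>} r) *
    (ennreal (norm \<xi> ^ ?d) * H \<xi>)))"
  proof (rule nn_integral_cong_nonzero, goal_cases)
    case (1 r)
    have "(NN \<xi>. (ennreal (1 / \<bar>r\<bar> ^ Suc ?d) * indicator {r. norm \<xi> \<le> \<bar>r\<bar>} r) *
      (ennreal (norm \<xi> ^ ?d) * H \<xi>))
      = ennreal (\<bar>r\<bar> ^ ?d) * (NN z. (ennreal (1 / \<bar>r\<bar> ^ Suc ?d) * indicator {s. norm (r *\<^sub>R z) \<le> \<bar>s\<bar>} r) *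
      (ennreal (norm (r *\<^sub>R z) ^ ?d) * H (r *\<^sub>R z)))"
      by (rule nn_integral_lborel_scale) (use 1 in auto)
    also have "\<dots> = (NN z. ennreal (\<bar>r\<bar> ^ ?d) * ((ennreal (1 / \<bar>r\<bar> ^ Suc ?d) * indicator {s. norm (r *\<^sub>R z) \<le> \<bar>s\<bar>} r) *
      (ennreal (norm (r *\<^sub>R z) ^ ?d) * H (r *\<^sub>R z))))"
      by (rule nn_integral_cmult[symmetric]) simp
    also have "\<dots> = (NN z. indicator (cball 0 1) z * ennreal (norm z ^ ?d) *
      ennreal (\<bar>r\<bar> ^ (?d - 1)) * H (r *\<^sub>R z))" (is "(NN z. ?f z) = (NN z. ?g z)")
    proof (intro nn_integral_cong)
      fix z :: 'a
      have ind: "(indicator {s. norm (r *\<^sub>R z) \<le> \<bar>s\<bar>} r :: ennreal) = indicator (cball 0 1) z"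
        using 1 by (auto simp: indicator_def)
      have eq: "\<bar>r\<bar> ^ ?d * (1 / \<bar>r\<bar> ^ Suc ?d) * norm (r *\<^sub>R z) ^ ?d = norm z ^ ?d * \<bar>r\<bar> ^ (?d - 1)"
        using d 1 by (cases ?d) (auto simp: power_mult_distrib field_simps)
      have "ennreal (\<bar>r\<bar> ^ ?d) * (ennreal (1 / \<bar>r\<bar> ^ Suc ?d) * ennreal (norm (r *\<^sub>R z) ^ ?d))
        = ennreal (norm z ^ ?d) * ennreal (\<bar>r\<bar> ^ (?d - 1))"
        by (subst ennreal_mult3, simp, simp, simp, subst eq) (simp add: ennreal_mult)
      then have "(ennreal (\<bar>r\<bar> ^ ?d) * (ennreal (1 / \<bar>r\<bar> ^ Suc ?d) * ennreal (norm (r *\<^sub>R z) ^ ?d))) * (indicator (cball 0 1) z * H (r *\<^sub>R z))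
        = (ennreal (norm z ^ ?d) * ennreal (\<bar>r\<bar> ^ (?d - 1))) * (indicator (cball 0 1) z * H (r *\<^sub>R z))"
        by (rule arg_cong)
      then show "?f z = ?g z"
        unfolding ind by (simp only: mult_ac)
    qed
    finally show ?case ..
  qed
  also have "\<dots> = (NN \<xi>. (NN r. (ennreal (1 / \<bar>r\<bar> ^ Suc ?d) * indicator {r. norm \<xi> \<le> \<bar>r\<bar>} r) *
    (ennreal (norm \<xi> ^ ?d) * H \<xi>)))"
    by (rule lborel_pair.Fubini'[symmetric]) simp
  also have "\<dots> = (NN \<xi>. ennreal (2 / ?d) * H \<xi>)"
  proof (rule nn_integral_cong_nonzero, goal_cases)
    case (1 \<xi>)
    have "(NN r. (ennreal (1 / \<bar>r\<bar> ^ Suc ?d) * indicator {r. norm \<xi> \<le> \<bar>r\<bar>} r) *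
      (ennreal (norm \<xi> ^ ?d) * H \<xi>))
      = ennreal (2 / (?d * norm \<xi> ^ ?d)) * (ennreal (norm \<xi> ^ ?d) * H \<xi>)"
      using nn_integral_inverse_power_tail[of "norm \<xi>" ?d] 1 d
      by (subst nn_integral_multc) (simp_all del: power_Suc)
    also have "\<dots> = ennreal (2 / ?d) * H \<xi>"
      using 1 by (simp add: mult.assoc[symmetric] ennreal_mult[symmetric])
    finally show ?case .
  qed
  also have "\<dots> = ennreal (2 / ?d) * (NN \<xi>. H \<xi>)"
    by (rule nn_integral_cmult) simp
  finally show ?thesis
    using d by (simp add: mult.assoc[symmetric] ennreal_mult[symmetric])
qed

section \<open>Relativistic changes of variables in one dimension\<close>

lemma sqrt_sum_squares_shift_bound:
  fixes x y m :: real
  assumes "m > 0" "x \<noteq> y"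
  shows "\<bar>sqrt (m\<^sup>2 + x\<^sup>2) - sqrt (m\<^sup>2 + y\<^sup>2)\<bar> < \<bar>x - y\<bar>"
proof -
  have a: "sqrt (m\<^sup>2 + x\<^sup>2) > \<bar>x\<bar>" "sqrt (m\<^sup>2 + y\<^sup>2) > \<bar>y\<bar>"
    using assms by (auto intro!: real_less_rsqrt)
  have "(sqrt (m\<^sup>2 + x\<^sup>2))\<^sup>2 = m\<^sup>2 + x\<^sup>2" "(sqrt (m\<^sup>2 + y\<^sup>2))\<^sup>2 = m\<^sup>2 + y\<^sup>2"
    by (auto intro!: real_sqrt_pow2 add_nonneg_nonneg)
  moreover have "\<bar>A - B\<bar> < \<bar>x - y\<bar>" if "A > \<bar>x\<bar>" "B > \<bar>y\<bar>" "A\<^sup>2 = m\<^sup>2 + x\<^sup>2" "B\<^sup>2 = m\<^sup>2 + y\<^sup>2" for A B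
  proof -
    \<comment> \<open>A^2 - B^2 equals x^2 - y^2, while A + B exceeds |x + y|.\<close>
    have "(A - B) * (A + B) = (x - y) * (x + y)"
      using that(3,4) by (simp add: algebra_simps power2_eq_square)
    then have "\<bar>A - B\<bar> * \<bar>A + B\<bar> = \<bar>x - y\<bar> * \<bar>x + y\<bar>"
      by (simp flip: abs_mult)
    also have "\<dots> < \<bar>x - y\<bar> * \<bar>A + B\<bar>"
      using that assms by (intro mult_strict_left_mono) auto
    finally show ?thesis by (rule mult_right_less_imp_less) simp
  qed
  ultimately show ?thesis using a by blast
qed

text \<open>A Lorentz boost. In the frame without energy transfer, two points of mass m have momenta
  q/2 and -q/2 and the common energy M. Boosting with the rapidity whose cosh is r/q and whose sinh
  is tau/q gives the momenta tau M/q +- r/2 and the energies r M/q +- tau/2. So the momenta differ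
  by r and the energies by tau.\<close>

lemma collision_energy:
  fixes m r \<tau> q :: real
  assumes r: "\<bar>\<tau>\<bar> < r" and q: "q = sqrt (r\<^sup>2 - \<tau>\<^sup>2)" and m: "m > 0"
    and M: "M = sqrt (m\<^sup>2 + q\<^sup>2 / 4)"
  shows "q > 0" "M > 0" "r * M / q + \<tau> / 2 > 0" "r * M / q - \<tau> / 2 > 0"
    "sqrt (m\<^sup>2 + (\<tau> * M / q + r / 2)\<^sup>2) = r * M / q + \<tau> / 2"
    "sqrt (m\<^sup>2 + (\<tau> * M / q - r / 2)\<^sup>2) = r * M / q - \<tau> / 2"
proof -
  have "\<tau>\<^sup>2 < r\<^sup>2" using r by (metis abs_le_square_iff abs_of_nonneg linorder_not_le order_trans abs_ge_zero less_imp_le)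
  then show q0: "q > 0" and M0: "M > 0" using m by (auto simp: q M add_pos_nonneg)
  have q2: "q\<^sup>2 = r\<^sup>2 - \<tau>\<^sup>2" using \<open>\<tau>\<^sup>2 < r\<^sup>2\<close> by (simp add: q)
  have M2: "M\<^sup>2 = m\<^sup>2 + q\<^sup>2 / 4" by (simp add: M)
  have "(q / 2)\<^sup>2 < M\<^sup>2" using m by (simp add: M2 power_divide)
  then have qM: "q / 2 < M" by (rule power2_less_imp_less) (use M0 in simp)
  have "\<bar>\<tau>\<bar> / 2 < r / 2" using r by simp
  also have "r / 2 \<le> r * M / q"
  proof -
    have "q * r \<le> (2 * M) * r" using qM r by (intro mult_right_mono) auto
    then show ?thesis using q0 by (simp add: field_simps)
  qed
  finally have t: "\<bar>\<tau>\<bar> / 2 < r * M / q" .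
  then show p1: "r * M / q + \<tau> / 2 > 0" and p2: "r * M / q - \<tau> / 2 > 0"
    using abs_ge_self[of \<tau>] abs_ge_minus_self[of \<tau>] by linarith+
  have key: "(r * M / q)\<^sup>2 - (\<tau> * M / q)\<^sup>2 = M\<^sup>2"
  proof -
    have "(r * M / q)\<^sup>2 - (\<tau> * M / q)\<^sup>2 = (r\<^sup>2 - \<tau>\<^sup>2) * M\<^sup>2 / q\<^sup>2"
      by (simp add: power_mult_distrib power_divide algebra_simps diff_divide_distrib)
    also have "\<dots> = M\<^sup>2" using q0 by (simp add: q2[symmetric])
    finally show ?thesis .
  qed
  have sq: "m\<^sup>2 + (a + r / 2)\<^sup>2 = (b + \<tau> / 2)\<^sup>2" "m\<^sup>2 + (a - r / 2)\<^sup>2 = (b - \<tau> / 2)\<^sup>2"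
    if "b\<^sup>2 - a\<^sup>2 = M\<^sup>2" "a * r = b * \<tau>" for a b
  proof -
    have "m\<^sup>2 = b\<^sup>2 - a\<^sup>2 - (r\<^sup>2 - \<tau>\<^sup>2) / 4" using that(1) M2 q2 by simp
    then show "m\<^sup>2 + (a + r / 2)\<^sup>2 = (b + \<tau> / 2)\<^sup>2" "m\<^sup>2 + (a - r / 2)\<^sup>2 = (b - \<tau> / 2)\<^sup>2"
      using that(2) by (simp_all add: power2_eq_square algebra_simps diff_divide_distrib)
  qed
  have ar: "(\<tau> * M / q) * r = (r * M / q) * \<tau>" by simp
  show "sqrt (m\<^sup>2 + (\<tau> * M / q + r / 2)\<^sup>2) = r * M / q + \<tau> / 2"
    unfolding sq(1)[OF key ar] using p1 by simp
  show "sqrt (m\<^sup>2 + (\<tau> * M / q - r / 2)\<^sup>2) = r * M / q - \<tau> / 2"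
    unfolding sq(2)[OF key ar] using p2 by simp
qed

text \<open>The energy difference of x and x - r is a strictly increasing function of x from the
  line onto (-r, r). Its inverse is the boosted momentum of \<open>collision_energy\<close>, and its
  derivative there is q M divided by the product of the two energies. In the application m is a
  transverse mass and x the component along xi.\<close>

lemma nn_integral_energy_difference:
  fixes m r :: real and h :: "real \<Rightarrow> ennreal"
  assumes m: "m > 0" and r: "r > 0" and [measurable]: "borel_fun h"
  shows "(NN x. h x) = (NN \<tau>. indicator {\<tau>. \<bar>\<tau>\<bar> < r} \<tau> *
    (let q = sqrt (r\<^sup>2 - \<tau>\<^sup>2); M = sqrt (m\<^sup>2 + q\<^sup>2 / 4) in
    ennreal ((r * M / q + \<tau> / 2) * (r * M / q - \<tau> / 2) / (q * M)) * h (\<tau> * M / q + r / 2)))"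
proof -
  define g where "g x = sqrt (m\<^sup>2 + x\<^sup>2) - sqrt (m\<^sup>2 + (x - r)\<^sup>2)" for x
  define g' where "g' x = x / sqrt (m\<^sup>2 + x\<^sup>2) - (x - r) / sqrt (m\<^sup>2 + (x - r)\<^sup>2)" for x
  define Q where "Q \<tau> = sqrt (r\<^sup>2 - \<tau>\<^sup>2)" for \<tau>
  define M where "M \<tau> = sqrt (m\<^sup>2 + (Q \<tau>)\<^sup>2 / 4)" for \<tau>
  define X where "X \<tau> = \<tau> * M \<tau> / Q \<tau> + r / 2" for \<tau>
  define J where "J \<tau> = (r * M \<tau> / Q \<tau> + \<tau> / 2) * (r * M \<tau> / Q \<tau> - \<tau> / 2) / (Q \<tau> * M \<tau>)" for \<tau>
  have [measurable]: "borel_fun Q" "borel_fun M"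
      "borel_fun X" "borel_fun J"
    unfolding Q_def[abs_def] M_def[abs_def] X_def[abs_def] J_def[abs_def] by measurable
  have pos: "m\<^sup>2 + x\<^sup>2 > 0" for x using m by (simp add: add_pos_nonneg)
  have deriv: "(g has_real_derivative g' x) (at x)" for x
  proof -
    have D: "((\<lambda>x. sqrt (m\<^sup>2 + (x - c)\<^sup>2)) has_real_derivative (x - c) / sqrt (m\<^sup>2 + (x - c)\<^sup>2)) (at x)" for c
      using pos[of "x - c"] by (auto intro!: derivative_eq_intros simp: divide_simps)
    show ?thesis unfolding g_def[abs_def] g'_def using DERIV_diff[OF D[of 0] D[of r]] by simp
  qed
  have cont: "continuous_on UNIV g'"
    unfolding g'_def using pos by (intro continuous_intros) (auto simp: less_imp_neq[THEN not_sym])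
  have gX: "g (X \<tau>) = \<tau>" and g'X: "g' (X \<tau>) = 1 / J \<tau>" and J0: "J \<tau> > 0" if "\<bar>\<tau>\<bar> < r" for \<tau>
  proof -
    note c = collision_energy[OF that Q_def m M_def]
    have X': "X \<tau> - r = \<tau> * M \<tau> / Q \<tau> - r / 2" by (simp add: X_def)
    show "g (X \<tau>) = \<tau>" unfolding g_def X' unfolding X_def c(5,6) by simp
    show "J \<tau> > 0" unfolding J_def using c by simp
    let ?a = "r * M \<tau> / Q \<tau> + \<tau> / 2" and ?b = "r * M \<tau> / Q \<tau> - \<tau> / 2"
    have q2: "(Q \<tau>)\<^sup>2 = r\<^sup>2 - \<tau>\<^sup>2"
      unfolding Q_def using that by (simp add: abs_le_square_iff[symmetric])
    have "(\<tau> * M \<tau> / Q \<tau> + r / 2) * ?b - (\<tau> * M \<tau> / Q \<tau> - r / 2) * ?a = (r\<^sup>2 - \<tau>\<^sup>2) * M \<tau> / Q \<tau>"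
      by (simp add: algebra_simps power2_eq_square diff_divide_distrib)
    also have "\<dots> = Q \<tau> * M \<tau>" unfolding q2[symmetric] using c(1) by (simp add: power2_eq_square)
    finally have n: "(\<tau> * M \<tau> / Q \<tau> + r / 2) * ?b - (\<tau> * M \<tau> / Q \<tau> - r / 2) * ?a = Q \<tau> * M \<tau>" .
    have "g' (X \<tau>) = (\<tau> * M \<tau> / Q \<tau> + r / 2) / ?a - (\<tau> * M \<tau> / Q \<tau> - r / 2) / ?b"
      unfolding g'_def X' unfolding X_def c(5,6) by simp
    also have "\<dots> = ((\<tau> * M \<tau> / Q \<tau> + r / 2) * ?b - (\<tau> * M \<tau> / Q \<tau> - r / 2) * ?a) / (?a * ?b)"
      using c(3,4) by (intro diff_frac_eq) auto
    also have "\<dots> = 1 / J \<tau>" unfolding n J_def by simp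
    finally show "g' (X \<tau>) = 1 / J \<tau>" .
  qed
  have g_bound: "\<bar>g x\<bar> < r" for x
    using sqrt_sum_squares_shift_bound[OF m, of x "x - r"] r by (simp add: g_def)
  \<comment> \<open>The velocity x / sqrt(m^2 + x^2) is strictly increasing, and g' is a difference
    of two velocities.\<close>
  have F: "x / sqrt (m\<^sup>2 + x\<^sup>2) < y / sqrt (m\<^sup>2 + y\<^sup>2)" if "x < y" for x y
  proof (rule DERIV_pos_imp_increasing[OF that])
    fix z
    have "((\<lambda>x. x / sqrt (m\<^sup>2 + x\<^sup>2)) has_real_derivative m\<^sup>2 / (sqrt (m\<^sup>2 + z\<^sup>2))^3) (at z)"
    proof -
      have s2: "(sqrt (m\<^sup>2 + z\<^sup>2))\<^sup>2 = m\<^sup>2 + z\<^sup>2" using pos[of z] by simp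
      have "((\<lambda>x. x / sqrt (m\<^sup>2 + x\<^sup>2)) has_real_derivative
        (1 * sqrt (m\<^sup>2 + z\<^sup>2) - z * (2 * z * (inverse (sqrt (m\<^sup>2 + z\<^sup>2)) / 2))) / (sqrt (m\<^sup>2 + z\<^sup>2) * sqrt (m\<^sup>2 + z\<^sup>2))) (at z)"
        using pos[of z] by (auto intro!: derivative_eq_intros)
      also have "(1 * sqrt (m\<^sup>2 + z\<^sup>2) - z * (2 * z * (inverse (sqrt (m\<^sup>2 + z\<^sup>2)) / 2))) / (sqrt (m\<^sup>2 + z\<^sup>2) * sqrt (m\<^sup>2 + z\<^sup>2))
        = ((sqrt (m\<^sup>2 + z\<^sup>2))\<^sup>2 - z\<^sup>2) / (sqrt (m\<^sup>2 + z\<^sup>2))^3"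
      proof -
        have "(1 * S - z * (2 * z * (inverse S / 2))) / (S * S) = (S\<^sup>2 - z\<^sup>2) / S^3" if "S > 0" for S
          using that by (simp add: field_simps power2_eq_square power3_eq_cube)
        then show ?thesis using pos[of z] real_sqrt_gt_zero by blast
      qed
      finally show ?thesis unfolding s2 by simp
    qed
    moreover have "m\<^sup>2 / (sqrt (m\<^sup>2 + z\<^sup>2))^3 > 0" using pos[of z] m by simp
    ultimately show "\<exists>y. ((\<lambda>x. x / sqrt (m\<^sup>2 + x\<^sup>2)) has_real_derivative y) (at z) \<and> 0 < y" by blast
  qed
  have g'_pos: "g' x > 0" for x using F[of "x - r" x] r by (simp add: g'_def)
  have inj: "inj g"
  proof (rule linorder_injI)
    fix x y :: real assume "x < y"
    then have "g x < g y" by (rule DERIV_pos_imp_increasing) (use deriv g'_pos in blast)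
    then show "g x \<noteq> g y" by simp
  qed
  have range: "range g = {\<tau>. \<bar>\<tau>\<bar> < r}"
  proof (intro set_eqI iffI)
    fix \<tau> assume "\<tau> \<in> {\<tau>. \<bar>\<tau>\<bar> < r}"
    then show "\<tau> \<in> range g" using gX by (metis mem_Collect_eq rangeI)
  qed (use g_bound in auto)
  have Xg: "X (g x) = x" for x
    using gX[OF g_bound[of x]] inj by (simp add: inj_eq)
  have "(NN x. h x) = (NN x. (ennreal (J (g x)) * h (X (g x))) * ennreal (g' x))"
  proof (intro nn_integral_cong)
    fix x :: real
    have "g' x = 1 / J (g x)" using g'X[OF g_bound[of x]] by (simp add: Xg)
    moreover have "J (g x) > 0" using J0[OF g_bound] .
    ultimately have "ennreal (J (g x)) * ennreal (g' x) = 1" by (simp flip: ennreal_mult)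
    moreover have "ennreal (J (g x)) * h (X (g x)) * ennreal (g' x) = (ennreal (J (g x)) * ennreal (g' x)) * h x"
      by (simp only: Xg mult_ac)
    ultimately show "h x = ennreal (J (g x)) * h (X (g x)) * ennreal (g' x)" by simp
  qed
  also have "\<dots> = (NN \<tau>. (ennreal (J \<tau>) * h (X \<tau>)) * indicator {\<tau>. \<bar>\<tau>\<bar> < r} \<tau>)"
    unfolding range[symmetric]
    by (rule nn_integral_lborel_substitution[OF deriv cont less_imp_le[OF g'_pos],
          of "\<lambda>\<tau>. ennreal (J \<tau>) * h (X \<tau>)"]) simp
  finally show ?thesis by (simp add: Let_def J_def X_def M_def Q_def mult_ac)
qed

lemma range_tanh_real: "range (tanh :: real \<Rightarrow> real) = {v. \<bar>v\<bar> < 1}"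
proof (intro set_eqI iffI)
  fix v :: real assume "v \<in> {v. \<bar>v\<bar> < 1}"
  then have v: "v\<^sup>2 < 1" by (simp add: abs_square_less_1)
  define k where "k = arsinh (v / sqrt (1 - v\<^sup>2))"
  have s: "sinh k = v / sqrt (1 - v\<^sup>2)" by (simp add: k_def)
  have "(cosh k)\<^sup>2 = (1 / sqrt (1 - v\<^sup>2))\<^sup>2"
    using v by (simp add: cosh_square_eq s power_divide field_simps)
  then have "cosh k = 1 / sqrt (1 - v\<^sup>2)"
    by (rule power2_eq_imp_eq) (use v in auto)
  then have "tanh k = v" using s v by (simp add: tanh_def)
  then show "v \<in> range tanh" by blast
next
  fix v :: real assume "v \<in> range tanh"
  then obtain x where "v = tanh x" by auto
  then show "v \<in> {v. \<bar>v\<bar> < 1}" using tanh_real_lt_1[of x] tanh_real_gt_neg1[of x] by (simp add: abs_if)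
qed

text \<open>Hyperbolic coordinates tau = q sinh u, r = q cosh u, where q takes both signs to cover r
  > 0 and r < 0. They arise in two one-dimensional steps, tau = r tanh u and then r = q cosh u; the
  factors |r|/cosh^2 u and cosh u combine to the Jacobian |q|.\<close>

lemma nn_integral_spacelike_hyperbolic:
  fixes k :: "real \<Rightarrow> real \<Rightarrow> ennreal"
  assumes [measurable]: "case_prod k \<in> borel_measurable (borel \<Otimes>\<^sub>M borel)"
  shows "(NN r \<tau>. indicator {\<tau>. \<bar>\<tau>\<bar> < \<bar>r\<bar>} \<tau> * k \<tau> r)
    = (NN q u. ennreal \<bar>q\<bar> * k (q * sinh u) (q * cosh u))"
proof -
  have [measurable]: "borel_fun (sinh :: real \<Rightarrow> real)"
    "borel_fun (cosh :: real \<Rightarrow> real)" "borel_fun (tanh :: real \<Rightarrow> real)"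
    by (auto intro!: borel_measurable_continuous_onI continuous_intros)
  have "(NN r \<tau>. indicator {\<tau>. \<bar>\<tau>\<bar> < \<bar>r\<bar>} \<tau> * k \<tau> r)
    = (NN r u. ennreal (\<bar>r\<bar> / (cosh u)\<^sup>2) * k (r * tanh u) r)"
  proof (rule nn_integral_cong_nonzero, goal_cases)
    case (1 r)
    have "(NN \<tau>. indicator {\<tau>. \<bar>\<tau>\<bar> < \<bar>r\<bar>} \<tau> * k \<tau> r)
      = ennreal \<bar>r\<bar> * (NN v. indicator {\<tau>. \<bar>\<tau>\<bar> < \<bar>r\<bar>} (r * v) * k (r * v) r)"
      using nn_integral_lborel_scale[of "\<lambda>\<tau>. indicator {\<tau>. \<bar>\<tau>\<bar> < \<bar>r\<bar>} \<tau> * k \<tau> r" r] 1 by simp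
    also have "\<dots> = ennreal \<bar>r\<bar> * (NN v. k (r * v) r * indicator (range tanh) v)"
      using 1 by (intro arg_cong[where f="\<lambda>x. ennreal \<bar>r\<bar> * x"], intro nn_integral_cong)
        (auto simp: range_tanh_real abs_mult split: split_indicator)
    also have "\<dots> = ennreal \<bar>r\<bar> * (NN u. k (r * tanh u) r * ennreal (1 - (tanh u)\<^sup>2))"
    proof (subst nn_integral_lborel_substitution[where g=tanh and g'="\<lambda>u. 1 - (tanh u)\<^sup>2" and h="\<lambda>v. k (r * v) r", symmetric])
      show "continuous_on UNIV (\<lambda>u::real. 1 - (tanh u)\<^sup>2)"
        by (auto intro!: continuous_intros)
      fix x :: real
      have "\<bar>tanh x\<bar> < 1" using range_tanh_real by blast
      then show "0 \<le> 1 - (tanh x)\<^sup>2" by (simp add: abs_square_le_1)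
      show "(tanh has_real_derivative 1 - (tanh x)\<^sup>2) (at x)"
        by (auto intro!: derivative_eq_intros)
    qed (auto simp: mult.commute)
    also have "\<dots> = (NN u. ennreal \<bar>r\<bar> * (k (r * tanh u) r * ennreal (1 - (tanh u)\<^sup>2)))"
      by (simp add: nn_integral_cmult)
    also have "\<dots> = (NN u. ennreal (\<bar>r\<bar> / (cosh u)\<^sup>2) * k (r * tanh u) r)" (is "(NN u. ?f u) = (NN u. ?g u)")
    proof (intro nn_integral_cong)
      fix u :: real
      have "1 - (tanh u)\<^sup>2 = 1 / (cosh u)\<^sup>2"
        by (simp add: tanh_def power_divide field_simps sinh_square_eq)
      then have "ennreal (\<bar>r\<bar> / (cosh u)\<^sup>2) = ennreal \<bar>r\<bar> * ennreal (1 - (tanh u)\<^sup>2)"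
        by (simp flip: ennreal_mult)
      then show "?f u = ?g u"
        by (simp only: mult_ac)
    qed
    finally show ?case .
  qed
  also have "\<dots> = (NN u r. ennreal (\<bar>r\<bar> / (cosh u)\<^sup>2) * k (r * tanh u) r)"
    by (rule lborel_pair.Fubini') simp
  also have "\<dots> = (NN u q. ennreal \<bar>q\<bar> * k (q * sinh u) (q * cosh u))"
  proof (rule nn_integral_cong)
    fix u :: real
    have "(NN r. ennreal (\<bar>r\<bar> / (cosh u)\<^sup>2) * k (r * tanh u) r)
      = ennreal (cosh u) * (NN q. ennreal (\<bar>cosh u * q\<bar> / (cosh u)\<^sup>2) * k ((cosh u * q) * tanh u) (cosh u * q))"
      using nn_integral_lborel_scale[of "\<lambda>r. ennreal (\<bar>r\<bar> / (cosh u)\<^sup>2) * k (r * tanh u) r" "cosh u"]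
      by simp
    also have "\<dots> = (NN q. ennreal (cosh u) * (ennreal (\<bar>cosh u * q\<bar> / (cosh u)\<^sup>2) * k ((cosh u * q) * tanh u) (cosh u * q)))"
      by (rule nn_integral_cmult[symmetric]) simp
    also have "\<dots> = (NN q. ennreal \<bar>q\<bar> * k (q * sinh u) (q * cosh u))" (is "(NN q. ?f q) = (NN q. ?g q)")
    proof (rule nn_integral_cong)
      fix q :: real
      have m1: "ennreal (cosh u) * ennreal (\<bar>cosh u * q\<bar> / (cosh u)\<^sup>2) = ennreal \<bar>q\<bar>"
        by (simp flip: ennreal_mult add: abs_mult power2_eq_square)
      have e: "(cosh u * q) * tanh u = q * sinh u"
        by (simp add: tanh_def)
      show "?f q = ?g q"
        unfolding e by (subst mult.assoc[symmetric], subst m1) (simp add: mult.commute)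
    qed
    finally show "(NN r. ennreal (\<bar>r\<bar> / (cosh u)\<^sup>2) * k (r * tanh u) r)
      = (NN q. ennreal \<bar>q\<bar> * k (q * sinh u) (q * cosh u))" .
  qed
  also have "\<dots> = (NN q u. ennreal \<bar>q\<bar> * k (q * sinh u) (q * cosh u))"
    by (rule lborel_pair.Fubini') simp
  finally show ?thesis .
qed

lemma nn_integral_sinh:
  assumes m: "m > 0" and [measurable]: "borel_fun h"
  shows "(NN x. h x) = (NN a. h (m * sinh a) * ennreal (m * cosh a))"
proof -
  have "range (\<lambda>a. m * sinh a) = UNIV"
  proof -
    have "x = m * sinh (arsinh (x / m))" for x using m by simp
    then show ?thesis by blast
  qed
  moreover have "(NN a. h (m * sinh a) * ennreal (m * cosh a))
    = (NN x. h x * indicator (range (\<lambda>a. m * sinh a)) x)"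
    using m by (intro nn_integral_lborel_substitution)
      (auto intro!: derivative_eq_intros continuous_intros)
  ultimately show ?thesis by simp
qed

text \<open>Two particles of masses m and n on a line: in their centre-of-mass frame the momenta are
  q/2 and -q/2 and the energies M and N, and \<kappa> is the rapidity of that frame. The coefficient
  of h is the Jacobian, the product of the two energies and of (M + N)/(2 M N) = 1/(2M) +
  1/(2N).\<close>

abbreviation center_of_mass_density :: "real \<Rightarrow> real \<Rightarrow> (real \<Rightarrow> real \<Rightarrow> ennreal) \<Rightarrow> real \<Rightarrow> real \<Rightarrow> ennreal" where
  "center_of_mass_density m n h q \<kappa> \<equiv>
    (let M = sqrt (m\<^sup>2 + q\<^sup>2 / 4); N = sqrt (n\<^sup>2 + q\<^sup>2 / 4) in
      ennreal ((M * cosh \<kappa> + q / 2 * sinh \<kappa>) * (N * cosh \<kappa> - q / 2 * sinh \<kappa>) * ((M + N) / (2 * M * N))) *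
        h (M * sinh \<kappa> + q / 2 * cosh \<kappa>) (N * sinh \<kappa> - q / 2 * cosh \<kappa>))"

text \<open>Written with rapidities a and c, the momenta are m sinh a and n sinh c. The difference a
  - c is a function D of the centre-of-mass momentum q alone, with D(q) = arsinh(q/2m) +
  arsinh(q/2n), and the rapidity of the frame is a - arsinh(q/2m). After the two sinh substitutions
  the change of variables is therefore the substitution by D between two translations.\<close>

lemma nn_integral_center_of_mass:
  fixes h :: "real \<Rightarrow> real \<Rightarrow> ennreal" and m n :: real
  assumes m: "m > 0" and n: "n > 0"
    and [measurable]: "case_prod h \<in> borel_measurable (borel \<Otimes>\<^sub>M borel)"
  shows "(NN x y. h x y) = (NN q v. center_of_mass_density m n h q v)"
proof -
  have [measurable]: "borel_fun (sinh :: real \<Rightarrow> real)"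
    "borel_fun (cosh :: real \<Rightarrow> real)" "borel_fun (arsinh :: real \<Rightarrow> real)"
    by (auto intro!: borel_measurable_continuous_onI continuous_intros)
  define A where "A m q = arsinh (q / (2 * m))" for m q :: real
  have [measurable]: "borel_fun (A m)" for m unfolding A_def[abs_def] by measurable
  define k where "k a c = h (m * sinh a) (n * sinh c) * ennreal (m * cosh a) * ennreal (n * cosh c)" for a c
  have [measurable]: "case_prod k \<in> borel_measurable (borel \<Otimes>\<^sub>M borel)"
    unfolding k_def[abs_def] by measurable
  define D where "D q = A m q + A n q" for q
  have [measurable]: "borel_fun D" unfolding D_def[abs_def] by measurable
  define D' where "D' q = 1 / (2 * sqrt (m\<^sup>2 + q\<^sup>2 / 4)) + 1 / (2 * sqrt (n\<^sup>2 + q\<^sup>2 / 4))" for q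
  have [measurable]: "borel_fun D'" unfolding D'_def[abs_def] by measurable
  have dA: "(A m has_real_derivative 1 / (2 * sqrt (m\<^sup>2 + q\<^sup>2 / 4))) (at q)" if "m > 0" for m q
  proof -
    have "sqrt (m\<^sup>2 + q\<^sup>2 / 4) = m * sqrt ((q / (2 * m))\<^sup>2 + 1)"
    proof -
      have "m\<^sup>2 + q\<^sup>2 / 4 = m\<^sup>2 * ((q / (2 * m))\<^sup>2 + 1)"
        using that by (simp add: field_simps power2_eq_square)
      then show ?thesis using that by (simp add: real_sqrt_mult)
    qed
    moreover have "(A m has_real_derivative (1 / (2 * m)) * (1 / sqrt ((q / (2 * m))\<^sup>2 + 1))) (at q)"
    proof -
      have "((\<lambda>q. q / (2 * m)) has_real_derivative 1 / (2 * m)) (at q)"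
        using that by (auto intro!: derivative_eq_intros)
      from DERIV_chain2[OF arsinh_real_has_field_derivative this] show ?thesis
        unfolding A_def[abs_def] by (simp add: mult.commute)
    qed
    ultimately show ?thesis by (simp add: mult_ac)
  qed
  have dD: "(D has_real_derivative D' q) (at q)" for q
    unfolding D_def[abs_def] D'_def by (intro DERIV_add dA m n)
  have D'0: "D' q \<ge> 0" for q unfolding D'_def by simp
  have cD': "continuous_on UNIV D'"
    unfolding D'_def using m n by (intro continuous_intros) (auto simp: add_pos_nonneg less_imp_neq[THEN not_sym])
  have isC: "isCont D q" for q using dD DERIV_isCont by blast
  \<comment> \<open>D is odd, so z >= 0 suffices. At q = 2 m sinh z the first summand of D already
    equals z and the second is nonnegative, which gives the upper end for the intermediate value
    theorem.\<close>
  have rD: "range D = UNIV"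
  proof (rule surjI)
    fix z :: real
    have up: "\<exists>q\<ge>0. D q = z" if "z \<ge> 0" for z
    proof -
      have "\<exists>q\<ge>0. q \<le> 2 * m * sinh z \<and> D q = z"
      proof (rule IVT)
        show "D 0 \<le> z" using that by (simp add: D_def A_def)
        have "A m (2 * m * sinh z) = z" using m by (simp add: A_def arsinh_sinh_real)
        moreover have "A n (2 * m * sinh z) \<ge> 0"
        proof -
          have "\<not> arsinh (2 * m * sinh z / (2 * n)) < 0"
            unfolding arsinh_real_neg_iff using m n that by (simp add: not_less)
          then show ?thesis unfolding A_def by (simp only: not_less)
        qed
        ultimately show "z \<le> D (2 * m * sinh z)" by (simp add: D_def)
        show "0 \<le> 2 * m * sinh z" using m that by simp
      qed (use isC in simp)
      then show ?thesis by blast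
    qed
    have odd: "D (- q) = - D q" for q by (simp add: D_def A_def)
    have "\<exists>q. D q = z"
    proof (cases "z \<ge> 0")
      case False
      then obtain q where "D q = - z" using up[of "- z"] by auto
      then have "D (- q) = z" by (simp add: odd)
      then show ?thesis ..
    qed (use up in blast)
    then show "D (SOME q. D q = z) = z" by (rule someI_ex)
  qed
  have sc: "m * sinh (A m q) = q / 2" "m * cosh (A m q) = sqrt (m\<^sup>2 + q\<^sup>2 / 4)" if "m > 0" for m q
  proof -
    show "m * sinh (A m q) = q / 2" using that by (simp add: A_def)
    then have s2: "(q / 2)\<^sup>2 = m\<^sup>2 * (sinh (A m q))\<^sup>2" by (metis power_mult_distrib)
    have "(m * cosh (A m q))\<^sup>2 = m\<^sup>2 + q\<^sup>2 / 4"
      using s2 by (simp add: power_mult_distrib cosh_square_eq algebra_simps power_divide)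
    then show "m * cosh (A m q) = sqrt (m\<^sup>2 + q\<^sup>2 / 4)"
      using that by (metis cosh_real_nonneg less_imp_le mult_nonneg_nonneg real_sqrt_unique)
  qed
  have "(NN x y. h x y)
    = (NN a. (NN y. h (m * sinh a) y) * ennreal (m * cosh a))"
    by (rule nn_integral_sinh[OF m]) measurable
  also have "\<dots> = (NN a. (NN c. h (m * sinh a) (n * sinh c) * ennreal (n * cosh c)) * ennreal (m * cosh a))"
    by (subst nn_integral_sinh[OF n]) auto
  also have "\<dots> = (NN a c. k a c)"
  proof (rule nn_integral_cong)
    fix a :: real
    have "(NN c. h (m * sinh a) (n * sinh c) * ennreal (n * cosh c)) * ennreal (m * cosh a)
      = (NN c. (h (m * sinh a) (n * sinh c) * ennreal (n * cosh c)) * ennreal (m * cosh a))"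
      by (rule nn_integral_multc[symmetric]) simp
    also have "\<dots> = (NN c. k a c)"
      by (rule nn_integral_cong) (simp add: k_def mult_ac)
    finally show "(NN c. h (m * sinh a) (n * sinh c) * ennreal (n * cosh c)) * ennreal (m * cosh a)
      = (NN c. k a c)" .
  qed
  also have "\<dots> = (NN a q. k a (a - D q) * ennreal (D' q))"
  proof (rule nn_integral_cong)
    fix a :: real
    have "(NN c. k a c) = (NN c. k a (a + c))"
      by (rule nn_integral_lborel_shift[symmetric]) simp
    also have "\<dots> = (NN c. k a (a - c))"
      using nn_integral_lborel_uminus[of "\<lambda>c. k a (a + c)"] by simp
    also have "\<dots> = (NN c. k a (a - c) * indicator (range D) c)"
      by (simp add: rD)
    also have "\<dots> = (NN q. k a (a - D q) * ennreal (D' q))"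
      by (rule nn_integral_lborel_substitution[OF dD cD' D'0, symmetric]) simp
    finally show "(NN c. k a c) = (NN q. k a (a - D q) * ennreal (D' q))" .
  qed
  also have "\<dots> = (NN q a. k a (a - D q) * ennreal (D' q))"
    by (rule lborel_pair.Fubini') simp
  also have "\<dots> = (NN q v. k (v + A m q) (v - A n q) * ennreal (D' q))"
  proof (rule nn_integral_cong)
    fix q :: real
    show "(NN a. k a (a - D q) * ennreal (D' q)) = (NN v. k (v + A m q) (v - A n q) * ennreal (D' q))"
      using nn_integral_lborel_shift[of "\<lambda>a. k a (a - D q) * ennreal (D' q)" "A m q"]
      by (simp add: D_def algebra_simps)
  qed
  also have "\<dots> = (NN q v. center_of_mass_density m n h q v)"
  proof (intro nn_integral_cong)
    fix q v :: real
    define M where "M = sqrt (m\<^sup>2 + q\<^sup>2 / 4)"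
    define N where "N = sqrt (n\<^sup>2 + q\<^sup>2 / 4)"
    have M0: "M > 0" and N0: "N > 0" using m n by (auto simp: M_def N_def add_pos_nonneg)
    note scm = sc[OF m, of q, folded M_def] and scn = sc[OF n, of q, folded N_def]
    have e1: "m * sinh (v + A m q) = M * sinh v + q / 2 * cosh v"
      by (simp only: sinh_add scm[symmetric]) (simp add: algebra_simps)
    have e2: "m * cosh (v + A m q) = M * cosh v + q / 2 * sinh v"
      by (simp only: cosh_add scm[symmetric]) (simp add: algebra_simps)
    have e3: "n * sinh (v - A n q) = N * sinh v - q / 2 * cosh v"
      by (simp only: sinh_diff scn[symmetric]) (simp add: algebra_simps)
    have e4: "n * cosh (v - A n q) = N * cosh v - q / 2 * sinh v"
      by (simp only: cosh_diff scn[symmetric]) (simp add: algebra_simps)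
    have D': "D' q = (M + N) / (2 * M * N)"
      unfolding D'_def M_def[symmetric] N_def[symmetric] using M0 N0 by (simp add: field_simps)
    have p: "M * cosh v + q / 2 * sinh v \<ge> 0" "N * cosh v - q / 2 * sinh v \<ge> 0"
      unfolding e2[symmetric] e4[symmetric] using m n by auto
    show "k (v + A m q) (v - A n q) * ennreal (D' q) = center_of_mass_density m n h q v"
      unfolding Let_def k_def e1 e2 e3 e4 D' M_def[symmetric] N_def[symmetric]
      using M0 N0 by (subst ennreal_mult3[OF p, symmetric]) (simp, simp only: mult_ac)
  qed
  finally show ?thesis .
qed

section \<open>Integrals over balls, ellipsoids and directions\<close>

lemma emeasure_unit_cball:
  "emeasure lborel (cball (0::'a::euclidean_space) 1) = ennreal (unit_ball_vol (DIM('a)))"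
  by (subst emeasure_cball) auto

text \<open>T(v) depends on |v| only, because a reflection exchanges two vectors of equal length,
  and it is homogeneous of degree 2. Summing over an orthonormal basis gives the integral of |xi|^2
  over the ball, which polar coordinates compute.\<close>

lemma nn_integral_ball_inner_square:
  fixes v :: "'a::euclidean_space"
  shows "(NN \<xi>. ennreal ((v \<bullet> \<xi>)\<^sup>2) * indicator (cball 0 1) \<xi>)
    = ennreal ((norm v)\<^sup>2 * unit_ball_vol (DIM('a)) / (DIM('a) + 2))"
proof -
  have [measurable]: "cball (0::'a) 1 \<in> sets borel" by simp
  define T where "T v = (NN \<xi>. ennreal ((v \<bullet> \<xi>)\<^sup>2) * indicator (cball 0 1) \<xi>)" for v :: 'a
  have isometric: "T v = T w" if vw: "norm v = norm w" for v w
  proof (cases "v = w")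
    case False
    define e where "e = sgn (v - w)"
    have e: "norm e = 1" using False by (simp add: e_def norm_sgn)
    have ee: "e \<bullet> e = 1" using e by (simp add: dot_square_norm)
    have vv: "v \<bullet> v = w \<bullet> w" using vw by (simp add: dot_square_norm)
    have refl: "v - (2 * (v \<bullet> e)) *\<^sub>R e = w"
    proof -
      have "(2 * (v \<bullet> e)) *\<^sub>R e = (2 * (v \<bullet> (v - w)) / (norm (v - w))\<^sup>2) *\<^sub>R (v - w)"
        by (simp add: e_def sgn_div_norm power2_eq_square divide_inverse mult_ac)
      also have "2 * (v \<bullet> (v - w)) = (norm (v - w))\<^sup>2"
        unfolding power2_norm_eq_inner using vv by (simp add: inner_diff_left inner_diff_right inner_commute)
      finally show ?thesis using False by simp
    qed
    have "T v = ennreal \<bar>- 1\<bar> * (NN \<xi>. ennreal ((v \<bullet> (\<xi> + ((- 1 - 1) * (\<xi> \<bullet> e)) *\<^sub>R e))\<^sup>2)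
      * indicator (cball 0 1) (\<xi> + ((- 1 - 1) * (\<xi> \<bullet> e)) *\<^sub>R e))"
      unfolding T_def
      by (rule nn_integral_stretch[OF e, of "- 1" "\<lambda>\<xi>. ennreal ((v \<bullet> \<xi>)\<^sup>2) * indicator (cball 0 1) \<xi>"]) simp_all
    also have "\<dots> = T w"
      proof -
     have eq: "ennreal ((v \<bullet> (\<xi> + ((- 1 - 1) * (\<xi> \<bullet> e)) *\<^sub>R e))\<^sup>2)
       * indicator (cball 0 1) (\<xi> + ((- 1 - 1) * (\<xi> \<bullet> e)) *\<^sub>R e)
       = ennreal ((w \<bullet> \<xi>)\<^sup>2) * indicator (cball 0 1) \<xi>" for \<xi>
     proof -
      have "v \<bullet> (\<xi> - (2 * (\<xi> \<bullet> e)) *\<^sub>R e) = (v - (2 * (v \<bullet> e)) *\<^sub>R e) \<bullet> \<xi>"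
        by (simp add: inner_diff_left inner_diff_right inner_commute)
      moreover have "(norm (\<xi> - (2 * (\<xi> \<bullet> e)) *\<^sub>R e))\<^sup>2 = (norm \<xi>)\<^sup>2"
      proof -
        define t where "t = \<xi> \<bullet> e"
        have "e \<bullet> \<xi> = t" by (simp add: t_def inner_commute)
        then show ?thesis
          unfolding power2_norm_eq_inner t_def[symmetric]
          by (simp add: inner_diff_left inner_diff_right t_def[symmetric] ee)
      qed
      then have "norm (\<xi> - (2 * (\<xi> \<bullet> e)) *\<^sub>R e) = norm \<xi>" by simp
      moreover have "\<xi> + ((- 1 - 1) * (\<xi> \<bullet> e)) *\<^sub>R e = \<xi> - (2 * (\<xi> \<bullet> e)) *\<^sub>R e"
        by simp
      ultimately show ?thesis
        by (simp only: refl indicator_def mem_cball_0)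
     qed
     show ?thesis
       unfolding eq T_def by simp
    qed
    finally show ?thesis .
  qed simp
  have scale: "T (c *\<^sub>R v) = ennreal (c\<^sup>2) * T v" for c v
  proof -
    have "T (c *\<^sub>R v) = (NN \<xi>. ennreal (c\<^sup>2) * (ennreal ((v \<bullet> \<xi>)\<^sup>2) * indicator (cball 0 1) \<xi>))"
      unfolding T_def by (intro nn_integral_cong) (simp add: power_mult_distrib ennreal_mult mult_ac)
    also have "\<dots> = ennreal (c\<^sup>2) * T v"
      unfolding T_def by (rule nn_integral_cmult) simp
    finally show ?thesis .
  qed
  obtain b0 :: 'a where b0: "b0 \<in> Basis" using nonempty_Basis by blast
  have "(\<Sum>b\<in>Basis. T b) = (NN \<xi>. ennreal ((norm \<xi>)\<^sup>2) * indicator (cball 0 1) (\<xi>::'a))"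
    unfolding T_def
  proof (subst nn_integral_sum[symmetric], measurable, rule nn_integral_cong)
    fix \<xi> :: 'a
    have "(\<Sum>b\<in>Basis. ennreal ((b \<bullet> \<xi>)\<^sup>2) * indicator (cball 0 1) \<xi>)
      = ennreal (\<Sum>b\<in>Basis. (b \<bullet> \<xi>)\<^sup>2) * indicator (cball 0 1) \<xi>"
      by (simp add: sum_distrib_right[symmetric])
    also have "(\<Sum>b\<in>Basis. (b \<bullet> \<xi>)\<^sup>2) = (norm \<xi>)\<^sup>2"
      by (simp add: norm_eq_sqrt_inner euclidean_inner[of \<xi> \<xi>] power2_eq_square inner_commute sum_nonneg)
    finally show "(\<Sum>b\<in>Basis. ennreal ((b \<bullet> \<xi>)\<^sup>2) * indicator (cball 0 1) \<xi>)
      = ennreal ((norm \<xi>)\<^sup>2) * indicator (cball 0 1) \<xi>" .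
  qed
  also have "\<dots> = ennreal (DIM('a) / 2) * (NN z. indicator (cball (0::'a) 1) z *
    ennreal (2 / (DIM('a) + 2)))"
  proof (subst nn_integral_polar, measurable, rule arg_cong[where f="\<lambda>x. ennreal (DIM('a) / 2) * x"], rule nn_integral_cong_AE)
    show "AE z in lborel. indicator (cball (0::'a) 1) z *
      (NN r. ennreal (\<bar>r\<bar> ^ (DIM('a) - 1)) * (ennreal ((norm (r *\<^sub>R sgn z))\<^sup>2) * indicator (cball 0 1) (r *\<^sub>R sgn z)))
      = indicator (cball 0 1) z * ennreal (2 / (DIM('a) + 2))"
      using AE_lborel_singleton[of "0::'a"]
    proof eventually_elim
      case (elim z)
      have "(NN r. ennreal (\<bar>r\<bar> ^ (DIM('a) - 1)) * (ennreal ((norm (r *\<^sub>R sgn z))\<^sup>2) * indicator (cball 0 1) (r *\<^sub>R sgn z)))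
        = (NN r. ennreal (\<bar>r\<bar> ^ ((DIM('a) + 2) - 1)) * indicator {-1..1} r)" (is "(NN r. ?f r) = (NN r. ?g r)")
      proof (rule nn_integral_cong)
        fix r :: real
        have "\<bar>r\<bar> ^ (DIM('a) - 1) * \<bar>r\<bar>\<^sup>2 = \<bar>r\<bar> ^ ((DIM('a) + 2) - 1)"
          by (simp only: power_add[symmetric]) (simp add: Suc_diff_le DIM_positive Suc_leI)
        then have "ennreal (\<bar>r\<bar> ^ ((DIM('a) + 2) - 1)) = ennreal (\<bar>r\<bar> ^ (DIM('a) - 1)) * ennreal (\<bar>r\<bar>\<^sup>2)"
          by (simp flip: ennreal_mult)
        then show "?f r = ?g r"
          using elim by (auto simp: norm_sgn mult.assoc abs_le_iff split: split_indicator)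
      qed
      also have "\<dots> = ennreal (2 / (DIM('a) + 2))"
        by (subst nn_integral_power_symmetric) auto
      finally show ?case by simp
    qed
  qed
  also have "\<dots> = ennreal (unit_ball_vol (DIM('a)) * DIM('a) / (DIM('a) + 2))"
    by (simp add: nn_integral_multc emeasure_unit_cball ennreal_mult[symmetric])
  finally have sum: "(\<Sum>b\<in>Basis. T b) = ennreal (unit_ball_vol (DIM('a)) * DIM('a) / (DIM('a) + 2))" .
  have "(\<Sum>b\<in>Basis. T b) = (\<Sum>b\<in>(Basis::'a set). T b0)"
    by (intro sum.cong refl isometric) (use b0 in simp)
  then have "ennreal (DIM('a)) * T b0 = ennreal (unit_ball_vol (DIM('a)) * DIM('a) / (DIM('a) + 2))"
    using sum by (simp add: ennreal_of_nat_eq_real_of_nat)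
  then have "ennreal (1 / DIM('a)) * (ennreal (DIM('a)) * T b0) = ennreal (1 / DIM('a)) * ennreal (unit_ball_vol (DIM('a)) * DIM('a) / (DIM('a) + 2))"
    by simp
  then have Tb0: "T b0 = ennreal (unit_ball_vol (DIM('a)) / (DIM('a) + 2))"
    by (simp add: mult.assoc[symmetric] ennreal_mult[symmetric])
  have "T v = T (norm v *\<^sub>R b0)"
    by (rule isometric) (use b0 in simp)
  also have "\<dots> = ennreal ((norm v)\<^sup>2 * unit_ball_vol (DIM('a)) / (DIM('a) + 2))"
    by (simp add: scale Tb0 ennreal_mult[symmetric])
  finally show ?thesis unfolding T_def .
qed

text \<open>In polar coordinates, the integral of g over {Q <= 1} has in the direction omega the
  radial integral of |r|^(d+k-1) up to 1/sqrt(Q(omega)). Read backwards, this turns averages over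
  directions with a power of a quadratic form in the denominator into moments of an
  ellipsoid.\<close>

lemma nn_integral_homogeneous_over_ellipsoid:
  fixes g Q :: "'a::euclidean_space \<Rightarrow> real"
  assumes [measurable]: "borel_fun g" "borel_fun Q"
    and g: "\<And>r \<omega>. g (r *\<^sub>R \<omega>) = \<bar>r\<bar> ^ k * g \<omega>" "\<And>\<omega>. g \<omega> \<ge> 0"
    and Q: "\<And>r \<omega>. Q (r *\<^sub>R \<omega>) = r\<^sup>2 * Q \<omega>" "\<And>\<omega>. \<omega> \<noteq> 0 \<Longrightarrow> Q \<omega> > 0"
  shows "(NN z. indicator (cball 0 1) z * ennreal (g (sgn z) / sqrt (Q (sgn z)) ^ (DIM('a) + k)))
    = ennreal ((DIM('a) + k) / DIM('a)) * (NN \<xi>. ennreal (g \<xi>) * indicator {\<xi>. Q \<xi> \<le> 1} \<xi>)"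
proof -
  let ?d = "DIM('a)"
  have d: "?d > 0" by simp
  have [measurable]: "cball (0::'a) 1 \<in> sets borel" by simp
  have "(NN \<xi>. ennreal (g \<xi>) * indicator {\<xi>. Q \<xi> \<le> 1} \<xi>)
    = ennreal (?d / 2) * (NN z. indicator (cball 0 1) z *
    (NN r. ennreal (\<bar>r\<bar> ^ (?d - 1)) * (ennreal (g (r *\<^sub>R sgn z)) * indicator {\<xi>. Q \<xi> \<le> 1} (r *\<^sub>R sgn z))))"
    by (rule nn_integral_polar) simp
  also have "\<dots> = ennreal (?d / 2) * (NN z. ennreal (2 / (?d + k)) * (indicator (cball 0 1) z *
    ennreal (g (sgn z) / sqrt (Q (sgn z)) ^ (?d + k))))"
  proof (rule arg_cong[where f="\<lambda>x. ennreal (?d / 2) * x"], rule nn_integral_cong_AE)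
    show "AE z in lborel. indicator (cball 0 1) z *
      (NN r. ennreal (\<bar>r\<bar> ^ (?d - 1)) * (ennreal (g (r *\<^sub>R sgn z)) * indicator {\<xi>. Q \<xi> \<le> 1} (r *\<^sub>R sgn z)))
     = ennreal (2 / (?d + k)) * (indicator (cball 0 1) z * ennreal (g (sgn z) / sqrt (Q (sgn z)) ^ (?d + k)))"
      using AE_lborel_singleton[of "0::'a"]
    proof eventually_elim
      case (elim z)
      define \<omega> where "\<omega> = sgn z"
      have "\<omega> \<noteq> 0" using elim by (simp add: \<omega>_def sgn_zero_iff)
      then have Q0: "Q \<omega> > 0" by (rule Q)
      define R where "R = 1 / sqrt (Q \<omega>)"
      have R: "R > 0" using Q0 by (simp add: R_def)
      have "(NN r. ennreal (\<bar>r\<bar> ^ (?d - 1)) * (ennreal (g (r *\<^sub>R \<omega>)) * indicator {\<xi>. Q \<xi> \<le> 1} (r *\<^sub>R \<omega>)))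
        = (NN r. ennreal (g \<omega>) * (ennreal (\<bar>r\<bar> ^ ((?d + k) - 1)) * indicator {-R..R} r))" (is "(NN r. ?f r) = (NN r. ?g r)")
      proof (rule nn_integral_cong)
        fix r :: real
        have "\<bar>r\<bar> ^ (?d - 1) * (\<bar>r\<bar> ^ k * g \<omega>) = g \<omega> * \<bar>r\<bar> ^ ((?d + k) - 1)"
          using d by (simp add: power_add[symmetric] mult.left_commute add.commute)
        then have 1: "ennreal (\<bar>r\<bar> ^ (?d - 1)) * ennreal (g (r *\<^sub>R \<omega>)) = ennreal (g \<omega>) * ennreal (\<bar>r\<bar> ^ ((?d + k) - 1))"
          using g(2) by (simp add: g(1) ennreal_mult[symmetric])
        have "r\<^sup>2 * Q \<omega> \<le> 1 \<longleftrightarrow> r\<^sup>2 \<le> R\<^sup>2"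
          using Q0 by (simp add: R_def power_divide field_simps)
        also have "\<dots> \<longleftrightarrow> r \<in> {-R..R}"
          using R by (auto simp: abs_le_square_iff[symmetric])
        finally have 2: "(indicator {\<xi>. Q \<xi> \<le> 1} (r *\<^sub>R \<omega>) :: ennreal) = indicator {-R..R} r"
          by (simp add: indicator_def Q(1))
        show "?f r = ?g r"
          unfolding 2 mult.assoc[symmetric] 1 ..
      qed
      also have "\<dots> = ennreal (g \<omega>) * ennreal (2 * R ^ (?d + k) / (?d + k))"
      proof -
        have "(NN r. ennreal (\<bar>r\<bar> ^ ((?d + k) - 1)) * indicator {-R..R} r) = ennreal (2 * R ^ (?d + k) / real (?d + k))"
          by (rule nn_integral_power_symmetric) (use R d in \<open>auto simp: Suc_le_eq\<close>)
        then show ?thesis by (subst nn_integral_cmult) simp_all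
      qed
      also have "\<dots> = ennreal (2 / (?d + k)) * ennreal (g \<omega> / sqrt (Q \<omega>) ^ (?d + k))"
        using g(2)[of \<omega>] R Q0 by (simp add: ennreal_mult[symmetric] R_def power_one_over field_simps)
      finally show ?case by (simp add: \<omega>_def mult_ac)
    qed
  qed
  also have "\<dots> = ennreal (?d / (?d + k)) * (NN z. indicator (cball 0 1) z *
    ennreal (g (sgn z) / sqrt (Q (sgn z)) ^ (?d + k)))"
    using d by (subst nn_integral_cmult) (auto simp: mult.assoc[symmetric] ennreal_mult[symmetric])
  finally have "(NN \<xi>. ennreal (g \<xi>) * indicator {\<xi>. Q \<xi> \<le> 1} \<xi>) = ennreal (?d / (?d + k)) * (NN z. indicator (cball 0 1) z *
    ennreal (g (sgn z) / sqrt (Q (sgn z)) ^ (?d + k)))" .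
  moreover have dk: "real ?d + real k \<noteq> 0" by (simp add: add_nonneg_eq_0_iff)
  ultimately show ?thesis
    using d by (simp add: dk mult.assoc[symmetric] ennreal_mult[symmetric])
qed

text \<open>L maps the unit ball onto the ellipsoid: it scales by 1/p orthogonally to P and by c/p
  along P, with determinant c/p^d. For energy p and momentum P, c is the Lorentz factor of the boost
  to the centre-of-mass frame.\<close>

lemma nn_integral_ellipsoid:
  fixes P :: "'a::euclidean_space" and H :: "'a \<Rightarrow> ennreal"
  assumes P: "norm P < p" and [measurable]: "borel_fun H"
  defines "c \<equiv> p / sqrt (p\<^sup>2 - (norm P)\<^sup>2)"
  defines "L \<equiv> \<lambda>\<xi>. (1 / p) *\<^sub>R (\<xi> + ((c - 1) * (\<xi> \<bullet> sgn P)) *\<^sub>R sgn P)"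
  shows "(NN \<xi>. H \<xi> * indicator {\<xi>. p\<^sup>2 * (norm \<xi>)\<^sup>2 - (P \<bullet> \<xi>)\<^sup>2 \<le> 1} \<xi>)
    = ennreal (c / p ^ DIM('a)) * (NN \<xi>. H (L \<xi>) * indicator (cball 0 1) \<xi>)"
proof -
  have p: "p > 0" using P norm_ge_zero[of P] by linarith
  have less: "(norm P)\<^sup>2 < p\<^sup>2" using P by (simp add: power_strict_mono)
  have c0: "c > 0" using p less by (simp add: c_def)
  have c2: "c\<^sup>2 = p\<^sup>2 / (p\<^sup>2 - (norm P)\<^sup>2)" using less by (simp add: c_def power_divide)
  define Q where "Q \<xi> = p\<^sup>2 * (norm \<xi>)\<^sup>2 - (P \<bullet> \<xi>)\<^sup>2" for \<xi>
  have [measurable]: "borel_fun Q" unfolding Q_def[abs_def] by measurable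
  have [measurable]: "cball (0::'a) 1 \<in> sets borel" by simp
  let ?H = "\<lambda>\<xi>. H \<xi> * indicator {\<xi>. Q \<xi> \<le> 1} \<xi>"
  have "(NN \<xi>. ?H \<xi>) = ennreal (\<bar>1/p\<bar> ^ DIM('a)) * (NN \<xi>. ?H ((1/p) *\<^sub>R \<xi>))"
    by (rule nn_integral_lborel_scale) (use p in auto)
  also have "(NN \<xi>. ?H ((1/p) *\<^sub>R \<xi>)) = ennreal c * (NN \<xi>. ?H (L \<xi>))"
  proof (cases "P = 0")
    case True
    then show ?thesis using p by (simp add: L_def c_def)
  next
    case False
    show ?thesis
      unfolding L_def using nn_integral_stretch[of "sgn P" c "\<lambda>\<xi>. ?H ((1/p) *\<^sub>R \<xi>)"] False c0
      by (simp add: norm_sgn)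
  qed
  also have "(NN \<xi>. ?H (L \<xi>)) = (NN \<xi>. H (L \<xi>) * indicator (cball 0 1) \<xi>)"
  proof (rule nn_integral_cong)
    fix \<xi> :: 'a
    have QL: "Q (L \<xi>) = (norm \<xi>)\<^sup>2"
    proof (cases "P = 0")
      case True
      then show ?thesis using p by (simp add: Q_def L_def c_def power_mult_distrib power_divide)
    next
      case False
      define e where "e = sgn P"
      have ee: "e \<bullet> e = 1" using False by (simp add: e_def norm_sgn dot_square_norm)
      have Pe: "P = norm P *\<^sub>R e" using False by (simp add: e_def sgn_div_norm)
      define t where "t = \<xi> \<bullet> e"
      have "L \<xi> = (1 / p) *\<^sub>R (\<xi> + ((c - 1) * t) *\<^sub>R e)" by (simp add: L_def e_def t_def)
      moreover have "(norm (\<xi> + ((c - 1) * t) *\<^sub>R e))\<^sup>2 = (norm \<xi>)\<^sup>2 + (c\<^sup>2 - 1) * t\<^sup>2"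
        unfolding power2_norm_eq_inner
        by (simp add: inner_add_left inner_add_right inner_commute[of e \<xi>] ee t_def[symmetric])
           (simp add: algebra_simps power2_eq_square)
      moreover have "P \<bullet> (\<xi> + ((c - 1) * t) *\<^sub>R e) = norm P * c * t"
        by (subst Pe) (simp add: inner_add_right inner_commute[of e \<xi>] ee t_def[symmetric] algebra_simps)
      ultimately have "Q (L \<xi>) = (norm \<xi>)\<^sup>2 + (c\<^sup>2 - 1) * t\<^sup>2 - (norm P * c * t / p)\<^sup>2"
        using p by (simp add: Q_def power_mult_distrib power_divide)
      also have "(norm P * c * t / p)\<^sup>2 = (norm P)\<^sup>2 * c\<^sup>2 / p\<^sup>2 * t\<^sup>2"
        by (simp add: power_mult_distrib power_divide)
      also have "(norm P)\<^sup>2 * c\<^sup>2 / p\<^sup>2 = c\<^sup>2 - 1"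
      proof -
        have "(norm P)\<^sup>2 * c\<^sup>2 / p\<^sup>2 = (norm P)\<^sup>2 / (p\<^sup>2 - (norm P)\<^sup>2)" using p by (simp add: c2)
        also have "\<dots> = c\<^sup>2 - 1" using less by (simp add: c2 field_simps)
        finally show ?thesis .
      qed
      finally show ?thesis by simp
    qed
    have "(norm \<xi>)\<^sup>2 \<le> 1 \<longleftrightarrow> \<xi> \<in> cball 0 1"
      by (simp add: abs_square_le_1)
    then show "?H (L \<xi>) = H (L \<xi>) * indicator (cball 0 1) \<xi>"
      by (simp add: QL indicator_def)
  qed
  finally show ?thesis
    using p c0 by (simp add: Q_def mult.assoc[symmetric] ennreal_mult[symmetric] power_one_over)
qed

lemma momentum_form_pos:
  assumes "norm P < p" "w \<noteq> 0"
  shows "p\<^sup>2 * (norm w)\<^sup>2 - (P \<bullet> w)\<^sup>2 > 0"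
proof -
  have "(P \<bullet> w)\<^sup>2 \<le> (norm P * norm w)\<^sup>2"
    using Cauchy_Schwarz_ineq2[of P w] by (simp add: abs_le_square_iff[symmetric])
  also have "\<dots> < (p * norm w)\<^sup>2"
    using assms by (intro power_strict_mono mult_strict_right_mono) auto
  finally show ?thesis by (simp add: power_mult_distrib)
qed

lemma nn_integral_sphere_kernel0:
  fixes P :: "'a::euclidean_space"
  assumes P: "norm P < p"
  shows "(NN z. indicator (cball 0 1) z * ennreal (1 / sqrt (p\<^sup>2 - (P \<bullet> sgn z)\<^sup>2) ^ DIM('a)))
    = ennreal (unit_ball_vol DIM('a) * p / (p ^ DIM('a) * sqrt (p\<^sup>2 - (norm P)\<^sup>2)))"
proof -
  define Q where "Q \<xi> = p\<^sup>2 * (norm \<xi>)\<^sup>2 - (P \<bullet> \<xi>)\<^sup>2" for \<xi>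
  have [measurable]: "borel_fun Q" unfolding Q_def[abs_def] by measurable
  have p: "p > 0" using P norm_ge_zero[of P] by linarith
  have less: "(norm P)\<^sup>2 < p\<^sup>2" using P by (simp add: power_strict_mono)
  have "(NN z. indicator (cball 0 1) z * ennreal (1 / sqrt (p\<^sup>2 - (P \<bullet> sgn z)\<^sup>2) ^ DIM('a)))
    = (NN z. indicator (cball 0 1) z * ennreal (1 / sqrt (Q (sgn z)) ^ (DIM('a) + 0)))"
  by (rule nn_integral_cong_nonzero) (simp add: Q_def norm_sgn)
  also have "\<dots> = ennreal ((DIM('a) + 0) / DIM('a)) * (NN \<xi>. ennreal 1 * indicator {\<xi>. Q \<xi> \<le> 1} \<xi>)"
    using nn_integral_homogeneous_over_ellipsoid[of "\<lambda>_. 1" Q 0] momentum_form_pos[OF P]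
    by (simp add: Q_def power_mult_distrib algebra_simps)
  also have "(NN \<xi>. ennreal 1 * indicator {\<xi>. Q \<xi> \<le> 1} \<xi>)
    = ennreal (p / sqrt (p\<^sup>2 - (norm P)\<^sup>2) / p ^ DIM('a)) * (NN \<xi>. ennreal 1 * indicator (cball (0::'a) 1) \<xi>)"
    unfolding Q_def by (rule nn_integral_ellipsoid[OF P]) simp
  finally show ?thesis
    using p less by (simp add: emeasure_unit_cball ennreal_mult[symmetric] field_simps)
qed

text \<open>The map L of \<open>nn_integral_ellipsoid\<close> is symmetric, so v . L xi = w . xi for
  w = L v, and the second moment of the unit ball reduces the integral to |w|^2.\<close>

lemma nn_integral_sphere_kernel1:
  fixes P v :: "'a::euclidean_space" and p :: real
  assumes P: "norm P < p"
  shows "(NN z. indicator (cball 0 1) z * ennreal ((v \<bullet> sgn z)\<^sup>2 / sqrt (p\<^sup>2 - (P \<bullet> sgn z)\<^sup>2) ^ (DIM('a) + 2)))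
    = ennreal (unit_ball_vol DIM('a) * ((norm v)\<^sup>2 + (v \<bullet> P)\<^sup>2 / (p\<^sup>2 - (norm P)\<^sup>2))
    / (DIM('a) * p * p ^ DIM('a) * sqrt (p\<^sup>2 - (norm P)\<^sup>2)))"
proof -
  define Q where "Q \<xi> = p\<^sup>2 * (norm \<xi>)\<^sup>2 - (P \<bullet> \<xi>)\<^sup>2" for \<xi>
  have [measurable]: "borel_fun Q" unfolding Q_def[abs_def] by measurable
  have p: "p > 0" using P norm_ge_zero[of P] by linarith
  have less: "(norm P)\<^sup>2 < p\<^sup>2" using P by (simp add: power_strict_mono)
  define c where "c = p / sqrt (p\<^sup>2 - (norm P)\<^sup>2)"
  have c2: "c\<^sup>2 = p\<^sup>2 / (p\<^sup>2 - (norm P)\<^sup>2)" using less by (simp add: c_def power_divide)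
  have c0: "c > 0" using p less by (simp add: c_def)
  define w where "w = (1 / p) *\<^sub>R (v + ((c - 1) * (v \<bullet> sgn P)) *\<^sub>R sgn P)"
  have "(NN z. indicator (cball 0 1) z * ennreal ((v \<bullet> sgn z)\<^sup>2 / sqrt (p\<^sup>2 - (P \<bullet> sgn z)\<^sup>2) ^ (DIM('a) + 2)))
    = (NN z. indicator (cball 0 1) z * ennreal ((v \<bullet> sgn z)\<^sup>2 / sqrt (Q (sgn z)) ^ (DIM('a) + 2)))"
  by (rule nn_integral_cong_nonzero) (simp add: Q_def norm_sgn)
  also have "\<dots> = ennreal ((DIM('a) + 2) / DIM('a)) * (NN \<xi>. ennreal ((v \<bullet> \<xi>)\<^sup>2) * indicator {\<xi>. Q \<xi> \<le> 1} \<xi>)"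
    using nn_integral_homogeneous_over_ellipsoid[of "\<lambda>\<xi>. (v \<bullet> \<xi>)\<^sup>2" Q 2] momentum_form_pos[OF P]
    by (simp add: Q_def power_mult_distrib algebra_simps)
  also have "(NN \<xi>. ennreal ((v \<bullet> \<xi>)\<^sup>2) * indicator {\<xi>. Q \<xi> \<le> 1} \<xi>)
    = ennreal (c / p ^ DIM('a)) * (NN \<xi>. ennreal ((v \<bullet> ((1 / p) *\<^sub>R (\<xi> + ((c - 1) * (\<xi> \<bullet> sgn P)) *\<^sub>R sgn P)))\<^sup>2) * indicator (cball (0::'a) 1) \<xi>)"
    unfolding Q_def c_def by (rule nn_integral_ellipsoid[OF P]) simp
  also have "\<dots> = ennreal (c / p ^ DIM('a)) * (NN \<xi>. ennreal ((w \<bullet> \<xi>)\<^sup>2) * indicator (cball (0::'a) 1) \<xi>)"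
    by (simp add: w_def inner_add_left inner_add_right inner_commute mult_ac)
  also have "\<dots> = ennreal (c / p ^ DIM('a)) * ennreal ((norm w)\<^sup>2 * unit_ball_vol (DIM('a)) / (DIM('a) + 2))"
    by (simp add: nn_integral_ball_inner_square)
  also have "(norm w)\<^sup>2 = ((norm v)\<^sup>2 + (v \<bullet> P)\<^sup>2 / (p\<^sup>2 - (norm P)\<^sup>2)) / p\<^sup>2"
  proof (cases "P = 0")
    case True
    then show ?thesis using p by (simp add: w_def power_divide)
  next
    case False
    define e where "e = sgn P"
    have ee: "e \<bullet> e = 1" using False by (simp add: e_def norm_sgn dot_square_norm)
    have Pe: "P = norm P *\<^sub>R e" using False by (simp add: e_def sgn_div_norm)
    define t where "t = v \<bullet> e"
    have "(norm (v + ((c - 1) * t) *\<^sub>R e))\<^sup>2 = (norm v)\<^sup>2 + (c\<^sup>2 - 1) * t\<^sup>2"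
      unfolding power2_norm_eq_inner
      by (simp add: inner_add_left inner_add_right inner_commute[of e v] ee t_def[symmetric])
         (simp add: algebra_simps power2_eq_square)
    moreover have "c\<^sup>2 - 1 = (norm P)\<^sup>2 / (p\<^sup>2 - (norm P)\<^sup>2)"
      using less by (simp add: c2 field_simps)
    moreover have "(v \<bullet> P)\<^sup>2 = (norm P)\<^sup>2 * t\<^sup>2"
      by (subst Pe) (simp add: t_def power_mult_distrib)
    ultimately show ?thesis
      by (simp add: w_def e_def[symmetric] t_def[symmetric] power_divide power_mult_distrib)
  qed
  finally have eq: "(NN z. indicator (cball 0 1) z * ennreal ((v \<bullet> sgn z)\<^sup>2 / sqrt (p\<^sup>2 - (P \<bullet> sgn z)\<^sup>2) ^ (DIM('a) + 2)))
    = ennreal ((DIM('a) + 2) / DIM('a)) * (ennreal (c / p ^ DIM('a)) *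
    ennreal (((norm v)\<^sup>2 + (v \<bullet> P)\<^sup>2 / (p\<^sup>2 - (norm P)\<^sup>2)) / p\<^sup>2 * unit_ball_vol (DIM('a)) / (DIM('a) + 2)))"
    by simp
  define A where "A = (norm v)\<^sup>2 + (v \<bullet> P)\<^sup>2 / (p\<^sup>2 - (norm P)\<^sup>2)"
  have A: "A \<ge> 0" using less by (simp add: A_def)
  have S: "sqrt (p\<^sup>2 - (norm P)\<^sup>2) > 0" using less by simp
  have n: "0 \<le> p / sqrt (p\<^sup>2 - (norm P)\<^sup>2) / p ^ DIM('a)"
    using p P by (intro divide_nonneg_nonneg) auto
  have "(real DIM('a) + 2) / DIM('a) * (p / S / p ^ DIM('a)) * (A / p\<^sup>2 * unit_ball_vol (DIM('a)) / (real DIM('a) + 2))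
    = unit_ball_vol DIM('a) * A / (DIM('a) * p * p ^ DIM('a) * S)" if "S > 0" for S
    using that p by (simp add: divide_simps) (simp add: power2_eq_square)
  from this[OF S] show ?thesis
    unfolding eq A_def[symmetric] c_def
    by (subst ennreal_mult3) (use n A in auto)
qed

section \<open>Fibres of the energy difference\<close>

definition energy :: "real \<Rightarrow> 'a::euclidean_space \<Rightarrow> real" where
  "energy s \<eta> = phi s (norm \<eta>)"

definition perp :: "'a::euclidean_space \<Rightarrow> 'a \<Rightarrow> 'a" where
  "perp w \<eta> = \<eta> - (\<eta> \<bullet> w) *\<^sub>R w"

text \<open>
  For |tau| < |xi|, \<open>fibre_pt s \<tau> \<xi>\<close> maps the hyperplane orthogonal to xi onto the fibre
  \<open>energy s \<eta> - energy s (\<eta> - \<xi>) = \<tau>\<close>.  Only the component of its last argument orthogonal to xi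
  matters; the factor \<open>theta\<close> in \<open>fibre_wt\<close> averages over the other component, so that an
  integral over the hyperplane can be written as a Lebesgue integral over the whole space.
\<close>

definition fibre_q :: "real \<Rightarrow> 'a::euclidean_space \<Rightarrow> real" where
  "fibre_q \<tau> \<xi> = sqrt ((norm \<xi>)\<^sup>2 - \<tau>\<^sup>2)"

text \<open>The energy that both eta and eta - xi have in the frame without energy transfer, where
  their momenta along xi are \<open>fibre_q / 2\<close> and its negative. The first two terms under
  the root are the squared transverse mass, the parameter m of
  \<open>collision_energy\<close>.\<close>

definition fibre_M :: "real \<Rightarrow> real \<Rightarrow> 'a::euclidean_space \<Rightarrow> 'a \<Rightarrow> real" where
  "fibre_M s \<tau> \<xi> \<eta> = sqrt (s\<^sup>2 + (norm (perp (sgn \<xi>) \<eta>))\<^sup>2 + (fibre_q \<tau> \<xi>)\<^sup>2 / 4)"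

definition fibre_pt :: "real \<Rightarrow> real \<Rightarrow> 'a::euclidean_space \<Rightarrow> 'a \<Rightarrow> 'a" where
  "fibre_pt s \<tau> \<xi> \<eta> = perp (sgn \<xi>) \<eta> + (\<tau> * fibre_M s \<tau> \<xi> \<eta> / fibre_q \<tau> \<xi>) *\<^sub>R sgn \<xi> + (1/2) *\<^sub>R \<xi>"

text \<open>The Lorentz-invariant density of the fibre: the Jacobian of
  \<open>nn_integral_energy_difference\<close> without the two energies.
  \<open>fibre_density\<close> restores them and represents delta(E(eta) - E(eta - xi) - tau) d eta.
  The indicator makes the weight 0 unless |tau| < |xi|, so the values of \<open>fibre_q\<close>
  elsewhere are irrelevant.\<close>

definition fibre_wt :: "real \<Rightarrow> real \<Rightarrow> 'a::euclidean_space \<Rightarrow> 'a \<Rightarrow> real" where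
  "fibre_wt s \<tau> \<xi> \<eta> = theta (\<eta> \<bullet> sgn \<xi>) * indicat_real {\<tau>. \<bar>\<tau>\<bar> < norm \<xi>} \<tau> / (fibre_q \<tau> \<xi> * fibre_M s \<tau> \<xi> \<eta>)"

abbreviation fibre_density :: "real \<Rightarrow> real \<Rightarrow> 'a::euclidean_space \<Rightarrow> 'a \<Rightarrow> real" where
  "fibre_density s \<tau> \<xi> \<eta> \<equiv> fibre_wt s \<tau> \<xi> \<eta> * energy s (fibre_pt s \<tau> \<xi> \<eta>) * energy s (fibre_pt s \<tau> \<xi> \<eta> - \<xi>)"

lemma energy_measurable [measurable]: "borel_fun (energy s)"
  unfolding energy_def[abs_def] phi_def by measurable

lemma measurable_perp [measurable (raw)]:
  assumes [measurable]: "f \<in> borel_measurable N" "g \<in> borel_measurable N"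
  shows "(\<lambda>x. perp (f x) (g x)) \<in> borel_measurable N"
  unfolding perp_def by measurable

lemma measurable_fibre_q [measurable (raw)]:
  assumes [measurable]: "f \<in> borel_measurable N" "g \<in> borel_measurable N"
  shows "(\<lambda>x. fibre_q (f x) (g x)) \<in> borel_measurable N"
  unfolding fibre_q_def by measurable

lemma measurable_fibre_M [measurable (raw)]:
  assumes [measurable]: "f \<in> borel_measurable N" "g \<in> borel_measurable N" "h \<in> borel_measurable N"
  shows "(\<lambda>x. fibre_M s (f x) (g x) (h x)) \<in> borel_measurable N"
  unfolding fibre_M_def by measurable

lemma measurable_fibre_pt [measurable (raw)]:
  assumes [measurable]: "f \<in> borel_measurable N" "g \<in> borel_measurable N" "h \<in> borel_measurable N"
  shows "(\<lambda>x. fibre_pt s (f x) (g x) (h x)) \<in> borel_measurable N"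
  unfolding fibre_pt_def by measurable

lemma measurable_fibre_wt [measurable (raw)]:
  assumes [measurable]: "f \<in> borel_measurable N" "g \<in> borel_measurable N" "h \<in> borel_measurable N"
  shows "(\<lambda>x. fibre_wt s (f x) (g x) (h x)) \<in> borel_measurable N"
  unfolding fibre_wt_def by measurable

lemma fibre_wt_nonneg: "fibre_wt s \<tau> \<xi> \<eta> \<ge> 0"
proof (cases "\<bar>\<tau>\<bar> < norm \<xi>")
  case True
  then have "\<tau>\<^sup>2 \<le> (norm \<xi>)\<^sup>2" by (simp add: abs_le_square_iff[symmetric])
  then show ?thesis unfolding fibre_wt_def fibre_q_def fibre_M_def
    by (intro divide_nonneg_nonneg mult_nonneg_nonneg) auto
qed (simp add: fibre_wt_def)

lemma energy_pos: "s > 0 \<Longrightarrow> energy s \<eta> > 0"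
  by (simp add: energy_def phi_def add_pos_nonneg)

lemma energy_ge: "s > 0 \<Longrightarrow> energy s \<eta> \<ge> s"
  by (simp add: energy_def phi_def real_le_rsqrt)

lemma energy_square: "(energy s \<eta>)\<^sup>2 = s\<^sup>2 + (norm \<eta>)\<^sup>2"
  by (simp add: energy_def phi_def)

lemma norm_less_energy: "s > 0 \<Longrightarrow> norm \<eta> < energy s \<eta>"
  unfolding energy_def phi_def by (rule real_less_rsqrt) simp

lemma perp_inner [simp]: "norm w = 1 \<Longrightarrow> perp w \<eta> \<bullet> w = 0" "norm w = 1 \<Longrightarrow> w \<bullet> perp w \<eta> = 0"
  by (simp_all add: perp_def inner_diff_left inner_diff_right inner_commute dot_square_norm)

lemma norm_perp_add:
  assumes "norm w = 1"
  shows "(norm (perp w \<eta> + x *\<^sub>R w))\<^sup>2 = (norm (perp w \<eta>))\<^sup>2 + x\<^sup>2"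
proof -
  have "w \<bullet> w = 1" using assms by (simp add: dot_square_norm)
  then show ?thesis
    unfolding power2_norm_eq_inner using assms
    by (simp add: inner_add_left inner_add_right power2_eq_square)
qed

lemma energy_perp_add:
  assumes "norm w = 1"
  shows "energy s (perp w \<eta> + x *\<^sub>R w) = sqrt (s\<^sup>2 + (norm (perp w \<eta>))\<^sup>2 + x\<^sup>2)"
  by (simp add: energy_def phi_def norm_perp_add[OF assms] add.assoc)

lemma fibre_pt_line:
  assumes "\<xi> \<noteq> 0"
  shows "fibre_pt s \<tau> \<xi> \<eta> = perp (sgn \<xi>) \<eta> + (\<tau> * fibre_M s \<tau> \<xi> \<eta> / fibre_q \<tau> \<xi> + norm \<xi> / 2) *\<^sub>R sgn \<xi>"
    "fibre_pt s \<tau> \<xi> \<eta> - \<xi> = perp (sgn \<xi>) \<eta> + (\<tau> * fibre_M s \<tau> \<xi> \<eta> / fibre_q \<tau> \<xi> - norm \<xi> / 2) *\<^sub>R sgn \<xi>"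
proof -
  have x: "\<xi> = norm \<xi> *\<^sub>R sgn \<xi>" using assms by (simp add: sgn_div_norm)
  then have h: "(1/2) *\<^sub>R \<xi> = (norm \<xi> / 2) *\<^sub>R sgn \<xi>"
    by (metis scaleR_scaleR mult.left_neutral times_divide_eq_left)
  then show 1: "fibre_pt s \<tau> \<xi> \<eta> = perp (sgn \<xi>) \<eta> + (\<tau> * fibre_M s \<tau> \<xi> \<eta> / fibre_q \<tau> \<xi> + norm \<xi> / 2) *\<^sub>R sgn \<xi>"
    unfolding fibre_pt_def by (simp add: scaleR_add_left)
  have "\<xi> = (norm \<xi> / 2) *\<^sub>R sgn \<xi> + (norm \<xi> / 2) *\<^sub>R sgn \<xi>"
    by (subst scaleR_add_left[symmetric]) (use x in simp)
  then have "fibre_pt s \<tau> \<xi> \<eta> - \<xi> = fibre_pt s \<tau> \<xi> \<eta> - ((norm \<xi> / 2) *\<^sub>R sgn \<xi> + (norm \<xi> / 2) *\<^sub>R sgn \<xi>)"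
    by simp
  then show "fibre_pt s \<tau> \<xi> \<eta> - \<xi> = perp (sgn \<xi>) \<eta> + (\<tau> * fibre_M s \<tau> \<xi> \<eta> / fibre_q \<tau> \<xi> - norm \<xi> / 2) *\<^sub>R sgn \<xi>"
    unfolding 1 by (simp add: scaleR_add_left scaleR_diff_left)
qed

lemma fibre_collision:
  assumes s: "s > 0" and \<tau>: "\<bar>\<tau>\<bar> < norm \<xi>"
  shows "fibre_q \<tau> \<xi> > 0" "fibre_M s \<tau> \<xi> \<eta> > 0"
    "energy s (fibre_pt s \<tau> \<xi> \<eta>) = norm \<xi> * fibre_M s \<tau> \<xi> \<eta> / fibre_q \<tau> \<xi> + \<tau> / 2"
    "energy s (fibre_pt s \<tau> \<xi> \<eta> - \<xi>) = norm \<xi> * fibre_M s \<tau> \<xi> \<eta> / fibre_q \<tau> \<xi> - \<tau> / 2"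
proof -
  have \<xi>: "\<xi> \<noteq> 0" using \<tau> by auto
  define m where "m = sqrt (s\<^sup>2 + (norm (perp (sgn \<xi>) \<eta>))\<^sup>2)"
  have m: "m > 0" using s by (simp add: m_def add_pos_nonneg)
  have m2: "m\<^sup>2 = s\<^sup>2 + (norm (perp (sgn \<xi>) \<eta>))\<^sup>2" by (simp add: m_def)
  have M: "fibre_M s \<tau> \<xi> \<eta> = sqrt (m\<^sup>2 + (fibre_q \<tau> \<xi>)\<^sup>2 / 4)"
    unfolding fibre_M_def m2 ..
  note c = collision_energy[OF \<tau> fibre_q_def m M]
  show "fibre_q \<tau> \<xi> > 0" "fibre_M s \<tau> \<xi> \<eta> > 0" by (fact c)+
  have w: "norm (sgn \<xi>) = 1" using \<xi> by (simp add: norm_sgn)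
  show "energy s (fibre_pt s \<tau> \<xi> \<eta>) = norm \<xi> * fibre_M s \<tau> \<xi> \<eta> / fibre_q \<tau> \<xi> + \<tau> / 2"
    unfolding fibre_pt_line[OF \<xi>] energy_perp_add[OF w] using c(5) unfolding m2 by simp
  show "energy s (fibre_pt s \<tau> \<xi> \<eta> - \<xi>) = norm \<xi> * fibre_M s \<tau> \<xi> \<eta> / fibre_q \<tau> \<xi> - \<tau> / 2"
    unfolding fibre_pt_line(2)[OF \<xi>] energy_perp_add[OF w] using c(6) unfolding m2 by simp
qed

lemma fibre_energy_difference:
  assumes "s > 0" "\<bar>\<tau>\<bar> < norm \<xi>"
  shows "energy s (fibre_pt s \<tau> \<xi> \<eta>) - energy s (fibre_pt s \<tau> \<xi> \<eta> - \<xi>) = \<tau>"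
  using fibre_collision(3,4)[OF assms, of \<eta>] by simp

text \<open>The co-area formula for the energy difference. On each line parallel to xi the
  coordinate is replaced by tau through \<open>nn_integral_energy_difference\<close>, with the
  transverse mass of the line in the place of m; \<open>fibre_density\<close> collects the Jacobian
  and \<open>theta\<close>.\<close>

lemma nn_integral_fibre:
  fixes H :: "'a::euclidean_space \<Rightarrow> ennreal"
  assumes s: "s > 0" and \<xi>: "\<xi> \<noteq> 0" and [measurable]: "borel_fun H"
  shows "(NN \<eta>. H \<eta>) = (NN \<tau> \<eta>.      ennreal (fibre_density s \<tau> \<xi> \<eta>) *
    H (fibre_pt s \<tau> \<xi> \<eta>))"
proof -
  define w where "w = sgn \<xi>"
  have w: "norm w = 1" using \<xi> by (simp add: w_def norm_sgn)
  have r: "norm \<xi> > 0" using \<xi> by simp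
  have "(NN \<eta>. H \<eta>) =
    (NN \<eta>. ennreal (theta (\<eta> \<bullet> w)) * (NN x. H (perp w \<eta> + x *\<^sub>R w)))"
    unfolding perp_def by (rule nn_integral_line[OF w]) simp
  also have "\<dots> = (NN \<eta> \<tau>.      ennreal (fibre_density s \<tau> \<xi> \<eta>) *
    H (fibre_pt s \<tau> \<xi> \<eta>))"
  proof (rule nn_integral_cong)
    fix \<eta> :: 'a
    define m where "m = sqrt (s\<^sup>2 + (norm (perp (sgn \<xi>) \<eta>))\<^sup>2)"
    have m: "m > 0" using s by (simp add: m_def add_pos_nonneg)
    have m2: "m\<^sup>2 = s\<^sup>2 + (norm (perp (sgn \<xi>) \<eta>))\<^sup>2" by (simp add: m_def)
    have M: "sqrt (m\<^sup>2 + (sqrt ((norm \<xi>)\<^sup>2 - \<tau>\<^sup>2))\<^sup>2 / 4) = fibre_M s \<tau> \<xi> \<eta>" for \<tau>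
      unfolding fibre_M_def m2 fibre_q_def ..
    have "(NN x. H (perp w \<eta> + x *\<^sub>R w)) =
      (NN \<tau>. indicator {\<tau>. \<bar>\<tau>\<bar> < norm \<xi>} \<tau> *
      (ennreal ((norm \<xi> * fibre_M s \<tau> \<xi> \<eta> / fibre_q \<tau> \<xi> + \<tau> / 2) *
      (norm \<xi> * fibre_M s \<tau> \<xi> \<eta> / fibre_q \<tau> \<xi> - \<tau> / 2) / (fibre_q \<tau> \<xi> * fibre_M s \<tau> \<xi> \<eta>)) *
      H (perp w \<eta> + (\<tau> * fibre_M s \<tau> \<xi> \<eta> / fibre_q \<tau> \<xi> + norm \<xi> / 2) *\<^sub>R w)))"
      using nn_integral_energy_difference[OF m r, of "\<lambda>x. H (perp w \<eta> + x *\<^sub>R w)"]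
      unfolding Let_def M unfolding fibre_q_def[symmetric] by simp
    then have "ennreal (theta (\<eta> \<bullet> w)) * (NN x. H (perp w \<eta> + x *\<^sub>R w))
      = (NN \<tau>. ennreal (theta (\<eta> \<bullet> w)) * (indicator {\<tau>. \<bar>\<tau>\<bar> < norm \<xi>} \<tau> *
      (ennreal ((norm \<xi> * fibre_M s \<tau> \<xi> \<eta> / fibre_q \<tau> \<xi> + \<tau> / 2) *
      (norm \<xi> * fibre_M s \<tau> \<xi> \<eta> / fibre_q \<tau> \<xi> - \<tau> / 2) / (fibre_q \<tau> \<xi> * fibre_M s \<tau> \<xi> \<eta>)) *
      H (perp w \<eta> + (\<tau> * fibre_M s \<tau> \<xi> \<eta> / fibre_q \<tau> \<xi> + norm \<xi> / 2) *\<^sub>R w))))"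
      by (simp add: nn_integral_cmult)
    also have "\<dots> = (NN \<tau>. ennreal (fibre_density s \<tau> \<xi> \<eta>) *
      H (fibre_pt s \<tau> \<xi> \<eta>))" (is "(NN \<tau>. ?f \<tau>) = (NN \<tau>. ?g \<tau>)")
    proof (rule nn_integral_cong)
      fix \<tau> :: real
      show "?f \<tau> = ?g \<tau>"
      proof (cases "\<bar>\<tau>\<bar> < norm \<xi>")
        case True
        note c = fibre_collision[OF s True]
        have e: "energy s (fibre_pt s \<tau> \<xi> \<eta>) > 0" "energy s (fibre_pt s \<tau> \<xi> \<eta> - \<xi>) > 0"
          using energy_pos[OF s] by auto
        have "fibre_density s \<tau> \<xi> \<eta>
          = theta (\<eta> \<bullet> w) * (energy s (fibre_pt s \<tau> \<xi> \<eta>) * energy s (fibre_pt s \<tau> \<xi> \<eta> - \<xi>) / (fibre_q \<tau> \<xi> * fibre_M s \<tau> \<xi> \<eta>))"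
          using True by (simp add: fibre_wt_def w_def)
        then have "ennreal (fibre_density s \<tau> \<xi> \<eta>)
          = ennreal (theta (\<eta> \<bullet> w)) * ennreal (energy s (fibre_pt s \<tau> \<xi> \<eta>) * energy s (fibre_pt s \<tau> \<xi> \<eta> - \<xi>) / (fibre_q \<tau> \<xi> * fibre_M s \<tau> \<xi> \<eta>))"
          using e c(1) c(2)[of \<eta>] by (simp add: ennreal_mult[symmetric])
        then show ?thesis
          unfolding c(3,4)[symmetric] w_def fibre_pt_line(1)[OF \<xi>, symmetric]
          using True by (simp add: mult.assoc)
      qed (simp add: fibre_wt_def)
    qed
    finally show "ennreal (theta (\<eta> \<bullet> w)) * (NN x. H (perp w \<eta> + x *\<^sub>R w))
      = (NN \<tau>. ennreal (fibre_density s \<tau> \<xi> \<eta>) *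
      H (fibre_pt s \<tau> \<xi> \<eta>))" .
  qed
  also have "\<dots> = (NN \<tau> \<eta>.      ennreal (fibre_density s \<tau> \<xi> \<eta>) *
    H (fibre_pt s \<tau> \<xi> \<eta>))"
    by (rule lborel_pair.Fubini') simp
  finally show ?thesis .
qed

lemma nn_integral_swap3:
  fixes g :: "'a::euclidean_space \<Rightarrow> 'b::euclidean_space \<Rightarrow> 'c::euclidean_space \<Rightarrow> ennreal"
  assumes [measurable]: "(\<lambda>(a, b, c). g a b c) \<in> borel_measurable (borel \<Otimes>\<^sub>M borel \<Otimes>\<^sub>M borel)"
  shows "(NN a b c. g a b c)
    = (NN c a b. g a b c)"
proof -
  have [measurable]: "(\<lambda>x. g (f1 x) (f2 x) (f3 x)) \<in> borel_measurable N"
    if [measurable]: "f1 \<in> borel_measurable N" "f2 \<in> borel_measurable N" "f3 \<in> borel_measurable N" for f1 f2 f3 and N :: "'x measure"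
  proof -
    have "(\<lambda>x. (\<lambda>(a, b, c). g a b c) (f1 x, f2 x, f3 x)) \<in> borel_measurable N" by measurable
    then show ?thesis by simp
  qed
  have "(NN a b c. g a b c)
    = (NN a c b. g a b c)"
    by (rule nn_integral_cong, rule lborel_pair.Fubini') measurable
  also have "\<dots> = (NN c a b. g a b c)"
    by (rule lborel_pair.Fubini') measurable
  finally show ?thesis .
qed

section \<open>Pairs of points on a fibre\<close>

text \<open>The density in (a, b) that results when xi is restricted to the line of direction w. In
  the coordinates of \<open>collision_pointwise\<close> the square root is M + N and the inner
  product with w in the numerator is q (M + N)/2, so the expression reduces to 2
  cosh(\<kappa>)^(d-1) q^(2j) / (M + N). Expressed through a, b and w, it can be averaged over
  w.\<close>

definition collision_kernel :: "real \<Rightarrow> nat \<Rightarrow> 'a::euclidean_space \<Rightarrow> 'a \<Rightarrow> 'a \<Rightarrow> real" where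
  "collision_kernel s j w a b = 2 * 4 ^ j * (energy s a + energy s b) ^ (DIM('a) - 1)
    * ((energy s b *\<^sub>R a - energy s a *\<^sub>R b) \<bullet> w) ^ (2 * j)
    / sqrt ((energy s a + energy s b)\<^sup>2 - ((a + b) \<bullet> w)\<^sup>2) ^ (DIM('a) + 2 * j)"

abbreviation kernel_mean :: "real \<Rightarrow> nat \<Rightarrow> 'a::euclidean_space \<Rightarrow> 'a \<Rightarrow> ennreal" where
  "kernel_mean s j a b \<equiv> (NN z. indicator (cball 0 1) z * ennreal (collision_kernel s j (sgn z) a b))"

abbreviation collision_term :: "real \<Rightarrow> (real \<Rightarrow> real) \<Rightarrow> ('a::euclidean_space \<Rightarrow> 'a \<Rightarrow> ennreal) \<Rightarrow> real \<Rightarrow> 'a \<Rightarrow> 'a \<Rightarrow> 'a \<Rightarrow> ennreal" where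
  "collision_term s W H \<tau> \<xi> \<eta> \<eta>' \<equiv>
    ennreal (W (fibre_q \<tau> \<xi>) * fibre_wt s \<tau> \<xi> \<eta> * fibre_wt s \<tau> \<xi> \<eta>'
        * energy s (fibre_pt s \<tau> \<xi> \<eta>) * energy s (fibre_pt s \<tau> \<xi> \<eta>' - \<xi>))
      * H (fibre_pt s \<tau> \<xi> \<eta>) (fibre_pt s \<tau> \<xi> \<eta>' - \<xi>)"

lemma measurable_collision_kernel [measurable (raw)]:
  assumes [measurable]: "f \<in> borel_measurable N" "g \<in> borel_measurable N" "h \<in> borel_measurable N"
  shows "(\<lambda>x. collision_kernel s j (f x) (g x) (h x)) \<in> borel_measurable N"
  unfolding collision_kernel_def by measurable

lemma momentum_less_energy:
  assumes "s > 0"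
  shows "norm (a + b) < energy s a + energy s b"
  using norm_triangle_ineq[of a b] norm_less_energy[OF assms, of a] norm_less_energy[OF assms, of b]
  by linarith

lemma collision_kernel_nonneg:
  assumes "s > 0" "norm w \<le> 1"
  shows "collision_kernel s j w a b \<ge> 0"
proof -
  have "\<bar>(a + b) \<bullet> w\<bar> \<le> norm (a + b) * norm w" by (rule Cauchy_Schwarz_ineq2)
  also have "\<dots> \<le> norm (a + b) * 1" using assms by (intro mult_left_mono) auto
  also have "\<dots> \<le> energy s a + energy s b" using momentum_less_energy[OF assms(1), of a b] by simp
  finally have "((a + b) \<bullet> w)\<^sup>2 \<le> (energy s a + energy s b)\<^sup>2"
    by (meson abs_ge_zero abs_le_square_iff abs_ge_self order_trans)
  then show ?thesis
    using energy_pos[OF assms(1), of a] energy_pos[OF assms(1), of b]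
    unfolding collision_kernel_def by (intro divide_nonneg_nonneg mult_nonneg_nonneg) auto
qed

text \<open>Both descriptions of a pair of fibre points share the parameters q and \<kappa>: they
  are the hyperbolic coordinates of (tau, r), and they are the centre-of-mass coordinates of the
  components of a and b along w. The third claim compares the two Jacobians. On the left, polar and
  hyperbolic coordinates contribute |q|^d and the two fibre weights q^(-2), which is why W is
  normalised by q^(d-2) W(q) = q^(2j).\<close>

lemma collision_pointwise:
  fixes w \<eta> \<eta>' :: "'a::euclidean_space" and q \<kappa> s :: real
  assumes s: "s > 0" and w: "norm w = 1" and q: "q \<noteq> 0" and d: "DIM('a) \<ge> 2"
    and W: "\<forall>q>0. q ^ (DIM('a) - 2) * W q = q ^ (2 * j)"
  defines "M \<equiv> sqrt (s\<^sup>2 + (norm (perp w \<eta>))\<^sup>2 + q\<^sup>2 / 4)" and "N \<equiv> sqrt (s\<^sup>2 + (norm (perp w \<eta>'))\<^sup>2 + q\<^sup>2 / 4)"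
  defines "\<xi> \<equiv> (q * cosh \<kappa>) *\<^sub>R w" and "\<tau> \<equiv> q * sinh \<kappa>"
  defines "a \<equiv> perp w \<eta> + (M * sinh \<kappa> + q / 2 * cosh \<kappa>) *\<^sub>R w"
    and "b \<equiv> perp w \<eta>' + (N * sinh \<kappa> - q / 2 * cosh \<kappa>) *\<^sub>R w"
  shows "fibre_pt s \<tau> \<xi> \<eta> = a" "fibre_pt s \<tau> \<xi> \<eta>' - \<xi> = b"
    "\<bar>q\<bar> * \<bar>q * cosh \<kappa>\<bar> ^ (DIM('a) - 1) * (W (fibre_q \<tau> \<xi>) * fibre_wt s \<tau> \<xi> \<eta> * fibre_wt s \<tau> \<xi> \<eta>' * energy s a * energy s b)
     = (M * cosh \<kappa> + q / 2 * sinh \<kappa>) * (N * cosh \<kappa> - q / 2 * sinh \<kappa>) * ((M + N) / (2 * M * N)) *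
      (theta (\<eta> \<bullet> w) * theta (\<eta>' \<bullet> w) * collision_kernel s j w a b)"
    "M * cosh \<kappa> + q / 2 * sinh \<kappa> > 0" "N * cosh \<kappa> - q / 2 * sinh \<kappa> > 0" "M > 0" "N > 0"
proof -
  have ww: "w \<bullet> w = 1" using w by (simp add: dot_square_norm)
  have \<xi>0: "\<xi> \<noteq> 0" using q w by (auto simp: \<xi>_def)
  have nx: "norm \<xi> = \<bar>q\<bar> * cosh \<kappa>" using w by (simp add: \<xi>_def abs_mult)
  have sx: "sgn \<xi> = sgn q *\<^sub>R w"
  proof -
    have "sgn \<xi> = (q * cosh \<kappa> / (\<bar>q\<bar> * cosh \<kappa>)) *\<^sub>R w"
      by (simp add: sgn_div_norm nx) (simp add: \<xi>_def divide_inverse mult.commute)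
    then show ?thesis by (simp add: sgn_real_def)
  qed
  have sq: "sgn q * sgn q = 1" "sgn q * \<bar>q\<bar> = q" "q / \<bar>q\<bar> = sgn q" "\<bar>q\<bar> > 0"
    using q by (auto simp: sgn_real_def)
  have sh: "\<bar>sinh \<kappa>\<bar> < cosh \<kappa>"
  proof (rule power2_less_imp_less)
    show "\<bar>sinh \<kappa>\<bar>\<^sup>2 < (cosh \<kappa>)\<^sup>2" by (simp add: cosh_square_eq)
  qed simp
  have tau: "\<bar>\<tau>\<bar> < norm \<xi>" using sh sq(4) by (simp add: nx \<tau>_def abs_mult)
  have perp: "perp (sgn \<xi>) x = perp w x" for x
    using sq(1) by (simp add: perp_def sx mult.left_commute)
  have fq: "fibre_q \<tau> \<xi> = \<bar>q\<bar>"
  proof -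
    have "(norm \<xi>)\<^sup>2 - \<tau>\<^sup>2 = q\<^sup>2 * ((cosh \<kappa>)\<^sup>2 - (sinh \<kappa>)\<^sup>2)"
      by (simp add: nx \<tau>_def power_mult_distrib algebra_simps)
    then show ?thesis by (simp add: fibre_q_def cosh_square_eq)
  qed
  have fM: "fibre_M s \<tau> \<xi> \<eta> = M" "fibre_M s \<tau> \<xi> \<eta>' = N"
    by (simp_all add: fibre_M_def perp fq M_def N_def)
  show M0: "M > 0" and N0: "N > 0" using s by (auto simp: M_def N_def add_pos_nonneg)
  have pt: "fibre_pt s \<tau> \<xi> x = perp w x + (fibre_M s \<tau> \<xi> x * sinh \<kappa> + q / 2 * cosh \<kappa>) *\<^sub>R w" for x
  proof -
    have "\<tau> * fibre_M s \<tau> \<xi> x / \<bar>q\<bar> * sgn q = fibre_M s \<tau> \<xi> x * sinh \<kappa> * (q / \<bar>q\<bar> * sgn q)"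
      by (simp add: \<tau>_def)
    then have "\<tau> * fibre_M s \<tau> \<xi> x / \<bar>q\<bar> * sgn q = fibre_M s \<tau> \<xi> x * sinh \<kappa>"
      by (simp only: sq mult_1_right)
    then have "(\<tau> * fibre_M s \<tau> \<xi> x / \<bar>q\<bar>) *\<^sub>R sgn \<xi> = (fibre_M s \<tau> \<xi> x * sinh \<kappa>) *\<^sub>R w"
      unfolding sx scaleR_scaleR by (rule arg_cong)
    moreover have "(1/2) *\<^sub>R \<xi> = (q / 2 * cosh \<kappa>) *\<^sub>R w" by (simp add: \<xi>_def)
    ultimately show ?thesis
      unfolding fibre_pt_def perp fq by (simp only: scaleR_add_left add.assoc)
  qed
  show a: "fibre_pt s \<tau> \<xi> \<eta> = a" unfolding pt fM a_def ..
  show b: "fibre_pt s \<tau> \<xi> \<eta>' - \<xi> = b"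
  proof -
    have "(N * sinh \<kappa> + q / 2 * cosh \<kappa>) - q * cosh \<kappa> = N * sinh \<kappa> - q / 2 * cosh \<kappa>" by simp
    then have "(N * sinh \<kappa> + q / 2 * cosh \<kappa>) *\<^sub>R w - (q * cosh \<kappa>) *\<^sub>R w = (N * sinh \<kappa> - q / 2 * cosh \<kappa>) *\<^sub>R w"
      by (simp only: scaleR_diff_left[symmetric])
    moreover have "fibre_pt s \<tau> \<xi> \<eta>' - \<xi> = perp w \<eta>' + ((N * sinh \<kappa> + q / 2 * cosh \<kappa>) *\<^sub>R w - \<xi>)"
      unfolding pt fM by simp
    ultimately show ?thesis unfolding b_def \<xi>_def by simp
  qed
  have "norm \<xi> * M' / \<bar>q\<bar> = M' * cosh \<kappa>" for M'
    using q by (simp add: nx)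
  then have ea: "energy s a = M * cosh \<kappa> + q / 2 * sinh \<kappa>" and eb: "energy s b = N * cosh \<kappa> - q / 2 * sinh \<kappa>"
    using fibre_collision(3)[OF s tau, of \<eta>] fibre_collision(4)[OF s tau, of \<eta>']
    unfolding a b fM fq by (auto simp: \<tau>_def)
  show "M * cosh \<kappa> + q / 2 * sinh \<kappa> > 0" "N * cosh \<kappa> - q / 2 * sinh \<kappa> > 0"
    unfolding ea[symmetric] eb[symmetric] using energy_pos[OF s] by auto
  have aw: "a \<bullet> w = M * sinh \<kappa> + q / 2 * cosh \<kappa>" and bw: "b \<bullet> w = N * sinh \<kappa> - q / 2 * cosh \<kappa>"
    using w by (simp_all add: a_def b_def inner_add_left ww)
  have P0: "energy s a + energy s b = (M + N) * cosh \<kappa>" unfolding ea eb by (simp add: algebra_simps)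
  have Pw: "(a + b) \<bullet> w = (M + N) * sinh \<kappa>" unfolding inner_add_left aw bw by (simp add: algebra_simps)
  have "(energy s a + energy s b)\<^sup>2 - ((a + b) \<bullet> w)\<^sup>2 = (M + N)\<^sup>2 * ((cosh \<kappa>)\<^sup>2 - (sinh \<kappa>)\<^sup>2)"
    unfolding P0 Pw by (simp add: power_mult_distrib right_diff_distrib)
  then have sqrt: "sqrt ((energy s a + energy s b)\<^sup>2 - ((a + b) \<bullet> w)\<^sup>2) = M + N"
    using M0 N0 by (simp add: cosh_square_eq)
  have v: "(energy s b *\<^sub>R a - energy s a *\<^sub>R b) \<bullet> w = q / 2 * (M + N)"
  proof -
    have "(energy s b *\<^sub>R a - energy s a *\<^sub>R b) \<bullet> w
      = (N * cosh \<kappa> - q / 2 * sinh \<kappa>) * (M * sinh \<kappa> + q / 2 * cosh \<kappa>) - (M * cosh \<kappa> + q / 2 * sinh \<kappa>) * (N * sinh \<kappa> - q / 2 * cosh \<kappa>)"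
      by (simp add: inner_diff_left aw bw ea eb)
    also have "\<dots> = q / 2 * (M + N) * ((cosh \<kappa>)\<^sup>2 - (sinh \<kappa>)\<^sup>2)"
      by (simp add: algebra_simps power2_eq_square)
    finally show ?thesis by (simp add: cosh_square_eq)
  qed
  define e where "e = energy s a * energy s b"
  define D where "D = DIM('a) - 2"
  have dD: "DIM('a) = D + 2" "DIM('a) - 1 = D + 1" using d by (auto simp: D_def)
  have Wq: "\<bar>q\<bar> ^ D * W \<bar>q\<bar> = q ^ (2 * j)"
    using W[rule_format, OF sq(4)] by (simp add: D_def power_mult)
  have ker: "collision_kernel s j w a b = 2 * (cosh \<kappa>) ^ (D + 1) * q ^ (2 * j) / (M + N)"
  proof -
    have "4 ^ j * (q / 2 * (M + N)) ^ (2 * j) = q ^ (2 * j) * (M + N) ^ (2 * j)"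
      by (simp add: power_mult_distrib power_divide power_mult)
    moreover have "collision_kernel s j w a b = 2 * ((M + N) * cosh \<kappa>) ^ (D + 1) * (4 ^ j * (q / 2 * (M + N)) ^ (2 * j)) / (M + N) ^ (D + 2 + 2 * j)"
      unfolding collision_kernel_def sqrt v unfolding P0 by (simp add: dD(1) mult_ac)
    ultimately have "collision_kernel s j w a b = 2 * ((M + N) * cosh \<kappa>) ^ (D + 1) * (q ^ (2 * j) * (M + N) ^ (2 * j)) / (M + N) ^ (D + 2 + 2 * j)"
      by simp
    also have "\<dots> = 2 * (cosh \<kappa>) ^ (D + 1) * q ^ (2 * j) * ((M + N) ^ (D + 1) * (M + N) ^ (2 * j)) / ((M + N) ^ (D + 1) * (M + N) ^ (2 * j) * (M + N))"
      by (simp add: power_mult_distrib power_add power2_eq_square mult_ac)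
    also have "\<dots> = 2 * (cosh \<kappa>) ^ (D + 1) * q ^ (2 * j) / (M + N)"
      using M0 N0 by simp
    finally show ?thesis .
  qed
  \<comment> \<open>For q < 0 the direction of xi is -w; this is where the evenness of
    \<open>theta\<close> enters.\<close>
  have th: "theta (x \<bullet> sgn \<xi>) = theta (x \<bullet> w)" for x
    using q unfolding sx by (cases "q > 0") (auto simp: sgn_real_def)
  have "\<bar>q\<bar> * \<bar>q * cosh \<kappa>\<bar> ^ (DIM('a) - 1) * (W (fibre_q \<tau> \<xi>) * fibre_wt s \<tau> \<xi> \<eta> * fibre_wt s \<tau> \<xi> \<eta>' * energy s a * energy s b)
    = (\<bar>q\<bar> ^ D * W \<bar>q\<bar>) * (cosh \<kappa>) ^ (D + 1) * theta (\<eta> \<bullet> w) * theta (\<eta>' \<bullet> w) * e / (M * N)"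
  proof -
    have "\<bar>q * cosh \<kappa>\<bar> = \<bar>q\<bar> * cosh \<kappa>" by (simp add: abs_mult)
    moreover have "Q * (Q * c) ^ (D + 1) * (W Q * (t * 1 / (Q * M)) * (t' * 1 / (Q * N)) * e1 * e2)
      = (Q ^ D * W Q) * c ^ (D + 1) * t * t' * (e1 * e2) / (M * N)" if "Q > 0" for Q c t t' e1 e2
      using that M0 N0 by (simp add: power_mult_distrib field_simps)
    ultimately show ?thesis
      using tau sq(4) unfolding dD(2) fibre_wt_def fq fM th e_def
      by (simp add: power_mult_distrib)
  qed
  also have "\<dots> = e * ((M + N) / (2 * M * N)) * (theta (\<eta> \<bullet> w) * theta (\<eta>' \<bullet> w) * collision_kernel s j w a b)"
    unfolding Wq ker using M0 N0 by (simp add: divide_simps)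
  finally show "\<bar>q\<bar> * \<bar>q * cosh \<kappa>\<bar> ^ (DIM('a) - 1) * (W (fibre_q \<tau> \<xi>) * fibre_wt s \<tau> \<xi> \<eta> * fibre_wt s \<tau> \<xi> \<eta>' * energy s a * energy s b)
    = (M * cosh \<kappa> + q / 2 * sinh \<kappa>) * (N * cosh \<kappa> - q / 2 * sinh \<kappa>) * ((M + N) / (2 * M * N)) *
    (theta (\<eta> \<bullet> w) * theta (\<eta>' \<bullet> w) * collision_kernel s j w a b)"
    unfolding e_def ea eb .
qed

text \<open>With w and the components orthogonal to w fixed, the problem is two-dimensional.
  Hyperbolic coordinates lead from (r, tau) to (q, \<kappa>), and centre-of-mass coordinates from
  (q, \<kappa>) to the components (x, y) of a and b along w.\<close>

lemma nn_integral_collision_direction: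
  fixes w :: "'a::euclidean_space" and H :: "'a \<Rightarrow> 'a \<Rightarrow> ennreal"
  assumes s: "s > 0" and w: "norm w = 1" and d: "DIM('a) \<ge> 2"
    and W: "\<forall>q>0. q ^ (DIM('a) - 2) * W q = q ^ (2 * j)" and W0: "\<And>q. W q \<ge> 0"
    and [measurable]: "borel_fun W" and H[measurable]: "case_prod H \<in> borel_measurable (borel \<Otimes>\<^sub>M borel)"
  shows "(NN r \<tau>. ennreal (\<bar>r\<bar> ^ (DIM('a) - 1)) *
    (collision_term s W H \<tau> (r *\<^sub>R w) \<eta> \<eta>'))
    = (NN x y. ennreal (theta (\<eta> \<bullet> w) * theta (\<eta>' \<bullet> w) * collision_kernel s j w (perp w \<eta> + x *\<^sub>R w) (perp w \<eta>' + y *\<^sub>R w))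
    * H (perp w \<eta> + x *\<^sub>R w) (perp w \<eta>' + y *\<^sub>R w))"
proof -
  note [measurable (raw)] = measurable_uncurry[OF H]
  define G where "G \<tau> r = ennreal (\<bar>r\<bar> ^ (DIM('a) - 1)) *
    (collision_term s W H \<tau> (r *\<^sub>R w) \<eta> \<eta>')" for \<tau> r
  have [measurable]: "case_prod G \<in> borel_measurable (borel \<Otimes>\<^sub>M borel)"
    unfolding G_def[abs_def] by measurable
  define h where "h x y = ennreal (theta (\<eta> \<bullet> w) * theta (\<eta>' \<bullet> w) * collision_kernel s j w (perp w \<eta> + x *\<^sub>R w) (perp w \<eta>' + y *\<^sub>R w))
    * H (perp w \<eta> + x *\<^sub>R w) (perp w \<eta>' + y *\<^sub>R w)" for x y
  have h[measurable]: "case_prod h \<in> borel_measurable (borel \<Otimes>\<^sub>M borel)"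
    unfolding h_def[abs_def] by measurable
  define m where "m = sqrt (s\<^sup>2 + (norm (perp w \<eta>))\<^sup>2)"
  define n where "n = sqrt (s\<^sup>2 + (norm (perp w \<eta>'))\<^sup>2)"
  have m: "m > 0" and n: "n > 0" using s by (auto simp: m_def n_def add_pos_nonneg)
  have m2: "m\<^sup>2 = s\<^sup>2 + (norm (perp w \<eta>))\<^sup>2" and n2: "n\<^sup>2 = s\<^sup>2 + (norm (perp w \<eta>'))\<^sup>2"
    by (simp_all add: m_def n_def)
  have "(NN r \<tau>. G \<tau> r) = (NN r \<tau>. indicator {\<tau>. \<bar>\<tau>\<bar> < \<bar>r\<bar>} \<tau> * G \<tau> r)"
    using w by (intro nn_integral_cong) (auto simp: G_def fibre_wt_def split: split_indicator)
  also have "\<dots> = (NN q \<kappa>. ennreal \<bar>q\<bar> * G (q * sinh \<kappa>) (q * cosh \<kappa>))"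
    by (rule nn_integral_spacelike_hyperbolic) measurable
  also have "\<dots> = (NN q \<kappa>. center_of_mass_density m n h q \<kappa>)"
  proof (rule nn_integral_cong_nonzero, goal_cases)
    case (1 q)
    show ?case
    proof (rule nn_integral_cong)
      fix \<kappa> :: real
      define M where "M = sqrt (m\<^sup>2 + q\<^sup>2 / 4)"
      define N where "N = sqrt (n\<^sup>2 + q\<^sup>2 / 4)"
      note c = collision_pointwise(1)[OF s w 1 d W, where \<eta>=\<eta> and \<kappa>=\<kappa>]
        collision_pointwise(2)[OF s w 1 d W, where \<eta>'=\<eta>' and \<kappa>=\<kappa>]
        collision_pointwise(3)[OF s w 1 d W, where \<eta>=\<eta> and \<eta>'=\<eta>' and \<kappa>=\<kappa>]
        collision_pointwise(4)[OF s w 1 d W, where \<eta>=\<eta> and \<kappa>=\<kappa>]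
        collision_pointwise(5)[OF s w 1 d W, where \<eta>'=\<eta>' and \<kappa>=\<kappa>]
        collision_pointwise(6)[OF s w 1 d W, where \<eta>=\<eta>]
        collision_pointwise(7)[OF s w 1 d W, where \<eta>'=\<eta>']
      define a where "a = perp w \<eta> + (M * sinh \<kappa> + q / 2 * cosh \<kappa>) *\<^sub>R w"
      define b where "b = perp w \<eta>' + (N * sinh \<kappa> - q / 2 * cosh \<kappa>) *\<^sub>R w"
      note c' = c[folded m2 n2, folded M_def N_def, folded a_def b_def]
      define Z where "Z = W (fibre_q (q * sinh \<kappa>) ((q * cosh \<kappa>) *\<^sub>R w)) * fibre_wt s (q * sinh \<kappa>) ((q * cosh \<kappa>) *\<^sub>R w) \<eta> *
        fibre_wt s (q * sinh \<kappa>) ((q * cosh \<kappa>) *\<^sub>R w) \<eta>' * energy s a * energy s b"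
      have Z0: "Z \<ge> 0" unfolding Z_def
        using W0 fibre_wt_nonneg energy_pos[OF s, of a] energy_pos[OF s, of b] by (intro mult_nonneg_nonneg) auto
      have K0: "theta (\<eta> \<bullet> w) * theta (\<eta>' \<bullet> w) * collision_kernel s j w a b \<ge> 0"
        using collision_kernel_nonneg[OF s, of w j a b] w by (intro mult_nonneg_nonneg) auto
      have J0: "(M * cosh \<kappa> + q / 2 * sinh \<kappa>) * (N * cosh \<kappa> - q / 2 * sinh \<kappa>) * ((M + N) / (2 * M * N)) \<ge> 0"
        using c'(4-7) by (intro mult_nonneg_nonneg divide_nonneg_nonneg) auto
      have "ennreal \<bar>q\<bar> * (ennreal (\<bar>q * cosh \<kappa>\<bar> ^ (DIM('a) - 1)) * ennreal Z)
        = ennreal ((M * cosh \<kappa> + q / 2 * sinh \<kappa>) * (N * cosh \<kappa> - q / 2 * sinh \<kappa>) * ((M + N) / (2 * M * N))) *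
        ennreal (theta (\<eta> \<bullet> w) * theta (\<eta>' \<bullet> w) * collision_kernel s j w a b)"
        using Z0 K0 J0 by (subst ennreal_mult3) (simp_all only: abs_ge_zero zero_le_power c'(3)[folded Z_def] ennreal_mult)
      then have "(ennreal \<bar>q\<bar> * (ennreal (\<bar>q * cosh \<kappa>\<bar> ^ (DIM('a) - 1)) * ennreal Z)) * H a b
        = (ennreal ((M * cosh \<kappa> + q / 2 * sinh \<kappa>) * (N * cosh \<kappa> - q / 2 * sinh \<kappa>) * ((M + N) / (2 * M * N))) *
        ennreal (theta (\<eta> \<bullet> w) * theta (\<eta>' \<bullet> w) * collision_kernel s j w a b)) * H a b"
        by (rule arg_cong)
      then show "ennreal \<bar>q\<bar> * G (q * sinh \<kappa>) (q * cosh \<kappa>) =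
        center_of_mass_density m n h q \<kappa>"
        unfolding Let_def M_def[symmetric] N_def[symmetric] h_def G_def c'(1,2) a_def[symmetric] b_def[symmetric] Z_def[symmetric]
        by (simp only: mult.assoc)
    qed
  qed
  also have "\<dots> = (NN x y. h x y)"
    by (rule nn_integral_center_of_mass[OF m n h, symmetric])
  finally show ?thesis unfolding G_def h_def .
qed

lemma nn_integral_line_twice:
  fixes w :: "'a::euclidean_space" and k :: "'a \<Rightarrow> 'a \<Rightarrow> ennreal"
  assumes w: "norm w = 1" and k: "case_prod k \<in> borel_measurable (borel \<Otimes>\<^sub>M borel)"
  shows "(NN \<eta> \<eta>' x y. ennreal (theta (\<eta> \<bullet> w) * theta (\<eta>' \<bullet> w)) *
    k (perp w \<eta> + x *\<^sub>R w) (perp w \<eta>' + y *\<^sub>R w))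
    = (NN a b. k a b)"
proof -
  note [measurable (raw)] = measurable_uncurry[OF k]
  have "(NN \<eta> \<eta>' x y. ennreal (theta (\<eta> \<bullet> w) * theta (\<eta>' \<bullet> w)) *
    k (perp w \<eta> + x *\<^sub>R w) (perp w \<eta>' + y *\<^sub>R w))
    = (NN \<eta>. ennreal (theta (\<eta> \<bullet> w)) * (NN x \<eta>'. ennreal (theta (\<eta>' \<bullet> w)) *
    (NN y. k (perp w \<eta> + x *\<^sub>R w) (perp w \<eta>' + y *\<^sub>R w))))" (is "(NN \<eta>. ?f \<eta>) = (NN \<eta>. ?g \<eta>)")
  proof (rule nn_integral_cong)
    fix \<eta> :: 'a
    have "(NN \<eta>' x y. ennreal (theta (\<eta> \<bullet> w) * theta (\<eta>' \<bullet> w)) *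
      k (perp w \<eta> + x *\<^sub>R w) (perp w \<eta>' + y *\<^sub>R w))
      = (NN x \<eta>' y. ennreal (theta (\<eta> \<bullet> w) * theta (\<eta>' \<bullet> w)) *
      k (perp w \<eta> + x *\<^sub>R w) (perp w \<eta>' + y *\<^sub>R w))"
      by (rule lborel_pair.Fubini') measurable
    also have "\<dots> = ?g \<eta>"
      by (simp add: nn_integral_cmult ennreal_mult mult.assoc)
    finally show "?f \<eta> = ?g \<eta>" .
  qed
  also have "\<dots> = (NN \<eta>. ennreal (theta (\<eta> \<bullet> w)) * (NN x b. k (perp w \<eta> + x *\<^sub>R w) b))"
    by (subst nn_integral_line[OF w, folded perp_def, symmetric]) simp_all
  also have "\<dots> = (NN a b. k a b)"
    by (rule nn_integral_line[OF w, folded perp_def, symmetric]) measurable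
  finally show ?thesis .
qed

text \<open>Polar coordinates in xi reduce to one direction at a time. There the integrals over the
  hyperplane components and over (x, y) recombine to integrals over a and b; exchanging them with
  the average over directions leaves \<open>kernel_mean\<close> as the kernel.\<close>

lemma nn_integral_collision:
  fixes H :: "'a::euclidean_space \<Rightarrow> 'a \<Rightarrow> ennreal"
  assumes s: "s > 0" and d: "DIM('a) \<ge> 2"
    and W: "\<forall>q>0. q ^ (DIM('a) - 2) * W q = q ^ (2 * j)" and W0: "\<And>q. W q \<ge> 0"
    and W'[measurable]: "borel_fun W" and H: "case_prod H \<in> borel_measurable (borel \<Otimes>\<^sub>M borel)"
  shows "(NN \<xi> \<tau> \<eta> \<eta>'. collision_term s W H \<tau> \<xi> \<eta> \<eta>')
    = ennreal (DIM('a) / 2) * (NN a b. H a b *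
    (kernel_mean s j a b))"
proof -
  note [measurable (raw)] = measurable_uncurry[OF H]
  have cb[measurable]: "cball (0::'a) 1 \<in> sets borel" by simp
  define G where "G \<xi> \<tau> \<eta> \<eta>' = 
    collision_term s W H \<tau> \<xi> \<eta> \<eta>'" for \<xi> \<tau> \<eta> \<eta>'
  have [measurable]: "(\<lambda>x. G (f1 x) (f2 x) (f3 x) (f4 x)) \<in> borel_measurable N"
    if [measurable]: "f1 \<in> borel_measurable N" "f2 \<in> borel_measurable N" "f3 \<in> borel_measurable N" "f4 \<in> borel_measurable N"
    for f1 f2 f3 f4 and N :: "'x measure"
    unfolding G_def by measurable
  let ?c = "\<lambda>r. ennreal (\<bar>r\<bar> ^ (DIM('a) - 1))"
  have "(NN \<xi> \<tau> \<eta> \<eta>'. G \<xi> \<tau> \<eta> \<eta>')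
    = ennreal (DIM('a) / 2) * (NN z. indicator (cball 0 1) z *
    (NN r. ?c r * (NN \<tau> \<eta> \<eta>'. G (r *\<^sub>R sgn z) \<tau> \<eta> \<eta>')))"
    by (rule nn_integral_polar) measurable
  also have "\<dots> = ennreal (DIM('a) / 2) * (NN z. indicator (cball 0 1) z *
    (NN a b. ennreal (collision_kernel s j (sgn z) a b) * H a b))"
  proof (rule arg_cong[where f="\<lambda>x. ennreal (DIM('a) / 2) * x"], rule nn_integral_cong_AE)
    show "AE z in lborel. indicator (cball 0 1) z *
      (NN r. ?c r * (NN \<tau> \<eta> \<eta>'. G (r *\<^sub>R sgn z) \<tau> \<eta> \<eta>'))
      = indicator (cball 0 1) z * (NN a b. ennreal (collision_kernel s j (sgn z) a b) * H a b)"
      using AE_lborel_singleton[of "0::'a"]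
    proof eventually_elim
      case (elim z)
      define w where "w = sgn z"
      have w: "norm w = 1" using elim by (simp add: w_def norm_sgn)
      have "(NN r. ?c r * (NN \<tau> \<eta> \<eta>'. G (r *\<^sub>R w) \<tau> \<eta> \<eta>'))
        = (NN r \<tau> \<eta> \<eta>'. ?c r * G (r *\<^sub>R w) \<tau> \<eta> \<eta>')"
        by (simp add: nn_integral_cmult)
      also have "\<dots> = (NN \<eta> r \<tau> \<eta>'. ?c r * G (r *\<^sub>R w) \<tau> \<eta> \<eta>')"
        by (rule nn_integral_swap3) measurable
      also have "\<dots> = (NN \<eta> \<eta>' r \<tau>. ?c r * G (r *\<^sub>R w) \<tau> \<eta> \<eta>')"
        by (rule nn_integral_cong, rule nn_integral_swap3) measurable
      also have "\<dots> = (NN \<eta> \<eta>' x y. ennreal (theta (\<eta> \<bullet> w) * theta (\<eta>' \<bullet> w) * collision_kernel s j w (perp w \<eta> + x *\<^sub>R w) (perp w \<eta>' + y *\<^sub>R w))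
       * H (perp w \<eta> + x *\<^sub>R w) (perp w \<eta>' + y *\<^sub>R w))"
        by (rule nn_integral_cong, rule nn_integral_cong)
           (unfold G_def, rule nn_integral_collision_direction[OF s w d W W0 W' H])
      also have "\<dots> = (NN \<eta> \<eta>' x y. ennreal (theta (\<eta> \<bullet> w) * theta (\<eta>' \<bullet> w)) *
        (ennreal (collision_kernel s j w (perp w \<eta> + x *\<^sub>R w) (perp w \<eta>' + y *\<^sub>R w))
        * H (perp w \<eta> + x *\<^sub>R w) (perp w \<eta>' + y *\<^sub>R w)))"
        using collision_kernel_nonneg[OF s, of w j] w
        by (intro nn_integral_cong) (simp add: ennreal_mult mult.assoc)
      also have "\<dots> = (NN a b. ennreal (collision_kernel s j w a b) * H a b)"
        by (rule nn_integral_line_twice[OF w, of "\<lambda>a b. ennreal (collision_kernel s j w a b) * H a b"]) measurable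
      finally show ?case unfolding w_def by (rule arg_cong)
    qed
  qed
  also have "(NN z. indicator (cball 0 1) z *
    (NN a b. ennreal (collision_kernel s j (sgn z) a b) * H a b))
    = (NN z a b. H a b * (indicator (cball 0 1) z * ennreal (collision_kernel s j (sgn z) a b)))"
    by (simp add: nn_integral_cmult[symmetric] mult_ac)
  also have "\<dots> = (NN a z b. H a b * (indicator (cball 0 1) z * ennreal (collision_kernel s j (sgn z) a b)))"
    by (rule lborel_pair.Fubini') measurable
  also have "\<dots> = (NN a b z. H a b * (indicator (cball 0 1) z * ennreal (collision_kernel s j (sgn z) a b)))"
    by (rule nn_integral_cong, rule lborel_pair.Fubini') measurable
  also have "\<dots> = (NN a b. H a b * (kernel_mean s j a b))"
    by (simp add: nn_integral_cmult)
  finally show ?thesis unfolding G_def .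
qed

section \<open>The averaged kernel and the invariant mass\<close>

definition invariant_mass :: "real \<Rightarrow> 'a::euclidean_space \<Rightarrow> 'a \<Rightarrow> real" where
  "invariant_mass s a b = sqrt ((energy s a + energy s b)\<^sup>2 - (norm (a + b))\<^sup>2)"

text \<open>The square k^2 of the momentum of either particle in the centre-of-mass frame: the
  squared invariant mass of the pair is 4 (s^2 + k^2).\<close>

definition relative_momentum_sq :: "real \<Rightarrow> 'a::euclidean_space \<Rightarrow> 'a \<Rightarrow> real" where
  "relative_momentum_sq s a b = (energy s a * energy s b - a \<bullet> b - s\<^sup>2) / 2"

text \<open>The average is that of \<open>nn_integral_sphere_kernel0\<close> for the total energy p
  = E(a) + E(b) and the total momentum a + b. All powers of p cancel, and only the invariant mass
  survives, as Lorentz invariance demands.\<close>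

lemma nn_integral_collision_kernel0:
  fixes a b :: "'a::euclidean_space"
  assumes s: "s > 0"
  shows "ennreal (DIM('a) / 2) * (kernel_mean s 0 a b)
    = ennreal (DIM('a) * unit_ball_vol (DIM('a)) / invariant_mass s a b)"
proof -
  define p where "p = energy s a + energy s b"
  have P: "norm (a + b) < p" unfolding p_def by (rule momentum_less_energy[OF s])
  have p: "p > 0" using P norm_ge_zero[of "a + b"] by linarith
  have S: "invariant_mass s a b > 0" using P unfolding invariant_mass_def p_def[symmetric]
    by (simp add: power_strict_mono)
  have [measurable]: "cball (0::'a) 1 \<in> sets borel" by simp
  have "kernel_mean s 0 a b
    = (NN z. ennreal (2 * p ^ (DIM('a) - 1)) * (indicator (cball 0 1) z * ennreal (1 / sqrt (p\<^sup>2 - ((a + b) \<bullet> sgn z)\<^sup>2) ^ DIM('a))))" (is "(NN z. ?f z) = (NN z. ?g z)")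
  proof (rule nn_integral_cong)
    fix z :: 'a
    have eq: "collision_kernel s 0 (sgn z) a b = 2 * p ^ (DIM('a) - 1) * (1 / sqrt (p\<^sup>2 - ((a + b) \<bullet> sgn z)\<^sup>2) ^ DIM('a))"
      unfolding collision_kernel_def p_def[symmetric] by simp
    have "ennreal (collision_kernel s 0 (sgn z) a b) = ennreal (2 * p ^ (DIM('a) - 1)) * ennreal (1 / sqrt (p\<^sup>2 - ((a + b) \<bullet> sgn z)\<^sup>2) ^ DIM('a))"
      by (subst eq, rule ennreal_mult') (use p in simp)
    then show "?f z = ?g z"
      by (simp only: mult_ac)
  qed
  also have "\<dots> = ennreal (2 * p ^ (DIM('a) - 1)) * ennreal (unit_ball_vol DIM('a) * p / (p ^ DIM('a) * invariant_mass s a b))"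
    unfolding invariant_mass_def p_def[symmetric]
    by (subst nn_integral_cmult) (simp, simp only: nn_integral_sphere_kernel0[OF P])
  finally have "ennreal (DIM('a) / 2) * (kernel_mean s 0 a b)
    = ennreal (DIM('a) / 2) * (ennreal (2 * p ^ (DIM('a) - 1)) * ennreal (unit_ball_vol DIM('a) * p / (p ^ DIM('a) * invariant_mass s a b)))"
    by simp
  also have "\<dots> = ennreal (DIM('a) / 2 * (2 * p ^ (DIM('a) - 1)) * (unit_ball_vol DIM('a) * p / (p ^ DIM('a) * invariant_mass s a b)))"
    using p S by (subst ennreal_mult3) auto
  also have "DIM('a) / 2 * (2 * p ^ (DIM('a) - 1)) * (unit_ball_vol DIM('a) * p / (p ^ DIM('a) * invariant_mass s a b))
    = DIM('a) * unit_ball_vol (DIM('a)) / invariant_mass s a b"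
  proof -
    have "p ^ DIM('a) = p * p ^ (DIM('a) - 1)" by (simp add: power_eq_if)
    then show ?thesis using p S by simp
  qed
  finally show ?thesis .
qed

text \<open>In the centre-of-mass frame v is the total energy times the momentum of a, and v . (a +
  b) = 0, so the claim is plain. In a general frame the second summand stretches the component of v
  along a + b by the Lorentz factor. The proof writes everything in the two energies x, y and c = a
  . b and compares polynomials.\<close>

lemma relative_momentum_identity:
  fixes a b :: "'a::euclidean_space"
  assumes s: "s > 0"
  defines "p \<equiv> energy s a + energy s b" and "v \<equiv> energy s b *\<^sub>R a - energy s a *\<^sub>R b"
  shows "(norm v)\<^sup>2 + (v \<bullet> (a + b))\<^sup>2 / (p\<^sup>2 - (norm (a + b))\<^sup>2) = p\<^sup>2 * relative_momentum_sq s a b"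
proof -
  define x where "x = energy s a"
  define y where "y = energy s b"
  define c where "c = a \<bullet> b"
  define D where "D = p\<^sup>2 - (norm (a + b))\<^sup>2"
  have aa: "a \<bullet> a = x\<^sup>2 - s\<^sup>2" and bb: "b \<bullet> b = y\<^sup>2 - s\<^sup>2"
    by (simp_all add: x_def y_def energy_square dot_square_norm)
  have D: "D = 2 * s\<^sup>2 + 2 * x * y - 2 * c"
    unfolding D_def power2_norm_eq_inner p_def x_def[symmetric] y_def[symmetric]
    by (simp add: inner_add_left inner_add_right aa bb inner_commute[of b a] c_def power2_eq_square algebra_simps)
  have "norm (a + b) < p" unfolding p_def by (rule momentum_less_energy[OF s])
  then have D0: "D > 0" by (simp add: D_def power_strict_mono)
  have v2: "(norm v)\<^sup>2 = y\<^sup>2 * (x\<^sup>2 - s\<^sup>2) + x\<^sup>2 * (y\<^sup>2 - s\<^sup>2) - 2 * x * y * c"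
    unfolding power2_norm_eq_inner v_def x_def[symmetric] y_def[symmetric]
    by (simp add: inner_diff_left inner_diff_right inner_commute[of b a] c_def[symmetric] aa bb)
       (simp add: power2_eq_square algebra_simps)
  have vP: "v \<bullet> (a + b) = y * (x\<^sup>2 - s\<^sup>2) - x * (y\<^sup>2 - s\<^sup>2) + (y - x) * c"
    unfolding v_def x_def[symmetric] y_def[symmetric]
    by (simp add: inner_diff_left inner_add_right inner_commute[of b a] c_def[symmetric] aa bb)
       (simp add: algebra_simps)
  have "2 * ((norm v)\<^sup>2 * D + (v \<bullet> (a + b))\<^sup>2) = (x + y)\<^sup>2 * (x * y - c - s\<^sup>2) * D"
    unfolding v2 vP D by (simp add: power2_eq_square algebra_simps)
  then have "(norm v)\<^sup>2 * D + (v \<bullet> (a + b))\<^sup>2 = (x + y)\<^sup>2 * ((x * y - c - s\<^sup>2) / 2) * D"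
    by simp
  then have "(norm v)\<^sup>2 + (v \<bullet> (a + b))\<^sup>2 / D = (x + y)\<^sup>2 * ((x * y - c - s\<^sup>2) / 2)"
    using D0 by (simp add: field_simps)
  then show ?thesis
    unfolding D_def relative_momentum_sq_def p_def x_def y_def c_def .
qed

text \<open>By \<open>relative_momentum_identity\<close> its product with p^2 is a sum of squares
  with positive coefficients.\<close>

lemma relative_momentum_sq_nonneg:
  assumes s: "s > 0"
  shows "relative_momentum_sq s a b \<ge> 0"
proof -
  let ?p = "energy s a + energy s b"
  have P: "norm (a + b) < ?p" by (rule momentum_less_energy[OF s])
  then have "?p > 0" using norm_ge_zero[of "a + b"] by linarith
  moreover have "?p\<^sup>2 - (norm (a + b))\<^sup>2 > 0" using P by (simp add: power_strict_mono)
  then have "?p\<^sup>2 * relative_momentum_sq s a b \<ge> 0"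
    unfolding relative_momentum_identity[OF s, symmetric] by simp
  ultimately show ?thesis by (simp add: zero_le_mult_iff)
qed

lemma nn_integral_collision_kernel1:
  fixes a b :: "'a::euclidean_space"
  assumes s: "s > 0"
  shows "ennreal (DIM('a) / 2) * (kernel_mean s 1 a b)
    = ennreal (4 * unit_ball_vol (DIM('a)) * relative_momentum_sq s a b / invariant_mass s a b)"
proof -
  define p where "p = energy s a + energy s b"
  define v where "v = energy s b *\<^sub>R a - energy s a *\<^sub>R b"
  have P: "norm (a + b) < p" unfolding p_def by (rule momentum_less_energy[OF s])
  have p: "p > 0" using P norm_ge_zero[of "a + b"] by linarith
  have S: "invariant_mass s a b > 0" using P unfolding invariant_mass_def p_def[symmetric]
    by (simp add: power_strict_mono)
  have R: "relative_momentum_sq s a b \<ge> 0" by (rule relative_momentum_sq_nonneg[OF s])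
  have [measurable]: "cball (0::'a) 1 \<in> sets borel" by simp
  have "kernel_mean s 1 a b
    = (NN z. ennreal (8 * p ^ (DIM('a) - 1)) * (indicator (cball 0 1) z * ennreal ((v \<bullet> sgn z)\<^sup>2 / sqrt (p\<^sup>2 - ((a + b) \<bullet> sgn z)\<^sup>2) ^ (DIM('a) + 2))))" (is "(NN z. ?f z) = (NN z. ?g z)")
  proof (rule nn_integral_cong)
    fix z :: 'a
    have eq: "collision_kernel s 1 (sgn z) a b = 8 * p ^ (DIM('a) - 1) * ((v \<bullet> sgn z)\<^sup>2 / sqrt (p\<^sup>2 - ((a + b) \<bullet> sgn z)\<^sup>2) ^ (DIM('a) + 2))"
      unfolding collision_kernel_def p_def[symmetric] v_def[symmetric] by simp
    have "ennreal (collision_kernel s 1 (sgn z) a b) = ennreal (8 * p ^ (DIM('a) - 1)) * ennreal ((v \<bullet> sgn z)\<^sup>2 / sqrt (p\<^sup>2 - ((a + b) \<bullet> sgn z)\<^sup>2) ^ (DIM('a) + 2))"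
      by (subst eq, rule ennreal_mult') (use p in simp)
    then show "?f z = ?g z"
      by (simp only: mult_ac)
  qed
  also have "\<dots> = ennreal (8 * p ^ (DIM('a) - 1)) * ennreal (unit_ball_vol DIM('a) * (p\<^sup>2 * relative_momentum_sq s a b) / (DIM('a) * p * p ^ DIM('a) * invariant_mass s a b))"
  proof -
    have id: "(norm v)\<^sup>2 + (v \<bullet> (a + b))\<^sup>2 / (p\<^sup>2 - (norm (a + b))\<^sup>2) = p\<^sup>2 * relative_momentum_sq s a b"
      unfolding p_def v_def by (rule relative_momentum_identity[OF s])
    show ?thesis
      unfolding invariant_mass_def p_def[symmetric]
      by (subst nn_integral_cmult) (simp, simp only: nn_integral_sphere_kernel1[OF P] id)
  qed
  finally have "ennreal (DIM('a) / 2) * (kernel_mean s 1 a b)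
    = ennreal (DIM('a) / 2) * (ennreal (8 * p ^ (DIM('a) - 1)) * ennreal (unit_ball_vol DIM('a) * (p\<^sup>2 * relative_momentum_sq s a b) / (DIM('a) * p * p ^ DIM('a) * invariant_mass s a b)))"
    by simp
  also have "\<dots> = ennreal (DIM('a) / 2 * (8 * p ^ (DIM('a) - 1)) * (unit_ball_vol DIM('a) * (p\<^sup>2 * relative_momentum_sq s a b) / (DIM('a) * p * p ^ DIM('a) * invariant_mass s a b)))"
    using p S R by (subst ennreal_mult3) auto
  also have "DIM('a) / 2 * (8 * p ^ (DIM('a) - 1)) * (unit_ball_vol DIM('a) * (p\<^sup>2 * relative_momentum_sq s a b) / (DIM('a) * p * p ^ DIM('a) * invariant_mass s a b))
    = 4 * unit_ball_vol (DIM('a)) * relative_momentum_sq s a b / invariant_mass s a b"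
  proof -
    have "p ^ DIM('a) = p * p ^ (DIM('a) - 1)" by (simp add: power_eq_if)
    then show ?thesis using p S by (simp add: power2_eq_square)
  qed
  finally show ?thesis .
qed

section \<open>The Fourier transform\<close>

lemma integrable_pair_mult:
  fixes f :: "'a::euclidean_space \<Rightarrow> 'c::{real_normed_field, banach, second_countable_topology}"
    and g :: "'b::euclidean_space \<Rightarrow> 'c"
  assumes f: "integrable lborel f" and g: "integrable lborel g"
  shows "integrable lborel2 (\<lambda>(x, y). f x * g y)"
proof (rule lborel_pair.Fubini_integrable)
  have [measurable]: "borel_fun f" "borel_fun g" using f g by auto
  show "(\<lambda>(x, y). f x * g y) \<in> borel_measurable lborel2" by measurable
  show "integrable lborel (\<lambda>x. LB y. norm (case (x, y) of (x, y) \<Rightarrow> f x * g y))"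
    using f g by (simp add: norm_mult)
  show "AE x in lborel. integrable lborel (\<lambda>y. case (x, y) of (x, y) \<Rightarrow> f x * g y)"
    using g by simp
qed

lemma integrable_pair_bound:
  fixes k :: "'a::euclidean_space \<Rightarrow> 'b::euclidean_space \<Rightarrow> 'c::{banach, second_countable_topology}"
  assumes "case_prod k \<in> borel_measurable lborel2"
    and f: "integrable lborel f" and g: "integrable lborel g"
    and le: "\<And>x y. norm (k x y) \<le> f x * (g y :: real)"
  shows "integrable lborel2 (case_prod k)"
  by (rule integrable_dominated[OF integrable_pair_mult[OF f g]])
     (use assms(1) le in \<open>auto intro!: AE_I2 order_trans[OF le abs_ge_self]\<close>)

section \<open>Gaussians and Fourier inversion\<close>

definition gauss :: "real \<Rightarrow> 'a::euclidean_space \<Rightarrow> real" where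
  "gauss c x = exp (- (c * (norm x)\<^sup>2 / 2))"

lemma gauss_measurable [measurable]: "borel_fun (gauss c)"
  unfolding gauss_def[abs_def] by measurable

lemma gauss_pos [simp]: "gauss c x > 0" "gauss c x \<ge> 0" "\<bar>gauss c x\<bar> = gauss c x"
  by (simp_all add: gauss_def)

lemma gauss_le_1: "c \<ge> 0 \<Longrightarrow> gauss c x \<le> 1"
  by (simp add: gauss_def)

lemma gauss_minus [simp]: "gauss c (- x) = gauss c x"
  by (simp add: gauss_def)

text \<open>The characteristic function of the standard normal distribution, rescaled by sqrt
  c.\<close>

lemma gauss_real_integral:
  assumes c: "c > 0"
  shows "integrable lborel (\<lambda>x::real. iexp (x * t) * of_real (exp (- (c * x\<^sup>2 / 2))))"
    and "(LB x. iexp (x * t) * of_real (exp (- (c * x\<^sup>2 / 2))))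
      = of_real (sqrt (2 * pi / c) * exp (- (t\<^sup>2 / (2 * c))))"
proof -
  have *: "(LB x. iexp (x * t) * of_real (exp (- (x\<^sup>2 / 2)))) = of_real (sqrt (2 * pi) * exp (- (t\<^sup>2 / 2)))"
    "integrable lborel (\<lambda>x::real. iexp (x * t) * of_real (exp (- (x\<^sup>2 / 2))))" for t
  proof -
    have n: "integrable lborel (\<lambda>x::real. exp (- (x\<^sup>2 / 2)))"
    proof -
      have "(\<lambda>x::real. exp (- (x\<^sup>2 / 2))) = (\<lambda>x. sqrt (2 * pi) * std_normal_density x)"
        by (auto simp: std_normal_density_def)
      then show ?thesis using integrable_normal_density[of 0 1] by simp
    qed
    show i: "integrable lborel (\<lambda>x::real. iexp (x * t) * of_real (exp (- (x\<^sup>2 / 2))))"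
      by (rule integrable_dominated[OF n]) (auto simp: norm_mult)
    have "char std_normal_distribution t = (LB x. std_normal_density x *\<^sub>R iexp (t * x))"
      unfolding char_def by (subst integral_density) auto
    also have "\<dots> = (LB x. of_real (1 / sqrt (2 * pi)) * (iexp (x * t) * of_real (exp (- (x\<^sup>2 / 2)))))"
      by (simp add: std_normal_density_def scaleR_conv_of_real mult_ac)
    also have "\<dots> = of_real (1 / sqrt (2 * pi)) * (LB x. (iexp (x * t) * of_real (exp (- (x\<^sup>2 / 2)))))"
      by (rule integral_mult_right_zero)
    finally have "of_real (exp (- (t\<^sup>2 / 2))) = of_real (1 / sqrt (2 * pi)) * (LB x. (iexp (x * t) * of_real (exp (- (x\<^sup>2 / 2)))))"
      by (simp add: char_std_normal_distribution)
    then have "of_real (sqrt (2 * pi)) * of_real (exp (- (t\<^sup>2 / 2))) = of_real (sqrt (2 * pi)) * (of_real (1 / sqrt (2 * pi)) * (LB x. (iexp (x * t) * of_real (exp (- (x\<^sup>2 / 2))))))"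
      by (rule arg_cong)
    then show "(LB x. iexp (x * t) * of_real (exp (- (x\<^sup>2 / 2)))) = of_real (sqrt (2 * pi) * exp (- (t\<^sup>2 / 2)))"
      by (simp add: mult.assoc[symmetric])
  qed
  let ?k = "1 / sqrt c"
  have k: "?k \<noteq> 0" "?k > 0" using c by auto
  have eq: "iexp ((0 + sqrt c * x) * (t / sqrt c)) * of_real (exp (- ((0 + sqrt c * x)\<^sup>2 / 2)))
    = iexp (x * t) * of_real (exp (- (c * x\<^sup>2 / 2)))" for x
    using c by (simp add: power_mult_distrib)
  have sc: "sqrt c \<noteq> 0" using c by simp
  show "integrable lborel (\<lambda>x::real. iexp (x * t) * of_real (exp (- (c * x\<^sup>2 / 2))))"
    using lborel_integrable_real_affine[OF *(2)[of "t / sqrt c"] sc, of 0] unfolding eq .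
  have "of_real (sqrt (2 * pi) * exp (- ((t / sqrt c)\<^sup>2 / 2)))
    = \<bar>sqrt c\<bar> *\<^sub>R (LB x. iexp (x * t) * of_real (exp (- (c * x\<^sup>2 / 2))))"
    using lborel_integral_real_affine[OF sc, of "\<lambda>x. iexp (x * (t / sqrt c)) * of_real (exp (- (x\<^sup>2 / 2)))" 0]
    unfolding eq *(1) by simp
  then have e: "of_real (sqrt (2 * pi) * exp (- ((t / sqrt c)\<^sup>2 / 2)))
    = of_real (sqrt c) * (LB x. iexp (x * t) * of_real (exp (- (c * x\<^sup>2 / 2))))"
    using c by (simp add: scaleR_conv_of_real)
  have "(LB x. iexp (x * t) * of_real (exp (- (c * x\<^sup>2 / 2)))) = of_real (sqrt (2 * pi) * exp (- ((t / sqrt c)\<^sup>2 / 2))) / of_real (sqrt c)"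
    unfolding e using sc by simp
  also have "\<dots> = of_real (sqrt (2 * pi) * exp (- ((t / sqrt c)\<^sup>2 / 2)) / sqrt c)" by simp
  also have "sqrt (2 * pi) * exp (- ((t / sqrt c)\<^sup>2 / 2)) / sqrt c = sqrt (2 * pi / c) * exp (- (t\<^sup>2 / (2 * c)))"
    using c by (simp add: power_divide real_sqrt_divide mult.commute)
  finally show "(LB x. iexp (x * t) * of_real (exp (- (c * x\<^sup>2 / 2))))
    = of_real (sqrt (2 * pi / c) * exp (- (t\<^sup>2 / (2 * c))))" .
qed

lemma norm_square_sum_Basis: "(norm (x::'a::euclidean_space))\<^sup>2 = (\<Sum>b\<in>Basis. (x \<bullet> b)\<^sup>2)"
  unfolding power2_norm_eq_inner by (subst euclidean_inner) (simp add: power2_eq_square)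

lemma gauss_integral:
  fixes \<xi> :: "'a::euclidean_space"
  assumes c: "c > 0"
  shows "integrable lborel (\<lambda>x. iexp (x \<bullet> \<xi>) * of_real (gauss c x))"
    and "(LB x. iexp (x \<bullet> \<xi>) * of_real (gauss c x))
      = of_real (sqrt (2 * pi / c) ^ DIM('a) * gauss (1 / c) \<xi>)"
proof -
  have eq: "iexp (x \<bullet> \<xi>) * of_real (gauss c x) = (\<Prod>b\<in>Basis. iexp ((x \<bullet> b) * (\<xi> \<bullet> b)) * of_real (exp (- (c * (x \<bullet> b)\<^sup>2 / 2))))" for x
  proof -
    have "(\<Prod>b\<in>Basis. iexp ((x \<bullet> b) * (\<xi> \<bullet> b))) = iexp (x \<bullet> \<xi>)"
      by (simp add: exp_sum[symmetric] euclidean_inner[of x \<xi>] sum_distrib_left)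
    moreover have "(\<Prod>b\<in>Basis. exp (- (c * (x \<bullet> b)\<^sup>2 / 2))) = gauss c x"
      by (simp add: exp_sum[symmetric] gauss_def norm_square_sum_Basis sum_negf sum_distrib_left sum_divide_distrib)
    ultimately show ?thesis by (simp add: prod.distrib flip: of_real_prod)
  qed
  note g = gauss_real_integral[OF c]
  show "integrable lborel (\<lambda>x. iexp (x \<bullet> \<xi>) * of_real (gauss c x))"
    unfolding eq by (rule integrable_lborel_prod_Basis) (rule g)
  have "(LB x. iexp (x \<bullet> \<xi>) * of_real (gauss c x)) = (\<Prod>b\<in>Basis. of_real (sqrt (2 * pi / c) * exp (- ((\<xi> \<bullet> b)\<^sup>2 / (2 * c)))))"
    unfolding eq by (subst integral_lborel_prod_Basis[OF g(1)]) (simp only: g(2))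
  also have "\<dots> = of_real (\<Prod>b\<in>(Basis::'a set). sqrt (2 * pi / c) * exp (- ((\<xi> \<bullet> b)\<^sup>2 / (2 * c))))"
    by simp
  also have "(\<Prod>b\<in>(Basis::'a set). sqrt (2 * pi / c) * exp (- ((\<xi> \<bullet> b)\<^sup>2 / (2 * c)))) = sqrt (2 * pi / c) ^ DIM('a) * gauss (1 / c) \<xi>"
    by (simp add: prod.distrib exp_sum[symmetric] gauss_def norm_square_sum_Basis sum_negf sum_divide_distrib mult.commute)
  finally show "(LB x. iexp (x \<bullet> \<xi>) * of_real (gauss c x))
    = of_real (sqrt (2 * pi / c) ^ DIM('a) * gauss (1 / c) \<xi>)" .
qed

lemma gauss_integrable: "c > 0 \<Longrightarrow> integrable lborel (gauss c :: 'a::euclidean_space \<Rightarrow> real)"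
proof -
  assume "c > 0"
  then have "integrable lborel (\<lambda>x. norm (iexp ((x::'a) \<bullet> 0) * of_real (gauss c x)))"
    by (intro integrable_norm gauss_integral)
  then show ?thesis by (simp add: norm_mult)
qed

lemma gauss_total: "c > 0 \<Longrightarrow> (LB x. gauss c (x::'a::euclidean_space)) = sqrt (2 * pi / c) ^ DIM('a)"
proof -
  assume c: "c > 0"
  have "complex_of_real (LB x. gauss c (x::'a)) = (LB x. iexp ((x::'a) \<bullet> 0) * of_real (gauss c x))"
    by simp
  also have "\<dots> = of_real (sqrt (2 * pi / c) ^ DIM('a) * gauss (1 / c) (0::'a))"
    by (rule gauss_integral[OF c])
  finally show ?thesis by (simp only: of_real_eq_iff) (simp add: gauss_def)
qed

lemma gauss_scale: "gauss c (k *\<^sub>R x) = gauss (c * k\<^sup>2) x"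
  by (simp add: gauss_def power_mult_distrib mult_ac)

text \<open>The transform with the positive sign. \<open>fourier_integral\<close> is its reflection,
  and for well-behaved functions \<open>FI\<close> inverts \<open>fourier_integral\<close> up to the
  factor (2 pi)^d.\<close>

definition FI :: "('a::euclidean_space \<Rightarrow> complex) \<Rightarrow> 'a \<Rightarrow> complex" where
  "FI f \<xi> = (LB x. iexp (x \<bullet> \<xi>) * f x)"

lemma fourier_integral_FI: "fourier_integral f \<xi> = FI f (- \<xi>)"
  by (simp add: fourier_integral_def FI_def)

lemma FI_integrand_integrable:
  "integrable lborel f \<Longrightarrow> integrable lborel (\<lambda>x. iexp (x \<bullet> \<xi>) * f x)"
  by (rule integrable_dominated) (auto simp: norm_mult)

lemma norm_FI_le:
  assumes "integrable lborel f"
  shows "cmod (FI f \<xi>) \<le> (LB x. cmod (f x))"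
proof -
  have "cmod (FI f \<xi>) \<le> (LB x. cmod (iexp (x \<bullet> \<xi>) * f x))"
    unfolding FI_def by (rule integral_norm_bound)
  then show ?thesis by (simp add: norm_mult)
qed

lemma FI_measurable [measurable]:
  assumes [measurable]: "borel_fun f"
  shows "borel_fun (FI f)"
proof -
  have "(\<lambda>(\<xi>, x). iexp (x \<bullet> \<xi>) * f x) \<in> borel_measurable (borel \<Otimes>\<^sub>M lborel)" by measurable
  then have "borel_fun (\<lambda>\<xi>. LB x. iexp (x \<bullet> \<xi>) * f x)"
    by (rule lborel.borel_measurable_lebesgue_integral)
  then show ?thesis by (simp add: FI_def[abs_def])
qed

lemma FI_duality:
  assumes f: "integrable lborel f" and g: "integrable lborel g"
  shows "integrable lborel (\<lambda>\<xi>. FI f \<xi> * g \<xi>)"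
    and "(LB \<xi>. FI f \<xi> * g \<xi>) = (LB x. f x * FI g x)"
proof -
  have [measurable]: "borel_fun f" "borel_fun g" using f g by auto
  show "integrable lborel (\<lambda>\<xi>. FI f \<xi> * g \<xi>)"
  proof (rule integrable_dominated[OF integrable_mult_right[OF integrable_norm[OF g], of "LB x. cmod (f x)"]])
    show "AE \<xi> in lborel. norm (FI f \<xi> * g \<xi>) \<le> norm ((LB x. cmod (f x)) * norm (g \<xi>))"
      using norm_FI_le[OF f] by (intro AE_I2) (simp add: norm_mult abs_mult integral_nonneg_AE mult_right_mono)
  qed simp
  have i: "integrable lborel2 (\<lambda>(x, \<xi>). iexp (x \<bullet> \<xi>) * f x * g \<xi>)"
    by (rule integrable_pair_bound[OF _ integrable_norm[OF f] integrable_norm[OF g]]) (auto simp: norm_mult)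
  have "(LB \<xi>. FI f \<xi> * g \<xi>) = (LB \<xi>. (LB x. iexp (x \<bullet> \<xi>) * f x * g \<xi>))"
    by (simp add: FI_def)
  also have "\<dots> = (LB x. (LB \<xi>. iexp (x \<bullet> \<xi>) * f x * g \<xi>))"
    by (rule lborel_pair.Fubini_integral[OF i])
  also have "\<dots> = (LB x. (LB \<xi>. f x * (iexp (\<xi> \<bullet> x) * g \<xi>)))"
    by (simp add: inner_commute mult_ac)
  also have "\<dots> = (LB x. f x * FI g x)"
    by (simp add: FI_def)
  finally show "(LB \<xi>. FI f \<xi> * g \<xi>) = (LB x. f x * FI g x)" .
qed

text \<open>Concentrating Gaussians form an approximate identity. With the variable rescaled, the
  Gaussian is fixed and dominates, and the continuity of r gives the limit.\<close>

lemma gauss_approximation: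
  fixes r :: "'a::euclidean_space \<Rightarrow> complex"
  assumes cont: "continuous_on UNIV r" and bdd: "\<And>x. cmod (r x) \<le> B"
  shows "(\<lambda>n. LB z. r (x + (1 / Suc n) *\<^sub>R z) * of_real (gauss 1 z)) \<longlonglongrightarrow> of_real (sqrt (2 * pi) ^ DIM('a)) * r x"
proof -
  have [measurable]: "borel_fun r" using cont by (rule borel_measurable_continuous_onI)
  have "(\<lambda>n. LB z. r (x + (1 / Suc n) *\<^sub>R z) * of_real (gauss 1 z)) \<longlonglongrightarrow> (LB z. r x * of_real (gauss 1 (z::'a)))"
  proof (rule integral_dominated_convergence[where w="\<lambda>z. B * gauss 1 z"])
    show "integrable lborel (\<lambda>z::'a. B * gauss 1 z)" by (simp add: gauss_integrable)
    show "AE z in lborel. norm (r (x + (1 / Suc n) *\<^sub>R z) * of_real (gauss 1 z)) \<le> B * gauss 1 z" for n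
      using bdd by (intro AE_I2) (simp add: norm_mult mult_right_mono)
    show "AE z in lborel. (\<lambda>n. r (x + (1 / Suc n) *\<^sub>R z) * of_real (gauss 1 z)) \<longlonglongrightarrow> r x * of_real (gauss 1 z)" (is "AE z in _. ?P z")
    proof (rule AE_I2)
      fix z :: 'a
      have "(\<lambda>n. x + (1 / real (Suc n)) *\<^sub>R z) \<longlonglongrightarrow> x + 0 *\<^sub>R z"
        by (intro tendsto_intros LIMSEQ_Suc[OF lim_1_over_n])
      then have "(\<lambda>n. r (x + (1 / real (Suc n)) *\<^sub>R z)) \<longlonglongrightarrow> r x"
        using cont by (auto intro!: continuous_on_tendsto_compose[OF cont])
      then show "?P z"
        by (intro tendsto_intros)
    qed
  qed simp_all
  also have "(LB z. r x * of_real (gauss 1 (z::'a))) = of_real (sqrt (2 * pi) ^ DIM('a)) * r x"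
    by (simp add: gauss_total)
  finally show ?thesis .
qed

lemma integral_gauss_shift_scale:
  fixes r :: "'a::euclidean_space \<Rightarrow> complex"
  assumes [measurable]: "borel_fun r" and e: "e > 0"
  shows "(LB y. r y * of_real (gauss (1 / e\<^sup>2) (y - x)))
    = of_real (e ^ DIM('a)) * (LB z. r (x + e *\<^sub>R z) * of_real (gauss 1 z))"
proof -
  have "(LB y. r y * of_real (gauss (1 / e\<^sup>2) (y - x)))
    = (LB y. r (x + y) * of_real (gauss (1 / e\<^sup>2) (x + y - x)))"
    by (rule integral_lborel_shift[symmetric]) simp
  also have "\<dots> = (LB y. r (x + y) * of_real (gauss (1 / e\<^sup>2) y))" by simp
  also have "\<dots> = (\<bar>e\<bar> ^ DIM('a)) *\<^sub>R (LB z. r (x + e *\<^sub>R z) * of_real (gauss (1 / e\<^sup>2) (e *\<^sub>R z)))"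
    by (rule integral_lborel_scale) (use e in auto)
  also have "\<dots> = of_real (e ^ DIM('a)) * (LB z. r (x + e *\<^sub>R z) * of_real (gauss 1 z))"
    using e by (simp add: gauss_scale scaleR_conv_of_real)
  finally show ?thesis .
qed

lemma sqrt_2pi_square: "sqrt (2 * pi) ^ n * sqrt (2 * pi) ^ n = (2 * pi) ^ n"
  unfolding power_mult_distrib[symmetric] by simp

text \<open>A Gaussian factor tending to 1 is inserted into the integral that defines
  \<open>FI (FI \<psi>) (- x)\<close>. By duality \<psi> is then integrated against the transform of
  this factor, a Gaussian concentrating at x. The resulting sequence converges to both sides of the
  claim.\<close>

theorem FI_inversion:
  fixes \<psi> :: "'a::euclidean_space \<Rightarrow> complex"
  assumes cont: "continuous_on UNIV \<psi>" and bdd: "\<And>x. cmod (\<psi> x) \<le> B"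
    and i: "integrable lborel \<psi>" and i': "integrable lborel (FI \<psi>)"
  shows "FI (FI \<psi>) (- x) = of_real ((2 * pi) ^ DIM('a)) * \<psi> x"
proof (rule LIMSEQ_unique)
  have [measurable]: "\<psi> \<in> borel_measurable borel" using cont by (rule borel_measurable_continuous_onI)
  define e where "e n = 1 / real (Suc n)" for n
  let ?E = "\<lambda>n \<xi>. iexp (\<xi> \<bullet> (- x)) * complex_of_real (gauss ((e n)\<^sup>2) \<xi>)"
  have e0: "e n > 0" for n by (simp add: e_def)
  have step: "(LB \<xi>. FI \<psi> \<xi> * ?E n \<xi>)
    = of_real (sqrt (2 * pi) ^ DIM('a)) * (LB z. \<psi> (x + e n *\<^sub>R z) * of_real (gauss 1 z))" for n
  proof -
    have "(LB \<xi>. FI \<psi> \<xi> * ?E n \<xi>)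
      = (LB y. \<psi> y * FI (\<lambda>\<xi>. iexp (\<xi> \<bullet> (- x)) * of_real (gauss ((e n)\<^sup>2) \<xi>)) y)"
      using e0[of n] by (intro FI_duality i gauss_integral) simp
    also have "\<dots> = (LB y. of_real (sqrt (2 * pi / (e n)\<^sup>2) ^ DIM('a)) * (\<psi> y * of_real (gauss (1 / (e n)\<^sup>2) (y - x))))" (is "(LB y. ?f y) = (LB y. ?g y)")
    proof (rule LB_cong)
      fix y :: 'a
      have "FI (\<lambda>\<xi>. iexp (\<xi> \<bullet> (- x)) * of_real (gauss ((e n)\<^sup>2) \<xi>)) y = (LB \<xi>. iexp (\<xi> \<bullet> (y - x)) * of_real (gauss ((e n)\<^sup>2) \<xi>))"
      proof -
        have "iexp (\<xi> \<bullet> y) * iexp (\<xi> \<bullet> (- x)) = iexp (\<xi> \<bullet> (y - x))" for \<xi> :: 'a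
          by (simp add: exp_add[symmetric] inner_diff_right right_diff_distrib)
        then show ?thesis unfolding FI_def mult.assoc[symmetric] by simp
      qed
      also have "\<dots> = of_real (sqrt (2 * pi / (e n)\<^sup>2) ^ DIM('a) * gauss (1 / (e n)\<^sup>2) (y - x))"
        using e0[of n] by (intro gauss_integral) simp
      finally show "?f y = ?g y"
        by simp
    qed
    also have "\<dots> = of_real (sqrt (2 * pi / (e n)\<^sup>2) ^ DIM('a)) * (LB y. (\<psi> y * of_real (gauss (1 / (e n)\<^sup>2) (y - x))))"
      by (rule integral_mult_right_zero)
    also have "\<dots> = of_real (sqrt (2 * pi / (e n)\<^sup>2) ^ DIM('a)) * (of_real (e n ^ DIM('a)) * (LB z. \<psi> (x + e n *\<^sub>R z) * of_real (gauss 1 z)))"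
      by (subst integral_gauss_shift_scale) (use e0 in auto)
    also have "\<dots> = of_real (sqrt (2 * pi / (e n)\<^sup>2) ^ DIM('a) * e n ^ DIM('a)) * (LB z. \<psi> (x + e n *\<^sub>R z) * of_real (gauss 1 z))"
      by simp
    also have "sqrt (2 * pi / (e n)\<^sup>2) ^ DIM('a) * e n ^ DIM('a) = sqrt (2 * pi) ^ DIM('a)"
      unfolding power_mult_distrib[symmetric] using e0[of n] by (simp add: real_sqrt_divide)
    finally show ?thesis .
  qed
  show "(\<lambda>n. LB \<xi>. FI \<psi> \<xi> * ?E n \<xi>) \<longlonglongrightarrow> of_real ((2 * pi) ^ DIM('a)) * \<psi> x"
  proof -
    have "(\<lambda>n. of_real (sqrt (2 * pi) ^ DIM('a)) * (LB z. \<psi> (x + e n *\<^sub>R z) * of_real (gauss 1 z)))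
      \<longlonglongrightarrow> of_real (sqrt (2 * pi) ^ DIM('a)) * (of_real (sqrt (2 * pi) ^ DIM('a)) * \<psi> x)"
      unfolding e_def by (intro tendsto_mult tendsto_const gauss_approximation[OF cont bdd])
    moreover have "complex_of_real (sqrt (2 * pi) ^ DIM('a)) * (of_real (sqrt (2 * pi) ^ DIM('a)) * \<psi> x) = of_real ((2 * pi) ^ DIM('a)) * \<psi> x"
      unfolding mult.assoc[symmetric] of_real_mult[symmetric] sqrt_2pi_square ..
    ultimately show ?thesis unfolding step by (simp only:)
  qed
  have "(\<lambda>n. LB \<xi>. FI \<psi> \<xi> * ?E n \<xi>) \<longlonglongrightarrow> (LB \<xi>. FI \<psi> \<xi> * (iexp (\<xi> \<bullet> (- x)) * of_real 1))"
  proof (rule integral_dominated_convergence[where w="\<lambda>\<xi>. cmod (FI \<psi> \<xi>)"])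
    show "integrable lborel (\<lambda>\<xi>. cmod (FI \<psi> \<xi>))" using i' by (rule integrable_norm)
    show "AE \<xi> in lborel. norm (FI \<psi> \<xi> * ?E n \<xi>) \<le> cmod (FI \<psi> \<xi>)" for n
      by (intro AE_I2) (simp add: norm_mult gauss_le_1 mult_left_le)
    show "AE \<xi> in lborel. (\<lambda>n. FI \<psi> \<xi> * ?E n \<xi>) \<longlonglongrightarrow> FI \<psi> \<xi> * (iexp (\<xi> \<bullet> (- x)) * of_real 1)" (is "AE \<xi> in _. ?P \<xi>")
    proof (rule AE_I2)
      fix \<xi> :: 'a
      have "(\<lambda>n. gauss ((e n)\<^sup>2) \<xi>) \<longlonglongrightarrow> exp (- (0\<^sup>2 * (norm \<xi>)\<^sup>2 / 2))"
        unfolding gauss_def e_def by (intro tendsto_intros LIMSEQ_Suc[OF lim_1_over_n]) simp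
      then have "(\<lambda>n. gauss ((e n)\<^sup>2) \<xi>) \<longlonglongrightarrow> 1" by simp
      then show "?P \<xi>"
        by (intro tendsto_intros)
    qed
  qed (use i' in auto)
  also have "(LB \<xi>. FI \<psi> \<xi> * (iexp (\<xi> \<bullet> (- x)) * of_real 1)) = FI (FI \<psi>) (- x)"
    by (simp add: FI_def[of "FI \<psi>"] mult.commute)
  finally show "(\<lambda>n. LB \<xi>. FI \<psi> \<xi> * ?E n \<xi>) \<longlonglongrightarrow> FI (FI \<psi>) (- x)" .
qed

section \<open>Functions determined by their Gaussian averages\<close>

lemma AE_zero_if_integral_continuous_zero:
  fixes h :: "'a::euclidean_space \<Rightarrow> complex"
  assumes h: "integrable lborel h"
    and zero: "\<And>\<rho> :: 'a \<Rightarrow> real. continuous_on UNIV \<rho> \<Longrightarrow> (\<And>x. 0 \<le> \<rho> x \<and> \<rho> x \<le> 1) \<Longrightarrow> (LB x. h x * of_real (\<rho> x)) = 0"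
  shows "AE x in lborel. h x = 0"
proof -
  have [measurable]: "borel_fun h" using h by auto
  define Z where "Z A \<longleftrightarrow> (LB x. h x * of_real (indicat_real A x)) = 0" for A
  have hint: "integrable lborel (\<lambda>x. h x * of_real (indicat_real A x))" if [measurable]: "A \<in> sets borel" for A
    by (rule integrable_dominated[OF integrable_norm[OF h]])
       (auto simp: norm_mult split: split_indicator)
  \<comment> \<open>The indicator of an open set is the pointwise limit of the continuous functions
    min(1, n dist(x, complement)). The distance is meaningful only if the complement is nonempty,
    hence the separate case.\<close>
  have Zopen: "Z U" if U: "open U" for U
  proof (cases "U = UNIV")
    case True
    have "(LB x. h x * of_real (1::real)) = 0" by (rule zero) auto
    then show ?thesis using True by (simp add: Z_def)
  next
    case False
    have [measurable]: "U \<in> sets borel" using U by simp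
    from False have ne: "- U \<noteq> {}" and cl: "closed (- U)" using U by auto
    define \<rho> where "\<rho> n x = min 1 (real n * infdist x (- U))" for n x
    have "(\<lambda>n. LB x. h x * of_real (\<rho> n x)) \<longlonglongrightarrow> (LB x. h x * of_real (indicat_real U x))"
    proof (rule integral_dominated_convergence[where w="\<lambda>x. cmod (h x)"])
      have "continuous_on UNIV (\<rho> n)" for n unfolding \<rho>_def by (intro continuous_intros)
      then have [measurable]: "\<rho> n \<in> borel_measurable borel" for n by (rule borel_measurable_continuous_onI)
      show "(\<lambda>x. h x * of_real (\<rho> n x)) \<in> borel_measurable lborel" for n by measurable
      show "(\<lambda>x. h x * of_real (indicat_real U x)) \<in> borel_measurable lborel" by measurable
      show "integrable lborel (\<lambda>x. cmod (h x))" using h by (rule integrable_norm)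
      show "AE x in lborel. norm (h x * of_real (\<rho> n x)) \<le> cmod (h x)" for n
        by (intro AE_I2) (auto simp: norm_mult \<rho>_def infdist_nonneg intro!: mult_left_le)
      show "AE x in lborel. (\<lambda>n. h x * of_real (\<rho> n x)) \<longlonglongrightarrow> h x * of_real (indicat_real U x)"
      proof (intro AE_I2 tendsto_intros)
        fix x
        show "(\<lambda>n. \<rho> n x) \<longlonglongrightarrow> indicat_real U x"
        proof (cases "x \<in> U")
          case True
          then have d: "infdist x (- U) > 0"
            using in_closed_iff_infdist_zero[OF cl ne, of x] infdist_nonneg[of x "- U"] by auto
          obtain N where N: "1 / infdist x (- U) \<le> real N" using real_arch_simple by blast
          have "\<forall>\<^sub>F n in sequentially. \<rho> n x = 1"
          proof (rule eventually_sequentiallyI[of N])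
            fix n assume "N \<le> n"
            then have "1 / infdist x (- U) \<le> real n" using N by (meson of_nat_mono order_trans)
            then have "1 \<le> real n * infdist x (- U)" using d by (simp add: field_simps)
            then show "\<rho> n x = 1" by (simp add: \<rho>_def)
          qed
          then show ?thesis using True by (simp add: tendsto_eventually)
        next
          case False
          then have "infdist x (- U) = 0" by simp
          then show ?thesis using False by (simp add: \<rho>_def)
        qed
      qed
    qed
    moreover have "(LB x. h x * of_real (\<rho> n x)) = 0" for n
      by (rule zero) (auto simp: \<rho>_def infdist_nonneg intro!: continuous_intros)
    ultimately show ?thesis by (simp add: Z_def LIMSEQ_const_iff)
  qed
  \<comment> \<open>The open sets are stable under intersection and generate the Borel sets, and the
    sets with \<open>Z\<close> form a Dynkin system.\<close>
  have Z: "Z A" if A: "A \<in> sets borel" for A :: "'a set"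
  proof -
    have A': "A \<in> sigma_sets UNIV {U. open U}" using A by (simp add: borel_def)
    have int: "Int_stable {U :: 'a set. open U}" by (auto simp: Int_stable_def)
    have pow: "{U. open U} \<subseteq> Pow (UNIV :: 'a set)" by simp
    show ?thesis
    proof (induction rule: sigma_sets_induct_disjoint[OF int pow A', case_names basic empty compl union])
      case (basic A) then show ?case using Zopen by simp
    next
      case empty then show ?case by (simp add: Z_def)
    next
      case (compl A)
      then have [measurable]: "A \<in> sets borel" by (simp add: borel_def)
      have "(LB x. h x * of_real (indicat_real (UNIV - A) x)) = (LB x. h x * of_real (indicat_real UNIV x) - h x * of_real (indicat_real A x))"
        by (intro Bochner_Integration.integral_cong) (auto split: split_indicator)
      also have "\<dots> = (LB x. h x * of_real (indicat_real UNIV x)) - (LB x. h x * of_real (indicat_real A x))"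
        by (rule Bochner_Integration.integral_diff) (intro hint, simp)+
      also have "\<dots> = 0" using compl(2) Zopen[of UNIV] by (simp only: Z_def) simp
      finally show ?case by (simp add: Z_def)
    next
      case (union A)
      then have [measurable]: "A n \<in> sets borel" for n by (auto simp: borel_def)
      have "(\<lambda>n. LB x. h x * of_real (indicat_real (\<Union>i<n. A i) x)) \<longlonglongrightarrow> (LB x. h x * of_real (indicat_real (\<Union>i. A i) x))"
      proof (rule integral_dominated_convergence[where w="\<lambda>x. cmod (h x)"])
        show "integrable lborel (\<lambda>x. cmod (h x))" using h by (rule integrable_norm)
        show "AE x in lborel. (\<lambda>n. h x * of_real (indicat_real (\<Union>i<n. A i) x)) \<longlonglongrightarrow> h x * of_real (indicat_real (\<Union>i. A i) x)"
          by (intro AE_I2 tendsto_intros LIMSEQ_indicator_UN)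
      qed (auto simp: norm_mult split: split_indicator)
      moreover have "(LB x. h x * of_real (indicat_real (\<Union>i<n. A i) x)) = 0" for n
      proof -
        have "(LB x. h x * of_real (indicat_real (\<Union>i<n. A i) x)) = (LB x. (\<Sum>i<n. h x * of_real (indicat_real (A i) x)))"
        proof (intro Bochner_Integration.integral_cong refl)
          fix x
          have "indicat_real (\<Union>i<n. A i) x = (\<Sum>i<n. indicat_real (A i) x)"
            using union(1) by (intro indicator_UN_disjoint) (auto simp: disjoint_family_on_def)
          then show "h x * of_real (indicat_real (\<Union>i<n. A i) x) = (\<Sum>i<n. h x * of_real (indicat_real (A i) x))"
            by (simp add: sum_distrib_left)
        qed
        also have "\<dots> = (\<Sum>i<n. LB x. h x * of_real (indicat_real (A i) x))"
          by (rule Bochner_Integration.integral_sum) (intro hint, simp)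
        finally show ?thesis using union(3) by (simp add: Z_def)
      qed
      ultimately show ?case by (simp add: Z_def LIMSEQ_const_iff)
    qed
  qed
  show ?thesis
  proof (rule sigma_finite_measure.density_zero[OF sigma_finite_lborel h])
    fix A :: "'a set" assume "A \<in> sets lborel"
    then have "Z A" by (intro Z) simp
    then show "set_lebesgue_integral lborel A h = 0"
      by (simp add: Z_def set_lebesgue_integral_def scaleR_conv_of_real mult.commute)
  qed
qed

text \<open>For continuous r with values in [0, 1], the integral of h against a Gaussian average of
  r vanishes by Fubini; as the Gaussians concentrate, it tends to a nonzero multiple of the integral
  of h r.\<close>

lemma AE_zero_if_gauss_integral_zero:
  fixes h :: "'a::euclidean_space \<Rightarrow> complex"
  assumes h: "integrable lborel h"
    and zero: "\<And>x e. e > 0 \<Longrightarrow> (LB y. h y * of_real (gauss (1 / e\<^sup>2) (y - x))) = 0"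
  shows "AE x in lborel. h x = 0"
proof (rule AE_zero_if_integral_continuous_zero[OF h])
  fix r :: "'a \<Rightarrow> real" assume cont: "continuous_on UNIV r" and bdd: "\<And>x. 0 \<le> r x \<and> r x \<le> 1"
  have [measurable]: "borel_fun r" using cont by (rule borel_measurable_continuous_onI)
  have [measurable]: "borel_fun h" using h by auto
  define e where "e n = 1 / real (Suc n)" for n
  let ?A = "\<lambda>n y. LB z. complex_of_real (r (y + e n *\<^sub>R z)) * of_real (gauss 1 z)"
  have e0: "e n > 0" for n by (simp add: e_def)
  have bdd': "cmod (of_real (r x)) \<le> 1" for x using bdd[of x] by simp
  have cont': "continuous_on UNIV (\<lambda>x. complex_of_real (r x))" using cont by (intro continuous_intros)
  have step: "(LB y. h y * ?A n y) = 0" for n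
  proof -
    define \<gamma> where "\<gamma> = (gauss (1 / (e n)\<^sup>2) :: 'a \<Rightarrow> real)"
    have [measurable]: "\<gamma> \<in> borel_measurable borel" unfolding \<gamma>_def by measurable
    have g0: "\<gamma> x \<ge> 0" for x by (simp add: \<gamma>_def)
    have gi: "integrable lborel \<gamma>" unfolding \<gamma>_def using e0[of n] by (intro gauss_integrable) simp
    have gs: "integrable lborel (\<lambda>x. \<gamma> (x - y))" "(LB x. \<gamma> (x - y)) = (LB x. \<gamma> x)" for y
      using integrable_lborel_shift[OF gi, of "- y"] integral_lborel_shift[of \<gamma> "- y"] by simp_all
    have ri: "integrable lborel (\<lambda>x. r x * \<gamma> (x - y))" for y
      by (rule integrable_dominated[OF gs(1)[of y]])
         (use bdd in \<open>auto simp: abs_mult g0 intro!: mult_left_le_one_le\<close>)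
    have rl: "(LB x. r x * \<gamma> (x - y)) \<le> (LB x. \<gamma> x)" for y
      unfolding gs(2)[of y, symmetric] using bdd g0
      by (intro integral_mono ri gs(1)) (auto intro!: mult_left_le_one_le)
    have i: "integrable lborel2 (\<lambda>(y, x). h y * of_real (r x * \<gamma> (x - y)))"
    proof (rule lborel_pair.Fubini_integrable)
      have "integrable lborel (\<lambda>y. cmod (h y) * (LB x. r x * \<gamma> (x - y)))"
      proof (rule integrable_dominated[OF integrable_mult_left[OF integrable_norm[OF h], of "LB x. \<gamma> x"]])
        show "AE y in lborel. norm (cmod (h y) * (LB x. r x * \<gamma> (x - y))) \<le> norm (norm (h y) * (LB x. \<gamma> x))"
          using rl bdd g0 by (intro AE_I2) (auto simp: abs_mult integral_nonneg_AE intro!: mult_left_mono)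
      qed measurable
      then show "integrable lborel (\<lambda>y. LB x. norm (case (y, x) of (y, x) \<Rightarrow> h y * of_real (r x * \<gamma> (x - y))))"
        using bdd g0 by (simp add: norm_mult abs_mult)
      show "AE y in lborel. integrable lborel (\<lambda>x. case (y, x) of (y, x) \<Rightarrow> h y * of_real (r x * \<gamma> (x - y)))"
        using ri by (intro AE_I2) (simp del: of_real_mult add: integrable_of_real)
    qed simp
    have ex: "complex_of_real (e n ^ DIM('a)) * ?A n y
      = (LB x. of_real (r x) * of_real (\<gamma> (x - y)))" for y
      unfolding \<gamma>_def by (rule integral_gauss_shift_scale[OF _ e0, symmetric]) simp
    have "of_real (e n ^ DIM('a)) * (LB y. h y * ?A n y)
      = (LB y. of_real (e n ^ DIM('a)) * (h y * ?A n y))"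
      by (rule integral_mult_right_zero[symmetric])
    also have "\<dots> = (LB y. h y * (of_real (e n ^ DIM('a)) * ?A n y))"
      by (intro Bochner_Integration.integral_cong refl) (rule mult.left_commute)
    also have "\<dots> = (LB y. h y * (LB x. of_real (r x) * of_real (\<gamma> (x - y))))"
      by (simp only: ex)
    also have "\<dots> = (LB y. (LB x. h y * of_real (r x * \<gamma> (x - y))))"
      by (simp only: integral_mult_right_zero of_real_mult)
    also have "\<dots> = (LB x. (LB y. h y * of_real (r x * \<gamma> (x - y))))"
      by (rule lborel_pair.Fubini_integral[OF i, symmetric])
    also have "\<dots> = (LB x. of_real (r x) * (LB y. h y * of_real (gauss (1 / (e n)\<^sup>2) (y - x))))" (is "(LB x. ?f x) = (LB x. ?g x)")
    proof (rule LB_cong)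
      fix x :: 'a
      have "\<gamma> (x - y) = gauss (1 / (e n)\<^sup>2) (y - x)" for y
        unfolding \<gamma>_def by (metis gauss_minus minus_diff_eq)
      then have "?f x = (LB y. of_real (r x) * (h y * of_real (gauss (1 / (e n)\<^sup>2) (y - x))))"
        by (simp add: mult_ac)
      then show "?f x = ?g x"
        by simp
    qed
    also have "\<dots> = 0" by (simp add: zero[OF e0])
    finally show ?thesis using e0[of n] by simp
  qed
  have "(\<lambda>n. LB y. h y * ?A n y)
    \<longlonglongrightarrow> (LB y. h y * (of_real (sqrt (2 * pi) ^ DIM('a)) * of_real (r y)))"
  proof (rule integral_dominated_convergence[where w="\<lambda>y. cmod (h y) * sqrt (2 * pi) ^ DIM('a)"])
    show "integrable lborel (\<lambda>y. cmod (h y) * sqrt (2 * pi) ^ DIM('a))"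
      by (intro integrable_mult_left integrable_norm h)
    show "AE y in lborel. (\<lambda>n. h y * ?A n y)
      \<longlonglongrightarrow> h y * (of_real (sqrt (2 * pi) ^ DIM('a)) * of_real (r y))"
      unfolding e_def by (intro AE_I2 tendsto_intros gauss_approximation[OF cont' bdd'])
    show "AE y in lborel. norm (h y * ?A n y) \<le> cmod (h y) * sqrt (2 * pi) ^ DIM('a)" (is "AE y in _. ?P y") for n
    proof (rule AE_I2)
      fix y :: 'a
      have "cmod (?A n y) \<le> (LB z. cmod (of_real (r (y + e n *\<^sub>R z)) * of_real (gauss 1 z)))"
        by (rule integral_norm_bound)
      also have "\<dots> \<le> (LB z. gauss 1 (z::'a))"
        by (rule integral_mono', simp add: gauss_integrable)
           (use bdd in \<open>auto simp: norm_mult intro!: mult_left_le_one_le\<close>)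
      also have "\<dots> = sqrt (2 * pi) ^ DIM('a)" by (simp add: gauss_total)
      finally show "?P y"
        unfolding norm_mult by (rule mult_left_mono) simp
    qed
  qed simp_all
  then have a: "(LB y. h y * (of_real (sqrt (2 * pi) ^ DIM('a)) * of_real (r y))) = 0"
    unfolding step by (rule LIMSEQ_const_iff[THEN iffD1, symmetric])
  have b: "(LB y. h y * (of_real (sqrt (2 * pi) ^ DIM('a)) * of_real (r y))) = of_real (sqrt (2 * pi) ^ DIM('a)) * (LB y. h y * of_real (r y))"
  proof -
    have "h y * (C * of_real (r y)) = C * (h y * of_real (r y))" for y C by (rule mult.left_commute)
    then show ?thesis by (simp only: integral_mult_right_zero)
  qed
  have "complex_of_real (sqrt (2 * pi) ^ DIM('a)) \<noteq> 0" by simp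
  then show "(LB x. h x * of_real (r x)) = 0"
    using a unfolding b mult_eq_0_iff by blast
qed

section \<open>Schwartz functions\<close>

inductive poly_fun :: "('a::euclidean_space \<Rightarrow> complex) \<Rightarrow> bool" where
  poly_const: "poly_fun (\<lambda>_. c)"
| poly_coord: "poly_fun (\<lambda>x. of_real (x \<bullet> b))"
| poly_add: "poly_fun p \<Longrightarrow> poly_fun q \<Longrightarrow> poly_fun (\<lambda>x. p x + q x)"
| poly_mult: "poly_fun p \<Longrightarrow> poly_fun q \<Longrightarrow> poly_fun (\<lambda>x. p x * q x)"

lemma poly_fun_growth: "poly_fun p \<Longrightarrow> \<exists>C N. \<forall>x. cmod (p x) \<le> C * (1 + norm x) ^ N"
proof (induction rule: poly_fun.induct)
  case (poly_const c)
  show ?case by (intro exI[of _ "cmod c"] exI[of _ 0]) simp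
next
  case (poly_coord b)
  have "\<bar>x \<bullet> b\<bar> \<le> norm b * (1 + norm x) ^ 1" for x :: 'a
    using Cauchy_Schwarz_ineq2[of x b] by (simp add: algebra_simps) (smt (verit) norm_ge_zero)
  then show ?case by (intro exI[of _ "norm b"] exI[of _ 1]) auto
next
  case (poly_add p q)
  then obtain C N D K where p: "\<And>x. cmod (p x) \<le> C * (1 + norm x) ^ N" and q: "\<And>x. cmod (q x) \<le> D * (1 + norm x) ^ K"
    by auto
  have "cmod (p x + q x) \<le> (\<bar>C\<bar> + \<bar>D\<bar>) * (1 + norm x) ^ (N + K)" for x
  proof -
    have "cmod (p x) \<le> \<bar>C\<bar> * (1 + norm x) ^ (N + K)"
      by (rule order_trans[OF p mult_mono]) (auto intro!: power_increasing)
    moreover have "cmod (q x) \<le> \<bar>D\<bar> * (1 + norm x) ^ (N + K)"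
      by (rule order_trans[OF q mult_mono]) (auto intro!: power_increasing)
    ultimately show ?thesis
      using norm_triangle_ineq[of "p x" "q x"] by (simp add: distrib_right)
  qed
  then show ?case by blast
next
  case (poly_mult p q)
  then obtain C N D K where p: "\<And>x. cmod (p x) \<le> C * (1 + norm x) ^ N" and q: "\<And>x. cmod (q x) \<le> D * (1 + norm x) ^ K"
    by auto
  have "cmod (p x * q x) \<le> (C * D) * (1 + norm x) ^ (N + K)" for x
  proof -
    have "cmod (p x) * cmod (q x) \<le> (C * (1 + norm x) ^ N) * (D * (1 + norm x) ^ K)"
      using p q by (intro mult_mono) (auto intro: order_trans[OF norm_ge_zero])
    then show ?thesis by (simp add: norm_mult power_add mult_ac)
  qed
  then show ?case by blast
qed

lemma poly_fun_derivative:
  "poly_fun p \<Longrightarrow> \<exists>D. (\<forall>b. poly_fun (\<lambda>x. D x b)) \<and> (\<forall>x. (p has_derivative D x) (at x))"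
proof (induction rule: poly_fun.induct)
  case (poly_const c)
  show ?case by (intro exI[of _ "\<lambda>_ _. 0"]) (auto intro: poly_fun.poly_const)
next
  case (poly_coord b)
  show ?case by (intro exI[of _ "\<lambda>_ h. of_real (h \<bullet> b)"]) (auto intro!: poly_fun.poly_const derivative_eq_intros)
next
  case (poly_add p q)
  then obtain D E where D: "\<And>b. poly_fun (\<lambda>x. D x b)" "\<And>x. (p has_derivative D x) (at x)"
    and E: "\<And>b. poly_fun (\<lambda>x. E x b)" "\<And>x. (q has_derivative E x) (at x)" by auto
  show ?case
    by (intro exI[of _ "\<lambda>x h. D x h + E x h"] conjI allI poly_fun.poly_add D(1) E(1) has_derivative_add[OF D(2) E(2)])
next
  case (poly_mult p q)
  then obtain D E where D: "\<And>b. poly_fun (\<lambda>x. D x b)" "\<And>x. (p has_derivative D x) (at x)"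
    and E: "\<And>b. poly_fun (\<lambda>x. E x b)" "\<And>x. (q has_derivative E x) (at x)" by auto
  show ?case
    by (intro exI[of _ "\<lambda>x h. p x * E x h + D x h * q x"] conjI allI poly_fun.poly_add poly_fun.poly_mult
        poly_mult.hyps D(1) E(1) has_derivative_mult[OF D(2) E(2)])
qed

text \<open>Modulated Gaussians are the explicit test functions from which uniqueness is derived.
  Their iterated partial derivatives are polynomial multiples of themselves, which is the purpose of
  \<open>poly_fun\<close>, and their Fourier transforms are multiples of translated
  Gaussians.\<close>

definition wave_packet :: "real \<Rightarrow> 'a::euclidean_space \<Rightarrow> 'a \<Rightarrow> complex" where
  "wave_packet c k x = iexp (x \<bullet> k) * of_real (gauss c x)"

lemma wave_packet_derivative:
  "(wave_packet c k has_derivative (\<lambda>h. (\<i> * of_real (h \<bullet> k) + of_real (- c) * of_real (x \<bullet> h)) * wave_packet c k x)) (at x)"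
proof -
  have eq: "wave_packet c k = (\<lambda>x. exp (\<i> * of_real (x \<bullet> k) + of_real (- c / 2) * of_real (x \<bullet> x)))"
  proof
    fix x :: 'a
    have "complex_of_real (gauss c x) = exp (of_real (- c / 2) * of_real (x \<bullet> x))"
      unfolding gauss_def power2_norm_eq_inner exp_of_real[symmetric] by simp
    then show "wave_packet c k x = exp (\<i> * of_real (x \<bullet> k) + of_real (- c / 2) * of_real (x \<bullet> x))"
      unfolding wave_packet_def by (simp only: exp_add)
  qed
  have inner: "((\<lambda>x. \<i> * of_real (x \<bullet> k) + of_real (- c / 2) * of_real (x \<bullet> x)) has_derivative
    (\<lambda>h. \<i> * of_real (h \<bullet> k) + of_real (- c / 2) * of_real (x \<bullet> h + h \<bullet> x))) (at x)"
    by (intro has_derivative_add has_derivative_mult_right has_derivative_of_real has_derivative_inner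
        has_derivative_inner_left has_derivative_ident)
  show ?thesis
    unfolding eq
    by (rule has_derivative_eq_rhs[OF has_derivative_compose[OF inner DERIV_exp[unfolded has_field_derivative_def]]])
       (auto simp: fun_eq_iff inner_commute algebra_simps)
qed

text \<open>Induction on n in which one factor 1 + |x| consumes half of the exponent: 1 + t <= exp
  t, and t - c t^2/4 <= 1/c by completing the square.\<close>

lemma gauss_poly_bounded:
  assumes "c > 0"
  shows "\<exists>B. \<forall>x::'a::euclidean_space. (1 + norm x) ^ n * gauss c x \<le> B"
  using assms
proof (induction n arbitrary: c)
  case 0
  then show ?case by (intro exI[of _ 1]) (auto simp: gauss_le_1)
next
  case (Suc n)
  obtain B where B: "\<And>x::'a. (1 + norm x) ^ n * gauss (c / 2) x \<le> B"
    using Suc.IH[of "c / 2"] Suc.prems by auto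
  have 1: "(1 + norm x) * gauss (c / 2) x \<le> exp (1 / c)" for x :: 'a
  proof -
    have "(1 + norm x) * gauss (c / 2) x \<le> exp (norm x) * gauss (c / 2) x"
      by (intro mult_right_mono) auto
    also have "\<dots> = exp (norm x - c / 4 * (norm x)\<^sup>2)"
      by (simp add: gauss_def exp_add[symmetric])
    also have "norm x - c / 4 * (norm x)\<^sup>2 \<le> 1 / c"
    proof -
      have "0 \<le> (c * norm x / 2 - 1)\<^sup>2" by simp
      then have "c * norm x - c\<^sup>2 * (norm x)\<^sup>2 / 4 \<le> 1"
        by (simp add: power2_diff power_mult_distrib power_divide)
      then have "c * (norm x - c / 4 * (norm x)\<^sup>2) \<le> 1"
        by (simp add: algebra_simps power2_eq_square)
      then show ?thesis using Suc.prems by (simp add: field_simps)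
    qed
    finally show ?thesis by simp
  qed
  have "(1 + norm x) ^ Suc n * gauss c x \<le> exp (1 / c) * B" for x :: 'a
  proof -
    have "gauss c x = gauss (c / 2) x * gauss (c / 2) x"
      by (simp add: gauss_def exp_add[symmetric])
    then have "(1 + norm x) ^ Suc n * gauss c x = ((1 + norm x) * gauss (c / 2) x) * ((1 + norm x) ^ n * gauss (c / 2) x)"
      by simp
    also have "\<dots> \<le> exp (1 / c) * B"
      using 1 B by (intro mult_mono) auto
    finally show ?thesis .
  qed
  then show ?case by blast
qed

lemma iterated_partial_poly_wave_packet:
  "\<exists>p. poly_fun p \<and> iterated_partial bs (wave_packet c k) = (\<lambda>x. p x * wave_packet c k x)"
proof (induction bs)
  case Nil
  show ?case by (intro exI[of _ "\<lambda>_. 1"]) (auto intro: poly_fun.poly_const)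
next
  case (Cons b bs)
  then obtain p where p: "poly_fun p" and eq: "iterated_partial bs (wave_packet c k) = (\<lambda>x. p x * wave_packet c k x)"
    by auto
  obtain D where D: "\<And>b. poly_fun (\<lambda>x. D x b)" "\<And>x. (p has_derivative D x) (at x)"
    using poly_fun_derivative[OF p] by auto
  let ?q = "\<lambda>x. p x * (\<i> * of_real (b \<bullet> k) + of_real (- c) * of_real (x \<bullet> b)) + D x b"
  have "poly_fun ?q"
    by (intro poly_fun.intros p D poly_const[of "\<i> * of_real (b \<bullet> k)"] poly_const[of "of_real (- c)"])
  moreover have "iterated_partial (b # bs) (wave_packet c k) = (\<lambda>x. ?q x * wave_packet c k x)"
  proof
    fix x
    have "((\<lambda>x. p x * wave_packet c k x) has_derivative
      (\<lambda>h. p x * ((\<i> * of_real (h \<bullet> k) + of_real (- c) * of_real (x \<bullet> h)) * wave_packet c k x) + D x h * wave_packet c k x)) (at x)"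
      by (intro has_derivative_mult D wave_packet_derivative)
    from frechet_derivative_at[OF this, symmetric]
    show "iterated_partial (b # bs) (wave_packet c k) x = ?q x * wave_packet c k x"
      by (simp add: eq algebra_simps)
  qed
  ultimately show ?case by blast
qed

lemma schwartz_wave_packet:
  assumes c: "c > 0"
  shows "schwartz (wave_packet c k)"
  unfolding schwartz_def
proof (intro ballI conjI allI)
  fix bs :: "'a list"
  obtain p where p: "poly_fun p" and eq: "iterated_partial bs (wave_packet c k) = (\<lambda>x. p x * wave_packet c k x)"
    using iterated_partial_poly_wave_packet by blast
  obtain D where D: "\<And>x. (p has_derivative D x) (at x)"
    using poly_fun_derivative[OF p] by auto
  show "iterated_partial bs (wave_packet c k) differentiable at x" for x
    unfolding eq differentiable_def using has_derivative_mult[OF D wave_packet_derivative] by blast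
  obtain C N where C: "\<And>x. cmod (p x) \<le> C * (1 + norm x) ^ N" using poly_fun_growth[OF p] by auto
  fix n :: nat
  obtain B where B: "\<And>x::'a. (1 + norm x) ^ (n + N) * gauss c x \<le> B" using gauss_poly_bounded[OF c] by blast
  have "C \<ge> 0" using order_trans[OF norm_ge_zero C[of 0]] by simp
  have "norm (norm x ^ n *\<^sub>R iterated_partial bs (wave_packet c k) x) \<le> C * B" for x
  proof -
    have "norm (norm x ^ n *\<^sub>R iterated_partial bs (wave_packet c k) x) = norm x ^ n * (cmod (p x) * gauss c x)"
      unfolding eq by (simp add: norm_mult wave_packet_def)
    also have "\<dots> \<le> (1 + norm x) ^ n * ((C * (1 + norm x) ^ N) * gauss c x)"
      using C \<open>C \<ge> 0\<close> by (intro mult_mono power_mono mult_right_mono) auto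
    also have "\<dots> = C * ((1 + norm x) ^ (n + N) * gauss c x)" by (simp add: power_add mult_ac)
    also have "\<dots> \<le> C * B" using B \<open>C \<ge> 0\<close> by (rule mult_left_mono)
    finally show ?thesis .
  qed
  then show "bounded (range (\<lambda>x. norm x ^ n *\<^sub>R iterated_partial bs (wave_packet c k) x))"
    unfolding bounded_iff by blast
qed

lemma one_plus_power_le: "r \<ge> 0 \<Longrightarrow> (1 + r) ^ n \<le> 2 ^ n * (1 + r ^ n)" for r :: real
proof -
  assume r: "r \<ge> 0"
  have "(1 + r) ^ n \<le> (2 * max 1 r) ^ n" using r by (intro power_mono) auto
  also have "\<dots> = 2 ^ n * max 1 r ^ n" by (simp add: power_mult_distrib)
  also have "max 1 r ^ n \<le> 1 + r ^ n" using r by (auto simp: max_def)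
  finally show ?thesis by simp
qed

lemma schwartz_decay:
  assumes f: "schwartz f" and bs: "bs \<in> lists Basis"
  shows "\<exists>C\<ge>0. \<forall>x. cmod (iterated_partial bs f x) \<le> C * (1 / (1 + norm x) ^ N)"
proof -
  let ?g = "iterated_partial bs f"
  have "\<forall>k. bounded (range (\<lambda>x. norm x ^ k *\<^sub>R ?g x))" using f bs by (auto simp: schwartz_def)
  then have "bounded (range (\<lambda>x. norm x ^ 0 *\<^sub>R ?g x))" "bounded (range (\<lambda>x. norm x ^ N *\<^sub>R ?g x))" by blast+
  then obtain A B where A: "\<And>x. cmod (?g x) \<le> A" and B: "\<And>x. norm x ^ N * cmod (?g x) \<le> B"
    unfolding bounded_iff by auto
  have "cmod (?g x) \<le> 2 ^ N * (A + B) * (1 / (1 + norm x) ^ N)" for x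
  proof -
    have "(1 + norm x) ^ N * cmod (?g x) \<le> (2 ^ N * (1 + norm x ^ N)) * cmod (?g x)"
      by (intro mult_right_mono one_plus_power_le) auto
    also have "\<dots> = 2 ^ N * (cmod (?g x) + norm x ^ N * cmod (?g x))" by (simp add: algebra_simps)
    also have "\<dots> \<le> 2 ^ N * (A + B)" using A B by (intro mult_left_mono add_mono) auto
    moreover have "(1 + norm x) ^ N > 0" by (simp add: add_pos_nonneg)
    ultimately show ?thesis by (simp add: field_simps)
  qed
  moreover have "2 ^ N * (A + B) \<ge> 0"
    using order_trans[OF norm_ge_zero A[of 0]] B[of 0] order_trans[OF _ B[of 0]] by simp
  ultimately show ?thesis by blast
qed

lemma schwartz_differentiable:
  "schwartz f \<Longrightarrow> bs \<in> lists Basis \<Longrightarrow> iterated_partial bs f differentiable at x"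
  by (auto simp: schwartz_def)

lemma schwartz_continuous:
  "schwartz f \<Longrightarrow> bs \<in> lists Basis \<Longrightarrow> continuous_on UNIV (iterated_partial bs f)"
  by (intro continuous_at_imp_continuous_on ballI differentiable_imp_continuous_within schwartz_differentiable)

lemma schwartz_partial_measurable:
  "schwartz f \<Longrightarrow> bs \<in> lists Basis \<Longrightarrow> iterated_partial bs f \<in> borel_measurable borel"
  by (intro borel_measurable_continuous_onI schwartz_continuous)

lemma schwartz_measurable: "schwartz f \<Longrightarrow> f \<in> borel_measurable borel"
  using schwartz_partial_measurable[of f "[]"] by simp

lemma iterated_partial_shift:
  assumes "schwartz f" "bs \<in> lists Basis"
  shows "iterated_partial bs (\<lambda>x. f (a + x)) = (\<lambda>x. iterated_partial bs f (a + x))"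
  using assms(2)
proof (induction bs rule: list.induct)
  case (Cons b bs)
  show ?case
  proof
    fix x
    have bs: "bs \<in> lists Basis" using Cons.prems by simp
    from Cons have eq: "iterated_partial bs (\<lambda>x. f (a + x)) = (\<lambda>x. iterated_partial bs f (a + x))" by simp
    have "(iterated_partial bs f has_derivative frechet_derivative (iterated_partial bs f) (at (a + x))) (at (a + x))"
      using schwartz_differentiable[OF assms(1) bs, of "a + x"] by (simp add: frechet_derivative_works)
    then have "((\<lambda>x. iterated_partial bs f (a + x)) has_derivative (\<lambda>h. frechet_derivative (iterated_partial bs f) (at (a + x)) h)) (at x)"
      by (rule has_derivative_compose[rotated]) (auto intro!: derivative_eq_intros)
    from frechet_derivative_at[OF this, symmetric]
    show "iterated_partial (b # bs) (\<lambda>x. f (a + x)) x = iterated_partial (b # bs) f (a + x)"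
      by (simp add: eq)
  qed
qed simp

lemma one_plus_norm_shift: "1 + norm x \<le> (1 + norm a) * (1 + norm (a + x))"
proof -
  have "norm x \<le> norm (a + x) + norm a" using norm_triangle_ineq4[of "a + x" a] by simp
  moreover have "0 \<le> norm a * norm (a + x)" by simp
  moreover have "(1 + norm a) * (1 + norm (a + x)) = 1 + norm a + norm (a + x) + norm a * norm (a + x)"
    by (simp add: algebra_simps)
  ultimately show ?thesis by linarith
qed

lemma schwartz_shift:
  assumes f: "schwartz f"
  shows "schwartz (\<lambda>x. f (a + x))"
  unfolding schwartz_def
proof (intro ballI conjI allI)
  fix bs :: "'a list" assume bs: "bs \<in> lists Basis"
  note eq = iterated_partial_shift[OF f bs, of a]
  show "iterated_partial bs (\<lambda>x. f (a + x)) differentiable at x" for x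
  proof -
    have "(iterated_partial bs f has_derivative frechet_derivative (iterated_partial bs f) (at (a + x))) (at (a + x))"
      using schwartz_differentiable[OF f bs, of "a + x"] by (simp add: frechet_derivative_works)
    then have "((\<lambda>x. iterated_partial bs f (a + x)) has_derivative (\<lambda>h. frechet_derivative (iterated_partial bs f) (at (a + x)) h)) (at x)"
      by (rule has_derivative_compose[rotated]) (auto intro!: derivative_eq_intros)
    then show ?thesis unfolding eq differentiable_def by blast
  qed
  fix k :: nat
  obtain C where C: "C \<ge> 0" "\<And>x. cmod (iterated_partial bs f x) \<le> C * (1 / (1 + norm x) ^ k)"
    using schwartz_decay[OF f bs] by blast
  have "norm (norm x ^ k *\<^sub>R iterated_partial bs (\<lambda>x. f (a + x)) x) \<le> (1 + norm a) ^ k * C" for x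
  proof -
    have "norm (norm x ^ k *\<^sub>R iterated_partial bs (\<lambda>x. f (a + x)) x) = norm x ^ k * cmod (iterated_partial bs f (a + x))"
      unfolding eq by simp
    also have "\<dots> \<le> ((1 + norm a) * (1 + norm (a + x))) ^ k * (C * (1 / (1 + norm (a + x)) ^ k))"
      using C one_plus_norm_shift[of x a] by (intro mult_mono power_mono) auto
    also have "\<dots> = (1 + norm a) ^ k * C"
    proof -
      have "1 + norm (a + x) \<noteq> 0" by (metis add_pos_nonneg less_irrefl norm_ge_zero zero_less_one)
      then show ?thesis by (simp add: power_mult_distrib)
    qed
    finally show ?thesis .
  qed
  then show "bounded (range (\<lambda>x. norm x ^ k *\<^sub>R iterated_partial bs (\<lambda>x. f (a + x)) x))"
    unfolding bounded_iff by blast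
qed

lemma integrable_decay:
  fixes f :: "'a::euclidean_space \<Rightarrow> complex"
  assumes "borel_fun f" "\<And>x. cmod (f x) \<le> C * (1 / (1 + norm x) ^ n)" "n \<ge> 2 * DIM('a)"
  shows "integrable lborel f"
proof (rule integrable_dominated[OF integrable_mult_right[OF integrable_inverse_1_plus_norm[OF assms(3)], of C]])
  show "AE x in lborel. norm (f x) \<le> norm (C * (1 / (1 + norm x) ^ n))"
    unfolding real_norm_def by (intro AE_I2 order_trans[OF assms(2) abs_ge_self])
qed (use assms(1) in simp)

lemma schwartz_integrable:
  fixes f :: "'a::euclidean_space \<Rightarrow> complex"
  assumes "schwartz f" "bs \<in> lists Basis"
  shows "integrable lborel (iterated_partial bs f)"
proof -
  obtain C where "\<And>x. cmod (iterated_partial bs f x) \<le> C * (1 / (1 + norm x) ^ (2 * DIM('a)))"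
    using schwartz_decay[OF assms] by blast
  then show ?thesis
    by (intro integrable_decay[of _ C "2 * DIM('a)"] schwartz_partial_measurable assms) auto
qed

lemma has_vector_derivative_sequentially:
  fixes f :: "real \<Rightarrow> 'b::real_normed_vector"
  assumes "(f has_vector_derivative D) (at 0)" and e: "filterlim e (at 0) sequentially"
  shows "(\<lambda>n. (f (e n) - f 0) /\<^sub>R e n) \<longlonglongrightarrow> D"
proof -
  have "((\<lambda>h. norm (f (0 + h) - f 0 - h *\<^sub>R D) / norm h) \<longlongrightarrow> 0) (at 0)"
    using assms(1) by (simp add: has_vector_derivative_def has_derivative_at)
  moreover have "\<forall>\<^sub>F h in at 0. norm (f (0 + h) - f 0 - h *\<^sub>R D) / norm h = norm ((f h - f 0) /\<^sub>R h - D)"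
    unfolding eventually_at_filter
  proof (intro always_eventually allI impI)
    fix h :: real assume h: "h \<noteq> 0"
    have "(f h - f 0) /\<^sub>R h - D = (f h - f 0 - h *\<^sub>R D) /\<^sub>R h"
      using h by (simp add: scaleR_diff_right)
    then show "norm (f (0 + h) - f 0 - h *\<^sub>R D) / norm h = norm ((f h - f 0) /\<^sub>R h - D)"
      by (simp add: divide_inverse mult.commute)
  qed
  ultimately have "((\<lambda>h. norm ((f h - f 0) /\<^sub>R h - D)) \<longlongrightarrow> 0) (at 0)"
    by (rule Lim_transform_eventually)
  then have "((\<lambda>h. (f h - f 0) /\<^sub>R h) \<longlongrightarrow> D) (at 0)"
    by (simp add: tendsto_norm_zero_iff LIM_zero_iff)
  then show ?thesis by (rule filterlim_compose[OF _ e])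
qed

text \<open>By translation, the transform of a difference quotient of f in the direction b is a
  multiple of \<open>FI f\<close>. The quotients are dominated by the mean value inequality: an
  intermediate point at distance at most 1 changes 1 + |x| by a factor of at most 2, which costs 2
  to the power of the decay rate.\<close>

lemma FI_directional_derivative:
  fixes f f' :: "'a::euclidean_space \<Rightarrow> complex"
  assumes b: "norm b = 1" and C: "C \<ge> 0"
    and deriv: "\<And>x t. ((\<lambda>t. f (x + t *\<^sub>R b)) has_vector_derivative f' (x + t *\<^sub>R b)) (at t)"
    and [measurable]: "borel_fun f" "borel_fun f'"
    and f: "\<And>x. cmod (f x) \<le> C * (1 / (1 + norm x) ^ (2 * DIM('a)))"
    and f': "\<And>x. cmod (f' x) \<le> C * (1 / (1 + norm x) ^ (2 * DIM('a)))"
  shows "FI f' \<xi> = - \<i> * of_real (\<xi> \<bullet> b) * FI f \<xi>"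
proof (rule LIMSEQ_unique)
  define e where "e n = 1 / real (Suc n)" for n
  have e0: "e n > 0" "e n \<le> 1" for n by (simp_all add: e_def)
  have elim: "e \<longlonglongrightarrow> 0" unfolding e_def by (rule LIMSEQ_Suc[OF lim_1_over_n])
  have elim': "filterlim e (at 0) sequentially"
    using elim e0 by (auto simp: filterlim_at less_imp_neq[THEN not_sym])
  have fi: "integrable lborel f" by (rule integrable_decay[OF _ f]) auto
  define g where "g n x = (f (x + e n *\<^sub>R b) - f x) / of_real (e n)" for n x
  have [measurable]: "borel_fun (g n)" for n unfolding g_def[abs_def] by measurable
  have bound: "cmod (g n x) \<le> 2 ^ (2 * DIM('a)) * C * (1 / (1 + norm x) ^ (2 * DIM('a)))" for n x
  proof -
    have "\<exists>s\<in>{0<..<e n}. norm (f (x + e n *\<^sub>R b) - f (x + 0 *\<^sub>R b)) \<le> norm ((e n - 0) *\<^sub>R f' (x + s *\<^sub>R b))"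
    proof (rule mvt_general)
      show "continuous_on {0..e n} (\<lambda>t. f (x + t *\<^sub>R b))"
        by (intro continuous_at_imp_continuous_on ballI) (rule has_vector_derivative_continuous[OF deriv])
      show "((\<lambda>t. f (x + t *\<^sub>R b)) has_derivative (\<lambda>y. y *\<^sub>R f' (x + t *\<^sub>R b))) (at t)" for t
        using deriv[of x t] by (simp add: has_vector_derivative_def)
    qed (use e0 in auto)
    then obtain s where s: "0 < s" "s < e n" "cmod (f (x + e n *\<^sub>R b) - f x) \<le> e n * cmod (f' (x + s *\<^sub>R b))"
      using e0[of n] by (auto simp: abs_of_pos)
    have "cmod (g n x) \<le> cmod (f' (x + s *\<^sub>R b))"
      using s(3) e0[of n] by (simp add: g_def norm_divide field_simps)
    also have "\<dots> \<le> C * (1 / (1 + norm (x + s *\<^sub>R b)) ^ (2 * DIM('a)))" by (rule f')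
    also have "C * (1 / (1 + norm (x + s *\<^sub>R b)) ^ (2 * DIM('a))) \<le> C * (2 ^ (2 * DIM('a)) * (1 / (1 + norm x) ^ (2 * DIM('a))))"
    proof (rule mult_left_mono[OF _ C])
      have "1 + norm x \<le> (1 + norm (s *\<^sub>R b)) * (1 + norm (s *\<^sub>R b + x))" by (rule one_plus_norm_shift)
      also have "\<dots> \<le> 2 * (1 + norm (x + s *\<^sub>R b))"
        using s e0[of n] b by (intro mult_mono) (auto simp: add.commute)
      finally have "(1 + norm x) ^ (2 * DIM('a)) \<le> (2 * (1 + norm (x + s *\<^sub>R b))) ^ (2 * DIM('a))"
        by (intro power_mono) auto
      then have "(1 + norm x) ^ (2 * DIM('a)) \<le> 2 ^ (2 * DIM('a)) * (1 + norm (x + s *\<^sub>R b)) ^ (2 * DIM('a))"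
        by (simp only: power_mult_distrib)
      moreover have "(1 + norm x) ^ (2 * DIM('a)) > 0" "(1 + norm (x + s *\<^sub>R b)) ^ (2 * DIM('a)) > 0"
        by (auto intro!: zero_less_power add_pos_nonneg)
      ultimately show "1 / (1 + norm (x + s *\<^sub>R b)) ^ (2 * DIM('a)) \<le> 2 ^ (2 * DIM('a)) * (1 / (1 + norm x) ^ (2 * DIM('a)))"
        by (simp add: divide_simps)
    qed
    finally show ?thesis by (simp add: mult_ac)
  qed
  show "(\<lambda>n. FI (g n) \<xi>) \<longlonglongrightarrow> FI f' \<xi>"
    unfolding FI_def
  proof (rule integral_dominated_convergence[where w="\<lambda>x. 2 ^ (2 * DIM('a)) * C * (1 / (1 + norm x) ^ (2 * DIM('a)))"])
    show "integrable lborel (\<lambda>x::'a. 2 ^ (2 * DIM('a)) * C * (1 / (1 + norm x) ^ (2 * DIM('a))))"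
      by (intro integrable_mult_right integrable_inverse_1_plus_norm) simp
    show "AE x in lborel. norm (iexp (x \<bullet> \<xi>) * g n x) \<le> 2 ^ (2 * DIM('a)) * C * (1 / (1 + norm x) ^ (2 * DIM('a)))" for n
      using bound by (intro AE_I2) (simp add: norm_mult)
    show "AE x in lborel. (\<lambda>n. iexp (x \<bullet> \<xi>) * g n x) \<longlonglongrightarrow> iexp (x \<bullet> \<xi>) * f' x"
    proof (intro AE_I2 tendsto_mult tendsto_const)
      fix x
      have "((\<lambda>t. f (x + t *\<^sub>R b)) has_vector_derivative f' x) (at 0)" using deriv[of x 0] by simp
      from has_vector_derivative_sequentially[OF this elim'] have "(\<lambda>n. (f (x + e n *\<^sub>R b) - f x) /\<^sub>R e n) \<longlonglongrightarrow> f' x"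
        by simp
      then show "(\<lambda>n. g n x) \<longlonglongrightarrow> f' x"
        by (simp add: g_def scaleR_conv_of_real divide_inverse mult.commute)
    qed
  qed simp_all
  have FIg: "FI (g n) \<xi> = ((iexp (- e n * (\<xi> \<bullet> b)) - 1) / of_real (e n)) * FI f \<xi>" for n
  proof -
    have sh: "integrable lborel (\<lambda>x. iexp (x \<bullet> \<xi>) * f (x + e n *\<^sub>R b))"
      using FI_integrand_integrable[OF integrable_lborel_shift[OF fi, of "e n *\<^sub>R b"], of \<xi>] by (simp add: add.commute)
    have "(LB x. iexp (x \<bullet> \<xi>) * f (x + e n *\<^sub>R b)) = (LB x. iexp ((e n *\<^sub>R b + x) \<bullet> \<xi> - e n * (\<xi> \<bullet> b)) * f (e n *\<^sub>R b + x))"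
    proof -
      have "(e n *\<^sub>R b + x) \<bullet> \<xi> - e n * (\<xi> \<bullet> b) = x \<bullet> \<xi>" for x
        by (simp add: inner_add_left inner_commute[of b])
      then show ?thesis by (simp add: add.commute)
    qed
    also have "\<dots> = (LB x. iexp (x \<bullet> \<xi> - e n * (\<xi> \<bullet> b)) * f x)"
      by (rule integral_lborel_shift) simp
    also have "\<dots> = (LB x. iexp (- e n * (\<xi> \<bullet> b)) * (iexp (x \<bullet> \<xi>) * f x))"
      by (simp add: mult.assoc[symmetric] exp_add[symmetric] right_diff_distrib)
    also have "\<dots> = iexp (- e n * (\<xi> \<bullet> b)) * FI f \<xi>" unfolding FI_def by (rule integral_mult_right_zero)
    finally have s: "(LB x. iexp (x \<bullet> \<xi>) * f (x + e n *\<^sub>R b)) = iexp (- e n * (\<xi> \<bullet> b)) * FI f \<xi>" .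
    have "FI (g n) \<xi> = (LB x. (iexp (x \<bullet> \<xi>) * f (x + e n *\<^sub>R b) - iexp (x \<bullet> \<xi>) * f x) / of_real (e n))"
      unfolding FI_def g_def by (simp add: right_diff_distrib)
    also have "\<dots> = (LB x. iexp (x \<bullet> \<xi>) * f (x + e n *\<^sub>R b) - iexp (x \<bullet> \<xi>) * f x) / of_real (e n)"
      by simp
    also have "(LB x. iexp (x \<bullet> \<xi>) * f (x + e n *\<^sub>R b) - iexp (x \<bullet> \<xi>) * f x) = iexp (- e n * (\<xi> \<bullet> b)) * FI f \<xi> - FI f \<xi>"
      unfolding s[symmetric] unfolding FI_def by (rule Bochner_Integration.integral_diff[OF sh FI_integrand_integrable[OF fi]])
    finally show ?thesis by (simp add: algebra_simps diff_divide_distrib)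
  qed
  have "((iexp \<circ> (\<lambda>t. - t * (\<xi> \<bullet> b))) has_vector_derivative (- (\<xi> \<bullet> b)) *\<^sub>R (\<i> * iexp (- 0 * (\<xi> \<bullet> b)))) (at 0)"
    by (rule vector_diff_chain_at) (auto intro!: derivative_eq_intros)
  from has_vector_derivative_sequentially[OF this elim'] have "(\<lambda>n. (iexp (- e n * (\<xi> \<bullet> b)) - 1) / of_real (e n)) \<longlonglongrightarrow> - \<i> * of_real (\<xi> \<bullet> b)"
    by (simp add: scaleR_conv_of_real divide_inverse mult_ac)
  then show "(\<lambda>n. FI (g n) \<xi>) \<longlonglongrightarrow> - \<i> * of_real (\<xi> \<bullet> b) * FI f \<xi>"
    unfolding FIg by (intro tendsto_mult tendsto_const)
qed

lemma schwartz_directional_derivative: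
  assumes f: "schwartz f" and bs: "bs \<in> lists Basis"
  shows "((\<lambda>t. iterated_partial bs f (x + t *\<^sub>R b)) has_vector_derivative iterated_partial (b # bs) f (x + t *\<^sub>R b)) (at t)"
proof -
  let ?D = "frechet_derivative (iterated_partial bs f) (at (x + t *\<^sub>R b))"
  have D: "(iterated_partial bs f has_derivative ?D) (at (x + t *\<^sub>R b))"
    using schwartz_differentiable[OF f bs] by (simp add: frechet_derivative_works)
  have "((\<lambda>t. x + t *\<^sub>R b) has_derivative (\<lambda>h. h *\<^sub>R b)) (at t)"
    by (auto intro!: derivative_eq_intros)
  from has_derivative_compose[OF this D]
  have "((\<lambda>t. iterated_partial bs f (x + t *\<^sub>R b)) has_derivative (\<lambda>h. ?D (h *\<^sub>R b))) (at t)" .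
  then show ?thesis
    unfolding has_vector_derivative_def
    by (simp add: linear_scale[OF has_derivative_linear[OF D]])
qed

lemma FI_iterated_partial:
  fixes f :: "'a::euclidean_space \<Rightarrow> complex"
  assumes f: "schwartz f" and b: "b \<in> Basis"
  shows "FI (iterated_partial (replicate n b) f) \<xi> = (- \<i> * of_real (\<xi> \<bullet> b)) ^ n * FI f \<xi>"
proof (induction n)
  case (Suc n)
  have l: "replicate m b \<in> lists Basis" for m using b by (induction m) auto
  obtain C where C: "C \<ge> 0" "\<And>x. cmod (iterated_partial (replicate n b) f x) \<le> C * (1 / (1 + norm x) ^ (2 * DIM('a)))"
    using schwartz_decay[OF f l] by blast
  obtain D where D: "D \<ge> 0" "\<And>x. cmod (iterated_partial (replicate (Suc n) b) f x) \<le> D * (1 / (1 + norm x) ^ (2 * DIM('a)))"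
    using schwartz_decay[OF f l] by blast
  have mono: "C * (1 / (1 + norm x) ^ (2 * DIM('a))) \<le> (C + D) * (1 / (1 + norm x) ^ (2 * DIM('a)))"
    "D * (1 / (1 + norm x) ^ (2 * DIM('a))) \<le> (C + D) * (1 / (1 + norm x) ^ (2 * DIM('a)))" for x :: 'a
    using C(1) D(1) by (intro mult_right_mono; simp)+
  have "FI (iterated_partial (replicate (Suc n) b) f) \<xi> = - \<i> * of_real (\<xi> \<bullet> b) * FI (iterated_partial (replicate n b) f) \<xi>"
  proof (rule FI_directional_derivative)
    show "norm b = 1" using b by simp
    show "C + D \<ge> 0" using C(1) D(1) by simp
    show "((\<lambda>t. iterated_partial (replicate n b) f (x + t *\<^sub>R b)) has_vector_derivative iterated_partial (replicate (Suc n) b) f (x + t *\<^sub>R b)) (at t)" for x t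
      using schwartz_directional_derivative[OF f l, of n x b t] by simp
    show "cmod (iterated_partial (replicate n b) f x) \<le> (C + D) * (1 / (1 + norm x) ^ (2 * DIM('a)))" for x
      by (rule order_trans[OF C(2) mono(1)])
    show "cmod (iterated_partial (replicate (Suc n) b) f x) \<le> (C + D) * (1 / (1 + norm x) ^ (2 * DIM('a)))" for x
      by (rule order_trans[OF D(2) mono(2)])
  qed (intro schwartz_partial_measurable[OF f] l)+
  then show ?case by (simp add: Suc.IH)
qed simp

text \<open>Some coordinate of xi has modulus at least |xi|/d, and the N-fold partial derivative in
  that coordinate multiplies \<open>FI f\<close> by its N-th power up to a unimodular factor. So
  repeated derivatives in one coordinate direction suffice.\<close>

lemma schwartz_FI_decay:
  fixes f :: "'a::euclidean_space \<Rightarrow> complex"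
  assumes f: "schwartz f"
  shows "\<exists>C\<ge>0. \<forall>\<xi>. cmod (FI f \<xi>) \<le> C * (1 / (1 + norm \<xi>) ^ N)"
proof -
  define K where "K b = (LB x. cmod (iterated_partial (replicate N b) f x))" for b
  have K0: "K b \<ge> 0" for b unfolding K_def by (simp add: integral_nonneg_AE)
  have Kb: "\<bar>\<xi> \<bullet> b\<bar> ^ N * cmod (FI f \<xi>) \<le> K b" if b: "b \<in> Basis" for b \<xi>
  proof -
    have l: "replicate N b \<in> lists Basis" using b by (induction N) auto
    have "cmod (FI (iterated_partial (replicate N b) f) \<xi>) \<le> K b"
      unfolding K_def by (rule norm_FI_le[OF schwartz_integrable[OF f l]])
    then show ?thesis unfolding FI_iterated_partial[OF f b] by (simp add: norm_mult norm_power)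
  qed
  define K' where "K' = DIM('a) ^ N * (\<Sum>b\<in>Basis. K b)"
  have N: "norm \<xi> ^ N * cmod (FI f \<xi>) \<le> K'" for \<xi>
  proof -
    have "\<exists>b\<in>Basis. norm \<xi> \<le> DIM('a) * \<bar>\<xi> \<bullet> b\<bar>"
    proof (rule ccontr)
      assume "\<not> ?thesis"
      then have "(\<Sum>b\<in>Basis. \<bar>\<xi> \<bullet> b\<bar>) < (\<Sum>b\<in>(Basis::'a set). norm \<xi> / DIM('a))"
        by (intro sum_strict_mono) (auto simp: field_simps)
      also have "\<dots> = norm \<xi>" by simp
      finally show False using norm_le_l1[of \<xi>] by simp
    qed
    then obtain b where b: "b \<in> Basis" "norm \<xi> \<le> DIM('a) * \<bar>\<xi> \<bullet> b\<bar>" by blast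
    have "norm \<xi> ^ N * cmod (FI f \<xi>) \<le> (DIM('a) * \<bar>\<xi> \<bullet> b\<bar>) ^ N * cmod (FI f \<xi>)"
      using b by (intro mult_right_mono power_mono) auto
    also have "\<dots> = DIM('a) ^ N * (\<bar>\<xi> \<bullet> b\<bar> ^ N * cmod (FI f \<xi>))" by (simp add: power_mult_distrib)
    also have "\<dots> \<le> DIM('a) ^ N * K b" using Kb[OF b(1)] by (intro mult_left_mono) auto
    also have "\<dots> \<le> K'"
      unfolding K'_def using b(1) K0 by (intro mult_left_mono member_le_sum) auto
    finally show ?thesis .
  qed
  define A where "A = (LB x. cmod (f x))"
  have A: "cmod (FI f \<xi>) \<le> A" for \<xi>
    unfolding A_def using schwartz_integrable[OF f, of "[]"] by (intro norm_FI_le) simp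
  have "cmod (FI f \<xi>) \<le> 2 ^ N * (A + K') * (1 / (1 + norm \<xi>) ^ N)" for \<xi>
  proof -
    have "(1 + norm \<xi>) ^ N * cmod (FI f \<xi>) \<le> (2 ^ N * (1 + norm \<xi> ^ N)) * cmod (FI f \<xi>)"
      by (intro mult_right_mono one_plus_power_le) auto
    also have "\<dots> = 2 ^ N * (cmod (FI f \<xi>) + norm \<xi> ^ N * cmod (FI f \<xi>))" by (simp add: algebra_simps)
    also have "\<dots> \<le> 2 ^ N * (A + K')" using A N by (intro mult_left_mono add_mono) auto
    moreover have "(1 + norm \<xi>) ^ N > 0" by (simp add: add_pos_nonneg)
    ultimately show ?thesis by (simp add: field_simps)
  qed
  moreover have "2 ^ N * (A + K') \<ge> 0"
    unfolding A_def K'_def using K0 by (intro mult_nonneg_nonneg add_nonneg_nonneg) (auto simp: sum_nonneg integral_nonneg_AE)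
  ultimately show ?thesis by blast
qed

lemma schwartz_FI_integrable:
  fixes f :: "'a::euclidean_space \<Rightarrow> complex"
  assumes f: "schwartz f"
  shows "integrable lborel (FI f)"
proof -
  obtain C where "\<And>\<xi>. cmod (FI f \<xi>) \<le> C * (1 / (1 + norm \<xi>) ^ (2 * DIM('a)))"
    using schwartz_FI_decay[OF f] by blast
  then show ?thesis using schwartz_measurable[OF f] by (intro integrable_decay[of _ C "2 * DIM('a)"]) auto
qed

lemma schwartz_integrable0: "schwartz f \<Longrightarrow> integrable lborel f"
  using schwartz_integrable[of f "[]"] by simp

lemma schwartz_continuous0: "schwartz f \<Longrightarrow> continuous_on UNIV f"
  using schwartz_continuous[of f "[]"] by simp

lemma schwartz_bounded: "schwartz f \<Longrightarrow> \<exists>B\<ge>0. \<forall>x. cmod (f x) \<le> B"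
  using schwartz_decay[of f "[]" 0] by auto

lemma FI_reflect:
  assumes [measurable]: "borel_fun g"
  shows "FI (\<lambda>y. g (- y)) x = fourier_integral g x"
proof -
  have "FI (\<lambda>y. g (- y)) x = (LB y. iexp ((- y) \<bullet> (- x)) * g (- y))"
    by (simp add: FI_def)
  also have "\<dots> = (LB y. iexp (y \<bullet> (- x)) * g y)"
    by (rule integral_lborel_uminus[of "\<lambda>y. iexp (y \<bullet> (- x)) * g y"]) measurable
  finally show ?thesis by (simp add: fourier_integral_FI FI_def)
qed

lemma fourier_integral_inversion:
  fixes f :: "'a::euclidean_space \<Rightarrow> complex"
  assumes "continuous_on UNIV f" "\<And>x. cmod (f x) \<le> B" "integrable lborel f" "integrable lborel (FI f)"
  shows "FI (fourier_integral f) x = of_real ((2 * pi) ^ DIM('a)) * f x"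
proof -
  have m: "borel_fun (FI f)" using assms(4) by auto
  have "FI (fourier_integral f) x = fourier_integral (FI f) x"
    using FI_reflect[OF m] unfolding fourier_integral_FI[abs_def] by simp
  also have "\<dots> = FI (FI f) (- x)" by (rule fourier_integral_FI)
  also have "\<dots> = of_real ((2 * pi) ^ DIM('a)) * f x" by (rule FI_inversion[OF assms])
  finally show ?thesis .
qed

lemma schwartz_fourier_inversion:
  fixes f :: "'a::euclidean_space \<Rightarrow> complex"
  assumes f: "schwartz f"
  shows "FI (fourier_integral f) x = of_real ((2 * pi) ^ DIM('a)) * f x"
proof -
  obtain B where B: "\<And>x. cmod (f x) \<le> B" using schwartz_bounded[OF f] by blast
  show ?thesis
    by (rule fourier_integral_inversion[OF schwartz_continuous0[OF f] B schwartz_integrable0[OF f] schwartz_FI_integrable[OF f]])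
qed

lemma schwartz_gauss_shift: "c > 0 \<Longrightarrow> schwartz (\<lambda>x. complex_of_real (gauss c (x - a)))"
  using schwartz_shift[OF schwartz_wave_packet[of c 0], of "- a"] by (simp add: wave_packet_def)

lemma fourier_integral_wave_packet:
  fixes k :: "'a::euclidean_space"
  assumes c: "c > 0"
  shows "fourier_integral (wave_packet c k) x = of_real (sqrt (2 * pi / c) ^ DIM('a) * gauss (1 / c) (x - k))"
proof -
  have "fourier_integral (wave_packet c k) x = (LB y. iexp (y \<bullet> (k - x)) * of_real (gauss c y))"
    unfolding fourier_integral_def wave_packet_def
    by (simp add: mult.assoc[symmetric] exp_add[symmetric] inner_diff_right right_diff_distrib)
  also have "\<dots> = of_real (sqrt (2 * pi / c) ^ DIM('a) * gauss (1 / c) (k - x))"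
    by (rule gauss_integral[OF c])
  also have "gauss (1 / c) (k - x) = gauss (1 / c) (x - k)"
    by (metis gauss_minus minus_diff_eq)
  finally show ?thesis .
qed

text \<open>The product h of g with a fixed Gaussian is integrable. Since a product of two Gaussians
  is a multiple of a Gaussian, the tests of h that \<open>AE_zero_if_gauss_integral_zero\<close>
  asks for are tests of g.\<close>

lemma AE_zero_if_gauss_tests:
  fixes g :: "'a::euclidean_space \<Rightarrow> complex"
  assumes [measurable]: "borel_fun g"
    and i: "\<And>c a. c > 0 \<Longrightarrow> integrable lborel (\<lambda>x. g x * of_real (gauss c (x - a)))"
    and z: "\<And>c a. c > 0 \<Longrightarrow> (LB x. g x * of_real (gauss c (x - a))) = 0"
  shows "AE x in lborel. g x = 0"
proof -
  define h where "h x = g x * of_real (gauss 1 x)" for x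
  have "AE x in lborel. h x = 0"
  proof (rule AE_zero_if_gauss_integral_zero)
    show "integrable lborel h" using i[of 1 0] by (simp add: h_def[abs_def])
    fix x :: 'a and e :: real assume e: "e > 0"
    define c where "c = 1 / e\<^sup>2"
    have c: "c > 0" using e by (simp add: c_def)
    \<comment> \<open>Completing the square in |y|^2 + c |y - x|^2 gives the centre m and the factor
      K of the product.\<close>
    define m where "m = (c / (1 + c)) *\<^sub>R x"
    define K where "K = exp (- ((c * (norm x)\<^sup>2 - c\<^sup>2 * (norm x)\<^sup>2 / (1 + c)) / 2))"
    have eq: "gauss 1 y * gauss c (y - x) = K * gauss (1 + c) (y - m)" for y
    proof -
      have "(1 + c) * (norm (y - m))\<^sup>2 = (1 + c) * (norm y)\<^sup>2 - 2 * c * (y \<bullet> x) + c\<^sup>2 * (norm x)\<^sup>2 / (1 + c)"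
      proof -
        have n1: "(norm (y - m))\<^sup>2 = (norm y)\<^sup>2 - 2 * (c / (1 + c)) * (y \<bullet> x) + (c / (1 + c))\<^sup>2 * (norm x)\<^sup>2"
          unfolding m_def power2_norm_eq_inner
          by (simp add: inner_diff_left inner_diff_right inner_commute power2_eq_square)
        have n2: "(1 + c) * (N - 2 * u * t + u\<^sup>2 * X) = (1 + c) * N - 2 * ((1 + c) * u) * t + ((1 + c) * u) * u * X" for N u t X
          by (simp add: algebra_simps power2_eq_square)
        have n3: "(1 + c) * (c / (1 + c)) = c" using c by simp
        show ?thesis unfolding n1 n2 n3 by (simp add: power2_eq_square)
      qed
      moreover have "(norm (y - x))\<^sup>2 = (norm y)\<^sup>2 - 2 * (y \<bullet> x) + (norm x)\<^sup>2"
        unfolding power2_norm_eq_inner by (simp add: inner_diff_left inner_diff_right inner_commute)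
      ultimately have "1 * (norm y)\<^sup>2 / 2 + c * (norm (y - x))\<^sup>2 / 2
        = (c * (norm x)\<^sup>2 - c\<^sup>2 * (norm x)\<^sup>2 / (1 + c)) / 2 + (1 + c) * (norm (y - m))\<^sup>2 / 2"
      proof -
        have "1 * N / 2 + c * B / 2 = (c * X - Z) / 2 + A / 2"
          if "A = (1 + c) * N - 2 * c * t + Z" "B = N - 2 * t + X" for A B N X Z t
          unfolding that by (simp add: field_simps)
        then show "(1 + c) * (norm (y - m))\<^sup>2 = (1 + c) * (norm y)\<^sup>2 - 2 * c * (y \<bullet> x) + c\<^sup>2 * (norm x)\<^sup>2 / (1 + c) \<Longrightarrow>
          (norm (y - x))\<^sup>2 = (norm y)\<^sup>2 - 2 * (y \<bullet> x) + (norm x)\<^sup>2 \<Longrightarrow> ?thesis" .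
      qed
      then have "- (1 * (norm y)\<^sup>2 / 2) + - (c * (norm (y - x))\<^sup>2 / 2)
        = - ((c * (norm x)\<^sup>2 - c\<^sup>2 * (norm x)\<^sup>2 / (1 + c)) / 2) + - ((1 + c) * (norm (y - m))\<^sup>2 / 2)"
        by linarith
      then show ?thesis unfolding gauss_def K_def exp_add[symmetric] by (rule arg_cong)
    qed
    have "(LB y. h y * of_real (gauss (1 / e\<^sup>2) (y - x))) = (LB y. of_real K * (g y * of_real (gauss (1 + c) (y - m))))" (is "(LB y. ?f y) = (LB y. ?g y)")
    proof (rule LB_cong)
      fix y
      have "?f y = g y * of_real (gauss 1 y * gauss c (y - x))"
        by (simp add: h_def c_def)
      also have "\<dots> = ?g y" unfolding eq by simp
      finally show "?f y = ?g y" .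
    qed
    also have "\<dots> = of_real K * (LB y. (g y * of_real (gauss (1 + c) (y - m))))"
      by (rule integral_mult_right_zero)
    also have "\<dots> = 0" using z[of "1 + c" m] c by simp
    finally show "(LB y. h y * of_real (gauss (1 / e\<^sup>2) (y - x))) = 0" .
  qed
  then show ?thesis
  proof eventually_elim
    case (elim x)
    have "gauss 1 x \<noteq> 0" using gauss_pos(1)[of 1 x] by (simp add: less_imp_neq[THEN not_sym])
    then show ?case using elim by (simp add: h_def)
  qed
qed

section \<open>The Fourier transform in the sense of distributions\<close>

lemma is_fourier_transformD:
  assumes "is_fourier_transform f g"
  shows "borel_fun f" "borel_fun g"
    "schwartz \<psi> \<Longrightarrow> integrable lborel (\<lambda>\<xi>. g \<xi> * \<psi> \<xi>)"
    "schwartz \<psi> \<Longrightarrow> integrable lborel (\<lambda>x. f x * fourier_integral \<psi> x)"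
    "schwartz \<psi> \<Longrightarrow> (LB \<xi>. g \<xi> * \<psi> \<xi>) = (LB x. f x * fourier_integral \<psi> x)"
  using assms unfolding is_fourier_transform_def by auto

lemma is_fourier_transform_unique:
  assumes g: "is_fourier_transform f g" and g': "is_fourier_transform f g'"
  shows "AE \<xi> in lborel. g \<xi> = g' \<xi>"
proof -
  note g1 = is_fourier_transformD[OF g] and g2 = is_fourier_transformD[OF g']
  note [measurable] = g1(2) g2(2)
  have "AE \<xi> in lborel. g \<xi> - g' \<xi> = 0"
  proof (rule AE_zero_if_gauss_tests)
    fix c :: real and a :: 'a assume c: "c > 0"
    note sch = schwartz_gauss_shift[OF c, of a]
    show "integrable lborel (\<lambda>x. (g x - g' x) * of_real (gauss c (x - a)))"
      unfolding left_diff_distrib by (intro Bochner_Integration.integrable_diff g1(3) g2(3) sch)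
    show "(LB x. (g x - g' x) * of_real (gauss c (x - a))) = 0"
      unfolding left_diff_distrib
      by (subst Bochner_Integration.integral_diff[OF g1(3)[OF sch] g2(3)[OF sch]]) (simp only: g1(5)[OF sch] g2(5)[OF sch] diff_self)
  qed simp
  then show ?thesis by simp
qed

text \<open>Every translated Gaussian is a multiple of the Fourier transform of a wave packet, so
  the defining identity tests f - f' against all of them.\<close>

lemma is_fourier_transform_inverse_unique:
  assumes g: "is_fourier_transform f g" and g': "is_fourier_transform f' g"
  shows "AE x in lborel. f x = f' x"
proof -
  note g1 = is_fourier_transformD[OF g] and g2 = is_fourier_transformD[OF g']
  note [measurable] = g1(1) g2(1)
  have "AE x in lborel. f x - f' x = 0"
  proof (rule AE_zero_if_gauss_tests)
    fix c :: real and a :: 'a assume c: "c > 0"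
    then have c': "1 / c > 0" by simp
    note sch = schwartz_wave_packet[OF c', of a]
    define K where "K = complex_of_real (sqrt (2 * pi / (1 / c)) ^ DIM('a))"
    have K: "K \<noteq> 0" using c by (simp add: K_def)
    have eq: "(f x - f' x) * of_real (gauss c (x - a)) = (f x * fourier_integral (wave_packet (1 / c) a) x - f' x * fourier_integral (wave_packet (1 / c) a) x) / K" for x
      using K c unfolding fourier_integral_wave_packet[OF c'] by (simp add: K_def field_simps)
    show "integrable lborel (\<lambda>x. (f x - f' x) * of_real (gauss c (x - a)))"
      unfolding eq by (intro integrable_divide_zero Bochner_Integration.integrable_diff g1(4) g2(4) sch)
    show "(LB x. (f x - f' x) * of_real (gauss c (x - a))) = 0"
      unfolding eq integral_divide_zero
      by (subst Bochner_Integration.integral_diff[OF g1(4)[OF sch] g2(4)[OF sch]])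
         (simp only: g1(5)[OF sch, symmetric] g2(5)[OF sch, symmetric] diff_self div_0)
  qed simp
  then show ?thesis by simp
qed

lemma is_fourier_transform_cong_AE:
  assumes g: "is_fourier_transform f g" and [measurable]: "borel_fun f'" "borel_fun g'"
    and f': "AE x in lborel. f x = f' x" and g': "AE x in lborel. g x = g' x"
  shows "is_fourier_transform f' g'"
  unfolding is_fourier_transform_def
proof (intro conjI allI impI assms(2,3))
  fix \<psi> :: "'a \<Rightarrow> complex" assume s: "schwartz \<psi>"
  note g1 = is_fourier_transformD[OF g]
  note [measurable] = g1(1,2) schwartz_measurable[OF s]
  have [measurable]: "fourier_integral \<psi> \<in> borel_measurable borel"
    unfolding fourier_integral_FI[abs_def] by measurable
  have 1: "AE \<xi> in lborel. g \<xi> * \<psi> \<xi> = g' \<xi> * \<psi> \<xi>" using g' by auto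
  have 2: "AE x in lborel. f x * fourier_integral \<psi> x = f' x * fourier_integral \<psi> x" using f' by auto
  show "integrable lborel (\<lambda>\<xi>. g' \<xi> * \<psi> \<xi>)"
    using g1(3)[OF s] by (subst integrable_cong_AE[of _ _ "\<lambda>\<xi>. g \<xi> * \<psi> \<xi>"]) (use 1 in auto)
  show "integrable lborel (\<lambda>x. f' x * fourier_integral \<psi> x)"
    using g1(4)[OF s] by (subst integrable_cong_AE[of _ _ "\<lambda>x. f x * fourier_integral \<psi> x"]) (use 2 in auto)
  have "(LB \<xi>. g' \<xi> * \<psi> \<xi>) = (LB \<xi>. g \<xi> * \<psi> \<xi>)"
    by (rule integral_cong_AE) (use 1 in auto)
  also have "\<dots> = (LB x. f x * fourier_integral \<psi> x)" by (rule g1(5)[OF s])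
  also have "\<dots> = (LB x. f' x * fourier_integral \<psi> x)"
    by (rule integral_cong_AE) (use 2 in auto)
  finally show "(LB \<xi>. g' \<xi> * \<psi> \<xi>) = (LB x. f' x * fourier_integral \<psi> x)" .
qed

lemma is_fourier_transform_add_scale:
  assumes g: "is_fourier_transform f g" and g': "is_fourier_transform f' g'"
  shows "is_fourier_transform (\<lambda>x. f x + c * f' x) (\<lambda>\<xi>. g \<xi> + c * g' \<xi>)"
  unfolding is_fourier_transform_def
proof (intro conjI allI impI)
  note g1 = is_fourier_transformD[OF g] and g2 = is_fourier_transformD[OF g']
  note [measurable] = g1(1,2) g2(1,2)
  show "borel_fun (\<lambda>x. f x + c * f' x)" "borel_fun (\<lambda>\<xi>. g \<xi> + c * g' \<xi>)" by measurable
  fix \<psi> :: "'a \<Rightarrow> complex" assume s: "schwartz \<psi>"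
  show "integrable lborel (\<lambda>\<xi>. (g \<xi> + c * g' \<xi>) * \<psi> \<xi>)" "integrable lborel (\<lambda>x. (f x + c * f' x) * fourier_integral \<psi> x)"
    unfolding distrib_right mult.assoc
    by (intro Bochner_Integration.integrable_add integrable_mult_right g1 g2 s)+
  show "(LB \<xi>. (g \<xi> + c * g' \<xi>) * \<psi> \<xi>) = (LB x. (f x + c * f' x) * fourier_integral \<psi> x)"
    unfolding distrib_right mult.assoc
    by (subst (1 2) Bochner_Integration.integral_add)
       (simp_all add: g1(3-5)[OF s] g2(3-5)[OF s])
qed

lemma is_fourier_transform_modulate:
  assumes g: "is_fourier_transform f g"
  shows "is_fourier_transform (\<lambda>x. iexp (x \<bullet> a) * f x) (\<lambda>\<xi>. g (\<xi> - a))"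
  unfolding is_fourier_transform_def
proof (intro conjI allI impI)
  note g1 = is_fourier_transformD[OF g]
  note [measurable] = g1(1,2)
  show "borel_fun (\<lambda>x. iexp (x \<bullet> a) * f x)" "borel_fun (\<lambda>\<xi>. g (\<xi> - a))" by measurable
  fix \<psi> :: "'a \<Rightarrow> complex" assume s: "schwartz \<psi>"
  note [measurable] = schwartz_measurable[OF s]
  define \<psi>' where "\<psi>' x = \<psi> (a + x)" for x
  have s': "schwartz \<psi>'" unfolding \<psi>'_def[abs_def] by (rule schwartz_shift[OF s])
  have ft: "fourier_integral \<psi>' x = iexp (x \<bullet> a) * fourier_integral \<psi> x" for x
  proof -
    have "fourier_integral \<psi>' x = (LB y. iexp (x \<bullet> a) * (exp (- (\<i> * of_real ((a + y) \<bullet> x))) * \<psi> (a + y)))"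
      unfolding fourier_integral_def \<psi>'_def
      by (simp add: mult.assoc[symmetric] exp_add[symmetric] inner_add_left inner_commute[of a x] algebra_simps)
    also have "\<dots> = iexp (x \<bullet> a) * (LB y. exp (- (\<i> * of_real ((a + y) \<bullet> x))) * \<psi> (a + y))"
      by (rule integral_mult_right_zero)
    also have "(LB y. exp (- (\<i> * of_real ((a + y) \<bullet> x))) * \<psi> (a + y)) = fourier_integral \<psi> x"
      unfolding fourier_integral_def by (rule integral_lborel_shift) simp
    finally show ?thesis .
  qed
  have eq: "g (\<xi> - a) * \<psi> \<xi> = g (- a + \<xi>) * \<psi>' (- a + \<xi>)" for \<xi> by (simp add: \<psi>'_def)
  have eq': "iexp (x \<bullet> a) * f x * fourier_integral \<psi> x = f x * fourier_integral \<psi>' x" for x by (simp add: ft)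
  show "integrable lborel (\<lambda>\<xi>. g (\<xi> - a) * \<psi> \<xi>)"
    unfolding eq using integrable_lborel_shift[OF g1(3)[OF s'], of "- a"] .
  show "integrable lborel (\<lambda>x. iexp (x \<bullet> a) * f x * fourier_integral \<psi> x)"
    unfolding eq' by (rule g1(4)[OF s'])
  have "(LB \<xi>. g (\<xi> - a) * \<psi> \<xi>) = (LB \<xi>. g \<xi> * \<psi>' \<xi>)"
    unfolding eq using schwartz_measurable[OF s'] by (intro integral_lborel_shift) simp
  then show "(LB \<xi>. g (\<xi> - a) * \<psi> \<xi>) = (LB x. iexp (x \<bullet> a) * f x * fourier_integral \<psi> x)"
    unfolding eq' g1(5)[OF s'] .
qed

lemma in_L2_iff: "in_L2 f \<longleftrightarrow> f \<in> borel_measurable borel \<and> (L2sq f) < \<infinity>"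
  unfolding in_L2_def integrable_iff_bounded by auto

lemma in_L2_nn_integral:
  "in_L2 f \<Longrightarrow> (L2sq f) = ennreal (LB x. nsq (f x))"
  unfolding in_L2_def by (intro nn_integral_eq_integral) auto

lemma in_L2_mult_integrable:
  assumes "in_L2 f" "in_L2 g"
  shows "integrable lborel (\<lambda>x. f x * g x)"
proof (rule integrable_dominated)
  show "integrable lborel (\<lambda>x. nsq (f x) + nsq (g x))"
    using assms unfolding in_L2_def by (intro Bochner_Integration.integrable_add) auto
  show "(\<lambda>x. f x * g x) \<in> borel_measurable lborel" using assms unfolding in_L2_def by auto
  show "AE x in lborel. norm (f x * g x) \<le> norm (nsq (f x) + nsq (g x))" (is "AE x in _. ?P x")
  proof (rule AE_I2)
    fix x
    have "2 * (cmod (f x) * cmod (g x)) \<le> nsq (f x) + nsq (g x)"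
      using sum_squares_bound[of "cmod (f x)" "cmod (g x)"] by (simp add: mult.assoc)
    moreover have "0 \<le> cmod (f x) * cmod (g x)" by simp
    ultimately have "cmod (f x) * cmod (g x) \<le> nsq (f x) + nsq (g x)" by linarith
    then show "?P x" by (simp add: norm_mult)
  qed
qed

lemma in_L2_bounded_integrable:
  assumes "integrable lborel f" "\<And>x. cmod (f x) \<le> B"
  shows "in_L2 f"
  unfolding in_L2_def
proof
  show [measurable]: "borel_fun f" using assms(1) by auto
  show "integrable lborel (\<lambda>x. nsq (f x))"
  proof (rule integrable_dominated[OF integrable_mult_right[OF integrable_norm[OF assms(1)], of B]])
    show "AE x in lborel. norm (nsq (f x)) \<le> norm (B * norm (f x))" (is "AE x in _. ?P x")
    proof (rule AE_I2)
      fix x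
      have "nsq (f x) \<le> B * cmod (f x)"
        unfolding power2_eq_square by (intro mult_right_mono assms) simp
      then show "?P x" by (simp add: abs_mult) (smt (verit) mult_right_mono norm_ge_zero)
    qed
  qed simp
qed

lemma schwartz_in_L2: "schwartz f \<Longrightarrow> in_L2 f"
  using schwartz_bounded schwartz_integrable0 in_L2_bounded_integrable by metis

lemma schwartz_fourier_integrable:
  "schwartz f \<Longrightarrow> integrable lborel (fourier_integral f)"
  unfolding fourier_integral_FI[abs_def] by (intro integrable_lborel_uminus schwartz_FI_integrable)

lemma schwartz_fourier_in_L2:
  assumes f: "schwartz f"
  shows "in_L2 (fourier_integral f)"
proof (rule in_L2_bounded_integrable)
  show "integrable lborel (fourier_integral f)" by (rule schwartz_fourier_integrable[OF f])
  show "cmod (fourier_integral f x) \<le> (LB x. cmod (f x))" for x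
    unfolding fourier_integral_FI by (rule norm_FI_le[OF schwartz_integrable0[OF f]])
qed

section \<open>The theorem of Plancherel\<close>

lemma FI_cnj: "cnj (FI f x) = FI (\<lambda>y. cnj (f y)) (- x)"
proof -
  have "cnj (FI f x) = (LB y. cnj (iexp (y \<bullet> x) * f y))"
    unfolding FI_def by (rule Bochner_Integration.integral_cnj[symmetric])
  also have "\<dots> = FI (\<lambda>y. cnj (f y)) (- x)"
    unfolding FI_def by (rule LB_cong) (simp add: exp_cnj)
  finally show ?thesis .
qed

text \<open>With a Gaussian cutoff, the squared L2 norm of \<open>FI F\<close> is a quadratic form
  in F whose kernel is a Gaussian in y - \<xi>. It is obtained by moving the transform from one
  factor to the other, and it gives the L2 bound directly for integrable F.\<close>

lemma FI_gauss_quadratic: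
  fixes F :: "'a::euclidean_space \<Rightarrow> complex"
  assumes F: "integrable lborel F" and e: "e > 0"
  shows "(LB x. of_real (nsq (FI F x) * gauss (e\<^sup>2) x))
    = of_real (sqrt (2 * pi / e\<^sup>2) ^ DIM('a)) *
    (LB \<xi>. F \<xi> * (LB y. cnj (F y) * of_real (gauss (1 / e\<^sup>2) (y - \<xi>))))"
proof -
  have [measurable]: "borel_fun F" using F by auto
  have cF: "integrable lborel (\<lambda>y. cnj (F y))" using F by simp
  define K where "K = complex_of_real (sqrt (2 * pi / e\<^sup>2) ^ DIM('a))"
  have e2: "e\<^sup>2 > 0" using e by simp
  define g where "g x = cnj (FI F x) * of_real (gauss (e\<^sup>2) x)" for x
  have [measurable]: "borel_fun (FI F)" by measurable
  have [measurable]: "FI (\<lambda>y. cnj (F y)) \<in> borel_measurable borel" using borel_measurable_integrable[OF cF] by (intro FI_measurable) simp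
  have gi: "integrable lborel g"
  proof (rule integrable_dominated[OF integrable_mult_right[OF gauss_integrable[OF e2], of "LB x. cmod (F x)"]])
    show "AE x in lborel. norm (g x) \<le> norm ((LB x. cmod (F x)) * gauss (e\<^sup>2) x)"
      using norm_FI_le[OF F] by (intro AE_I2) (simp add: g_def norm_mult abs_mult mult_right_mono integral_nonneg_AE)
  qed (simp add: g_def[abs_def] FI_cnj)
  have FIg: "FI g \<xi> = K * (LB y. cnj (F y) * of_real (gauss (1 / e\<^sup>2) (y - \<xi>)))" for \<xi>
  proof -
    have "FI g \<xi> = (LB x. FI (\<lambda>y. cnj (F y)) (- x) * (iexp ((- x) \<bullet> (- \<xi>)) * of_real (gauss (e\<^sup>2) (- x))))"
      unfolding FI_def[of g] g_def FI_cnj by (simp add: mult_ac)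
    also have "\<dots> = (LB x. FI (\<lambda>y. cnj (F y)) x * (iexp (x \<bullet> (- \<xi>)) * of_real (gauss (e\<^sup>2) x)))"
      by (rule integral_lborel_uminus) simp
    also have "\<dots> = (LB y. cnj (F y) * FI (\<lambda>x. iexp (x \<bullet> (- \<xi>)) * of_real (gauss (e\<^sup>2) x)) y)"
      by (rule FI_duality[OF cF gauss_integral(1)[OF e2]])
    also have "\<dots> = (LB y. K * (cnj (F y) * of_real (gauss (1 / e\<^sup>2) (y - \<xi>))))" (is "(LB y. ?f y) = (LB y. ?g y)")
    proof (rule LB_cong)
      fix y :: 'a
      have "iexp (x \<bullet> y) * iexp (x \<bullet> (- \<xi>)) = iexp (x \<bullet> (y - \<xi>))" for x :: 'a
        by (simp add: exp_add[symmetric] inner_diff_right right_diff_distrib)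
      then have "FI (\<lambda>x. iexp (x \<bullet> (- \<xi>)) * of_real (gauss (e\<^sup>2) x)) y = (LB x. iexp (x \<bullet> (y - \<xi>)) * of_real (gauss (e\<^sup>2) x))"
        unfolding FI_def mult.assoc[symmetric] by simp
      also have "\<dots> = K * of_real (gauss (1 / e\<^sup>2) (y - \<xi>))"
        unfolding gauss_integral(2)[OF e2] K_def by simp
      finally show "?f y = ?g y"
        by simp
    qed
    also have "\<dots> = K * (LB y. cnj (F y) * of_real (gauss (1 / e\<^sup>2) (y - \<xi>)))"
      by (rule integral_mult_right_zero)
    finally show ?thesis .
  qed
  have "(LB x. of_real (nsq (FI F x) * gauss (e\<^sup>2) x)) = (LB x. FI F x * g x)"
    unfolding g_def of_real_mult complex_norm_square by (simp add: mult.assoc)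
  also have "\<dots> = (LB \<xi>. F \<xi> * FI g \<xi>)"
    by (rule FI_duality[OF F gi])
  also have "\<dots> = (LB \<xi>. K * (F \<xi> * (LB y. cnj (F y) * of_real (gauss (1 / e\<^sup>2) (y - \<xi>)))))"
    unfolding FIg by (simp only: mult.left_commute)
  also have "\<dots> = K * (LB \<xi>. F \<xi> * (LB y. cnj (F y) * of_real (gauss (1 / e\<^sup>2) (y - \<xi>))))"
    by (rule integral_mult_right_zero)
  finally show ?thesis unfolding K_def .
qed

text \<open>The integral of a function that is not integrable is 0 by convention, so the bound
  covers every f, in particular fibre integrals whose convergence is not known.\<close>

lemma integral_norm_bound_ennreal':
  shows "ennreal (norm (integral\<^sup>L M f)) \<le> (\<integral>\<^sup>+x. ennreal (norm (f x)) \<partial>M)"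
  by (cases "integrable M f") (auto intro: integral_norm_bound_ennreal simp: not_integrable_integral_eq)

text \<open>Young's inequality, from 2 f(\<xi>) f(y) <= f(\<xi>)^2 + f(y)^2 and the translation and
  reflection invariance of the integral of g.\<close>

lemma nn_integral_convolution_quadratic:
  fixes f :: "'a::euclidean_space \<Rightarrow> real" and g :: "'a \<Rightarrow> real"
  assumes [measurable]: "borel_fun f" "borel_fun g"
    and f0: "\<And>x. f x \<ge> 0" and g0: "\<And>x. g x \<ge> 0"
  shows "(NN \<xi> y. ennreal (f \<xi> * f y * g (y - \<xi>)))
    \<le> (NN x. ennreal ((f x)\<^sup>2)) * (NN x. ennreal (g x))"
proof -
  have g1: "(NN \<xi>. ennreal (g (y - \<xi>))) = (NN x. ennreal (g x))" for y
    using nn_integral_lborel_uminus[of "\<lambda>\<xi>. ennreal (g (y + \<xi>))"] nn_integral_lborel_shift[of "\<lambda>x. ennreal (g x)" y] by simp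
  have g2: "(NN y. ennreal (g (y - \<xi>))) = (NN x. ennreal (g x))" for \<xi>
    using nn_integral_lborel_shift[of "\<lambda>x. ennreal (g x)" "- \<xi>"] by simp
  have "(NN \<xi> y. ennreal (f \<xi> * f y * g (y - \<xi>)))
    \<le> (NN \<xi> y. ennreal (1/2) * (ennreal ((f \<xi>)\<^sup>2) * ennreal (g (y - \<xi>))) + ennreal (1/2) * (ennreal ((f y)\<^sup>2) * ennreal (g (y - \<xi>))))"
  proof (intro nn_integral_mono)
    fix \<xi> y :: 'a
    have "f \<xi> * f y * g (y - \<xi>) \<le> ((f \<xi>)\<^sup>2 + (f y)\<^sup>2) / 2 * g (y - \<xi>)"
      using sum_squares_bound[of "f \<xi>" "f y"] g0 by (intro mult_right_mono) auto
    also have "\<dots> = 1/2 * ((f \<xi>)\<^sup>2 * g (y - \<xi>)) + 1/2 * ((f y)\<^sup>2 * g (y - \<xi>))"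
      by (simp add: field_simps)
    finally have "ennreal (f \<xi> * f y * g (y - \<xi>)) \<le> ennreal (1/2 * ((f \<xi>)\<^sup>2 * g (y - \<xi>)) + 1/2 * ((f y)\<^sup>2 * g (y - \<xi>)))"
      by (rule ennreal_leI)
    also have "\<dots> = ennreal (1/2) * (ennreal ((f \<xi>)\<^sup>2) * ennreal (g (y - \<xi>))) + ennreal (1/2) * (ennreal ((f y)\<^sup>2) * ennreal (g (y - \<xi>)))"
    proof -
      have m: "ennreal (1/2 * (u * v)) = ennreal (1/2) * (ennreal u * ennreal v)" if "u \<ge> 0" "v \<ge> 0" for u v
        using that by (subst ennreal_mult, simp, simp, subst ennreal_mult) auto
      show ?thesis
        using g0 by (subst ennreal_plus) (simp_all only: m zero_le_power2, simp_all)
    qed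
    finally show "ennreal (f \<xi> * f y * g (y - \<xi>)) \<le> ennreal (1/2) * (ennreal ((f \<xi>)\<^sup>2) * ennreal (g (y - \<xi>))) + ennreal (1/2) * (ennreal ((f y)\<^sup>2) * ennreal (g (y - \<xi>)))" .
  qed
  also have "\<dots> = ennreal (1/2) * (NN \<xi>. ennreal ((f \<xi>)\<^sup>2) * (NN y. ennreal (g (y - \<xi>))))
    + ennreal (1/2) * (NN \<xi> y. ennreal ((f y)\<^sup>2) * ennreal (g (y - \<xi>)))"
    by (simp add: nn_integral_add nn_integral_cmult)
  also have "(NN \<xi> y. ennreal ((f y)\<^sup>2) * ennreal (g (y - \<xi>)))
    = (NN y \<xi>. ennreal ((f y)\<^sup>2) * ennreal (g (y - \<xi>)))"
    by (rule lborel_pair.Fubini') simp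
  also have "\<dots> = (NN y. ennreal ((f y)\<^sup>2) * (NN \<xi>. ennreal (g (y - \<xi>))))"
    by (simp add: nn_integral_cmult)
  finally have main: "(NN \<xi> y. ennreal (f \<xi> * f y * g (y - \<xi>)))
    \<le> ennreal (1/2) * (NN \<xi>. ennreal ((f \<xi>)\<^sup>2) * (NN x. ennreal (g x)))
    + ennreal (1/2) * (NN y. ennreal ((f y)\<^sup>2) * (NN x. ennreal (g x)))"
    unfolding g1 g2 .
  note main
  also have "ennreal (1/2) * (NN \<xi>. ennreal ((f \<xi>)\<^sup>2) * (NN x. ennreal (g x)))
    + ennreal (1/2) * (NN y. ennreal ((f y)\<^sup>2) * (NN x. ennreal (g x)))
    = (ennreal (1/2) + ennreal (1/2)) * ((NN x. ennreal ((f x)\<^sup>2)) * (NN x. ennreal (g x)))"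
    by (simp add: nn_integral_multc distrib_right)
  also have "ennreal (1/2) + ennreal (1/2) = 1"
    by (subst ennreal_plus[symmetric]) auto
  finally show ?thesis by simp
qed

text \<open>The prefactor of the quadratic form in \<open>FI_gauss_quadratic\<close> and the mass of
  its kernel multiply to (2 pi)^d whatever the width; Fatou's lemma then removes the cutoff.\<close>

lemma FI_L2_bound:
  fixes F :: "'a::euclidean_space \<Rightarrow> complex"
  assumes F: "integrable lborel F"
  shows "(L2sq (\<lambda>x. FI F x)) \<le> ennreal ((2 * pi) ^ DIM('a)) * L2sq F"
proof -
  have [measurable]: "borel_fun F" using F by auto
  define e where "e n = 1 / real (Suc n)" for n
  have e0: "e n > 0" for n by (simp add: e_def)
  let ?N = "(L2sq F)"
  have step: "(NN x. ennreal (nsq (FI F x) * gauss ((e n)\<^sup>2) x)) \<le> ennreal ((2 * pi) ^ DIM('a)) * ?N" for n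
  proof -
    have e2: "(e n)\<^sup>2 > 0" using e0[of n] by simp
    define A where "A = (LB x. cmod (F x))"
    have A: "cmod (FI F x) \<le> A" for x unfolding A_def by (rule norm_FI_le[OF F])
    have i: "integrable lborel (\<lambda>x. nsq (FI F x) * gauss ((e n)\<^sup>2) x)"
    proof (rule integrable_dominated[OF integrable_mult_right[OF gauss_integrable[OF e2], of "A\<^sup>2"]])
      show "AE x in lborel. norm (nsq (FI F x) * gauss ((e n)\<^sup>2) x) \<le> norm (A\<^sup>2 * gauss ((e n)\<^sup>2) x)"
        by (intro AE_I2) (simp add: abs_mult mult_right_mono power_mono[OF A])
    qed simp
    define \<gamma> where "\<gamma> = (gauss (1 / (e n)\<^sup>2) :: 'a \<Rightarrow> real)"
    have [measurable]: "\<gamma> \<in> borel_measurable borel" unfolding \<gamma>_def by measurable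
    have e2': "1 / (e n)\<^sup>2 > 0" using e2 by simp
    define K where "K = sqrt (2 * pi / (e n)\<^sup>2) ^ DIM('a)"
    have K0: "K \<ge> 0" by (simp add: K_def)
    let ?I = "(LB \<xi>. F \<xi> * (LB y. cnj (F y) * of_real (\<gamma> (y - \<xi>))))"
    have "ennreal (LB x. nsq (FI F x) * gauss ((e n)\<^sup>2) x) \<le> ennreal (cmod (of_real (LB x. nsq (FI F x) * gauss ((e n)\<^sup>2) x)))"
      by (intro ennreal_leI) simp
    also have "complex_of_real (LB x. nsq (FI F x) * gauss ((e n)\<^sup>2) x) = of_real K * ?I"
      unfolding K_def \<gamma>_def FI_gauss_quadratic[OF F e0, symmetric] by (rule integral_of_real[symmetric], rule i)
    also have "ennreal (cmod (of_real K * ?I)) = ennreal K * ennreal (cmod ?I)"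
      using K0 by (simp add: norm_mult ennreal_mult)
    also have "ennreal (cmod ?I) \<le> (NN \<xi>. ennreal (cmod (F \<xi> * (LB y. cnj (F y) * of_real (\<gamma> (y - \<xi>))))))"
      by (rule integral_norm_bound_ennreal')
    also have "\<dots> \<le> (NN \<xi> y. ennreal (cmod (F \<xi>) * cmod (F y) * \<gamma> (y - \<xi>)))"
    proof (rule nn_integral_mono)
      fix \<xi> :: 'a
      have "ennreal (cmod (LB y. cnj (F y) * of_real (\<gamma> (y - \<xi>)))) \<le> (NN y. ennreal (cmod (cnj (F y) * of_real (\<gamma> (y - \<xi>)))))"
        by (rule integral_norm_bound_ennreal')
      also have "\<dots> = (NN y. ennreal (cmod (F y) * \<gamma> (y - \<xi>)))"
        by (simp add: norm_mult \<gamma>_def)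
      finally have "ennreal (cmod (F \<xi>)) * ennreal (cmod (LB y. cnj (F y) * of_real (\<gamma> (y - \<xi>)))) \<le> ennreal (cmod (F \<xi>)) * (NN y. ennreal (cmod (F y) * \<gamma> (y - \<xi>)))"
        by (rule mult_left_mono) simp
      also have "\<dots> = (NN y. ennreal (cmod (F \<xi>) * cmod (F y) * \<gamma> (y - \<xi>)))"
        by (subst nn_integral_cmult[symmetric]) (auto simp: ennreal_mult[symmetric] \<gamma>_def mult.assoc)
      finally show "ennreal (cmod (F \<xi> * (LB y. cnj (F y) * of_real (\<gamma> (y - \<xi>))))) \<le> (NN y. ennreal (cmod (F \<xi>) * cmod (F y) * \<gamma> (y - \<xi>)))"
        by (simp add: norm_mult ennreal_mult)
    qed
    also have "\<dots> \<le> ?N * (NN x. ennreal (\<gamma> x))"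
      by (rule nn_integral_convolution_quadratic) (auto simp: \<gamma>_def)
    also have "(NN x. ennreal (\<gamma> x)) = ennreal (sqrt (2 * pi / (1 / (e n)\<^sup>2)) ^ DIM('a))"
      unfolding \<gamma>_def gauss_total[OF e2', symmetric]
      by (rule nn_integral_eq_integral[OF gauss_integrable[OF e2']]) simp
    finally have "ennreal (LB x. nsq (FI F x) * gauss ((e n)\<^sup>2) x) \<le> ennreal K * (?N * ennreal (sqrt (2 * pi / (1 / (e n)\<^sup>2)) ^ DIM('a)))"
      by (simp add: mult_left_mono)
    also have "\<dots> = (ennreal K * ennreal (sqrt (2 * pi / (1 / (e n)\<^sup>2)) ^ DIM('a))) * ?N"
      by (simp only: mult_ac)
    also have "ennreal K * ennreal (sqrt (2 * pi / (1 / (e n)\<^sup>2)) ^ DIM('a)) = ennreal ((2 * pi) ^ DIM('a))"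
    proof -
      have "sqrt (2 * pi / (e n)\<^sup>2) * sqrt (2 * pi / (1 / (e n)\<^sup>2)) = sqrt ((2 * pi)\<^sup>2)"
        unfolding real_sqrt_mult[symmetric] using e0[of n] by (simp add: power2_eq_square)
      also have "\<dots> = 2 * pi" by (rule real_sqrt_unique) auto
      finally have "K * sqrt (2 * pi / (1 / (e n)\<^sup>2)) ^ DIM('a) = (2 * pi) ^ DIM('a)"
        unfolding K_def power_mult_distrib[symmetric] by (rule arg_cong)
      then show ?thesis using K0 by (simp flip: ennreal_mult)
    qed
    also have "ennreal (LB x. nsq (FI F x) * gauss ((e n)\<^sup>2) x) = (NN x. ennreal (nsq (FI F x) * gauss ((e n)\<^sup>2) x))"
      by (rule nn_integral_eq_integral[OF i, symmetric]) simp
    finally show ?thesis .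
  qed
  have "(L2sq (\<lambda>x. FI F x)) = (NN x. liminf (\<lambda>n. ennreal (nsq (FI F x) * gauss ((e n)\<^sup>2) x)))" (is "(NN x. ?f x) = (NN x. ?g x)")
  proof (rule nn_integral_cong)
    fix x :: 'a
    have "(\<lambda>n. gauss ((e n)\<^sup>2) x) \<longlonglongrightarrow> exp (- (0\<^sup>2 * (norm x)\<^sup>2 / 2))"
      unfolding gauss_def e_def by (intro tendsto_intros LIMSEQ_Suc[OF lim_1_over_n]) simp
    then have "(\<lambda>n. nsq (FI F x) * gauss ((e n)\<^sup>2) x) \<longlonglongrightarrow> nsq (FI F x) * 1"
      by (intro tendsto_intros) simp
    then have "(\<lambda>n. ennreal (nsq (FI F x) * gauss ((e n)\<^sup>2) x)) \<longlonglongrightarrow> ennreal (nsq (FI F x))"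
      by (intro tendsto_ennrealI) simp
    then show "?f x = ?g x"
      by (intro lim_imp_Liminf[symmetric]) auto
  qed
  also have "\<dots> \<le> liminf (\<lambda>n. NN x. ennreal (nsq (FI F x) * gauss ((e n)\<^sup>2) x))"
    by (rule nn_integral_liminf) simp
  also have "\<dots> \<le> ennreal ((2 * pi) ^ DIM('a)) * ?N"
    using step by (intro Liminf_le always_eventually allI) auto
  finally show ?thesis .
qed

lemma FI_in_L2:
  assumes "integrable lborel F" "in_L2 F"
  shows "in_L2 (FI F)"
  unfolding in_L2_iff
proof
  show "borel_fun (FI F)" using assms(1) by (intro FI_measurable) auto
  have "ennreal ((2 * pi) ^ DIM('a)) * (L2sq F) < \<infinity>"
    using assms(2) by (simp add: in_L2_iff ennreal_mult_less_top)
  then show "(L2sq (\<lambda>x. FI F x)) < \<infinity>"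
    using FI_L2_bound[OF assms(1)] by (rule le_less_trans[rotated])
qed

lemma L2_tail_small:
  fixes F :: "'a::euclidean_space \<Rightarrow> complex"
  assumes F: "in_L2 F" and e: "e > 0"
  shows "\<exists>R\<ge>n. (NN x. ennreal (nsq (F x) * indicat_real {x. norm x > R} x)) \<le> ennreal e"
proof -
  have [measurable]: "borel_fun F" using F by (simp add: in_L2_def)
  have Fi: "integrable lborel (\<lambda>x. nsq (F x))" using F by (simp add: in_L2_def)
  have "(\<lambda>k. LB x. nsq (F x) * indicat_real {x. norm x > real k} x) \<longlonglongrightarrow> (LINT x|(lborel :: 'a measure). 0)"
  proof (rule integral_dominated_convergence[where w="\<lambda>x. nsq (F x)"])
    show "AE x in lborel. (\<lambda>k. nsq (F x) * indicat_real {x. norm x > real k} x) \<longlonglongrightarrow> 0" (is "AE x in _. ?P x")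
    proof (rule AE_I2)
      fix x :: 'a
      obtain N where N: "norm x \<le> real N" using real_arch_simple by blast
      have "\<forall>\<^sub>F k in sequentially. nsq (F x) * indicat_real {x. norm x > real k} x = 0"
      proof (rule eventually_sequentiallyI[of N])
        fix k assume "N \<le> k"
        then have "norm x \<le> real k" using N by (meson of_nat_mono order_trans)
        then show "nsq (F x) * indicat_real {x. norm x > real k} x = 0" by simp
      qed
      then show "?P x"
        by (rule tendsto_eventually)
    qed
  qed (use Fi in \<open>auto split: split_indicator\<close>)
  then have "(\<lambda>k. LB x. nsq (F x) * indicat_real {x. norm x > real k} x) \<longlonglongrightarrow> 0" by simp
  from order_tendstoD(2)[OF this e] obtain K where K: "\<And>k. k \<ge> K \<Longrightarrow> (LB x. nsq (F x) * indicat_real {x. norm x > real k} x) < e"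
    unfolding eventually_sequentially by blast
  obtain m where m: "n \<le> real m" using real_arch_simple by blast
  define k where "k = max K m"
  have "(NN x. ennreal (nsq (F x) * indicat_real {x. norm x > real k} x)) = ennreal (LB x. nsq (F x) * indicat_real {x. norm x > real k} x)"
    by (rule nn_integral_eq_integral) (auto intro!: integrable_dominated[OF Fi] split: split_indicator)
  also have "\<dots> \<le> ennreal e" using K[of k] by (intro ennreal_leI) (simp add: k_def)
  finally show ?thesis using m by (intro exI[of _ "real k"]) (simp add: k_def)
qed

text \<open>The transforms of all p(t, .) F are constructed at once, because the result must be
  Borel in (t, x) jointly, as a Klein-Gordon solution has to be. F is cut off to balls; since |p| <=
  1, the tails are small uniformly in t, and for every t the transforms of the truncated functions
  converge almost everywhere in x.\<close>

lemma L2_fourier_family: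
  fixes F :: "'a::euclidean_space \<Rightarrow> complex" and p :: "'b::euclidean_space \<Rightarrow> 'a \<Rightarrow> complex"
  assumes F: "in_L2 F" and p: "case_prod p \<in> borel_measurable (borel \<Otimes>\<^sub>M borel)" and p1: "\<And>t \<xi>. cmod (p t \<xi>) \<le> 1"
  shows "\<exists>u \<in> borel_measurable borel. \<forall>t.
    (L2sq (\<lambda>x. u (t, x))) \<le> ennreal ((2 * pi) ^ DIM('a)) * (L2sq F) \<and>
    (\<forall>h. integrable lborel h \<longrightarrow> in_L2 h \<longrightarrow> (LB x. u (t, x) * h x) = (LB \<xi>. p t \<xi> * F \<xi> * FI h \<xi>))"
proof -
  have Fm[measurable]: "borel_fun F" using F by (simp add: in_L2_def)
  note [measurable (raw)] = measurable_uncurry[OF p]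
  define c where "c = (2 * pi) ^ DIM('a)"
  have c0: "c > 0" by (simp add: c_def)
  define NF where "NF = L2sq F"
  have NF: "NF < \<infinity>" using F by (simp add: NF_def in_L2_iff)
  \<comment> \<open>Tails of size 8^(-n) leave room for weights 2^n: the sum of 2^n |difference|^2
    still has a finite integral, and where it is finite the differences decay geometrically. The
    condition R n >= n makes the balls exhaust the space.\<close>
  have "\<exists>R. \<forall>n::nat. R n \<ge> real n \<and> (NN x. ennreal (nsq (F x) * indicat_real {x. norm x > R n} x)) \<le> ennreal ((1/8) ^ n)"
    by (intro choice allI) (use L2_tail_small[OF F, of "(1/8) ^ n" "real n" for n] in auto)
  then obtain R where R: "\<And>n. R n \<ge> real n"
    and tail: "\<And>n. (NN x. ennreal (nsq (F x) * indicat_real {x. norm x > R n} x)) \<le> ennreal ((1/8) ^ n)"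
    by blast
  define G where "G n t \<xi> = p t \<xi> * (F \<xi> * of_real (indicat_real (cball 0 (R n)) \<xi>))" for n t \<xi>
  have cb[measurable]: "cball (0::'a) r \<in> sets borel" for r by simp
  have Gm[measurable]: "G n t \<in> borel_measurable borel" for n t
    unfolding G_def[abs_def] by measurable
  have G_le: "cmod (G n t \<xi>) \<le> cmod (F \<xi>)" for n t \<xi>
    using p1[of t \<xi>] by (auto simp: G_def norm_mult intro!: mult_left_le_one_le split: split_indicator)
  have Fi: "integrable lborel (\<lambda>x. nsq (F x))" using F by (simp add: in_L2_def)
  have Gi: "integrable lborel (G n t)" for n t
  proof (rule integrable_dominated)
    have "integrable lborel (indicat_real (cball (0::'a) (R n)))"
      using emeasure_lborel_cball_finite[of "0::'a" "R n"] by (intro integrable_real_indicator) auto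
    then show "integrable lborel (\<lambda>x. nsq (F x) + indicat_real (cball 0 (R n)) x)"
      using Fi by simp
    show "AE x in lborel. norm (G n t x) \<le> norm (nsq (F x) + indicat_real (cball 0 (R n)) x)" (is "AE x in _. ?P x")
    proof (rule AE_I2)
      fix x
      have "cmod (F x) \<le> nsq (F x) + 1"
        using sum_squares_bound[of "cmod (F x)" 1] norm_ge_zero[of "F x"] by (simp; linarith)
      then show "?P x"
        using G_le[of n t x] by (cases "x \<in> cball 0 (R n)") (auto simp: G_def)
    qed
  qed simp
  define u' where "u' n z = FI (G n (fst z)) (snd z)" for n z
  have u'm[measurable]: "borel_fun (u' n)" for n
  proof -
    have "(\<lambda>(z, x). iexp (x \<bullet> snd z) * G n (fst z) x) \<in> borel_measurable ((borel \<Otimes>\<^sub>M borel) \<Otimes>\<^sub>M lborel)"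
      unfolding G_def by measurable
    then have "(\<lambda>z. LB x. iexp (x \<bullet> snd z) * G n (fst z) x) \<in> borel_measurable (borel \<Otimes>\<^sub>M borel)"
      by (rule lborel.borel_measurable_lebesgue_integral)
    then show ?thesis unfolding u'_def[abs_def] FI_def borel_prod .
  qed
  have u't[measurable]: "borel_fun (\<lambda>x. u' n (t, x))" for n t
    unfolding u'_def by simp
  have bound: "(L2sq (\<lambda>x. u' n (t, x))) \<le> ennreal c * NF" for n t
  proof -
    have "(L2sq (\<lambda>x. u' n (t, x))) \<le> ennreal c * (L2sq (\<lambda>x. G n t x))"
      unfolding u'_def c_def using FI_L2_bound[OF Gi] by simp
    also have "\<dots> \<le> ennreal c * NF"
      unfolding NF_def using G_le by (intro mult_left_mono nn_integral_mono ennreal_leI power_mono) auto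
    finally show ?thesis .
  qed
  have diff: "(L2sq (\<lambda>x. u' m (t, x) - u' n (t, x))) \<le> ennreal (2 * c * (1/8) ^ n)" if "m \<ge> n" for m n t
  proof -
    have "u' m (t, x) - u' n (t, x) = FI (\<lambda>\<xi>. G m t \<xi> - G n t \<xi>) x" for x
      unfolding u'_def FI_def
      by (simp add: right_diff_distrib Bochner_Integration.integral_diff[OF FI_integrand_integrable[OF Gi] FI_integrand_integrable[OF Gi], unfolded FI_def])
    then have "(L2sq (\<lambda>x. u' m (t, x) - u' n (t, x))) \<le> ennreal c * (L2sq (\<lambda>x. G m t x - G n t x))"
      unfolding c_def using FI_L2_bound[OF Bochner_Integration.integrable_diff[OF Gi Gi]] by simp
    also have "(L2sq (\<lambda>x. G m t x - G n t x))
      \<le> (NN x. ennreal (nsq (F x) * indicat_real {x. norm x > R m} x) + ennreal (nsq (F x) * indicat_real {x. norm x > R n} x))" (is "(NN x. ?f x) \<le> (NN x. ?g x)")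
    proof (rule nn_integral_mono)
      fix x :: 'a
      have "nsq (G m t x - G n t x) \<le> nsq (F x) * indicat_real {x. norm x > R m} x + nsq (F x) * indicat_real {x. norm x > R n} x"
      proof (cases "(norm x > R m) = (norm x > R n)")
        case True
        then have "G m t x = G n t x" by (auto simp: G_def not_less split: split_indicator)
        then show ?thesis by simp
      next
        case False
        then have "cmod (G m t x - G n t x) = cmod (p t x) * cmod (F x)" by (auto simp: G_def norm_mult split: split_indicator)
        also have "\<dots> \<le> cmod (F x)" using p1[of t x] by (simp add: mult_left_le_one_le)
        finally have "nsq (G m t x - G n t x) \<le> nsq (F x)" by (intro power_mono) auto
        then show ?thesis using False by (auto split: split_indicator)
      qed
      then show "?f x \<le> ?g x"
        by (simp add: ennreal_leI flip: ennreal_plus)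
    qed
    also have "\<dots> = (NN x. ennreal (nsq (F x) * indicat_real {x. norm x > R m} x)) + (NN x. ennreal (nsq (F x) * indicat_real {x. norm x > R n} x))"
      by (rule nn_integral_add) auto
    also have "\<dots> \<le> ennreal ((1/8) ^ m) + ennreal ((1/8) ^ n)" by (intro add_mono tail)
    also have "\<dots> \<le> ennreal (2 * (1/8) ^ n)"
    proof -
      have "(1/8::real) ^ m \<le> (1/8) ^ n" using that by (intro power_decreasing) auto
      then show ?thesis by (simp add: ennreal_leI flip: ennreal_plus)
    qed
    finally have "(L2sq (\<lambda>x. u' m (t, x) - u' n (t, x))) \<le> ennreal c * ennreal (2 * (1/8) ^ n)"
      by (simp add: mult_left_mono)
    also have "\<dots> = ennreal (2 * c * (1/8) ^ n)" using c0 by (simp add: ennreal_mult[symmetric] mult_ac)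
    finally show ?thesis .
  qed
  \<comment> \<open>A pointwise limit keeps u Borel on the product. Where the sequence diverges,
    \<open>lim\<close> has some unspecified value; for each t this concerns only a null set of
    x.\<close>
  define u where "u z = lim (\<lambda>n. u' n z)" for z
  have um: "borel_fun u" unfolding u_def[abs_def] by measurable
  have conv: "AE x in lborel. (\<lambda>n. u' n (t, x)) \<longlonglongrightarrow> u (t, x)" for t
  proof -
    define D where "D n x = nsq (u' (Suc n) (t, x) - u' n (t, x))" for n x
    have [measurable]: "borel_fun (D n)" for n unfolding D_def[abs_def] by measurable
    have D0: "D n x \<ge> 0" for n x by (simp add: D_def)
    have "(NN x. (\<Sum>n. ennreal (2 ^ n * D n x))) = (\<Sum>n. NN x. ennreal (2 ^ n * D n x))"
      by (rule nn_integral_suminf) simp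
    also have "\<dots> \<le> (\<Sum>n. ennreal (2 * c * (1/4) ^ n))"
    proof (rule suminf_le)
      fix n
      have "(NN x. ennreal (2 ^ n * D n x)) = ennreal (2 ^ n) * (NN x. ennreal (D n x))"
        by (subst nn_integral_cmult[symmetric]) (auto simp: ennreal_mult[symmetric] D0)
      also have "\<dots> \<le> ennreal (2 ^ n) * ennreal (2 * c * (1/8) ^ n)"
        using diff[of n "Suc n" t] by (intro mult_left_mono) (auto simp: D_def)
      also have "\<dots> = ennreal (2 * c * (1/4) ^ n)"
      proof -
        have "(2::real) ^ n * (1/8) ^ n = (1/4) ^ n" unfolding power_mult_distrib[symmetric] by simp
        then have "2 ^ n * (2 * c * (1/8) ^ n) = 2 * c * (1/4) ^ n" by (simp add: mult_ac)
        then show ?thesis using c0 by (simp flip: ennreal_mult)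
      qed
      finally show "(NN x. ennreal (2 ^ n * D n x)) \<le> ennreal (2 * c * (1/4) ^ n)" .
    qed auto
    also have "\<dots> < \<infinity>"
    proof -
      have "summable (\<lambda>n. 2 * c * (1/4) ^ n)" by (intro summable_mult summable_geometric) simp
      then have "(\<Sum>n. ennreal (2 * c * (1/4) ^ n)) = ennreal (\<Sum>n. 2 * c * (1/4) ^ n)"
        using c0 by (intro suminf_ennreal2) auto
      then show ?thesis by simp
    qed
    finally have "AE x in lborel. (\<Sum>n. ennreal (2 ^ n * D n x)) \<noteq> \<infinity>"
      by (intro nn_integral_noteq_infinite) (auto simp: less_top)
    then show ?thesis
    proof eventually_elim
      case (elim x)
      obtain K where K: "(\<Sum>n. ennreal (2 ^ n * D n x)) = ennreal K" "K \<ge> 0"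
        using elim by (cases "(\<Sum>n. ennreal (2 ^ n * D n x))") auto
      have Dn: "2 ^ n * D n x \<le> K" for n
      proof -
        have "(\<Sum>k\<in>{n}. ennreal (2 ^ k * D k x)) \<le> (\<Sum>k. ennreal (2 ^ k * D k x))"
          by (rule sum_le_suminf) auto
        then show ?thesis using K by simp
      qed
      have "cmod (u' (Suc n) (t, x) - u' n (t, x)) \<le> sqrt K * (1 / sqrt 2) ^ n" for n
      proof -
        have "D n x \<le> K / 2 ^ n" using Dn[of n] by (simp add: field_simps)
        then have "sqrt (D n x) \<le> sqrt (K / 2 ^ n)" by (rule real_sqrt_le_mono)
        also have "\<dots> = sqrt K * (1 / sqrt 2) ^ n"
          by (simp add: real_sqrt_divide real_sqrt_power power_one_over)
        finally show ?thesis by (simp add: D_def)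
      qed
      moreover have "summable (\<lambda>n. sqrt K * (1 / sqrt 2) ^ n)"
        by (intro summable_mult summable_geometric) simp
      ultimately have "summable (\<lambda>n. u' (Suc n) (t, x) - u' n (t, x))"
        by (rule summable_comparison_test'[rotated])
      then have "(\<lambda>n. \<Sum>k<n. u' (Suc k) (t, x) - u' k (t, x)) \<longlonglongrightarrow> (\<Sum>k. u' (Suc k) (t, x) - u' k (t, x))"
        by (rule summable_LIMSEQ)
      then have "(\<lambda>n. u' n (t, x) - u' 0 (t, x)) \<longlonglongrightarrow> (\<Sum>k. u' (Suc k) (t, x) - u' k (t, x))"
        unfolding sum_lessThan_telescope[of "\<lambda>n. u' n (t, x)"] .
      then have "(\<lambda>n. (u' n (t, x) - u' 0 (t, x)) + u' 0 (t, x)) \<longlonglongrightarrow> (\<Sum>k. u' (Suc k) (t, x) - u' k (t, x)) + u' 0 (t, x)"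
        by (intro tendsto_intros)
      then have "convergent (\<lambda>n. u' n (t, x))" by (auto simp: convergent_def)
      then show ?case unfolding u_def by (simp add: convergent_LIMSEQ_iff)
    qed
  qed
  have ut[measurable]: "borel_fun (\<lambda>x. u (t, x))" for t
    unfolding u_def by measurable
  have fatou: "(L2sq (\<lambda>x. u (t, x) - v x)) \<le> B"
    if [measurable]: "borel_fun v" and B: "\<forall>\<^sub>F m in sequentially. (L2sq (\<lambda>x. u' m (t, x) - v x)) \<le> B" for t v B
  proof -
    have "(L2sq (\<lambda>x. u (t, x) - v x)) = (NN x. liminf (\<lambda>m. ennreal (nsq (u' m (t, x) - v x))))"
    proof (rule nn_integral_cong_AE)
      show "AE x in lborel. ennreal (nsq (u (t, x) - v x)) = liminf (\<lambda>m. ennreal (nsq (u' m (t, x) - v x)))"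
        using conv[of t]
      proof eventually_elim
        case (elim x)
        then have "(\<lambda>m. ennreal (nsq (u' m (t, x) - v x))) \<longlonglongrightarrow> ennreal (nsq (u (t, x) - v x))"
          by (intro tendsto_ennrealI tendsto_intros)
        then show ?case by (intro lim_imp_Liminf[symmetric]) auto
      qed
    qed
    also have "\<dots> \<le> liminf (\<lambda>m. NN x. ennreal (nsq (u' m (t, x) - v x)))"
      by (rule nn_integral_liminf) simp
    also have "\<dots> \<le> B" using B by (intro Liminf_le) auto
    finally show ?thesis .
  qed
  have ubound: "(L2sq (\<lambda>x. u (t, x))) \<le> ennreal c * NF" for t
    using fatou[of "\<lambda>_. 0" t "ennreal c * NF"] bound by simp
  have udiff: "(L2sq (\<lambda>x. u (t, x) - u' n (t, x))) \<le> ennreal (2 * c * (1/8) ^ n)" for n t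
    by (rule fatou) (use diff in \<open>auto simp: eventually_sequentially\<close>)
  have uL2: "in_L2 (\<lambda>x. u (t, x))" for t
    unfolding in_L2_iff using ubound[of t] NF c0 ut by (auto intro: le_less_trans simp: ennreal_mult_less_top)
  have u'L2: "in_L2 (\<lambda>x. u' n (t, x))" for n t
    unfolding in_L2_iff using bound[of n t] NF c0 u't by (auto intro: le_less_trans simp: ennreal_mult_less_top)
  have dual: "(LB x. u (t, x) * h x) = (LB \<xi>. p t \<xi> * F \<xi> * FI h \<xi>)"
    if r: "integrable lborel h" and r2: "in_L2 h" for t h
  proof (rule LIMSEQ_unique)
    have [measurable]: "h \<in> borel_measurable borel" using r by auto
    have FIr: "in_L2 (FI h)" by (rule FI_in_L2[OF r r2])
    have FIm[measurable]: "FI h \<in> borel_measurable borel" by measurable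
    have eq: "(LB x. u' n (t, x) * h x) = (LB \<xi>. G n t \<xi> * FI h \<xi>)" for n
      unfolding u'_def by (simp add: FI_duality(2)[OF Gi r])
    show "(\<lambda>n. LB x. u' n (t, x) * h x) \<longlonglongrightarrow> (LB \<xi>. p t \<xi> * F \<xi> * FI h \<xi>)"
      unfolding eq
    proof (rule integral_dominated_convergence[where w="\<lambda>\<xi>. cmod (F \<xi> * FI h \<xi>)"])
      show "integrable lborel (\<lambda>\<xi>. cmod (F \<xi> * FI h \<xi>))"
        by (intro integrable_norm in_L2_mult_integrable F FIr)
      show "AE \<xi> in lborel. norm (G n t \<xi> * FI h \<xi>) \<le> cmod (F \<xi> * FI h \<xi>)" for n
        unfolding norm_mult by (intro AE_I2 mult_right_mono G_le) simp
      show "AE \<xi> in lborel. (\<lambda>n. G n t \<xi> * FI h \<xi>) \<longlonglongrightarrow> p t \<xi> * F \<xi> * FI h \<xi>"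
      proof (intro AE_I2 tendsto_mult tendsto_const)
        fix \<xi> :: 'a
        obtain N where N: "norm \<xi> \<le> real N" using real_arch_simple by blast
        have "\<forall>\<^sub>F n in sequentially. G n t \<xi> = p t \<xi> * F \<xi>"
        proof (rule eventually_sequentiallyI[of N])
          fix n assume "N \<le> n"
          then have "norm \<xi> \<le> R n" using N R[of n] by (meson of_nat_mono order_trans)
          then show "G n t \<xi> = p t \<xi> * F \<xi>" by (simp add: G_def)
        qed
        then show "(\<lambda>n. G n t \<xi>) \<longlonglongrightarrow> p t \<xi> * F \<xi>" by (rule tendsto_eventually)
      qed
    qed simp_all
    define S where "S = (LB x. nsq (h x))"
    have est: "cmod ((LB x. u' n (t, x) * h x) - (LB x. u (t, x) * h x)) \<le> (1/2) ^ n * S + 2 * c * (1/4) ^ n" for n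
    proof -
      have dL2: "integrable lborel (\<lambda>x. nsq (u (t, x) - u' n (t, x)))"
      proof (rule integrableI_bounded)
        show "(NN x. ennreal (norm (nsq (u (t, x) - u' n (t, x))))) < \<infinity>"
          using udiff[of t n] by (auto intro: le_less_trans)
      qed simp
      have dle: "(LB x. nsq (u (t, x) - u' n (t, x))) \<le> 2 * c * (1/8) ^ n"
      proof -
        have "ennreal (LB x. nsq (u (t, x) - u' n (t, x))) \<le> ennreal (2 * c * (1/8) ^ n)"
          using udiff[of t n] by (subst nn_integral_eq_integral[OF dL2, symmetric]) auto
        then show ?thesis using c0 by (subst (asm) ennreal_le_iff) auto
      qed
      have ri: "integrable lborel (\<lambda>x. nsq (h x))" using r2 by (simp add: in_L2_def)
      have "(LB x. u' n (t, x) * h x) - (LB x. u (t, x) * h x) = (LB x. u' n (t, x) * h x - u (t, x) * h x)"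
        by (rule Bochner_Integration.integral_diff[symmetric]) (intro in_L2_mult_integrable u'L2 uL2 r2)+
      also have "cmod \<dots> \<le> (LB x. (1/2) ^ n * nsq (h x) + 2 ^ n * nsq (u (t, x) - u' n (t, x)))"
      proof (rule order_trans[OF integral_norm_bound integral_mono'])
        show "integrable lborel (\<lambda>x. (1/2) ^ n * nsq (h x) + 2 ^ n * nsq (u (t, x) - u' n (t, x)))"
          using ri dL2 by (intro Bochner_Integration.integrable_add integrable_mult_right)
        fix x
        \<comment> \<open>The square root s of 2^n weights the arithmetic-geometric inequality: h
          receives 2^(-n), and the squared difference, whose integral is of order 8^(-n), receives
          2^n.\<close>
        define s where "s = sqrt 2 ^ n"
        have s: "s > 0" "s * s = 2 ^ n" by (auto simp: s_def power_mult_distrib[symmetric])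
        have "2 * (cmod (h x) / s) * (s * cmod (u (t, x) - u' n (t, x))) \<le> (cmod (h x) / s)\<^sup>2 + (s * cmod (u (t, x) - u' n (t, x)))\<^sup>2"
          by (rule sum_squares_bound)
        also have "2 * (cmod (h x) / s) * (s * cmod (u (t, x) - u' n (t, x))) = 2 * (cmod (h x) * cmod (u (t, x) - u' n (t, x)))"
          using s by simp
        also have "(cmod (h x) / s)\<^sup>2 + (s * cmod (u (t, x) - u' n (t, x)))\<^sup>2 = (1/2) ^ n * nsq (h x) + 2 ^ n * nsq (u (t, x) - u' n (t, x))"
          unfolding s(2)[symmetric] power_one_over by (simp add: s(2) power_divide power_mult_distrib power2_eq_square)
        finally have "2 * (cmod (h x) * cmod (u (t, x) - u' n (t, x))) \<le> (1/2) ^ n * nsq (h x) + 2 ^ n * nsq (u (t, x) - u' n (t, x))" .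
        moreover have "norm (u' n (t, x) * h x - u (t, x) * h x) = cmod (h x) * cmod (u (t, x) - u' n (t, x))"
          by (metis left_diff_distrib mult.commute norm_minus_commute norm_mult)
        moreover have "0 \<le> cmod (h x) * cmod (u (t, x) - u' n (t, x))" by simp
        ultimately show "norm (u' n (t, x) * h x - u (t, x) * h x) \<le> (1/2) ^ n * nsq (h x) + 2 ^ n * nsq (u (t, x) - u' n (t, x))"
          by linarith
      qed simp
      also have "\<dots> = (1/2) ^ n * S + 2 ^ n * (LB x. nsq (u (t, x) - u' n (t, x)))"
        unfolding S_def using ri dL2 by (subst Bochner_Integration.integral_add) auto
      also have "\<dots> \<le> (1/2) ^ n * S + 2 ^ n * (2 * c * (1/8) ^ n)"
        using dle by (intro add_left_mono mult_left_mono) auto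
      also have "(2::real) ^ n * (2 * c * (1/8) ^ n) = 2 * c * (1/4) ^ n"
      proof -
        have "(2::real) ^ n * (1/8) ^ n = (1/4) ^ n" unfolding power_mult_distrib[symmetric] by simp
        then show ?thesis by (simp add: mult_ac)
      qed
      finally show ?thesis .
    qed
    have "(\<lambda>n. (1/2) ^ n * S + 2 * c * (1/4) ^ n) \<longlonglongrightarrow> 0 * S + 2 * c * 0"
      by (intro tendsto_intros LIMSEQ_power_zero) auto
    then have "(\<lambda>n. (1/2) ^ n * S + 2 * c * (1/4) ^ n) \<longlonglongrightarrow> 0" by simp
    then have "(\<lambda>n. (LB x. u' n (t, x) * h x) - (LB x. u (t, x) * h x)) \<longlonglongrightarrow> 0"
      by (rule Lim_null_comparison[OF always_eventually, rotated]) (use est in blast)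
    then show "(\<lambda>n. LB x. u' n (t, x) * h x) \<longlonglongrightarrow> (LB x. u (t, x) * h x)"
      by (simp add: LIM_zero_iff)
  qed
  show ?thesis
    using um ubound dual unfolding c_def NF_def by blast
qed

text \<open>The inverse transform is (2 pi)^(-d) times the function of
  \<open>L2_fourier_family\<close>; the defining identity is duality combined with the inversion
  formula for the Schwartz test function. The index t will be time.\<close>

lemma L2_fourier_inverse_family:
  fixes F :: "'a::euclidean_space \<Rightarrow> complex" and p :: "'b::euclidean_space \<Rightarrow> 'a \<Rightarrow> complex"
  assumes F: "in_L2 F" and p: "case_prod p \<in> borel_measurable (borel \<Otimes>\<^sub>M borel)" and p1: "\<And>t \<xi>. cmod (p t \<xi>) \<le> 1"
  shows "\<exists>v \<in> borel_measurable borel. \<forall>t. is_fourier_transform (\<lambda>x. v (t, x)) (\<lambda>\<xi>. p t \<xi> * F \<xi>) \<and>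
    ennreal ((2 * pi) ^ DIM('a)) * (L2sq (\<lambda>x. v (t, x))) \<le> L2sq F"
proof -
  have Fm[measurable]: "borel_fun F" using F by (simp add: in_L2_def)
  have pm[measurable]: "borel_fun (p t)" for t
  proof -
    have "borel_fun (\<lambda>x. case_prod p (t, x))" using p by measurable
    then show ?thesis by simp
  qed
  define c where "c = (2 * pi) ^ DIM('a)"
  have c0: "c > 0" by (simp add: c_def)
  define NF where "NF = L2sq F"
  have NF: "NF < \<infinity>" using F by (simp add: NF_def in_L2_iff)
  obtain u where um[measurable]: "borel_fun u"
    and ub: "\<And>t. (L2sq (\<lambda>x. u (t, x))) \<le> ennreal c * NF"
    and ud: "\<And>t r. integrable lborel r \<Longrightarrow> in_L2 r \<Longrightarrow> (LB x. u (t, x) * r x) = (LB \<xi>. p t \<xi> * F \<xi> * FI r \<xi>)"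
    using L2_fourier_family[OF F p p1] unfolding c_def NF_def by blast
  define v where "v z = of_real (1 / c) * u z" for z
  have vm[measurable]: "borel_fun v" unfolding v_def[abs_def] by measurable
  have vb: "ennreal c * (L2sq (\<lambda>x. v (t, x))) \<le> NF" for t
  proof -
    have e: "nsq (v (t, x)) = (1 / c\<^sup>2) * nsq (u (t, x))" for x
      using c0 by (simp add: v_def norm_mult norm_divide power_mult_distrib power_divide)
    have "ennreal c * (L2sq (\<lambda>x. v (t, x))) = ennreal c * (ennreal (1 / c\<^sup>2) * (L2sq (\<lambda>x. u (t, x))))"
      unfolding e by (subst nn_integral_cmult[symmetric]) (auto simp: ennreal_mult[symmetric])
    also have "\<dots> \<le> ennreal c * (ennreal (1 / c\<^sup>2) * (ennreal c * NF))"
      by (intro mult_left_mono ub) auto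
    also have "\<dots> = ennreal (c * (1 / c\<^sup>2) * c) * NF"
      using c0 by (simp add: ennreal_mult mult.assoc del: times_divide_eq_left times_divide_eq_right)
    also have "c * (1 / c\<^sup>2) * c = 1" using c0 by (simp add: power2_eq_square)
    finally show ?thesis by simp
  qed
  have vL2: "in_L2 (\<lambda>x. v (t, x))" for t
  proof -
    have "ennreal c * (L2sq (\<lambda>x. v (t, x))) < \<infinity>" using vb NF by (rule le_less_trans)
    then have "(L2sq (\<lambda>x. v (t, x))) < \<infinity>" using c0 by (auto simp: ennreal_mult_less_top)
    then show ?thesis unfolding in_L2_iff by simp
  qed
  have pFL2: "in_L2 (\<lambda>\<xi>. p t \<xi> * F \<xi>)" for t
    unfolding in_L2_def
  proof
    show "integrable lborel (\<lambda>x. nsq (p t x * F x))"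
    proof (rule integrable_dominated)
      show "integrable lborel (\<lambda>x. nsq (F x))" using F by (simp add: in_L2_def)
      show "AE x in lborel. norm (nsq (p t x * F x)) \<le> norm (nsq (F x))"
        using p1[of t] by (intro AE_I2) (auto simp: norm_mult power_mult_distrib mult_left_le_one_le power_le_one)
    qed simp
  qed simp
  have "is_fourier_transform (\<lambda>x. v (t, x)) (\<lambda>\<xi>. p t \<xi> * F \<xi>)" for t
    unfolding is_fourier_transform_def
  proof (intro conjI allI impI)
    fix \<psi> :: "'a \<Rightarrow> complex" assume s: "schwartz \<psi>"
    show "integrable lborel (\<lambda>\<xi>. p t \<xi> * F \<xi> * \<psi> \<xi>)"
      by (rule in_L2_mult_integrable[OF pFL2 schwartz_in_L2[OF s]])
    show "integrable lborel (\<lambda>x. v (t, x) * fourier_integral \<psi> x)"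
      by (rule in_L2_mult_integrable[OF vL2 schwartz_fourier_in_L2[OF s]])
    have "(LB x. v (t, x) * fourier_integral \<psi> x) = of_real (1 / c) * (LB x. u (t, x) * fourier_integral \<psi> x)"
      unfolding v_def mult.assoc by (rule integral_mult_right_zero)
    also have "\<dots> = of_real (1 / c) * (LB \<xi>. p t \<xi> * F \<xi> * FI (fourier_integral \<psi>) \<xi>)"
      using ud[OF schwartz_fourier_integrable[OF s] schwartz_fourier_in_L2[OF s]] by simp
    also have "\<dots> = (LB \<xi>. of_real (1 / c) * (p t \<xi> * F \<xi> * FI (fourier_integral \<psi>) \<xi>))"
      by (rule integral_mult_right_zero[symmetric])
    also have "\<dots> = (LB \<xi>. p t \<xi> * F \<xi> * \<psi> \<xi>)"
      unfolding schwartz_fourier_inversion[OF s] c_def[symmetric] using c0 by (simp add: mult.assoc)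
    finally show "(LB \<xi>. p t \<xi> * F \<xi> * \<psi> \<xi>) = (LB x. v (t, x) * fourier_integral \<psi> x)" ..
  qed simp_all
  then show ?thesis using vm vb unfolding c_def NF_def by blast
qed

lemma L2_fourier_inverse:
  fixes F :: "'a::euclidean_space \<Rightarrow> complex"
  assumes F: "in_L2 F"
  shows "\<exists>v. is_fourier_transform v F \<and>
    ennreal ((2 * pi) ^ DIM('a)) * (L2sq v) \<le> L2sq F"
proof -
  obtain v where "\<forall>t::real. is_fourier_transform (\<lambda>x. v (t, x)) (\<lambda>\<xi>. 1 * F \<xi>) \<and>
    ennreal ((2 * pi) ^ DIM('a)) * (L2sq (\<lambda>x. v (t, x))) \<le> L2sq F"
    using L2_fourier_inverse_family[OF F, of "\<lambda>(t::real) \<xi>. 1"] by auto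
  then show ?thesis by (intro exI[of _ "\<lambda>x. v (0, x)"]) simp
qed

lemma L2_fourier:
  fixes F :: "'a::euclidean_space \<Rightarrow> complex"
  assumes F: "in_L2 F"
  shows "\<exists>g. is_fourier_transform F g \<and> in_L2 g \<and>
    (L2sq g) \<le> ennreal ((2 * pi) ^ DIM('a)) * L2sq F"
proof -
  have [measurable]: "borel_fun F" using F by (simp add: in_L2_def)
  obtain u where um[measurable]: "borel_fun u"
    and ub: "\<And>t::real. (L2sq (\<lambda>x. u (t, x))) \<le> ennreal ((2 * pi) ^ DIM('a)) * L2sq F"
    and ud: "\<And>(t::real) \<rho>. integrable lborel \<rho> \<Longrightarrow> in_L2 \<rho> \<Longrightarrow> (LB x. u (t, x) * \<rho> x) = (LB \<xi>. 1 * F \<xi> * FI \<rho> \<xi>)"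
    using L2_fourier_family[OF F, of "\<lambda>(t::real) \<xi>. 1"] by auto
  define g where "g x = u (0, - x)" for x
  have gm[measurable]: "borel_fun g" unfolding g_def[abs_def] by measurable
  have gb: "L2sq g \<le> ennreal ((2 * pi) ^ DIM('a)) * L2sq F"
    unfolding g_def using ub[of 0] nn_integral_lborel_uminus[of "\<lambda>x. ennreal (nsq (u (0, x)))"] by simp
  have "L2sq g < \<infinity>"
    by (rule le_less_trans[OF gb]) (use F in \<open>simp add: in_L2_iff ennreal_mult_less_top\<close>)
  then have g2: "in_L2 g" unfolding in_L2_iff by simp
  have "is_fourier_transform F g"
    unfolding is_fourier_transform_def
  proof (intro conjI allI impI)
    fix \<psi> :: "'a \<Rightarrow> complex" assume s: "schwartz \<psi>"
    note [measurable] = schwartz_measurable[OF s]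
    show "integrable lborel (\<lambda>\<xi>. g \<xi> * \<psi> \<xi>)"
      by (rule in_L2_mult_integrable[OF g2 schwartz_in_L2[OF s]])
    show "integrable lborel (\<lambda>x. F x * fourier_integral \<psi> x)"
      by (rule in_L2_mult_integrable[OF F schwartz_fourier_in_L2[OF s]])
    define \<rho> where "\<rho> x = \<psi> (- x)" for x
    have r1: "integrable lborel \<rho>" unfolding \<rho>_def by (intro integrable_lborel_uminus schwartz_integrable0 s)
    have r2: "in_L2 \<rho>" unfolding \<rho>_def in_L2_def
      using schwartz_in_L2[OF s] by (auto simp: in_L2_def intro!: integrable_lborel_uminus)
    have "(LB \<xi>. g \<xi> * \<psi> \<xi>) = (LB \<xi>. u (0, - \<xi>) * \<rho> (- \<xi>))"
      by (simp add: g_def \<rho>_def)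
    also have "\<dots> = (LB \<xi>. u (0, \<xi>) * \<rho> \<xi>)"
      by (rule integral_lborel_uminus) (simp add: \<rho>_def[abs_def])
    also have "\<dots> = (LB x. F x * FI \<rho> x)"
      using ud[OF r1 r2] by simp
    also have "\<dots> = (LB x. F x * fourier_integral \<psi> x)"
      unfolding \<rho>_def FI_reflect[OF schwartz_measurable[OF s]] ..
    finally show "(LB \<xi>. g \<xi> * \<psi> \<xi>) = (LB x. F x * fourier_integral \<psi> x)" .
  qed simp_all
  then show ?thesis using g2 gb by blast
qed

lemma nn_integral_square_cong_AE:
  "AE x in lborel. f x = g x \<Longrightarrow> (L2sq f) = L2sq g"
  by (rule nn_integral_cong_AE) auto

text \<open>By uniqueness, g and f agree almost everywhere with the functions that
  \<open>L2_fourier\<close> and \<open>L2_fourier_inverse\<close> construct. Each construction comes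
  with one inequality between the norms; the two have the same constant in opposite directions and
  force equality.\<close>

theorem plancherel:
  fixes f g :: "'a::euclidean_space \<Rightarrow> complex"
  assumes fg: "is_fourier_transform f g"
  shows "in_L2 f \<longleftrightarrow> in_L2 g"
    and "in_L2 g \<Longrightarrow> (LB x. nsq (g x)) = (2 * pi) ^ DIM('a) * (LB x. nsq (f x))"
proof -
  let ?c = "(2 * pi) ^ DIM('a)"
  let ?N = "\<lambda>f::'a \<Rightarrow> complex. L2sq f"
  have A: "in_L2 g \<and> ?N g \<le> ennreal ?c * ?N f" if f: "in_L2 f"
  proof -
    obtain h where h: "is_fourier_transform f h" "in_L2 h" "?N h \<le> ennreal ?c * ?N f"
      using L2_fourier[OF f] by blast
    have "?N g = ?N h" by (rule nn_integral_square_cong_AE[OF is_fourier_transform_unique[OF fg h(1)]])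
    then show ?thesis using h is_fourier_transformD(2)[OF fg] by (simp add: in_L2_iff)
  qed
  have B: "in_L2 f \<and> ennreal ?c * ?N f \<le> ?N g" if g: "in_L2 g"
  proof -
    obtain h where h: "is_fourier_transform h g" "ennreal ?c * ?N h \<le> ?N g"
      using L2_fourier_inverse[OF g] by blast
    have e: "?N f = ?N h" by (rule nn_integral_square_cong_AE[OF is_fourier_transform_inverse_unique[OF fg h(1)]])
    have "ennreal ?c * ?N h < \<infinity>" using g h(2) by (auto simp: in_L2_iff intro: le_less_trans)
    then have "?N h < \<infinity>" by (auto simp: ennreal_mult_less_top)
    then show ?thesis using h e is_fourier_transformD(1)[OF fg] by (simp add: in_L2_iff)
  qed
  show "in_L2 f \<longleftrightarrow> in_L2 g" using A B by blast
  assume g: "in_L2 g"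
  then have f: "in_L2 f" using B by blast
  have "ennreal (LB x. nsq (g x)) = ennreal (?c * (LB x. nsq (f x)))"
    using A[OF f] B[OF g] unfolding in_L2_nn_integral[OF f] in_L2_nn_integral[OF g]
    by (simp add: ennreal_mult integral_nonneg_AE antisym)
  then show "(LB x. nsq (g x)) = ?c * (LB x. nsq (f x))"
    by (simp add: integral_nonneg_AE)
qed

lemma measurable_cnj [measurable (raw)]: "f \<in> borel_measurable M \<Longrightarrow> (\<lambda>x. cnj (f x)) \<in> borel_measurable M"
  by (rule measurable_compose[OF _ borel_measurable_continuous_onI[OF continuous_on_cnj[OF continuous_on_id]]])

lemma in_L2_cnj: "in_L2 f \<Longrightarrow> in_L2 (\<lambda>x. cnj (f x))"
  by (simp add: in_L2_def measurable_cnj)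

lemma L2_translate_product:
  assumes F: "in_L2 F"
  shows "in_L2 (\<lambda>\<eta>. F (\<eta> - \<xi>))" "integrable lborel (\<lambda>\<eta>. F \<eta> * cnj (F (\<eta> - \<xi>)))"
    "(LB \<eta>. cmod (F \<eta> * cnj (F (\<eta> - \<xi>)))) \<le> (LB \<eta>. nsq (F \<eta>))"
proof -
  have F2: "integrable lborel (\<lambda>x. nsq (F x))" using F by (simp add: in_L2_def)
  have shift: "in_L2 (\<lambda>\<eta>. F (\<eta> - \<xi>))" "(LB \<eta>. nsq (F (\<eta> - \<xi>))) = (LB \<eta>. nsq (F \<eta>))"
    using F integrable_lborel_shift[OF F2, of "- \<xi>"] integral_lborel_shift[of "\<lambda>x. nsq (F x)" "- \<xi>"] by (auto simp: in_L2_def)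
  show "in_L2 (\<lambda>\<eta>. F (\<eta> - \<xi>))" by fact
  show i: "integrable lborel (\<lambda>\<eta>. F \<eta> * cnj (F (\<eta> - \<xi>)))" by (intro in_L2_mult_integrable in_L2_cnj F shift)
  have "(LB \<eta>. cmod (F \<eta> * cnj (F (\<eta> - \<xi>)))) \<le> (LB \<eta>. (1/2) * nsq (F \<eta>) + (1/2) * nsq (F (\<eta> - \<xi>)))"
  proof (rule Bochner_Integration.integral_mono)
    show "integrable lborel (\<lambda>\<eta>. (1/2) * nsq (F \<eta>) + (1/2) * nsq (F (\<eta> - \<xi>)))"
      using F2 shift(1) by (simp add: in_L2_def)
    show "cmod (F \<eta> * cnj (F (\<eta> - \<xi>))) \<le> (1/2) * nsq (F \<eta>) + (1/2) * nsq (F (\<eta> - \<xi>))" for \<eta>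
      using sum_squares_bound[of "cmod (F \<eta>)" "cmod (F (\<eta> - \<xi>))"] by (simp add: norm_mult)
  qed (intro integrable_norm i)
  also have "\<dots> = (LB \<eta>. nsq (F \<eta>))" using F2 shift by (simp add: in_L2_def)
  finally show "(LB \<eta>. cmod (F \<eta> * cnj (F (\<eta> - \<xi>)))) \<le> (LB \<eta>. nsq (F \<eta>))" .
qed

lemma in_L2_add_scale:
  assumes f: "in_L2 f" and g: "in_L2 g"
  shows "in_L2 (\<lambda>x. f x + c * g x)"
  unfolding in_L2_def
proof
  have [measurable]: "borel_fun f" "borel_fun g" using f g by (auto simp: in_L2_def)
  show "borel_fun (\<lambda>x. f x + c * g x)" by measurable
  show "integrable lborel (\<lambda>x. nsq (f x + c * g x))"
  proof (rule integrable_dominated)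
    show "integrable lborel (\<lambda>x. 2 * nsq (f x) + 2 * nsq c * nsq (g x))"
      using f g by (auto simp: in_L2_def)
    show "AE x in lborel. norm (nsq (f x + c * g x)) \<le> norm (2 * nsq (f x) + 2 * nsq c * nsq (g x))" (is "AE x in _. ?P x")
    proof (rule AE_I2)
      fix x
      have "nsq (f x + c * g x) \<le> (cmod (f x) + cmod c * cmod (g x))\<^sup>2"
        using norm_triangle_ineq[of "f x" "c * g x"] by (intro power_mono) (auto simp: norm_mult)
      also have "\<dots> \<le> 2 * nsq (f x) + 2 * (cmod c * cmod (g x))\<^sup>2"
        using sum_squares_bound[of "cmod (f x)" "cmod c * cmod (g x)"] by (simp add: power2_sum)
      finally show "?P x"
        by (simp add: power_mult_distrib)
    qed
  qed measurable
qed

lemma L2_norm_add_scale: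
  assumes f: "in_L2 f" and g: "in_L2 g"
  shows "(LB x. nsq (f x + c * g x)) =
    (LB x. nsq (f x)) + nsq c * (LB x. nsq (g x)) + 2 * Re (cnj c * (LB x. f x * cnj (g x)))"
proof -
  note i = in_L2_mult_integrable[OF f in_L2_cnj[OF g]]
  have fi: "integrable lborel (\<lambda>x. nsq (f x))" "integrable lborel (\<lambda>x. nsq (g x))"
    using f g by (auto simp: in_L2_def)
  have e: "nsq (f x + c * g x) = nsq (f x) + nsq c * nsq (g x) + 2 * Re (cnj c * (f x * cnj (g x)))" for x
    unfolding cmod_power2 by (simp add: power2_eq_square algebra_simps)
  have i': "integrable lborel (\<lambda>x. cnj c * (f x * cnj (g x)))" using i by (rule integrable_mult_right)
  have r: "(LB x. Re (cnj c * (f x * cnj (g x)))) = Re (cnj c * (LB x. f x * cnj (g x)))"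
    using i' by (subst integral_Re) auto
  have ri: "integrable lborel (\<lambda>x. Re (cnj c * (f x * cnj (g x))))" using i' by (rule integrable_Re)
  define R where "R x = Re (cnj c * (f x * cnj (g x)))" for x
  show ?thesis
    unfolding e r[symmetric] R_def[symmetric] using fi ri[folded R_def] by simp
qed

text \<open>Plancherel for f1 + c f2 determines the real part of cnj c times the inner product; c =
  1 and c = \<i> give its real and imaginary part.\<close>

lemma plancherel_polarized:
  fixes f1 g1 :: "'a::euclidean_space \<Rightarrow> complex"
  assumes F1: "is_fourier_transform f1 g1" and F2: "is_fourier_transform f2 g2" and g: "in_L2 g1" "in_L2 g2"
  shows "(LB x. g1 x * cnj (g2 x)) = of_real ((2 * pi) ^ DIM('a)) * (LB x. f1 x * cnj (f2 x))"
proof -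
  let ?c = "(2 * pi) ^ DIM('a)"
  have f: "in_L2 f1" "in_L2 f2" using plancherel(1)[OF F1] plancherel(1)[OF F2] g by auto
  define P Q where "P = (LB x. g1 x * cnj (g2 x))" and "Q = (LB x. f1 x * cnj (f2 x))"
  have "Re (cnj c * P) = ?c * Re (cnj c * Q)" for c
    using plancherel(2)[OF is_fourier_transform_add_scale[OF F1 F2, of c] in_L2_add_scale[OF g, of c]]
      plancherel(2)[OF F1 g(1)] plancherel(2)[OF F2 g(2)]
    unfolding L2_norm_add_scale[OF g] L2_norm_add_scale[OF f] P_def[symmetric] Q_def[symmetric]
    by (simp add: algebra_simps)
  from this[of 1] this[of \<i>] have "P = of_real ?c * Q"
    by (simp add: complex_eq_iff)
  then show ?thesis by (simp add: P_def Q_def)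
qed

text \<open>Multiplication of v by exp(i x . xi) translates V by xi, so polarised Plancherel for V
  and its translate expresses the transform of |v|^2 as an autocorrelation.\<close>

lemma fourier_autocorrelation:
  fixes v V :: "'a::euclidean_space \<Rightarrow> complex"
  assumes V: "is_fourier_transform v V" and V2: "in_L2 V"
  shows "(LB \<eta>. V \<eta> * cnj (V (\<eta> - \<xi>))) = of_real ((2 * pi) ^ DIM('a)) * fourier_integral (\<lambda>x. of_real (nsq (v x))) \<xi>"
proof -
  have "(LB \<eta>. V \<eta> * cnj (V (\<eta> - \<xi>))) = of_real ((2 * pi) ^ DIM('a)) * (LB x. v x * cnj (iexp (x \<bullet> \<xi>) * v x))"
    by (rule plancherel_polarized[OF V is_fourier_transform_modulate[OF V] V2 L2_translate_product(1)[OF V2]])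
  also have "(LB x. v x * cnj (iexp (x \<bullet> \<xi>) * v x)) = fourier_integral (\<lambda>x. of_real (nsq (v x))) \<xi>"
    unfolding fourier_integral_def
    by (rule LB_cong) (simp add: exp_cnj complex_norm_square[symmetric] mult_ac)
  finally show ?thesis .
qed

text \<open>All images of f under the symbol have the transform m g up to null sets, so the choice
  made in \<open>multiplier\<close> does not influence the norm.\<close>

lemma multiplier_L2:
  fixes f g :: "'a::euclidean_space \<Rightarrow> complex"
  assumes fg: "is_fourier_transform f g" and [measurable]: "borel_fun m"
  shows "multiplier_dom m f \<longleftrightarrow> in_L2 (\<lambda>\<xi>. m \<xi> * g \<xi>)"
    and "in_L2 (\<lambda>\<xi>. m \<xi> * g \<xi>) \<Longrightarrow>
      (L2_norm (multiplier m f))\<^sup>2 = (LB \<xi>. nsq (m \<xi> * g \<xi>)) / (2 * pi) ^ DIM('a)"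
proof -
  have [measurable]: "borel_fun g" by (rule is_fourier_transformD(2)[OF fg])
  have img: "is_fourier_transform h (\<lambda>\<xi>. m \<xi> * g \<xi>)" if "is_multiplier_image m f h" for h
  proof -
    obtain g' where g': "is_fourier_transform f g'" "is_fourier_transform h (\<lambda>\<xi>. m \<xi> * g' \<xi>)"
      using \<open>is_multiplier_image m f h\<close> unfolding is_multiplier_image_def by blast
    show ?thesis
      by (rule is_fourier_transform_cong_AE[OF g'(2) is_fourier_transformD(1)[OF g'(2)]])
        (use is_fourier_transform_unique[OF g'(1) fg] in auto)
  qed
  have ex: "\<exists>h. in_L2 h \<and> is_multiplier_image m f h" if mg: "in_L2 (\<lambda>\<xi>. m \<xi> * g \<xi>)"
  proof -
    obtain h where h: "is_fourier_transform h (\<lambda>\<xi>. m \<xi> * g \<xi>)" using L2_fourier_inverse[OF mg] by blast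
    then show ?thesis using plancherel(1)[OF h] mg fg unfolding is_multiplier_image_def by blast
  qed
  show "multiplier_dom m f \<longleftrightarrow> in_L2 (\<lambda>\<xi>. m \<xi> * g \<xi>)"
    using ex img plancherel(1) unfolding multiplier_dom_def by blast
  assume mg: "in_L2 (\<lambda>\<xi>. m \<xi> * g \<xi>)"
  have "is_multiplier_image m f (multiplier m f)"
    unfolding multiplier_def using someI_ex[OF ex[OF mg]] by blast
  from plancherel(2)[OF img[OF this] mg]
  show "(L2_norm (multiplier m f))\<^sup>2 = (LB \<xi>. nsq (m \<xi> * g \<xi>)) / (2 * pi) ^ DIM('a)"
    unfolding L2_norm_def by (simp add: integral_nonneg_AE)
qed

lemma fourier_integral_duality:
  assumes f: "integrable lborel f" and g: "integrable lborel g"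
  shows "(LB x. f x * fourier_integral g x) = (LB \<xi>. fourier_integral f \<xi> * g \<xi>)"
proof -
  have m[measurable]: "borel_fun g" "borel_fun (FI f)"
    using f g by auto
  have "(LB x. f x * fourier_integral g x) = (LB x. f x * FI (\<lambda>y. g (- y)) x)"
    unfolding FI_reflect[OF m(1)] ..
  also have "\<dots> = (LB \<xi>. FI f \<xi> * g (- \<xi>))"
    by (rule FI_duality(2)[OF f integrable_lborel_uminus[OF g], symmetric])
  also have "\<dots> = (LB \<xi>. FI f (- \<xi>) * g (- (- \<xi>)))"
    by (rule integral_lborel_uminus[symmetric]) measurable
  finally show ?thesis by (simp add: fourier_integral_FI)
qed

lemma norm_fourier_integral_le:
  "integrable lborel f \<Longrightarrow> cmod (fourier_integral f \<xi>) \<le> (LB x. cmod (f x))"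
  unfolding fourier_integral_FI by (rule norm_FI_le)

section \<open>The Fourier transform of the Klein--Gordon density\<close>

text \<open>The transform in tau only. The density |u|^2 is integrable in x with a bound uniform in
  t, so integrability in t has to come from the test function, whose transform in tau
  decays.\<close>

definition time_fourier :: "(real \<times> 'a::euclidean_space \<Rightarrow> complex) \<Rightarrow> real \<Rightarrow> 'a \<Rightarrow> complex" where
  "time_fourier \<psi> t \<xi> = fourier_integral (\<lambda>\<tau>. \<psi> (\<tau>, \<xi>)) t"

lemma schwartz_slice_decay:
  fixes \<psi> :: "real \<times> 'a::euclidean_space \<Rightarrow> complex"
  assumes s: "schwartz \<psi>"
  shows "\<exists>C\<ge>0. \<forall>\<tau> \<xi>. cmod (iterated_partial (replicate m (1, 0)) \<psi> (\<tau>, \<xi>)) \<le> C * (1 / (1 + norm \<xi>) ^ N) * (1 / (1 + norm \<tau>) ^ 2)"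
proof -
  have l: "replicate m ((1, 0) :: real \<times> 'a) \<in> lists Basis"
    by (induction m) (auto simp: Basis_prod_def)
  obtain C where C: "C \<ge> 0" "\<And>z. cmod (iterated_partial (replicate m (1, 0)) \<psi> z) \<le> C * (1 / (1 + norm z) ^ (N + 2))"
    using schwartz_decay[OF s l] by blast
  have "cmod (iterated_partial (replicate m (1, 0)) \<psi> (\<tau>, \<xi>)) \<le> C * (1 / (1 + norm \<xi>) ^ N) * (1 / (1 + norm \<tau>) ^ 2)" for \<tau> \<xi>
  proof -
    have "norm \<tau> \<le> norm (\<tau>, \<xi>)" "norm \<xi> \<le> norm (\<tau>, \<xi>)"
      by (auto simp: norm_Pair intro: real_le_rsqrt)
    then have "(1 + norm \<xi>) ^ N * (1 + norm \<tau>) ^ 2 \<le> (1 + norm (\<tau>, \<xi>)) ^ N * (1 + norm (\<tau>, \<xi>)) ^ 2"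
      by (intro mult_mono power_mono) auto
    then have "1 / (1 + norm (\<tau>, \<xi>)) ^ (N + 2) \<le> 1 / ((1 + norm \<xi>) ^ N * (1 + norm \<tau>) ^ 2)"
      unfolding power_add by (intro divide_left_mono mult_pos_pos zero_less_power add_pos_nonneg) auto
    from order_trans[OF C(2) mult_left_mono[OF this C(1)]] show ?thesis by simp
  qed
  then show ?thesis using C(1) by blast
qed

lemma time_fourier_derivative:
  fixes \<psi> :: "real \<times> 'a::euclidean_space \<Rightarrow> complex"
  assumes s: "schwartz \<psi>"
  shows "FI (\<lambda>\<tau>. iterated_partial (replicate (Suc m) (1, 0)) \<psi> (\<tau>, \<xi>)) t = - \<i> * of_real t * FI (\<lambda>\<tau>. iterated_partial (replicate m (1, 0)) \<psi> (\<tau>, \<xi>)) t"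
proof -
  have l: "replicate m ((1, 0) :: real \<times> 'a) \<in> lists Basis" for m
    by (induction m) (auto simp: Basis_prod_def)
  obtain C where C: "C \<ge> 0" "\<And>\<tau>. cmod (iterated_partial (replicate m (1, 0)) \<psi> (\<tau>, \<xi>)) \<le> C * (1 / (1 + norm \<tau>) ^ 2)"
    using schwartz_slice_decay[OF s, of m 0] by auto
  obtain D where D: "D \<ge> 0" "\<And>\<tau>. cmod (iterated_partial (replicate (Suc m) (1, 0)) \<psi> (\<tau>, \<xi>)) \<le> D * (1 / (1 + norm \<tau>) ^ 2)"
    using schwartz_slice_decay[OF s, of "Suc m" 0] by auto
  have mono: "C * (1 / (1 + norm x) ^ 2) \<le> (C + D) * (1 / (1 + norm x) ^ 2)"
    "D * (1 / (1 + norm x) ^ 2) \<le> (C + D) * (1 / (1 + norm x) ^ 2)" for x :: real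
    using C(1) D(1) by (intro mult_right_mono; simp)+
  note [measurable] = schwartz_partial_measurable[OF s l]
  have "FI (\<lambda>\<tau>. iterated_partial (replicate (Suc m) (1, 0)) \<psi> (\<tau>, \<xi>)) t = - \<i> * of_real (t \<bullet> 1) * FI (\<lambda>\<tau>. iterated_partial (replicate m (1, 0)) \<psi> (\<tau>, \<xi>)) t"
  proof (rule FI_directional_derivative)
    show "norm (1::real) = 1" "C + D \<ge> 0" using C(1) D(1) by simp_all
    show "((\<lambda>t. iterated_partial (replicate m (1, 0)) \<psi> (x + t *\<^sub>R 1, \<xi>)) has_vector_derivative iterated_partial (replicate (Suc m) (1, 0)) \<psi> (x + t *\<^sub>R 1, \<xi>)) (at t)" for x t
      using schwartz_directional_derivative[OF s l, of m "(x, \<xi>)" "(1, 0)" t] by simp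
    show "cmod (iterated_partial (replicate m (1, 0)) \<psi> (x, \<xi>)) \<le> (C + D) * (1 / (1 + norm x) ^ (2 * DIM(real)))" for x
      using order_trans[OF C(2) mono(1)] by simp
    show "cmod (iterated_partial (replicate (Suc m) (1, 0)) \<psi> (x, \<xi>)) \<le> (C + D) * (1 / (1 + norm x) ^ (2 * DIM(real)))" for x
      using order_trans[OF D(2) mono(2)] by simp
    show "borel_fun (\<lambda>\<tau>. iterated_partial (replicate m (1, 0)) \<psi> (\<tau>, \<xi>))"
      "borel_fun (\<lambda>\<tau>. iterated_partial (replicate (Suc m) (1, 0)) \<psi> (\<tau>, \<xi>))"
      by measurable
  qed
  then show ?thesis by simp
qed

lemma schwartz_slice:
  fixes \<psi> :: "real \<times> 'a::euclidean_space \<Rightarrow> complex"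
  assumes s: "schwartz \<psi>"
  shows "integrable lborel (\<lambda>\<tau>. \<psi> (\<tau>, \<xi>))" "continuous_on UNIV (\<lambda>\<tau>. \<psi> (\<tau>, \<xi>))" "borel_fun (\<lambda>\<tau>. \<psi> (\<tau>, \<xi>))"
proof -
  note [measurable] = schwartz_measurable[OF s]
  show "borel_fun (\<lambda>\<tau>. \<psi> (\<tau>, \<xi>))" by measurable
  obtain C where C: "\<And>\<tau>. cmod (\<psi> (\<tau>, \<xi>)) \<le> C * (1 / (1 + norm \<tau>) ^ 2)"
    using schwartz_slice_decay[OF s, of 0 0] by auto
  show "integrable lborel (\<lambda>\<tau>. \<psi> (\<tau>, \<xi>))" by (rule integrable_decay[OF _ C]) auto
  show "continuous_on UNIV (\<lambda>\<tau>. \<psi> (\<tau>, \<xi>))"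
    by (rule continuous_on_compose2[OF schwartz_continuous0[OF s]]) (auto intro!: continuous_intros)
qed

text \<open>Two derivatives in tau produce a factor t^2; together with the bound without derivatives
  they give 1 + t^2. The decay in xi is inherited from \<psi> and its derivatives.\<close>

lemma time_fourier_decay:
  fixes \<psi> :: "real \<times> 'a::euclidean_space \<Rightarrow> complex"
  assumes s: "schwartz \<psi>"
  shows "\<exists>K\<ge>0. \<forall>t \<xi>. cmod (time_fourier \<psi> t \<xi>) \<le> K * (1 / (1 + t\<^sup>2)) * (1 / (1 + norm \<xi>) ^ N)"
proof -
  let ?D = "\<lambda>m \<xi> \<tau>. iterated_partial (replicate m (1, 0)) \<psi> (\<tau>, \<xi>)"
  have l: "replicate m ((1, 0) :: real \<times> 'a) \<in> lists Basis" for m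
    by (induction m) (auto simp: Basis_prod_def)
  note [measurable] = schwartz_partial_measurable[OF s l]
  define J where "J = (LB \<tau>. 1 / (1 + norm (\<tau>::real)) ^ 2)"
  have Ji: "integrable lborel (\<lambda>\<tau>::real. 1 / (1 + norm \<tau>) ^ 2)" by (rule integrable_inverse_1_plus_norm) simp
  have J0: "J \<ge> 0" unfolding J_def by (simp add: integral_nonneg_AE)
  have bound: "\<exists>C\<ge>0. \<forall>t \<xi>. cmod (FI (?D m \<xi>) t) \<le> C * (1 / (1 + norm \<xi>) ^ N)" for m
  proof -
    obtain C where C: "C \<ge> 0" "\<And>\<tau> \<xi>. cmod (?D m \<xi> \<tau>) \<le> C * (1 / (1 + norm \<xi>) ^ N) * (1 / (1 + norm \<tau>) ^ 2)"
      using schwartz_slice_decay[OF s] by blast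
    have "cmod (FI (?D m \<xi>) t) \<le> (C * J) * (1 / (1 + norm \<xi>) ^ N)" for t \<xi>
    proof -
      have i: "integrable lborel (?D m \<xi>)"
        by (rule integrable_decay[where n=2 and C="C * (1 / (1 + norm \<xi>) ^ N)"]) (use C(2) in auto)
      have "cmod (FI (?D m \<xi>) t) \<le> (LB \<tau>. cmod (?D m \<xi> \<tau>))" by (rule norm_FI_le[OF i])
      also have "\<dots> \<le> (LB \<tau>::real. C * (1 / (1 + norm \<xi>) ^ N) * (1 / (1 + norm \<tau>) ^ 2))"
        by (rule Bochner_Integration.integral_mono[OF integrable_norm[OF i] integrable_mult_right[OF Ji] C(2)])
      also have "\<dots> = (C * J) * (1 / (1 + norm \<xi>) ^ N)" unfolding J_def by (simp only: integral_mult_right_zero mult_ac)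
      finally show ?thesis .
    qed
    then show ?thesis using C(1) J0 by (intro exI[of _ "C * J"]) auto
  qed
  obtain A where A: "A \<ge> 0" "\<And>t \<xi>. cmod (FI (?D 0 \<xi>) t) \<le> A * (1 / (1 + norm \<xi>) ^ N)" using bound[of 0] by blast
  obtain B where B: "B \<ge> 0" "\<And>t \<xi>. cmod (FI (?D 2 \<xi>) t) \<le> B * (1 / (1 + norm \<xi>) ^ N)" using bound[of 2] by blast
  have "cmod (time_fourier \<psi> t \<xi>) \<le> (A + B) * (1 / (1 + t\<^sup>2)) * (1 / (1 + norm \<xi>) ^ N)" for t \<xi>
  proof -
    have e: "time_fourier \<psi> t \<xi> = FI (?D 0 \<xi>) (- t)" by (simp add: time_fourier_def fourier_integral_FI)
    have "FI (?D 2 \<xi>) (- t) = of_real (- (t\<^sup>2)) * FI (?D 0 \<xi>) (- t)"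
      using time_fourier_derivative[OF s, of 0 \<xi> "- t"] time_fourier_derivative[OF s, of "Suc 0" \<xi> "- t"]
      by (simp add: numeral_2_eq_2 power2_eq_square mult_ac)
    then have "t\<^sup>2 * cmod (time_fourier \<psi> t \<xi>) \<le> B * (1 / (1 + norm \<xi>) ^ N)"
      using B(2)[of \<xi> "- t"] by (simp add: e norm_mult norm_power)
    moreover have "cmod (time_fourier \<psi> t \<xi>) \<le> A * (1 / (1 + norm \<xi>) ^ N)"
      using A(2)[of \<xi> "- t"] by (simp add: e)
    ultimately have "(1 + t\<^sup>2) * cmod (time_fourier \<psi> t \<xi>) \<le> (A + B) * (1 / (1 + norm \<xi>) ^ N)"
      by (simp add: distrib_right add_divide_distrib)
    moreover have "1 + t\<^sup>2 > 0" by (simp add: add_pos_nonneg)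
    ultimately have "cmod (time_fourier \<psi> t \<xi>) \<le> (A + B) * (1 / (1 + norm \<xi>) ^ N) / (1 + t\<^sup>2)"
      by (simp only: pos_le_divide_eq mult.commute)
    then show ?thesis by (simp add: mult.commute)
  qed
  then show ?thesis using A(1) B(1) by (intro exI[of _ "A + B"]) auto
qed

lemma time_fourier_measurable:
  assumes s: "schwartz \<psi>"
  shows "(\<lambda>(t, \<xi>). time_fourier \<psi> t \<xi>) \<in> borel_measurable (borel \<Otimes>\<^sub>M borel)"
proof -
  note [measurable] = schwartz_measurable[OF s]
  show ?thesis unfolding time_fourier_def fourier_integral_def by measurable
qed

lemma time_fourier_inversion:
  fixes \<psi> :: "real \<times> 'a::euclidean_space \<Rightarrow> complex"
  assumes s: "schwartz \<psi>"
  shows "(LB t. iexp (t * w) * time_fourier \<psi> t \<xi>) = of_real (2 * pi) * \<psi> (w, \<xi>)"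
proof -
  note [measurable] = schwartz_slice(3)[OF s]
  obtain B where B: "\<And>z. cmod (\<psi> z) \<le> B" using schwartz_bounded[OF s] by blast
  obtain K where K: "K \<ge> 0" "\<And>t \<xi>. cmod (time_fourier \<psi> t \<xi>) \<le> K * (1 / (1 + t\<^sup>2)) * (1 / (1 + norm \<xi>) ^ 0)"
    using time_fourier_decay[OF s] by blast
  have "FI (fourier_integral (\<lambda>\<tau>. \<psi> (\<tau>, \<xi>))) w = of_real ((2 * pi) ^ DIM(real)) * \<psi> (w, \<xi>)"
  proof (rule fourier_integral_inversion[OF schwartz_slice(2)[OF s] B schwartz_slice(1)[OF s]])
    show "integrable lborel (FI (\<lambda>\<tau>. \<psi> (\<tau>, \<xi>)))"
    proof (rule integrable_dominated[OF integrable_mult_right[OF integrable_inverse_1_plus_square, of K]])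
      show "AE t in lborel. norm (FI (\<lambda>\<tau>. \<psi> (\<tau>, \<xi>)) t) \<le> norm (K * (1 / (1 + t\<^sup>2)))"
        using K(2)[of "- t" \<xi> for t] K(1) by (intro AE_I2) (simp add: time_fourier_def fourier_integral_FI)
      show "FI (\<lambda>\<tau>. \<psi> (\<tau>, \<xi>)) \<in> borel_measurable lborel" by measurable
    qed
  qed
  then show ?thesis by (simp add: FI_def time_fourier_def)
qed

lemma fourier_integral_time_fourier:
  fixes \<psi> :: "real \<times> 'a::euclidean_space \<Rightarrow> complex"
  assumes s: "schwartz \<psi>"
  shows "fourier_integral \<psi> (t, x) = fourier_integral (time_fourier \<psi> t) x"
proof -
  note [measurable] = schwartz_measurable[OF s]
  have i: "integrable lborel2 \<psi>" using schwartz_integrable0[OF s] unfolding lborel_prod .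
  have i': "integrable lborel2 (\<lambda>(\<tau>, \<xi>). exp (- (\<i> * of_real ((\<tau>, \<xi>) \<bullet> (t, x)))) * \<psi> (\<tau>, \<xi>))"
    by (rule integrable_dominated[OF i]) (auto simp: norm_mult)
  have "fourier_integral \<psi> (t, x) = (LINT z|lborel2. (case z of (\<tau>, \<xi>) \<Rightarrow> exp (- (\<i> * of_real ((\<tau>, \<xi>) \<bullet> (t, x)))) * \<psi> (\<tau>, \<xi>)))"
    unfolding fourier_integral_def lborel_prod by (rule LB_cong) auto
  also have "\<dots> = (LB \<xi> \<tau>. exp (- (\<i> * of_real ((\<tau>, \<xi>) \<bullet> (t, x)))) * \<psi> (\<tau>, \<xi>))"
    by (rule lborel_pair.integral_snd[OF i', symmetric])
  also have "\<dots> = (LB \<xi>. exp (- (\<i> * of_real (\<xi> \<bullet> x))) * time_fourier \<psi> t \<xi>)" (is "(LB \<xi>. ?f \<xi>) = (LB \<xi>. ?g \<xi>)")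
  proof (rule LB_cong)
    fix \<xi> :: 'a
    have "exp (- (\<i> * of_real ((\<tau>, \<xi>) \<bullet> (t, x)))) = exp (- (\<i> * of_real (\<xi> \<bullet> x))) * exp (- (\<i> * of_real (\<tau> \<bullet> t)))" for \<tau>
      unfolding exp_add[symmetric] by (rule arg_cong[of _ _ exp]) (simp add: algebra_simps)
    then have "exp (- (\<i> * of_real ((\<tau>, \<xi>) \<bullet> (t, x)))) * \<psi> (\<tau>, \<xi>) = exp (- (\<i> * of_real (\<xi> \<bullet> x))) * (exp (- (\<i> * of_real (\<tau> \<bullet> t))) * \<psi> (\<tau>, \<xi>))" for \<tau>
      by (simp only: mult.assoc)
    then show "?f \<xi> = ?g \<xi>"
      unfolding time_fourier_def fourier_integral_def by (simp only: integral_mult_right_zero)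
  qed
  finally show ?thesis by (simp add: fourier_integral_def)
qed

lemma fourier_phase:
  shows "iexp a * F \<eta> * cnj (iexp b * F z) = iexp (a - b) * (F \<eta> * cnj (F z))"
  by (simp add: exp_cnj right_diff_distrib exp_diff exp_minus field_simps)

text \<open>At fixed t, the transform in x of |u(t, .)|^2 is the autocorrelation of exp(i t w) F,
  whose phase is t (w(eta) - w(eta - xi)). After the exchange of integrals, the integral over t is a
  Fourier inversion in time and evaluates \<psi> at tau = w(eta) - w(eta - xi).\<close>

lemma density_dual:
  fixes F :: "'a::euclidean_space \<Rightarrow> complex" and u :: "real \<times> 'a \<Rightarrow> complex"
  assumes F: "in_L2 F" and um[measurable]: "borel_fun u"
    and u: "\<And>t. is_fourier_transform (\<lambda>x. u (t, x)) (\<lambda>\<eta>. iexp (t * w \<eta>) * F \<eta>)"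
    and om[measurable]: "borel_fun w"
    and s: "schwartz \<psi>"
  shows "integrable lborel (\<lambda>z. of_real (nsq (u z)) * fourier_integral \<psi> z)"
    and "(LB z. of_real (nsq (u z)) * fourier_integral \<psi> z)
      = of_real (2 * pi / (2 * pi) ^ DIM('a)) *
      (LB \<xi> \<eta>. F \<eta> * cnj (F (\<eta> - \<xi>)) * \<psi> (w \<eta> - w (\<eta> - \<xi>), \<xi>))"
proof -
  let ?c = "(2 * pi) ^ DIM('a)"
  have [measurable]: "borel_fun F" using F by (simp add: in_L2_def)
  note [measurable] = schwartz_measurable[OF s]
  define A where "A = (LB x. nsq (F x))"
  have A0: "A \<ge> 0" by (simp add: A_def integral_nonneg_AE)
  have VL2: "in_L2 (\<lambda>\<eta>. iexp (t * w \<eta>) * F \<eta>)" for t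
    using F by (simp add: in_L2_def norm_mult)
  have uL2: "in_L2 (\<lambda>x. u (t, x))" for t using plancherel(1)[OF u] VL2 by blast
  have ur: "integrable lborel (\<lambda>x. nsq (u (t, x)))" for t using uL2[of t] by (simp add: in_L2_def)
  have ui: "integrable lborel (\<lambda>x. complex_of_real (nsq (u (t, x))))" for t
    by (intro integrable_of_real ur)
  have uA: "(LB x. nsq (u (t, x))) = A / ?c" for t
    using plancherel(2)[OF u VL2, of t] by (simp add: A_def norm_mult)
  define N where "N = 2 * DIM('a)"
  obtain K where K: "K \<ge> 0" "\<And>t \<xi>. cmod (time_fourier \<psi> t \<xi>) \<le> K * (1 / (1 + t\<^sup>2)) * (1 / (1 + norm \<xi>) ^ N)"
    using time_fourier_decay[OF s] by blast
  have tfm[measurable]: "(\<lambda>x. time_fourier \<psi> (f x) (g x)) \<in> borel_measurable M"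
    if [measurable]: "f \<in> borel_measurable M" "g \<in> borel_measurable M" for f g and M :: "'x measure"
    using measurable_compose[OF _ time_fourier_measurable[OF s], of "\<lambda>x. (f x, g x)" M] by simp
  have iN: "integrable lborel (\<lambda>\<xi>::'a. 1 / (1 + norm \<xi>) ^ N)"
    unfolding N_def by (rule integrable_inverse_1_plus_norm) simp
  have iT: "integrable lborel (\<lambda>t::real. c * (1 / (1 + t\<^sup>2)))" for c
    by (intro integrable_mult_right integrable_inverse_1_plus_square)
  have tfi: "integrable lborel (time_fourier \<psi> t)" for t
    by (rule integrable_decay[where n=N and C="K * (1 / (1 + t\<^sup>2))"]) (use K(2) in \<open>auto simp: N_def\<close>)
  define J where "J = (LB \<xi>::'a. 1 / (1 + norm \<xi>) ^ N)"
  have J0: "J \<ge> 0" unfolding J_def by (simp add: integral_nonneg_AE)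
  have fib: "cmod (fourier_integral \<psi> (t, x)) \<le> K * J * (1 / (1 + t\<^sup>2))" for t x
  proof -
    have "cmod (fourier_integral \<psi> (t, x)) \<le> (LB \<xi>. cmod (time_fourier \<psi> t \<xi>))"
      unfolding fourier_integral_time_fourier[OF s] by (rule norm_fourier_integral_le[OF tfi])
    also have "\<dots> \<le> (LB \<xi>::'a. K * (1 / (1 + t\<^sup>2)) * (1 / (1 + norm \<xi>) ^ N))"
      by (rule Bochner_Integration.integral_mono[OF integrable_norm[OF tfi] integrable_mult_right[OF iN] K(2)])
    also have "\<dots> = K * J * (1 / (1 + t\<^sup>2))" unfolding J_def integral_mult_right_zero by simp
    finally show ?thesis .
  qed
  have FIm[measurable]: "fourier_integral \<psi> \<in> borel_measurable borel"
    using schwartz_fourier_in_L2[OF s] by (simp add: in_L2_def)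
  have ip: "integrable lborel2 (\<lambda>(t, x). of_real (nsq (u (t, x))) * fourier_integral \<psi> (t, x))"
  proof (rule lborel_pair.Fubini_integrable)
    have "integrable lborel (\<lambda>x. of_real (nsq (u (t, x))) * fourier_integral \<psi> (t, x))" for t
    proof (rule integrable_dominated[OF integrable_mult_right[OF ur, of "K * J * (1 / (1 + t\<^sup>2))" t]], goal_cases)
      case 2
      show ?case
      proof (rule AE_I2)
        fix x
        have "norm (of_real (nsq (u (t, x))) * fourier_integral \<psi> (t, x)) = cmod (fourier_integral \<psi> (t, x)) * nsq (u (t, x))"
          by (simp add: norm_mult norm_power)
        also have "\<dots> \<le> K * J * (1 / (1 + t\<^sup>2)) * nsq (u (t, x))" by (intro mult_right_mono fib) simp
        also have "\<dots> \<le> norm (K * J * (1 / (1 + t\<^sup>2)) * nsq (u (t, x)))" unfolding real_norm_def by (rule abs_ge_self)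
        finally show "norm (of_real (nsq (u (t, x))) * fourier_integral \<psi> (t, x)) \<le> norm (K * J * (1 / (1 + t\<^sup>2)) * nsq (u (t, x)))" .
      qed
    qed measurable
    then show "AE t in lborel. integrable lborel (\<lambda>x. case (t, x) of (t, x) \<Rightarrow> of_real (nsq (u (t, x))) * fourier_integral \<psi> (t, x))"
      by simp
    show "integrable lborel (\<lambda>t. LB x. norm (case (t, x) of (t, x) \<Rightarrow> of_real (nsq (u (t, x))) * fourier_integral \<psi> (t, x)))"
    proof (rule integrable_dominated[OF iT[of "K * J * (A / ?c)"]])
      show "AE t in lborel. norm (LB x. norm (case (t, x) of (t, x) \<Rightarrow> of_real (nsq (u (t, x))) * fourier_integral \<psi> (t, x))) \<le> norm (K * J * (A / ?c) * (1 / (1 + t\<^sup>2)))" (is "AE t in _. ?P t")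
      proof (rule AE_I2)
        fix t
        have "(LB x. norm (case (t, x) of (t, x) \<Rightarrow> of_real (nsq (u (t, x))) * fourier_integral \<psi> (t, x)))
          \<le> (LB x. K * J * (1 / (1 + t\<^sup>2)) * nsq (u (t, x)))"
        proof (rule integral_mono')
          show "integrable lborel (\<lambda>x. K * J * (1 / (1 + t\<^sup>2)) * nsq (u (t, x)))"
            by (intro integrable_mult_right ur)
          fix x
          show "norm (case (t, x) of (t, x) \<Rightarrow> of_real (nsq (u (t, x))) * fourier_integral \<psi> (t, x)) \<le> K * J * (1 / (1 + t\<^sup>2)) * nsq (u (t, x))"
            using mult_right_mono[OF fib[of t x], of "nsq (u (t, x))"] by (simp add: norm_mult norm_power mult.commute)
        qed (use K(1) J0 in auto)
        also have "\<dots> = K * J * (A / ?c) * (1 / (1 + t\<^sup>2))" unfolding integral_mult_right_zero uA by (simp add: mult_ac)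
        finally show "?P t"
          using K(1) J0 A0 by (simp add: integral_nonneg_AE abs_mult)
      qed
    qed measurable
  qed measurable
  then show "integrable lborel (\<lambda>z. of_real (nsq (u z)) * fourier_integral \<psi> z)"
    unfolding lborel_prod by (rule back_subst[of "integrable lborel"]) auto
  define G where "G \<xi> \<eta> = F \<eta> * cnj (F (\<eta> - \<xi>))" for \<xi> \<eta>
  define D where "D \<xi> \<eta> = w \<eta> - w (\<eta> - \<xi>)" for \<xi> \<eta>
  have Gm[measurable]: "(\<lambda>x. G (f x) (g x)) \<in> borel_measurable M"
    if [measurable]: "f \<in> borel_measurable M" "g \<in> borel_measurable M" for f g and M :: "'x measure"
    unfolding G_def by measurable
  have Dm[measurable]: "(\<lambda>x. D (f x) (g x)) \<in> borel_measurable M"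
    if [measurable]: "f \<in> borel_measurable M" "g \<in> borel_measurable M" for f g and M :: "'x measure"
    unfolding D_def by measurable
  have Gi: "integrable lborel (G \<xi>)" and GA: "(LB \<eta>. cmod (G \<xi> \<eta>)) \<le> A" for \<xi>
    using L2_translate_product(2,3)[OF F, of \<xi>] unfolding G_def A_def .
  define L where "L t \<xi> = (LB \<eta>. iexp (t * D \<xi> \<eta>) * G \<xi> \<eta>)" for t \<xi>
  have Lm[measurable]: "(\<lambda>(t, \<xi>). L t \<xi>) \<in> borel_measurable (borel \<Otimes>\<^sub>M borel)"
    unfolding L_def by measurable
  have LA: "cmod (L t \<xi>) \<le> A" for t \<xi>
  proof -
    have "cmod (L t \<xi>) \<le> (LB \<eta>. cmod (iexp (t * D \<xi> \<eta>) * G \<xi> \<eta>))" unfolding L_def by (rule integral_norm_bound)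
    then show ?thesis using GA[of \<xi>] by (simp add: norm_mult)
  qed
  have slice: "(LB x. of_real (nsq (u (t, x))) * fourier_integral \<psi> (t, x)) = of_real (1 / ?c) * (LB \<xi>. L t \<xi> * time_fourier \<psi> t \<xi>)" for t
  proof -
    have "(LB x. of_real (nsq (u (t, x))) * fourier_integral \<psi> (t, x)) = (LB \<xi>. fourier_integral (\<lambda>x. of_real (nsq (u (t, x)))) \<xi> * time_fourier \<psi> t \<xi>)"
      unfolding fourier_integral_time_fourier[OF s] by (rule fourier_integral_duality[OF ui tfi])
    also have "\<dots> = (LB \<xi>. of_real (1 / ?c) * (L t \<xi> * time_fourier \<psi> t \<xi>))" (is "(LB \<xi>. ?f \<xi>) = (LB \<xi>. ?g \<xi>)")
    proof (rule LB_cong)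
      fix \<xi> :: 'a
      have "L t \<xi> = of_real ?c * fourier_integral (\<lambda>x. of_real (nsq (u (t, x)))) \<xi>"
        unfolding fourier_autocorrelation[OF u VL2, symmetric] L_def
        by (rule LB_cong) (simp only: fourier_phase G_def D_def right_diff_distrib)
      then show "?f \<xi> = ?g \<xi>"
        by simp
    qed
    finally show ?thesis by (simp only: integral_mult_right_zero)
  qed
  have "(LB z. of_real (nsq (u z)) * fourier_integral \<psi> z) = (LINT z|lborel2. (case z of (t, x) \<Rightarrow> of_real (nsq (u (t, x))) * fourier_integral \<psi> (t, x)))"
    unfolding lborel_prod by (rule LB_cong) auto
  also have "\<dots> = (LB t x. of_real (nsq (u (t, x))) * fourier_integral \<psi> (t, x))"
    by (rule lborel_pair.integral_fst[OF ip, symmetric])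
  also have "\<dots> = of_real (1 / ?c) * (LB t \<xi>. L t \<xi> * time_fourier \<psi> t \<xi>)"
    unfolding slice by (simp only: integral_mult_right_zero)
  also have "(LB t \<xi>. L t \<xi> * time_fourier \<psi> t \<xi>) = (LB \<xi> t. L t \<xi> * time_fourier \<psi> t \<xi>)"
  proof (rule lborel_pair.Fubini_integral[symmetric], rule integrable_pair_bound[OF _ iT[of "A * K"] iN])
    show "cmod (L t \<xi> * time_fourier \<psi> t \<xi>) \<le> A * K * (1 / (1 + t\<^sup>2)) * (1 / (1 + norm \<xi>) ^ N)" for t \<xi>
      using mult_mono[OF LA K(2) A0] by (simp add: norm_mult)
  qed measurable
  also have "\<dots> = (LB \<xi>. of_real (2 * pi) * (LB \<eta>. G \<xi> \<eta> * \<psi> (D \<xi> \<eta>, \<xi>)))" (is "(LB \<xi>. ?f \<xi>) = (LB \<xi>. ?g \<xi>)")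
  proof (rule LB_cong)
    fix \<xi> :: 'a
    have "(LB t. L t \<xi> * time_fourier \<psi> t \<xi>) = (LB t \<eta>. iexp (t * D \<xi> \<eta>) * G \<xi> \<eta> * time_fourier \<psi> t \<xi>)"
      unfolding L_def by (simp only: integral_mult_left_zero)
    also have "\<dots> = (LB \<eta> t. iexp (t * D \<xi> \<eta>) * G \<xi> \<eta> * time_fourier \<psi> t \<xi>)"
    proof (rule lborel_pair.Fubini_integral[symmetric], rule integrable_pair_bound[OF _ iT[of "K * (1 / (1 + norm \<xi>) ^ N)"] integrable_norm[OF Gi]])
      show "cmod (iexp (t * D \<xi> \<eta>) * G \<xi> \<eta> * time_fourier \<psi> t \<xi>) \<le> K * (1 / (1 + norm \<xi>) ^ N) * (1 / (1 + t\<^sup>2)) * norm (G \<xi> \<eta>)" for t \<eta>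
        using mult_right_mono[OF K(2)[of t \<xi>], of "norm (G \<xi> \<eta>)"] by (simp add: norm_mult mult_ac)
    qed measurable
    also have "\<dots> = (LB \<eta>. of_real (2 * pi) * (G \<xi> \<eta> * \<psi> (D \<xi> \<eta>, \<xi>)))" (is "(LB \<eta>. ?u \<eta>) = (LB \<eta>. ?v \<eta>)")
    proof (rule LB_cong)
      fix \<eta> :: 'a
      have "(LB t. iexp (t * D \<xi> \<eta>) * G \<xi> \<eta> * time_fourier \<psi> t \<xi>) = (LB t. G \<xi> \<eta> * (iexp (t * D \<xi> \<eta>) * time_fourier \<psi> t \<xi>))"
        by (simp only: mult_ac)
      also have "\<dots> = G \<xi> \<eta> * (of_real (2 * pi) * \<psi> (D \<xi> \<eta>, \<xi>))"
        unfolding integral_mult_right_zero time_fourier_inversion[OF s] ..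
      finally show "?u \<eta> = ?v \<eta>"
        by (simp only: mult_ac)
    qed
    finally show "?f \<xi> = ?g \<xi>"
      by (simp only: integral_mult_right_zero)
  qed
  finally show "(LB z. of_real (nsq (u z)) * fourier_integral \<psi> z)
    = of_real (2 * pi / ?c) * (LB \<xi> \<eta>. F \<eta> * cnj (F (\<eta> - \<xi>)) * \<psi> (w \<eta> - w (\<eta> - \<xi>), \<xi>))"
    unfolding G_def D_def by (simp only: integral_mult_right_zero) simp
qed

text \<open>The integral of F(eta) cnj (F(eta - xi)) over the fibre. For F in L2 it converges for
  almost every (tau, xi); where it diverges it is 0 by convention, and for |tau| >= |xi| the weight
  makes it 0.\<close>

definition pair_transform :: "real \<Rightarrow> ('a::euclidean_space \<Rightarrow> complex) \<Rightarrow> real \<times> 'a \<Rightarrow> complex" where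
  "pair_transform s F = (\<lambda>(\<tau>, \<xi>). LINT \<eta>|lborel.
    of_real (fibre_density s \<tau> \<xi> \<eta>) *
    (F (fibre_pt s \<tau> \<xi> \<eta>) * cnj (F (fibre_pt s \<tau> \<xi> \<eta> - \<xi>))))"

lemma pair_transform_measurable [measurable]:
  assumes [measurable]: "borel_fun F"
  shows "pair_transform s F \<in> borel_measurable borel"
proof -
  have "pair_transform s F \<in> borel_measurable (borel \<Otimes>\<^sub>M borel)"
    unfolding pair_transform_def by measurable
  then show ?thesis by (simp add: borel_prod)
qed

text \<open>The formula \<open>nn_integral_fibre\<close> as an equality of measures, which carries
  it over to complex integrands.\<close>

lemma fibre_distr:
  fixes \<xi> :: "'a::euclidean_space"
  assumes s: "s > 0" and \<xi>: "\<xi> \<noteq> 0"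
  shows "distr (density lborel2 (\<lambda>(\<tau>, \<eta>).
    ennreal (fibre_density s \<tau> \<xi> \<eta>)))
    lborel (\<lambda>(\<tau>, \<eta>). fibre_pt s \<tau> \<xi> \<eta>) = lborel"
proof (rule measure_eqI)
  fix A :: "'a set" assume "A \<in> sets (distr (density lborel2 (\<lambda>(\<tau>, \<eta>).
    ennreal (fibre_density s \<tau> \<xi> \<eta>)))
    lborel (\<lambda>(\<tau>, \<eta>). fibre_pt s \<tau> \<xi> \<eta>))"
  then have A[measurable]: "A \<in> sets borel" by simp
  let ?K = "\<lambda>\<tau> \<eta>. ennreal (fibre_density s \<tau> \<xi> \<eta>)"
  let ?D = "density lborel2 (\<lambda>(\<tau>, \<eta>). ?K \<tau> \<eta>)"
  have "emeasure (distr ?D lborel (\<lambda>(\<tau>, \<eta>). fibre_pt s \<tau> \<xi> \<eta>)) A = (\<integral>\<^sup>+\<eta>. indicator A \<eta> \<partial>distr ?D lborel (\<lambda>(\<tau>, \<eta>). fibre_pt s \<tau> \<xi> \<eta>))"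
    by simp
  also have "\<dots> = (\<integral>\<^sup>+z. indicator A (case z of (\<tau>, \<eta>) \<Rightarrow> fibre_pt s \<tau> \<xi> \<eta>) \<partial>?D)"
    by (rule nn_integral_distr) measurable
  also have "\<dots> = (\<integral>\<^sup>+z. (case z of (\<tau>, \<eta>) \<Rightarrow> ?K \<tau> \<eta>) * indicator A (case z of (\<tau>, \<eta>) \<Rightarrow> fibre_pt s \<tau> \<xi> \<eta>) \<partial>lborel2)"
    by (rule nn_integral_density) measurable
  also have "\<dots> = (NN \<tau> \<eta>. ?K \<tau> \<eta> * indicator A (fibre_pt s \<tau> \<xi> \<eta>))"
    by (subst lborel.nn_integral_fst[symmetric]) simp_all
  also have "\<dots> = (NN \<eta>. indicator A \<eta>)"
    by (rule nn_integral_fibre[OF s \<xi>, symmetric]) simp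
  finally show "emeasure (distr ?D lborel (\<lambda>(\<tau>, \<eta>). fibre_pt s \<tau> \<xi> \<eta>)) A = emeasure lborel A" by simp
qed simp

lemma fibre_integral:
  fixes h :: "'a::euclidean_space \<Rightarrow> complex"
  assumes s: "s > 0" and \<xi>: "\<xi> \<noteq> 0" and h: "integrable lborel h"
  defines "k \<equiv> \<lambda>(\<tau>, \<eta>). of_real (fibre_density s \<tau> \<xi> \<eta>) * h (fibre_pt s \<tau> \<xi> \<eta>)"
  shows "integrable lborel2 k" and "(LB \<eta>. h \<eta>) = (LB \<tau> \<eta>. k (\<tau>, \<eta>))"
proof -
  have [measurable]: "borel_fun h" using h by auto
  let ?K = "\<lambda>(\<tau>, \<eta>). fibre_density s \<tau> \<xi> \<eta>"
  let ?D = "density lborel2 (\<lambda>z. ennreal (?K z))"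
  let ?p = "\<lambda>(\<tau>, \<eta>). fibre_pt s \<tau> \<xi> \<eta>"
  have K0: "AE z in lborel2. 0 \<le> ?K z"
    by (intro AE_I2) (auto intro!: mult_nonneg_nonneg fibre_wt_nonneg energy_pos[OF s, THEN less_imp_le])
  have D: "distr ?D lborel ?p = lborel"
    using fibre_distr[OF s \<xi>] by (simp add: case_prod_beta')
  have k: "k = (\<lambda>z. ?K z *\<^sub>R h (?p z))" by (auto simp: k_def fun_eq_iff scaleR_conv_of_real)
  have "integrable (distr ?D lborel ?p) h" unfolding D by (rule h)
  then have "integrable ?D (\<lambda>z. h (?p z))" by (subst (asm) integrable_distr_eq) auto
  then show ki: "integrable lborel2 k" unfolding k
    by (subst (asm) integrable_density) (use K0 in auto)
  have "(LB \<eta>. h \<eta>) = (LINT \<eta>|distr ?D lborel ?p. h \<eta>)" unfolding D ..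
  also have "\<dots> = (LINT z|?D. h (?p z))" by (rule integral_distr) auto
  also have "\<dots> = (LINT z|lborel2. k z)" unfolding k
    by (rule integral_density) (use K0 in auto)
  also have "\<dots> = (LB \<tau> \<eta>. k (\<tau>, \<eta>))"
    using lborel_pair.integral_fst'[OF ki] by simp
  finally show "(LB \<eta>. h \<eta>) = (LB \<tau> \<eta>. k (\<tau>, \<eta>))" .
qed

lemma AE_lborel_nonzero: "AE x in lborel. x \<noteq> (0::'a::euclidean_space)"
  by (rule AE_lborel_singleton)

text \<open>On a fibre the value of \<psi> is the constant \<psi>(tau, xi), so disintegrating the
  integral over eta along the fibres produces the pairing with \<open>pair_transform\<close>. It is
  integrable because for xi other than 0 the integral of |\<open>pair_transform\<close>| over tau is
  at most the squared L2 norm of F, while \<psi> decays in xi uniformly in tau.\<close>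

lemma pair_transform_dual:
  fixes F :: "'a::euclidean_space \<Rightarrow> complex"
  assumes s: "s > 0" and F: "in_L2 F" and sch: "schwartz \<psi>"
  shows "integrable lborel (\<lambda>z. pair_transform s F z * \<psi> z)"
    and "(LB z. pair_transform s F z * \<psi> z)
      = (LB \<xi> \<eta>. F \<eta> * cnj (F (\<eta> - \<xi>)) * \<psi> (energy s \<eta> - energy s (\<eta> - \<xi>), \<xi>))"
proof -
  have [measurable]: "borel_fun F" using F by (simp add: in_L2_def)
  note [measurable] = schwartz_measurable[OF sch]
  define N where "N = 2 * DIM('a)"
  obtain C where C: "C \<ge> 0" "\<And>z. cmod (\<psi> z) \<le> C * (1 / (1 + norm z) ^ N)"
    using schwartz_decay[OF sch, of "[]" N] by auto
  have psi: "cmod (\<psi> (\<tau>, \<xi>)) \<le> C * (1 / (1 + norm \<xi>) ^ N)" for \<tau> \<xi>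
  proof -
    have "norm \<xi> \<le> norm (\<tau>, \<xi>)" by (auto simp: norm_Pair intro: real_le_rsqrt)
    then have "1 / (1 + norm (\<tau>, \<xi>)) ^ N \<le> 1 / (1 + norm \<xi>) ^ N"
      by (intro divide_left_mono power_mono mult_pos_pos zero_less_power add_pos_nonneg) auto
    from order_trans[OF C(2) mult_left_mono[OF this C(1)]] show ?thesis .
  qed
  define G where "G \<xi> \<eta> = F \<eta> * cnj (F (\<eta> - \<xi>))" for \<xi> \<eta>
  define K where "K \<tau> \<xi> \<eta> = fibre_density s \<tau> \<xi> \<eta>" for \<tau> and \<xi> \<eta> :: 'a
  define Q where "Q \<xi> = (NN \<eta>. ennreal (cmod (G \<xi> \<eta>)))" for \<xi>
  define A where "A = (LB x. nsq (F x))"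
  have K0: "K \<tau> \<xi> \<eta> \<ge> 0" for \<tau> \<xi> \<eta>
    unfolding K_def by (intro mult_nonneg_nonneg fibre_wt_nonneg energy_pos[OF s, THEN less_imp_le])
  have Gm[measurable]: "(\<lambda>x. G (f x) (g x)) \<in> borel_measurable M"
    if [measurable]: "f \<in> borel_measurable M" "g \<in> borel_measurable M" for f g and M :: "'x measure"
    unfolding G_def by measurable
  have Km[measurable]: "(\<lambda>x. K (f x) (g x) (h x)) \<in> borel_measurable M"
    if [measurable]: "f \<in> borel_measurable M" "g \<in> borel_measurable M" "h \<in> borel_measurable M" for f g h and M :: "'x measure"
    unfolding K_def by measurable
  have Gi: "integrable lborel (G \<xi>)" for \<xi>
    using L2_translate_product(2)[OF F, of \<xi>] unfolding G_def .
  have QA: "Q \<xi> \<le> ennreal A" for \<xi>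
    unfolding Q_def using L2_translate_product(3)[OF F, of \<xi>]
    by (subst nn_integral_eq_integral) (auto intro!: ennreal_leI integrable_norm[OF L2_translate_product(2)[OF F]] simp: G_def A_def)
  have pull: "(NN \<tau> \<eta>. ennreal (K \<tau> \<xi> \<eta> * cmod (G \<xi> (fibre_pt s \<tau> \<xi> \<eta>)))) = Q \<xi>" if "\<xi> \<noteq> 0" for \<xi>
    unfolding Q_def nn_integral_fibre[OF s that, of "\<lambda>\<eta>. ennreal (cmod (G \<xi> \<eta>))", simplified] K_def[symmetric]
    by (simp add: ennreal_mult' K0)
  have PT: "pair_transform s F (\<tau>, \<xi>) = (LB \<eta>. of_real (K \<tau> \<xi> \<eta>) * G \<xi> (fibre_pt s \<tau> \<xi> \<eta>))" for \<tau> \<xi>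
    by (simp add: pair_transform_def K_def G_def)
  have PTle: "ennreal (cmod (pair_transform s F (\<tau>, \<xi>))) \<le> (NN \<eta>. ennreal (K \<tau> \<xi> \<eta> * cmod (G \<xi> (fibre_pt s \<tau> \<xi> \<eta>))))" for \<tau> \<xi>
    unfolding PT using integral_norm_bound_ennreal'[of lborel "\<lambda>\<eta>. of_real (K \<tau> \<xi> \<eta>) * G \<xi> (fibre_pt s \<tau> \<xi> \<eta>)"]
    by (simp add: norm_mult K0)
  have PTQ: "(NN \<tau>. ennreal (cmod (pair_transform s F (\<tau>, \<xi>)))) \<le> ennreal A" if "\<xi> \<noteq> 0" for \<xi>
    using order_trans[OF nn_integral_mono[OF PTle] order_trans[OF eq_refl[OF pull[OF that]] QA]] by simp
  have iC: "integrable lborel (\<lambda>\<xi>::'a. C * (1 / (1 + norm \<xi>) ^ N))"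
    unfolding N_def by (intro integrable_mult_right integrable_inverse_1_plus_norm) simp
  have i: "integrable lborel2 (\<lambda>z. pair_transform s F z * \<psi> z)"
  proof (rule integrableI_bounded)
    have "(\<integral>\<^sup>+z. ennreal (norm (pair_transform s F z * \<psi> z)) \<partial>lborel2) = (NN \<xi> \<tau>. ennreal (norm (pair_transform s F (\<tau>, \<xi>) * \<psi> (\<tau>, \<xi>))))"
      by (rule lborel_pair.nn_integral_snd[symmetric]) (simp add: lborel_prod)
    also have "\<dots> \<le> (NN \<xi>. ennreal A * ennreal (C * (1 / (1 + norm (\<xi>::'a)) ^ N)))"
    proof (rule nn_integral_mono_AE)
      show "AE \<xi>::'a in lborel. (NN \<tau>. ennreal (norm (pair_transform s F (\<tau>, \<xi>) * \<psi> (\<tau>, \<xi>)))) \<le> ennreal A * ennreal (C * (1 / (1 + norm \<xi>) ^ N))"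
        using AE_lborel_nonzero
      proof eventually_elim
        case (elim \<xi>)
        have "(NN \<tau>. ennreal (norm (pair_transform s F (\<tau>, \<xi>) * \<psi> (\<tau>, \<xi>)))) \<le> (NN \<tau>. ennreal (cmod (pair_transform s F (\<tau>, \<xi>))) * ennreal (C * (1 / (1 + norm \<xi>) ^ N)))"
          unfolding norm_mult using psi by (intro nn_integral_mono) (auto simp: ennreal_mult'' intro!: mult_left_mono ennreal_leI)
        also have "\<dots> = (NN \<tau>. ennreal (cmod (pair_transform s F (\<tau>, \<xi>)))) * ennreal (C * (1 / (1 + norm \<xi>) ^ N))"
          by (rule nn_integral_multc) measurable
        also have "\<dots> \<le> ennreal A * ennreal (C * (1 / (1 + norm \<xi>) ^ N))"
          by (intro mult_right_mono PTQ elim) simp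
        finally show ?case .
      qed
    qed
    also have "\<dots> = ennreal A * (NN \<xi>. ennreal (C * (1 / (1 + norm (\<xi>::'a)) ^ N)))"
      by (rule nn_integral_cmult) measurable
    also have "(NN \<xi>. ennreal (C * (1 / (1 + norm (\<xi>::'a)) ^ N))) = ennreal (LB \<xi>. C * (1 / (1 + norm (\<xi>::'a)) ^ N))"
      by (rule nn_integral_eq_integral[OF iC]) (use C(1) in auto)
    also have "ennreal A * \<dots> < \<infinity>" by (simp add: ennreal_mult_less_top)
    finally show "(\<integral>\<^sup>+z. ennreal (norm (pair_transform s F z * \<psi> z)) \<partial>lborel2) < \<infinity>" .
  qed (simp add: lborel_prod)
  then show "integrable lborel (\<lambda>z. pair_transform s F z * \<psi> z)" by (simp add: lborel_prod)
  have i': "integrable lborel2 (\<lambda>(\<tau>, \<xi>). pair_transform s F (\<tau>, \<xi>) * \<psi> (\<tau>, \<xi>))"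
    using i by (rule back_subst[of "integrable _"]) auto
  have "(LB z. pair_transform s F z * \<psi> z) = (LINT z|lborel2. (case z of (\<tau>, \<xi>) \<Rightarrow> pair_transform s F (\<tau>, \<xi>) * \<psi> (\<tau>, \<xi>)))"
    unfolding lborel_prod by (rule LB_cong) auto
  also have "\<dots> = (LB \<xi> \<tau>. pair_transform s F (\<tau>, \<xi>) * \<psi> (\<tau>, \<xi>))"
    by (rule lborel_pair.integral_snd[OF i', symmetric])
  also have "\<dots> = (LB \<xi> \<eta>. G \<xi> \<eta> * \<psi> (energy s \<eta> - energy s (\<eta> - \<xi>), \<xi>))"
  proof (rule integral_cong_AE)
    show "(\<lambda>\<xi>. LB \<tau>. pair_transform s F (\<tau>, \<xi>) * \<psi> (\<tau>, \<xi>)) \<in> borel_measurable lborel"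
      "(\<lambda>\<xi>. LB \<eta>. G \<xi> \<eta> * \<psi> (energy s \<eta> - energy s (\<eta> - \<xi>), \<xi>)) \<in> borel_measurable lborel"
      by measurable
    show "AE \<xi> in lborel. (LB \<tau>. pair_transform s F (\<tau>, \<xi>) * \<psi> (\<tau>, \<xi>)) = (LB \<eta>. G \<xi> \<eta> * \<psi> (energy s \<eta> - energy s (\<eta> - \<xi>), \<xi>))"
      using AE_lborel_nonzero
    proof eventually_elim
      case (elim \<xi>)
      define h where "h \<eta> = G \<xi> \<eta> * \<psi> (energy s \<eta> - energy s (\<eta> - \<xi>), \<xi>)" for \<eta>
      obtain B where B: "\<And>z. cmod (\<psi> z) \<le> B" using schwartz_bounded[OF sch] by blast
      have hi: "integrable lborel h"
      proof (rule integrable_dominated[OF integrable_mult_left[OF integrable_norm[OF Gi[of \<xi>]], of B]])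
        show "AE \<eta> in lborel. norm (h \<eta>) \<le> norm (norm (G \<xi> \<eta>) * B)"
          by (intro AE_I2) (auto simp: h_def norm_mult abs_mult intro!: mult_left_mono order_trans[OF B abs_ge_self])
      qed (simp add: h_def[abs_def])
      have "(LB \<eta>. h \<eta>) = (LB \<tau> \<eta>. of_real (K \<tau> \<xi> \<eta>) * h (fibre_pt s \<tau> \<xi> \<eta>))"
        using fibre_integral(2)[OF s elim hi] by (simp add: K_def)
      also have "\<dots> = (LB \<tau>. pair_transform s F (\<tau>, \<xi>) * \<psi> (\<tau>, \<xi>))" (is "(LB \<tau>. ?f \<tau>) = (LB \<tau>. ?g \<tau>)")
      proof (rule LB_cong)
        fix \<tau>
        have "of_real (K \<tau> \<xi> \<eta>) * h (fibre_pt s \<tau> \<xi> \<eta>) = of_real (K \<tau> \<xi> \<eta>) * G \<xi> (fibre_pt s \<tau> \<xi> \<eta>) * \<psi> (\<tau>, \<xi>)" for \<eta>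
        proof (cases "\<bar>\<tau>\<bar> < norm \<xi>")
          case True
          then show ?thesis by (simp add: h_def fibre_energy_difference[OF s True])
        next
          case False
          then show ?thesis by (simp add: K_def fibre_wt_def)
        qed
        then show "?f \<tau> = ?g \<tau>"
          by (simp only: PT integral_mult_left_zero)
      qed
      finally show ?case by (simp add: h_def)
    qed
  qed
  finally show "(LB z. pair_transform s F z * \<psi> z)
    = (LB \<xi> \<eta>. F \<eta> * cnj (F (\<eta> - \<xi>)) * \<psi> (energy s \<eta> - energy s (\<eta> - \<xi>), \<xi>))"
    by (simp add: G_def)
qed

text \<open>A solution exists by \<open>L2_fourier_inverse_family\<close> with the unimodular
  multiplier exp(i t E), so the chosen function is one; its transform may be computed from the given
  F, by uniqueness up to null sets.\<close>

lemma klein_gordon_spec: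
  fixes f F :: "'a::euclidean_space \<Rightarrow> complex"
  assumes fF: "is_fourier_transform f F" and F: "in_L2 F"
  shows "klein_gordon s f \<in> borel_measurable borel"
    "is_fourier_transform (\<lambda>x. klein_gordon s f (t, x)) (\<lambda>\<eta>. iexp (t * energy s \<eta>) * F \<eta>)"
proof -
  have Fm[measurable]: "borel_fun F" using F by (simp add: in_L2_def)
  have "\<exists>v \<in> borel_measurable borel. \<forall>t::real. is_fourier_transform (\<lambda>x. v (t, x)) (\<lambda>\<xi>. iexp (t * energy s \<xi>) * F \<xi>) \<and>
    ennreal ((2 * pi) ^ DIM('a)) * (L2sq (\<lambda>x. v (t, x))) \<le> L2sq F"
    by (rule L2_fourier_inverse_family[OF F]) auto
  then have "\<exists>u. is_klein_gordon s f u"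
    unfolding is_klein_gordon_def is_multiplier_image_def energy_def using fF by blast
  then have u: "is_klein_gordon s f (klein_gordon s f)"
    unfolding klein_gordon_def by (rule someI_ex)
  then show "klein_gordon s f \<in> borel_measurable borel" by (simp add: is_klein_gordon_def)
  obtain g where g: "is_fourier_transform f g" "is_fourier_transform (\<lambda>x. klein_gordon s f (t, x)) (\<lambda>\<xi>. iexp (t * energy s \<xi>) * g \<xi>)"
    using u unfolding is_klein_gordon_def is_multiplier_image_def energy_def by blast
  show "is_fourier_transform (\<lambda>x. klein_gordon s f (t, x)) (\<lambda>\<eta>. iexp (t * energy s \<eta>) * F \<eta>)"
    by (rule is_fourier_transform_cong_AE[OF g(2) is_fourier_transformD(1)[OF g(2)]])
      (use is_fourier_transform_unique[OF g(1) fF] in auto)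
qed

text \<open>\<open>density_dual\<close> and \<open>pair_transform_dual\<close> have the same double
  integral on the right. In the constant, 2 pi comes from Fourier inversion in time and (2 pi)^(-d)
  from Plancherel in space.\<close>

theorem density_fourier:
  fixes f F :: "'a::euclidean_space \<Rightarrow> complex"
  assumes s: "s > 0" and fF: "is_fourier_transform f F" and F: "in_L2 F"
  shows "is_fourier_transform (kg_density s f) (\<lambda>z. of_real (2 * pi / (2 * pi) ^ DIM('a)) * pair_transform s F z)"
  unfolding is_fourier_transform_def
proof (intro conjI allI impI)
  note um[measurable] = klein_gordon_spec(1)[OF fF F, of s]
  have [measurable]: "borel_fun F" using F by (simp add: in_L2_def)
  show "kg_density s f \<in> borel_measurable borel" unfolding kg_density_def[abs_def] by measurable
  show "borel_fun (\<lambda>z. of_real (2 * pi / (2 * pi) ^ DIM('a)) * pair_transform s F z)" by measurable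
  fix \<psi> :: "real \<times> 'a \<Rightarrow> complex" assume sch: "schwartz \<psi>"
  note D = density_dual[OF F um klein_gordon_spec(2)[OF fF F] energy_measurable sch] and P = pair_transform_dual[OF s F sch]
  show "integrable lborel (\<lambda>z. of_real (2 * pi / (2 * pi) ^ DIM('a)) * pair_transform s F z * \<psi> z)"
    unfolding mult.assoc by (intro integrable_mult_right P)
  show "integrable lborel (\<lambda>z. kg_density s f z * fourier_integral \<psi> z)" unfolding kg_density_def by (rule D(1))
  show "(LB z. of_real (2 * pi / (2 * pi) ^ DIM('a)) * pair_transform s F z * \<psi> z) = (LB z. kg_density s f z * fourier_integral \<psi> z)"
    unfolding kg_density_def D(2) P(2)[symmetric] by (simp only: mult.assoc integral_mult_right_zero)
qed

section \<open>The sharp inequality\<close>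

definition collision_const :: "nat \<Rightarrow> nat \<Rightarrow> real" where
  "collision_const n j = (if j = 0 then n else 4) * unit_ball_vol n"

text \<open>The squared symbol of |box|^beta for beta = (2 - d + 2j)/4 as a function of q =
  sqrt(|xi|^2 - tau^2). The case j = 0 belongs to the first estimate and j = 1 to the second;
  q^(d-2) times the weight is q^(2j), as the collision formula requires.\<close>

definition radial_weight :: "nat \<Rightarrow> nat \<Rightarrow> real \<Rightarrow> real" where
  "radial_weight n j q = q powr (2 - real n + 2 * real j)"

definition collision_density :: "real \<Rightarrow> nat \<Rightarrow> 'a::euclidean_space \<Rightarrow> 'a \<Rightarrow> real" where
  "collision_density s j a b = collision_const DIM('a) j * relative_momentum_sq s a b ^ j / invariant_mass s a b"

lemma radial_weight_nonneg: "radial_weight n j q \<ge> 0"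
  by (simp add: radial_weight_def)

lemma radial_weight_power:
  assumes "n \<ge> 2" "q > 0"
  shows "q ^ (n - 2) * radial_weight n j q = q ^ (2 * j)"
proof -
  have "q ^ (n - 2) * radial_weight n j q = q powr real (n - 2) * q powr (2 - real n + 2 * real j)"
    unfolding radial_weight_def powr_realpow[OF assms(2)] ..
  also have "\<dots> = q powr real (2 * j)"
    using assms by (simp add: powr_add[symmetric] of_nat_diff)
  finally show ?thesis using assms by (simp only: powr_realpow)
qed

lemma measurable_relative_momentum_sq [measurable (raw)]:
  assumes [measurable]: "f \<in> borel_measurable M" "g \<in> borel_measurable M"
  shows "(\<lambda>x. relative_momentum_sq s (f x) (g x)) \<in> borel_measurable M"
  unfolding relative_momentum_sq_def by measurable

lemma measurable_invariant_mass [measurable (raw)]: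
  assumes [measurable]: "f \<in> borel_measurable M" "g \<in> borel_measurable M"
  shows "(\<lambda>x. invariant_mass s (f x) (g x)) \<in> borel_measurable M"
  unfolding invariant_mass_def by measurable

lemma measurable_collision_density [measurable (raw)]:
  assumes [measurable]: "f \<in> borel_measurable M" "g \<in> borel_measurable M"
  shows "(\<lambda>x. collision_density s j (f x) (g x)) \<in> borel_measurable M"
  unfolding collision_density_def by measurable

lemma invariant_mass_relative_momentum:
  assumes s: "s > 0"
  shows "invariant_mass s a b = 2 * sqrt (s\<^sup>2 + relative_momentum_sq s a b)"
proof -
  have "(energy s a + energy s b)\<^sup>2 - (norm (a + b))\<^sup>2 = 2\<^sup>2 * (s\<^sup>2 + relative_momentum_sq s a b)"
    unfolding power2_sum energy_square relative_momentum_sq_def power2_norm_eq_inner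
    by (simp add: inner_add_left inner_add_right inner_commute field_simps)
  then show ?thesis unfolding invariant_mass_def by (simp only: real_sqrt_mult) simp
qed

lemma invariant_mass_ge:
  assumes s: "s > 0"
  shows "invariant_mass s a b \<ge> 2 * s"
  using relative_momentum_sq_nonneg[OF s, of a b] s
  unfolding invariant_mass_relative_momentum[OF s] by (simp add: real_le_rsqrt)

lemma invariant_mass_le:
  assumes s: "s > 0"
  shows "invariant_mass s a b \<le> energy s a + energy s b"
  unfolding invariant_mass_def using energy_pos[OF s, of a] energy_pos[OF s, of b]
  by (intro real_le_lsqrt) auto

text \<open>E(a) E(b) > s^2 + a . b is the strict Cauchy-Schwarz inequality for the vectors (s, a)
  and (s, b), which are parallel only if a = b. This strictness is what rules out
  extremisers.\<close>

lemma relative_momentum_sq_pos: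
  assumes s: "s > 0" and ab: "a \<noteq> b"
  shows "relative_momentum_sq s a b > 0"
proof -
  have "(s\<^sup>2 + a \<bullet> b)\<^sup>2 < (energy s a * energy s b)\<^sup>2"
  proof -
    have "(a \<bullet> b)\<^sup>2 \<le> (norm a)\<^sup>2 * (norm b)\<^sup>2"
      using Cauchy_Schwarz_ineq[of a b] by (simp add: power2_norm_eq_inner)
    moreover have "0 < s\<^sup>2 * (norm (a - b))\<^sup>2" using s ab by simp
    moreover have "(norm (a - b))\<^sup>2 = (norm a)\<^sup>2 + (norm b)\<^sup>2 - 2 * (a \<bullet> b)"
      by (simp add: power2_norm_eq_inner inner_diff_left inner_diff_right inner_commute)
    moreover have "(s\<^sup>2 + (norm a)\<^sup>2) * (s\<^sup>2 + (norm b)\<^sup>2) - (s\<^sup>2 + a \<bullet> b)\<^sup>2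
      = s\<^sup>2 * ((norm a)\<^sup>2 + (norm b)\<^sup>2 - 2 * (a \<bullet> b)) + ((norm a)\<^sup>2 * (norm b)\<^sup>2 - (a \<bullet> b)\<^sup>2)"
      by (simp add: power2_eq_square algebra_simps)
    ultimately show ?thesis
      unfolding power_mult_distrib energy_square by simp
  qed
  then have "\<bar>s\<^sup>2 + a \<bullet> b\<bar> < \<bar>energy s a * energy s b\<bar>" by (metis abs_le_square_iff not_le)
  then show ?thesis
    using energy_pos[OF s, of a] energy_pos[OF s, of b] by (simp add: relative_momentum_sq_def abs_mult)
qed

lemma relative_momentum_sq_le:
  assumes s: "s > 0"
  shows "relative_momentum_sq s a b \<le> energy s a * energy s b"
proof -
  have "- (a \<bullet> b) \<le> norm a * norm b" using Cauchy_Schwarz_ineq2[of a b] by (simp add: abs_le_iff)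
  also have "\<dots> \<le> energy s a * energy s b"
    using norm_less_energy[OF s, of a] norm_less_energy[OF s, of b] by (intro mult_mono) (auto intro: less_imp_le energy_pos[OF s])
  finally have "- (a \<bullet> b) \<le> energy s a * energy s b" .
  moreover have "- (a \<bullet> b) - s\<^sup>2 \<le> - (a \<bullet> b)" by simp
  ultimately have "- (a \<bullet> b) - s\<^sup>2 \<le> energy s a * energy s b" by (rule order_trans[rotated])
  then have "energy s a * energy s b - a \<bullet> b - s\<^sup>2 \<le> 2 * (energy s a * energy s b)" by simp
  then show ?thesis unfolding relative_momentum_sq_def by simp
qed

lemma collision_const_pos: "n > 0 \<Longrightarrow> collision_const n j > 0"
  by (simp add: collision_const_def)

lemma collision_density_nonneg: "s > 0 \<Longrightarrow> collision_density s j (a::'a::euclidean_space) b \<ge> 0"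
  unfolding collision_density_def
  using collision_const_pos[of "DIM('a)" j] relative_momentum_sq_nonneg[of s a b] invariant_mass_ge[of s a b]
  by (intro divide_nonneg_nonneg mult_nonneg_nonneg zero_le_power) auto

lemma collision_formula:
  fixes H :: "'a::euclidean_space \<Rightarrow> 'a \<Rightarrow> ennreal"
  assumes s: "s > 0" and d: "DIM('a) \<ge> 2" and j: "j \<le> 1"
    and H: "case_prod H \<in> borel_measurable (borel \<Otimes>\<^sub>M borel)"
  shows "(NN \<xi> \<tau> \<eta> \<eta>'. collision_term s (radial_weight DIM('a) j) H \<tau> \<xi> \<eta> \<eta>')
    = (NN a b. H a b * ennreal (collision_density s j a b))"
proof -
  have [measurable]: "(\<lambda>x. H (f x) (g x)) \<in> borel_measurable N"
    if [measurable]: "f \<in> borel_measurable N" "g \<in> borel_measurable N" for f g and N :: "'x measure"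
    using measurable_compose[OF _ H, of "\<lambda>x. (f x, g x)" N] by simp
  have cb[measurable]: "cball (0::'a) 1 \<in> sets borel" by simp
  have rw[measurable]: "radial_weight n j \<in> borel_measurable borel" for n
    unfolding radial_weight_def[abs_def] by measurable
  have ker: "ennreal (DIM('a) / 2) * (kernel_mean s j a b) = ennreal (collision_density s j a b)" for a b :: 'a
  proof (cases "j = 0")
    case True
    then show ?thesis using nn_integral_collision_kernel0[OF s, of a b] by (simp add: collision_density_def collision_const_def)
  next
    case False
    then have "j = 1" using j by simp
    then show ?thesis using nn_integral_collision_kernel1[OF s, of a b] by (simp add: collision_density_def collision_const_def)
  qed
  show ?thesis
    unfolding ker[symmetric]
    by (subst nn_integral_collision[OF s d _ radial_weight_nonneg rw H])
      (auto simp: radial_weight_power[OF d] mult.left_commute[of _ "ennreal (real DIM('a) / 2)"] nn_integral_cmult)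
qed

abbreviation box_pair :: "real \<Rightarrow> nat \<Rightarrow> ('a::euclidean_space \<Rightarrow> complex) \<Rightarrow> real \<times> 'a \<Rightarrow> complex" where
  "box_pair s j F z \<equiv> box_symbol ((2 - real DIM('a) + 2 * real j) / 4) z * pair_transform s F z"

lemma box_pair_transform:
  fixes F :: "'a::euclidean_space \<Rightarrow> complex"
  assumes s: "s > 0"
  shows "nsq (box_symbol ((2 - real DIM('a) + 2 * real j) / 4) (\<tau>, \<xi>) * pair_transform s F (\<tau>, \<xi>))
    = radial_weight DIM('a) j (fibre_q \<tau> \<xi>) * nsq (pair_transform s F (\<tau>, \<xi>))"
proof (cases "\<bar>\<tau>\<bar> < norm \<xi>")
  case True
  then have lt: "\<tau>\<^sup>2 < (norm \<xi>)\<^sup>2" by (metis abs_norm_cancel abs_le_square_iff not_le)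
  then have q: "fibre_q \<tau> \<xi> > 0" and a: "\<bar>\<tau>\<^sup>2 - (norm \<xi>)\<^sup>2\<bar> = fibre_q \<tau> \<xi> powr 2"
    by (auto simp: fibre_q_def powr_half_sqrt[symmetric] powr_powr)
  let ?e = "2 - real DIM('a) + 2 * real j"
  have "(\<bar>\<tau>\<^sup>2 - (norm \<xi>)\<^sup>2\<bar> powr (?e / 4))\<^sup>2 = fibre_q \<tau> \<xi> powr ?e"
    unfolding a powr_powr power2_eq_square[of "_ powr _"] powr_add[symmetric] by (rule arg_cong[where f="\<lambda>x. fibre_q \<tau> \<xi> powr x"]) (simp add: field_simps)
  then show ?thesis
    by (simp add: box_symbol_def norm_mult power_mult_distrib radial_weight_def)
next
  \<comment> \<open>For |tau| >= |xi| the weight \<open>fibre_wt\<close> vanishes and with it both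
    sides, whatever the symbol.\<close>
  case False
  then have "pair_transform s F (\<tau>, \<xi>) = 0"
    by (simp add: pair_transform_def fibre_wt_def)
  then show ?thesis by simp
qed

text \<open>Cauchy-Schwarz with respect to the weight \<open>fibre_wt\<close> for the functions E
  |F| at eta and at eta - xi; the product of the two integrals is then read as a double integral
  over pairs of fibre points. It holds at every (tau, xi), also where the fibre integral
  diverges.\<close>

lemma pair_transform_square_le:
  fixes F :: "'a::euclidean_space \<Rightarrow> complex"
  assumes s: "s > 0" and [measurable]: "borel_fun F"
  defines "H \<equiv> \<lambda>a b. ennreal (energy s a * nsq (F a) * (energy s b * nsq (F b)))"
  shows "ennreal (nsq (pair_transform s F (\<tau>, \<xi>))) \<le> (NN \<eta> \<eta>'.       ennreal (fibre_wt s \<tau> \<xi> \<eta> * fibre_wt s \<tau> \<xi> \<eta>' * energy s (fibre_pt s \<tau> \<xi> \<eta>) * energy s (fibre_pt s \<tau> \<xi> \<eta>' - \<xi>))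
    * H (fibre_pt s \<tau> \<xi> \<eta>) (fibre_pt s \<tau> \<xi> \<eta>' - \<xi>))"
proof -
  let ?p = "fibre_pt s \<tau> \<xi>" and ?w = "fibre_wt s \<tau> \<xi>"
  have e0: "energy s \<eta> \<ge> 0" for \<eta> :: 'a using energy_pos[OF s, of \<eta>] by simp
  define X where "X \<eta> = sqrt (?w \<eta>) * (energy s (?p \<eta>) * cmod (F (?p \<eta>)))" for \<eta>
  define Y where "Y \<eta> = sqrt (?w \<eta>) * (energy s (?p \<eta> - \<xi>) * cmod (F (?p \<eta> - \<xi>)))" for \<eta>
  have [measurable]: "borel_fun X" "borel_fun Y"
    unfolding X_def[abs_def] Y_def[abs_def] by measurable
  have X0: "X \<eta> \<ge> 0" and Y0: "Y \<eta> \<ge> 0" for \<eta>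
    using fibre_wt_nonneg by (auto simp: X_def Y_def e0 intro!: mult_nonneg_nonneg)
  have XY: "norm (of_real (?w \<eta> * energy s (?p \<eta>) * energy s (?p \<eta> - \<xi>)) * (F (?p \<eta>) * cnj (F (?p \<eta> - \<xi>)))) = X \<eta> * Y \<eta>" for \<eta>
    using fibre_wt_nonneg[of s \<tau> \<xi> \<eta>] real_sqrt_mult_self[of "?w \<eta>"] e0[of "?p \<eta>"] e0[of "?p \<eta> - \<xi>"]
    by (simp add: X_def Y_def norm_mult abs_mult)
  have "ennreal (cmod (pair_transform s F (\<tau>, \<xi>))) \<le> (NN \<eta>. ennreal (X \<eta> * Y \<eta>))"
    unfolding pair_transform_def prod.case
    by (rule order_trans[OF integral_norm_bound_ennreal']) (simp only: XY order_refl)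
  then have "ennreal (nsq (pair_transform s F (\<tau>, \<xi>))) \<le> (NN \<eta>. ennreal (X \<eta>) * ennreal (Y \<eta>))\<^sup>2"
    by (simp add: ennreal_mult X0 Y0 power_mono flip: ennreal_power)
  also have "\<dots> \<le> (NN \<eta>. (ennreal (X \<eta>))\<^sup>2) * (NN \<eta>. (ennreal (Y \<eta>))\<^sup>2)"
    by (rule Cauchy_Schwarz_nn_integral) measurable
  also have "\<dots> = (NN \<eta> \<eta>'. (ennreal (X \<eta>))\<^sup>2 * (ennreal (Y \<eta>'))\<^sup>2)"
    by (simp add: nn_integral_cmult nn_integral_multc)
  also have "\<dots> = (NN \<eta> \<eta>'. ennreal (?w \<eta> * ?w \<eta>' * energy s (?p \<eta>) * energy s (?p \<eta>' - \<xi>)) * H (?p \<eta>) (?p \<eta>' - \<xi>))"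
  proof (rule nn_integral_cong, rule nn_integral_cong)
    fix \<eta> \<eta>' :: 'a
    have "(X \<eta>)\<^sup>2 * (Y \<eta>')\<^sup>2 = ?w \<eta> * ?w \<eta>' * energy s (?p \<eta>) * energy s (?p \<eta>' - \<xi>) * (energy s (?p \<eta>) * nsq (F (?p \<eta>)) * (energy s (?p \<eta>' - \<xi>) * nsq (F (?p \<eta>' - \<xi>))))"
      unfolding X_def Y_def power_mult_distrib using fibre_wt_nonneg[of s \<tau> \<xi> \<eta>] fibre_wt_nonneg[of s \<tau> \<xi> \<eta>']
      by (simp add: power2_eq_square mult_ac)
    then show "(ennreal (X \<eta>))\<^sup>2 * (ennreal (Y \<eta>'))\<^sup>2 = ennreal (?w \<eta> * ?w \<eta>' * energy s (?p \<eta>) * energy s (?p \<eta>' - \<xi>)) * H (?p \<eta>) (?p \<eta>' - \<xi>)"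
      unfolding H_def by (simp add: ennreal_power X0 Y0 e0 fibre_wt_nonneg flip: ennreal_mult)
  qed
  finally show ?thesis .
qed

lemma nn_integral_box_pair_transform:
  fixes F :: "'a::euclidean_space \<Rightarrow> complex"
  assumes s: "s > 0" and [measurable]: "borel_fun F"
  shows "(L2sq (\<lambda>z. box_pair s j F z))
    = (NN \<xi> \<tau>. ennreal (radial_weight DIM('a) j (fibre_q \<tau> \<xi>)) * ennreal (nsq (pair_transform s F (\<tau>, \<xi>))))"
proof -
  have [measurable]: "borel_fun (box_symbol \<beta> :: real \<times> 'a \<Rightarrow> complex)" for \<beta>
    unfolding box_symbol_def borel_prod[symmetric] by measurable
  have "(\<integral>\<^sup>+z. ennreal (nsq (box_pair s j F z)) \<partial>lborel2)
    = (NN \<xi> \<tau>. ennreal (nsq (box_symbol ((2 - real DIM('a) + 2 * real j) / 4) (\<tau>, \<xi>) * pair_transform s F (\<tau>, \<xi>))))"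
    by (rule lborel_pair.nn_integral_snd[symmetric]) (simp add: lborel_prod)
  then show ?thesis
    unfolding box_pair_transform[OF s] by (simp add: lborel_prod ennreal_mult radial_weight_nonneg)
qed

lemma pair_transform_upper:
  fixes F :: "'a::euclidean_space \<Rightarrow> complex"
  assumes s: "s > 0" and d: "DIM('a) \<ge> 2" and j: "j \<le> 1" and [measurable]: "borel_fun F"
  shows "(L2sq (\<lambda>z. box_pair s j F z))
    \<le> (NN a b. ennreal (energy s a * nsq (F a) * (energy s b * nsq (F b))) * ennreal (collision_density s j a b))"
  unfolding nn_integral_box_pair_transform[OF s assms(4)]
  unfolding collision_formula[OF s d j, of "\<lambda>a b. ennreal (energy s a * nsq (F a) * (energy s b * nsq (F b)))", simplified, symmetric]
proof (rule nn_integral_mono, rule nn_integral_mono)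
  fix \<xi> :: 'a and \<tau> :: real
  let ?H = "\<lambda>a b. ennreal (energy s a * nsq (F a) * (energy s b * nsq (F b)))"
  let ?W = "radial_weight DIM('a) j (fibre_q \<tau> \<xi>)"
  have "ennreal ?W * ennreal (nsq (pair_transform s F (\<tau>, \<xi>))) \<le> ennreal ?W * (NN \<eta> \<eta>'.       ennreal (fibre_wt s \<tau> \<xi> \<eta> * fibre_wt s \<tau> \<xi> \<eta>' * energy s (fibre_pt s \<tau> \<xi> \<eta>) * energy s (fibre_pt s \<tau> \<xi> \<eta>' - \<xi>))
    * ?H (fibre_pt s \<tau> \<xi> \<eta>) (fibre_pt s \<tau> \<xi> \<eta>' - \<xi>))"
    by (intro mult_left_mono pair_transform_square_le s) auto
  also have "\<dots> = (NN \<eta> \<eta>'. ennreal ?W * (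
    ennreal (fibre_wt s \<tau> \<xi> \<eta> * fibre_wt s \<tau> \<xi> \<eta>' * energy s (fibre_pt s \<tau> \<xi> \<eta>) * energy s (fibre_pt s \<tau> \<xi> \<eta>' - \<xi>))
    * ?H (fibre_pt s \<tau> \<xi> \<eta>) (fibre_pt s \<tau> \<xi> \<eta>' - \<xi>)))"
    by (simp add: nn_integral_cmult)
  finally show "ennreal ?W * ennreal (nsq (pair_transform s F (\<tau>, \<xi>))) \<le> (NN \<eta> \<eta>'.       ennreal (?W * fibre_wt s \<tau> \<xi> \<eta> * fibre_wt s \<tau> \<xi> \<eta>' * energy s (fibre_pt s \<tau> \<xi> \<eta>) * energy s (fibre_pt s \<tau> \<xi> \<eta>' - \<xi>))
    * ?H (fibre_pt s \<tau> \<xi> \<eta>) (fibre_pt s \<tau> \<xi> \<eta>' - \<xi>))"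
    by (simp add: ennreal_mult' radial_weight_nonneg mult.assoc)
qed

text \<open>For a positive F the square of the fibre integral is exactly a double integral over
  pairs of fibre points, and can be compared pointwise with the integrand of
  \<open>collision_formula\<close>.\<close>

lemma pair_transform_lower:
  fixes F :: "'a::euclidean_space \<Rightarrow> complex"
  assumes s: "s > 0" and d: "DIM('a) \<ge> 2" and j: "j \<le> 1"
    and F: "F = (\<lambda>\<eta>. of_real (exp (- c * energy s \<eta>)))" and F2: "in_L2 F"
  shows "(NN a b. ennreal (s\<^sup>2 * exp (- 2 * c * (energy s (a::'a) + energy s b))) * ennreal (collision_density s j a b))
    \<le> (L2sq (\<lambda>z. box_pair s j F z))"
proof -
  have Fm[measurable]: "borel_fun F" using F2 by (simp add: in_L2_def)
  let ?H = "\<lambda>a b::'a. ennreal (s\<^sup>2 * exp (- 2 * c * (energy s a + energy s b)))"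
  let ?p = "\<lambda>\<tau> \<xi>. fibre_pt s \<tau> \<xi>" and ?w = "\<lambda>\<tau> \<xi>. fibre_wt s \<tau> \<xi>" and ?W = "\<lambda>\<tau> \<xi>. radial_weight DIM('a) j (fibre_q \<tau> \<xi>)"
  have e0: "energy s \<eta> \<ge> 0" for \<eta> :: 'a using energy_pos[OF s, of \<eta>] by simp
  define k where "k \<tau> \<xi> \<eta> = ?w \<tau> \<xi> \<eta> * energy s (?p \<tau> \<xi> \<eta>) * energy s (?p \<tau> \<xi> \<eta> - \<xi>) * exp (- c * (energy s (?p \<tau> \<xi> \<eta>) + energy s (?p \<tau> \<xi> \<eta> - \<xi>)))" for \<tau> and \<xi> \<eta> :: 'a
  have k0: "k \<tau> \<xi> \<eta> \<ge> 0" for \<tau> \<xi> \<eta>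
    unfolding k_def by (intro mult_nonneg_nonneg fibre_wt_nonneg e0) simp
  have km[measurable]: "(\<lambda>x. k (f x) (g x) (h x)) \<in> borel_measurable M"
    if [measurable]: "f \<in> borel_measurable M" "g \<in> borel_measurable M" "h \<in> borel_measurable M" for f g h and M :: "'x measure"
    unfolding k_def by measurable
  have kF: "of_real (?w \<tau> \<xi> \<eta> * energy s (?p \<tau> \<xi> \<eta>) * energy s (?p \<tau> \<xi> \<eta> - \<xi>)) * (F (?p \<tau> \<xi> \<eta>) * cnj (F (?p \<tau> \<xi> \<eta> - \<xi>))) = of_real (k \<tau> \<xi> \<eta>)" for \<tau> \<xi> \<eta>
    unfolding k_def F complex_cnj_complex_of_real distrib_left exp_add of_real_mult by (simp only: mult_ac)
  have sq: "ennreal (nsq (pair_transform s F (\<tau>, \<xi>))) = (NN \<eta> \<eta>'. ennreal (k \<tau> \<xi> \<eta> * k \<tau> \<xi> \<eta>'))"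
    if i: "integrable lborel (\<lambda>\<eta>. complex_of_real (k \<tau> \<xi> \<eta>))" for \<tau> \<xi>
  proof -
    have ki: "integrable lborel (k \<tau> \<xi>)" using integrable_Re[OF i] by simp
    have "pair_transform s F (\<tau>, \<xi>) = of_real (LB \<eta>. k \<tau> \<xi> \<eta>)"
      unfolding pair_transform_def prod.case kF using ki by (rule integral_of_real)
    then have "ennreal (nsq (pair_transform s F (\<tau>, \<xi>))) = (NN \<eta>. ennreal (k \<tau> \<xi> \<eta>)) * (NN \<eta>. ennreal (k \<tau> \<xi> \<eta>))"
      using k0 by (simp add: nn_integral_eq_integral[OF ki] integral_nonneg_AE power2_eq_square ennreal_mult[symmetric])
    also have "\<dots> = (NN \<eta> \<eta>'. ennreal (k \<tau> \<xi> \<eta>) * ennreal (k \<tau> \<xi> \<eta>'))"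
      by (simp add: nn_integral_cmult nn_integral_multc)
    finally show ?thesis by (simp add: ennreal_mult k0)
  qed
  have pt: "?w \<tau> \<xi> \<eta> * ?w \<tau> \<xi> \<eta>' * energy s (?p \<tau> \<xi> \<eta>) * energy s (?p \<tau> \<xi> \<eta>' - \<xi>) * (s\<^sup>2 * exp (- 2 * c * (energy s (?p \<tau> \<xi> \<eta>) + energy s (?p \<tau> \<xi> \<eta>' - \<xi>))))
    \<le> k \<tau> \<xi> \<eta> * k \<tau> \<xi> \<eta>'" for \<tau> \<xi> \<eta> \<eta>'
  proof (cases "\<bar>\<tau>\<bar> < norm \<xi>")
    case True
    define e1 e2 e3 e4 where "e1 = energy s (?p \<tau> \<xi> \<eta>)" and "e2 = energy s (?p \<tau> \<xi> \<eta> - \<xi>)" and "e3 = energy s (?p \<tau> \<xi> \<eta>')" and "e4 = energy s (?p \<tau> \<xi> \<eta>' - \<xi>)"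
    have "e1 - e2 = \<tau>" "e3 - e4 = \<tau>" unfolding e1_def e2_def e3_def e4_def by (rule fibre_energy_difference[OF s True])+
    \<comment> \<open>Both energy differences equal tau, so e1 + e4 = e2 + e3 and the product of the
      exponentials depends on e1 + e4 alone.\<close>
    then have "- c * (e1 + e2) + - c * (e3 + e4) = - 2 * c * (e1 + e4)" by (auto simp: algebra_simps)
    then have ex: "exp (- c * (e1 + e2)) * exp (- c * (e3 + e4)) = exp (- 2 * c * (e1 + e4))" unfolding exp_add[symmetric] by simp
    have "s\<^sup>2 \<le> e2 * e3" unfolding power2_eq_square e2_def e3_def using s e0 by (intro mult_mono energy_ge) auto
    then have "?w \<tau> \<xi> \<eta> * ?w \<tau> \<xi> \<eta>' * e1 * e4 * (s\<^sup>2 * exp (- 2 * c * (e1 + e4))) \<le> ?w \<tau> \<xi> \<eta> * ?w \<tau> \<xi> \<eta>' * e1 * e4 * ((e2 * e3) * exp (- 2 * c * (e1 + e4)))"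
      by (intro mult_left_mono mult_right_mono mult_nonneg_nonneg fibre_wt_nonneg) (auto simp: e1_def e4_def e0)
    also have "\<dots> = k \<tau> \<xi> \<eta> * k \<tau> \<xi> \<eta>'"
    proof -
      have "k \<tau> \<xi> \<eta> = ?w \<tau> \<xi> \<eta> * e1 * e2 * exp (- c * (e1 + e2))" "k \<tau> \<xi> \<eta>' = ?w \<tau> \<xi> \<eta>' * e3 * e4 * exp (- c * (e3 + e4))"
        by (simp_all only: k_def e1_def e2_def e3_def e4_def)
      then show ?thesis unfolding ex[symmetric] by (simp only: mult_ac)
    qed
    finally show ?thesis by (simp only: e1_def e4_def)
  next
    case False
    then show ?thesis by (simp add: k_def fibre_wt_def)
  qed
  have "(NN (a::'a) b. ?H a b * ennreal (collision_density s j a b))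
    = (NN \<xi> \<tau> \<eta> \<eta>'. ennreal (?W \<tau> \<xi> * ?w \<tau> \<xi> \<eta> * ?w \<tau> \<xi> \<eta>' * energy s (?p \<tau> \<xi> \<eta>) * energy s (?p \<tau> \<xi> \<eta>' - \<xi>))
    * ?H (?p \<tau> \<xi> \<eta>) (?p \<tau> \<xi> \<eta>' - \<xi>))"
    by (rule collision_formula[OF s d j, of ?H, symmetric]) measurable
  also have "\<dots> \<le> (NN \<xi> \<tau>. ennreal (?W \<tau> \<xi>) * ennreal (nsq (pair_transform s F (\<tau>, \<xi>))))"
  proof (rule nn_integral_mono_AE)
    show "AE \<xi>::'a in lborel. (NN \<tau> \<eta> \<eta>'. ennreal (?W \<tau> \<xi> * ?w \<tau> \<xi> \<eta> * ?w \<tau> \<xi> \<eta>' * energy s (?p \<tau> \<xi> \<eta>) * energy s (?p \<tau> \<xi> \<eta>' - \<xi>))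
      * ?H (?p \<tau> \<xi> \<eta>) (?p \<tau> \<xi> \<eta>' - \<xi>))
      \<le> (NN \<tau>. ennreal (?W \<tau> \<xi>) * ennreal (nsq (pair_transform s F (\<tau>, \<xi>))))"
      using AE_lborel_nonzero
    proof eventually_elim
      case (elim \<xi>)
      \<comment> \<open>A lower bound needs the fibre integral to converge for almost every tau,
        since a divergent one would count as 0.\<close>
      from lborel_pair.AE_integrable_fst'[OF fibre_integral(1)[OF s elim L2_translate_product(2)[OF F2, of \<xi>]]]
      have "AE \<tau> in lborel. integrable lborel (\<lambda>\<eta>. complex_of_real (k \<tau> \<xi> \<eta>))" by (simp only: prod.case kF)
      then show ?case
      proof (intro nn_integral_mono_AE, eventually_elim)
        case (elim \<tau>)
        have "(NN \<eta> \<eta>'. ennreal (?W \<tau> \<xi> * ?w \<tau> \<xi> \<eta> * ?w \<tau> \<xi> \<eta>' * energy s (?p \<tau> \<xi> \<eta>) * energy s (?p \<tau> \<xi> \<eta>' - \<xi>))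
          * ?H (?p \<tau> \<xi> \<eta>) (?p \<tau> \<xi> \<eta>' - \<xi>)) \<le> (NN \<eta> \<eta>'. ennreal (?W \<tau> \<xi>) * ennreal (k \<tau> \<xi> \<eta> * k \<tau> \<xi> \<eta>'))"
        proof (rule nn_integral_mono, rule nn_integral_mono)
          fix \<eta> \<eta>' :: 'a
          from mult_left_mono[OF pt[of \<tau> \<xi> \<eta> \<eta>'] radial_weight_nonneg[of "DIM('a)" j "fibre_q \<tau> \<xi>"]]
          show "ennreal (?W \<tau> \<xi> * ?w \<tau> \<xi> \<eta> * ?w \<tau> \<xi> \<eta>' * energy s (?p \<tau> \<xi> \<eta>) * energy s (?p \<tau> \<xi> \<eta>' - \<xi>))
            * ?H (?p \<tau> \<xi> \<eta>) (?p \<tau> \<xi> \<eta>' - \<xi>) \<le> ennreal (?W \<tau> \<xi>) * ennreal (k \<tau> \<xi> \<eta> * k \<tau> \<xi> \<eta>')"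
            by (subst (1 2) ennreal_mult[symmetric])
              (auto intro!: ennreal_leI mult_nonneg_nonneg radial_weight_nonneg fibre_wt_nonneg e0 k0 simp: mult.assoc)
        qed
        also have "\<dots> = ennreal (?W \<tau> \<xi>) * ennreal (nsq (pair_transform s F (\<tau>, \<xi>)))"
          unfolding sq[OF elim(2)] by (simp add: nn_integral_cmult)
        finally show ?case .
      qed
    qed
  qed
  also have "\<dots> = (L2sq (\<lambda>z. box_pair s j F z))"
    by (rule nn_integral_box_pair_transform[OF s Fm, symmetric])
  finally show ?thesis .
qed

text \<open>The double integral that bounds the left-hand side, up to a constant, once the invariant
  mass is replaced by its minimum 2 s. For j = 0 it is the square of a single integral.\<close>

definition pair_energy :: "real \<Rightarrow> nat \<Rightarrow> ('a::euclidean_space \<Rightarrow> complex) \<Rightarrow> real" where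
  "pair_energy s j F = (LINT z|lborel2. (case z of (a, b) \<Rightarrow>
    energy s a * nsq (F a) * (energy s b * nsq (F b)) * relative_momentum_sq s a b ^ j))"

lemma measurable_box_symbol [measurable]: "borel_fun (box_symbol \<beta> :: real \<times> 'a::euclidean_space \<Rightarrow> complex)"
  unfolding box_symbol_def borel_prod[symmetric] by measurable

lemma pair_energy_integrable:
  fixes F :: "'a::euclidean_space \<Rightarrow> complex"
  assumes s: "s > 0" and [measurable]: "borel_fun F"
    and i: "integrable lborel (\<lambda>\<eta>. energy s \<eta> ^ (j + 1) * nsq (F \<eta>))"
  shows "integrable lborel2 (\<lambda>(a, b). energy s a * nsq (F a) * (energy s b * nsq (F b)) * relative_momentum_sq s a b ^ j)"
proof (rule integrable_pair_bound[OF _ i i])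
  fix a b :: 'a
  have e0: "energy s \<eta> \<ge> 0" for \<eta> :: 'a using energy_pos[OF s, of \<eta>] by simp
  have "energy s a * nsq (F a) * (energy s b * nsq (F b)) * relative_momentum_sq s a b ^ j
    \<le> energy s a * nsq (F a) * (energy s b * nsq (F b)) * (energy s a * energy s b) ^ j"
    by (intro mult_left_mono power_mono relative_momentum_sq_le relative_momentum_sq_nonneg s mult_nonneg_nonneg e0) auto
  then show "norm (energy s a * nsq (F a) * (energy s b * nsq (F b)) * relative_momentum_sq s a b ^ j)
    \<le> energy s a ^ (j + 1) * nsq (F a) * (energy s b ^ (j + 1) * nsq (F b))"
    using relative_momentum_sq_nonneg[OF s, of a b] by (simp add: abs_mult e0 power_mult_distrib mult_ac)
qed measurable

text \<open>The gap between the bound and the exact kernel is a positive multiple of X times 1/(2s)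
  - 1/(invariant mass). It is nonnegative, and positive where a and b differ and F(a), F(b) are
  nonzero. The diagonal being a null set, a vanishing gap forces F = 0 almost everywhere.\<close>

theorem pair_transform_sharp:
  fixes F :: "'a::euclidean_space \<Rightarrow> complex"
  assumes s: "s > 0" and d: "DIM('a) \<ge> 2" and j: "j \<le> 1" and Fm[measurable]: "borel_fun F"
    and i: "integrable lborel (\<lambda>\<eta>. energy s \<eta> ^ (j + 1) * nsq (F \<eta>))"
  defines "B \<equiv> \<lambda>z. box_pair s j F z"
  shows "in_L2 B"
    and "(LB z. nsq (B z)) \<le> collision_const DIM('a) j / (2 * s) * pair_energy s j F"
    and "\<not> (AE \<eta> in lborel. F \<eta> = 0) \<Longrightarrow> (LB z. nsq (B z)) < collision_const DIM('a) j / (2 * s) * pair_energy s j F"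
proof -
  let ?M = "lborel2 :: ('a \<times> 'a) measure"
  let ?c = "collision_const DIM('a) j"
  define G where "G = (\<lambda>(a, b). energy s a * nsq (F a) * (energy s b * nsq (F b)))"
  define X where "X = (\<lambda>(a, b). G (a, b) * relative_momentum_sq s a b ^ j)"
  define Y where "Y = (\<lambda>(a, b). G (a, b) * collision_density s j a b)"
  have e0: "energy s \<eta> \<ge> 0" for \<eta> :: 'a using energy_pos[OF s, of \<eta>] by simp
  have c0: "?c > 0" by (rule collision_const_pos) simp
  have G0: "G z \<ge> 0" for z by (auto simp: G_def e0 split: prod.split)
  have X0: "X z \<ge> 0" for z by (auto simp: X_def G0 split: prod.split intro!: mult_nonneg_nonneg zero_le_power relative_momentum_sq_nonneg[OF s])
  have Y0: "Y z \<ge> 0" for z by (auto simp: Y_def G0 split: prod.split intro!: mult_nonneg_nonneg collision_density_nonneg[OF s])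
  have Gm[measurable]: "G \<in> borel_measurable (borel \<Otimes>\<^sub>M borel)" unfolding G_def by measurable
  have Ym[measurable]: "Y \<in> borel_measurable ?M" unfolding Y_def by measurable
  have Xi: "integrable ?M X"
    using pair_energy_integrable[OF s Fm i] by (simp add: X_def G_def)
  have gap: "?c / (2 * s) * X (a, b) - Y (a, b) = ?c * X (a, b) * (1 / (2 * s) - 1 / invariant_mass s a b)" for a b
    by (simp add: X_def Y_def collision_density_def algebra_simps)
  have gap0: "1 / (2 * s) - 1 / invariant_mass s a b \<ge> 0" for a b :: 'a
    using invariant_mass_ge[OF s, of a b] s by (simp add: frac_le)
  have YX: "Y z \<le> ?c / (2 * s) * X z" for z
  proof -
    obtain a b where z: "z = (a, b)" by (cases z)
    have "0 \<le> ?c * X (a, b) * (1 / (2 * s) - 1 / invariant_mass s a b)"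
      using c0 by (intro mult_nonneg_nonneg X0 gap0) auto
    then show ?thesis unfolding z gap[symmetric] by simp
  qed
  have Yi: "integrable ?M Y"
    by (rule integrable_dominated[OF integrable_mult_right[OF Xi, of "?c / (2 * s)"]])
      (use YX Y0 X0 c0 s in \<open>auto simp: abs_mult\<close>)
  have PX: "pair_energy s j F = (LINT z|?M. X z)"
    unfolding pair_energy_def by (rule LB_cong) (simp add: X_def G_def split: prod.split)
  have Bm[measurable]: "borel_fun B" unfolding B_def by measurable
  have "L2sq B \<le> (NN a b. ennreal (energy s a * nsq (F a) * (energy s b * nsq (F b))) * ennreal (collision_density s j a b))"
    unfolding B_def by (rule pair_transform_upper[OF s d j Fm])
  also have "\<dots> = (NN a b. ennreal (Y (a, b)))"
    by (simp add: Y_def G_def ennreal_mult e0 collision_density_nonneg[OF s])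
  also have "\<dots> = (\<integral>\<^sup>+z. ennreal (Y z) \<partial>?M)"
    by (rule lborel.nn_integral_fst) measurable
  also have "\<dots> = ennreal (LINT z|?M. Y z)" by (rule nn_integral_eq_integral[OF Yi]) (simp add: Y0)
  finally have le: "L2sq B \<le> ennreal (LINT z|?M. Y z)" .
  then have "L2sq B < \<infinity>" by (rule le_less_trans) simp
  then show B2: "in_L2 B" unfolding in_L2_iff by simp
  have BY: "(LB z. nsq (B z)) \<le> (LINT z|?M. Y z)"
    using le Y0 unfolding in_L2_nn_integral[OF B2] by (simp add: integral_nonneg_AE)
  have D: "?c / (2 * s) * pair_energy s j F - (LINT z|?M. Y z) = (LINT z|?M. ?c / (2 * s) * X z - Y z)"
    unfolding PX using Xi Yi by simp
  have D0: "0 \<le> (LINT z|?M. ?c / (2 * s) * X z - Y z)" using YX by (intro integral_nonneg_AE AE_I2) simp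
  then show "(LB z. nsq (B z)) \<le> ?c / (2 * s) * pair_energy s j F" using BY D by linarith
  assume nz: "\<not> (AE \<eta> in lborel. F \<eta> = 0)"
  have "(LINT z|?M. ?c / (2 * s) * X z - Y z) \<noteq> 0"
  proof
    assume z: "(LINT z|?M. ?c / (2 * s) * X z - Y z) = 0"
    have "AE z in ?M. ?c / (2 * s) * X z - Y z = 0"
    proof (subst integral_nonneg_eq_0_iff_AE[symmetric])
      show "integrable ?M (\<lambda>z. ?c / (2 * s) * X z - Y z)" using Xi Yi by simp
      show "AE z in ?M. 0 \<le> ?c / (2 * s) * X z - Y z" using YX by simp
    qed (rule z)
    from lborel_pair.AE_pair[OF this] have ae: "AE a in lborel. AE b in lborel. ?c / (2 * s) * X (a, b) - Y (a, b) = 0" .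
    have key: "a = b \<or> F a = 0 \<or> F b = 0" if "?c / (2 * s) * X (a, b) - Y (a, b) = 0" for a b
    proof (rule ccontr)
      assume n: "\<not> (a = b \<or> F a = 0 \<or> F b = 0)"
      then have R: "relative_momentum_sq s a b > 0" by (intro relative_momentum_sq_pos s) auto
      have "sqrt (s\<^sup>2) < sqrt (s\<^sup>2 + relative_momentum_sq s a b)" using R by (intro real_sqrt_less_mono) simp
      then have "2 * s < invariant_mass s a b" unfolding invariant_mass_relative_momentum[OF s] using s by simp
      then have "1 / (2 * s) - 1 / invariant_mass s a b > 0" using s by (simp add: frac_less2)
      moreover have "X (a, b) > 0" unfolding X_def G_def using n R energy_pos[OF s, of a] energy_pos[OF s, of b] by simp
      ultimately have "?c * X (a, b) * (1 / (2 * s) - 1 / invariant_mass s a b) > 0" using c0 by (intro mult_pos_pos)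
      then show False using that unfolding gap by simp
    qed
    \<comment> \<open>There is a point a with F(a) nonzero whose slice of the gap vanishes almost
      everywhere, for otherwise F would vanish almost everywhere. Then F(b) = 0 for almost all b
      other than a.\<close>
    have "\<not> (AE a in lborel. \<not> (F a \<noteq> 0 \<and> (AE b in lborel. ?c / (2 * s) * X (a, b) - Y (a, b) = 0)))"
    proof
      assume "AE a in lborel. \<not> (F a \<noteq> 0 \<and> (AE b in lborel. ?c / (2 * s) * X (a, b) - Y (a, b) = 0))"
      then have "AE a in lborel. F a = 0" using ae by eventually_elim auto
      then show False using nz by simp
    qed
    then obtain a where a: "F a \<noteq> 0" "AE b in lborel. ?c / (2 * s) * X (a, b) - Y (a, b) = 0"
      by (metis (mono_tags, lifting) AE_I2)
    have "AE b in lborel. F b = 0"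
      using a(2) AE_lborel_singleton[of a]
    proof eventually_elim
      case (elim b)
      then show ?case using key[of a b] a(1) by auto
    qed
    then show False using nz by simp
  qed
  then show "(LB z. nsq (B z)) < ?c / (2 * s) * pair_energy s j F" using BY D D0 by linarith
qed

section \<open>The two right-hand sides as integrals over pairs\<close>

lemma integral_pair_mult:
  fixes f g :: "'a::euclidean_space \<Rightarrow> real"
  assumes "integrable lborel f" "integrable lborel g"
  shows "(LINT z|lborel2. (case z of (a, b) \<Rightarrow> f a * g b)) = (LB a. f a) * (LB b. g b)"
  using lborel_pair.integral_fst'[OF integrable_pair_mult[OF assms]] by simp

lemma pair_energy_0:
  assumes i: "integrable lborel (\<lambda>\<eta>. energy s \<eta> * nsq (F \<eta>))"
  shows "pair_energy s 0 F = (LB \<eta>. energy s \<eta> * nsq (F \<eta>))\<^sup>2"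
  unfolding pair_energy_def using integral_pair_mult[OF i i] by (simp add: power2_eq_square)

text \<open>Each term of E(a) E(b) - a . b - s^2, twice the squared relative momentum, factorises
  under the double integral. This is the origin of the difference of fourth powers in the second
  estimate; the excess |P|^2 comes from a . b, P being the momentum weighted by E |F|^2.\<close>

lemma pair_energy_1:
  fixes F :: "'a::euclidean_space \<Rightarrow> complex"
  assumes s: "s > 0" and [measurable]: "borel_fun F"
    and i1: "integrable lborel (\<lambda>\<eta>. energy s \<eta> * nsq (F \<eta>))"
    and i2: "integrable lborel (\<lambda>\<eta>. (energy s \<eta>)\<^sup>2 * nsq (F \<eta>))"
  defines "P \<equiv> LB \<eta>. (energy s \<eta> * nsq (F \<eta>)) *\<^sub>R \<eta>"
  shows "(LB \<eta>. (energy s \<eta>)\<^sup>2 * nsq (F \<eta>))\<^sup>2 - s\<^sup>2 * (LB \<eta>. energy s \<eta> * nsq (F \<eta>))\<^sup>2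
    = 2 * pair_energy s 1 F + (norm P)\<^sup>2"
proof -
  let ?M = "lborel2 :: ('a \<times> 'a) measure"
  define f g where "f \<eta> = energy s \<eta> * nsq (F \<eta>)" and "g \<eta> = (energy s \<eta>)\<^sup>2 * nsq (F \<eta>)" for \<eta>
  have e0: "energy s \<eta> \<ge> 0" for \<eta> :: 'a using energy_pos[OF s, of \<eta>] by simp
  have fi: "integrable lborel f" and gi: "integrable lborel g" using i1 i2 unfolding f_def g_def .
  have [measurable]: "borel_fun f" "borel_fun g" using fi gi by auto
  have fv: "norm (f \<eta> *\<^sub>R \<eta>) \<le> g \<eta>" for \<eta>
    using mult_left_mono[OF less_imp_le[OF norm_less_energy[OF s, of \<eta>]], of "f \<eta>"] e0[of \<eta>]
    by (simp add: f_def g_def power2_eq_square mult_ac)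
  have vi: "integrable lborel (\<lambda>\<eta>. f \<eta> *\<^sub>R \<eta>)"
    by (rule integrable_dominated[OF gi]) (use fv in \<open>auto intro!: AE_I2 order_trans[OF fv abs_ge_self] simp del: norm_scaleR\<close>)
  have ii: "integrable ?M (\<lambda>(a, b). (f a *\<^sub>R a) \<bullet> (f b *\<^sub>R b))"
  proof (rule integrable_pair_bound[OF _ gi gi])
    show "norm ((f a *\<^sub>R a) \<bullet> (f b *\<^sub>R b)) \<le> g a * g b" for a b
      unfolding real_norm_def by (rule order_trans[OF Cauchy_Schwarz_ineq2 mult_mono]) (use fv order_trans[OF norm_ge_zero fv] in auto)
  qed measurable
  have "(LINT z|?M. (case z of (a, b) \<Rightarrow> (f a *\<^sub>R a) \<bullet> (f b *\<^sub>R b))) = (LB a b. (f a *\<^sub>R a) \<bullet> (f b *\<^sub>R b))"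
    using lborel_pair.integral_fst'[OF ii] by simp
  also have "\<dots> = (LB a. (f a *\<^sub>R a) \<bullet> P)"
    by (rule LB_cong, subst integral_inner_right) (use vi in \<open>auto simp: P_def f_def\<close>)
  also have "\<dots> = P \<bullet> P"
    by (subst integral_inner_left) (use vi in \<open>auto simp: P_def f_def\<close>)
  finally have ip: "(LINT z|?M. (case z of (a, b) \<Rightarrow> (f a *\<^sub>R a) \<bullet> (f b *\<^sub>R b))) = (norm P)\<^sup>2"
    by (simp add: power2_norm_eq_inner)
  have "2 * pair_energy s 1 F = (LINT z|?M. 2 * (case z of (a, b) \<Rightarrow> energy s a * nsq (F a) * (energy s b * nsq (F b)) * relative_momentum_sq s a b ^ 1))"
    unfolding pair_energy_def by (rule integral_mult_right_zero[symmetric])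
  also have "\<dots> = (LINT z|?M. (case z of (a, b) \<Rightarrow> g a * g b) - (case z of (a, b) \<Rightarrow> (f a *\<^sub>R a) \<bullet> (f b *\<^sub>R b)) - s\<^sup>2 * (case z of (a, b) \<Rightarrow> f a * f b))"
  proof (rule LB_cong)
    fix z :: "'a \<times> 'a"
    obtain a b where z: "z = (a, b)" by (cases z)
    have "2 * (energy s a * nsq (F a) * (energy s b * nsq (F b)) * relative_momentum_sq s a b ^ 1) = f a * f b * (energy s a * energy s b - a \<bullet> b - s\<^sup>2)"
      by (simp add: f_def relative_momentum_sq_def)
    then show "2 * (case z of (a, b) \<Rightarrow> energy s a * nsq (F a) * (energy s b * nsq (F b)) * relative_momentum_sq s a b ^ 1)
      = (case z of (a, b) \<Rightarrow> g a * g b) - (case z of (a, b) \<Rightarrow> (f a *\<^sub>R a) \<bullet> (f b *\<^sub>R b)) - s\<^sup>2 * (case z of (a, b) \<Rightarrow> f a * f b)"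
      unfolding z prod.case
      by (simp add: f_def g_def algebra_simps power2_eq_square)
  qed
  also have "\<dots> = (LB \<eta>. g \<eta>)\<^sup>2 - (norm P)\<^sup>2 - s\<^sup>2 * (LB \<eta>. f \<eta>)\<^sup>2"
  proof -
    have "(LINT z|?M. u z - v z - s\<^sup>2 * w z) = (LINT z|?M. u z) - (LINT z|?M. v z) - s\<^sup>2 * (LINT z|?M. w z)"
      if "integrable ?M u" "integrable ?M v" "integrable ?M w" for u v w :: "'a \<times> 'a \<Rightarrow> real"
      using that by simp
    from this[OF integrable_pair_mult[OF gi gi] ii integrable_pair_mult[OF fi fi]] show ?thesis
      unfolding ip integral_pair_mult[OF gi gi] integral_pair_mult[OF fi fi] power2_eq_square[of "integral\<^sup>L _ _"] .
  qed
  finally show ?thesis by (simp add: f_def g_def)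
qed

section \<open>Norms of f and of the density on the Fourier side\<close>

lemma phi_multiplier:
  fixes f F :: "'a::euclidean_space \<Rightarrow> complex"
  assumes s: "s > 0" and fF: "is_fourier_transform f F" and \<alpha>: "real m = 2 * \<alpha>"
  shows "multiplier_dom (phi_symbol s \<alpha>) f \<longleftrightarrow> integrable lborel (\<lambda>\<eta>. energy s \<eta> ^ m * nsq (F \<eta>))"
    and "multiplier_dom (phi_symbol s \<alpha>) f \<Longrightarrow>
      (L2_norm (multiplier (phi_symbol s \<alpha>) f))\<^sup>2 = (LB \<eta>. energy s \<eta> ^ m * nsq (F \<eta>)) / (2 * pi) ^ DIM('a)"
proof -
  have [measurable]: "borel_fun F" by (rule is_fourier_transformD(2)[OF fF])
  have ms[measurable]: "borel_fun (phi_symbol s \<alpha> :: 'a \<Rightarrow> complex)"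
    unfolding phi_symbol_def[abs_def] phi_def by measurable
  have e: "nsq (phi_symbol s \<alpha> \<eta> * F \<eta>) = energy s \<eta> ^ m * nsq (F \<eta>)" for \<eta> :: 'a
  proof -
    have "(energy s \<eta> powr \<alpha>)\<^sup>2 = energy s \<eta> ^ m"
      unfolding powr_realpow[OF energy_pos[OF s], symmetric] \<alpha> power2_eq_square powr_add[symmetric] by simp
    then show ?thesis by (simp add: phi_symbol_def norm_mult power_mult_distrib energy_def)
  qed
  have L2: "in_L2 (\<lambda>\<eta>. phi_symbol s \<alpha> \<eta> * F \<eta>) \<longleftrightarrow> integrable lborel (\<lambda>\<eta>. energy s \<eta> ^ m * nsq (F \<eta>))"
    unfolding in_L2_def e by simp
  show 1: "multiplier_dom (phi_symbol s \<alpha>) f \<longleftrightarrow> integrable lborel (\<lambda>\<eta>. energy s \<eta> ^ m * nsq (F \<eta>))"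
    unfolding multiplier_L2(1)[OF fF ms] L2 ..
  assume "multiplier_dom (phi_symbol s \<alpha>) f"
  then have "in_L2 (\<lambda>\<eta>. phi_symbol s \<alpha> \<eta> * F \<eta>)" unfolding 1 L2 .
  from multiplier_L2(2)[OF fF ms this]
  show "(L2_norm (multiplier (phi_symbol s \<alpha>) f))\<^sup>2 = (LB \<eta>. energy s \<eta> ^ m * nsq (F \<eta>)) / (2 * pi) ^ DIM('a)"
    unfolding e .
qed

text \<open>The energy is at least s > 0, so a finite energy norm already puts F into L2.\<close>

lemma phi_multiplier_fourier:
  fixes f :: "'a::euclidean_space \<Rightarrow> complex"
  assumes s: "s > 0" and "multiplier_dom (phi_symbol s (1/2)) f"
  shows "\<exists>F. is_fourier_transform f F \<and> in_L2 F"
proof -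
  obtain F where F: "is_fourier_transform f F"
    using assms(2) unfolding multiplier_dom_def is_multiplier_image_def by blast
  have [measurable]: "borel_fun F" by (rule is_fourier_transformD(2)[OF F])
  have i: "integrable lborel (\<lambda>\<eta>. energy s \<eta> ^ 1 * nsq (F \<eta>))"
    using phi_multiplier(1)[OF s F, of 1 "1/2"] assms(2) by simp
  have "integrable lborel (\<lambda>\<eta>. nsq (F \<eta>))"
  proof (rule integrable_dominated[OF integrable_mult_right[OF i, of "1 / s"]])
    show "AE \<eta> in lborel. norm (nsq (F \<eta>)) \<le> norm (1 / s * (energy s \<eta> ^ 1 * nsq (F \<eta>)))" (is "AE \<eta> in _. ?P \<eta>")
    proof (rule AE_I2)
      fix \<eta> :: 'a
      have "1 * nsq (F \<eta>) \<le> (energy s \<eta> / s) * nsq (F \<eta>)"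
        using energy_ge[OF s, of \<eta>] s by (intro mult_right_mono) auto
      then show "?P \<eta>"
        using s energy_pos[OF s, of \<eta>] by (simp add: abs_mult)
    qed
  qed measurable
  then show ?thesis using F by (auto simp: in_L2_def)
qed

text \<open>The squared constant of \<open>density_fourier\<close>, divided by the Plancherel
  constant of space-time, whose dimension is n + 1.\<close>

definition kg_const :: "nat \<Rightarrow> real" where
  "kg_const n = (2 * pi) ^ 2 / ((2 * pi) ^ n) ^ 2 / (2 * pi) ^ (n + 1)"

lemma kg_const_pos: "kg_const n > 0"
  by (simp add: kg_const_def)

lemma kg_box_norm:
  fixes f F :: "'a::euclidean_space \<Rightarrow> complex"
  assumes s: "s > 0" and fF: "is_fourier_transform f F" and F: "in_L2 F"
    and L2: "in_L2 (\<lambda>z. box_symbol \<beta> z * pair_transform s F z)"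
  shows "multiplier_dom (box_symbol \<beta>) (kg_density s f)"
    and "(L2_norm (multiplier (box_symbol \<beta>) (kg_density s f)))\<^sup>2
      = kg_const DIM('a) * (LB z. nsq (box_symbol \<beta> z * pair_transform s F z))"
proof -
  define K where "K = complex_of_real (2 * pi / (2 * pi) ^ DIM('a))"
  let ?B = "\<lambda>z. box_symbol \<beta> z * pair_transform s F z"
  have D: "is_fourier_transform (kg_density s f) (\<lambda>z. K * pair_transform s F z)"
    unfolding K_def by (rule density_fourier[OF s fF F])
  have e: "nsq (box_symbol \<beta> z * (K * pair_transform s F z)) = nsq K * nsq (?B z)" for z
    by (simp add: norm_mult power_mult_distrib)
  have L2': "in_L2 (\<lambda>z. box_symbol \<beta> z * (K * pair_transform s F z))"
    using L2 is_fourier_transformD(2)[OF D] measurable_box_symbol[of \<beta>, where 'a='a] unfolding in_L2_def e by auto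
  show "multiplier_dom (box_symbol \<beta>) (kg_density s f)"
    using multiplier_L2(1)[OF D measurable_box_symbol] L2' by blast
  have "(L2_norm (multiplier (box_symbol \<beta>) (kg_density s f)))\<^sup>2 = (LB z. nsq K * nsq (?B z)) / (2 * pi) ^ DIM(real \<times> 'a)"
    using multiplier_L2(2)[OF D measurable_box_symbol L2'] unfolding e .
  also have "\<dots> = nsq K / (2 * pi) ^ (DIM('a) + 1) * (LB z. nsq (?B z))"
    unfolding integral_mult_right_zero by (simp add: DIM_prod)
  also have "nsq K / (2 * pi) ^ (DIM('a) + 1) = kg_const DIM('a)"
    unfolding K_def norm_of_real power2_abs power_divide kg_const_def ..
  finally show "(L2_norm (multiplier (box_symbol \<beta>) (kg_density s f)))\<^sup>2 = kg_const DIM('a) * (LB z. nsq (?B z))" .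
qed

theorem kg_sharp:
  fixes f F :: "'a::euclidean_space \<Rightarrow> complex"
  assumes s: "s > 0" and d: "DIM('a) \<ge> 2" and j: "j \<le> 1"
    and fF: "is_fourier_transform f F" and F: "in_L2 F"
    and i: "integrable lborel (\<lambda>\<eta>. energy s \<eta> ^ (j + 1) * nsq (F \<eta>))"
  defines "\<beta> \<equiv> (2 - real DIM('a) + 2 * real j) / 4"
    and "c \<equiv> kg_const DIM('a) * (collision_const DIM('a) j / (2 * s))"
  shows "multiplier_dom (box_symbol \<beta>) (kg_density s f)"
    and "(L2_norm (multiplier (box_symbol \<beta>) (kg_density s f)))\<^sup>2 \<le> c * pair_energy s j F"
    and "\<not> (AE x in lborel. f x = 0) \<Longrightarrow> (L2_norm (multiplier (box_symbol \<beta>) (kg_density s f)))\<^sup>2 < c * pair_energy s j F"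
proof -
  have Fm: "borel_fun F" using F by (simp add: in_L2_def)
  note P = pair_transform_sharp[OF s d j Fm i, folded \<beta>_def]
  note N = kg_box_norm[OF s fF F P(1)]
  show "multiplier_dom (box_symbol \<beta>) (kg_density s f)" by (rule N(1))
  show "(L2_norm (multiplier (box_symbol \<beta>) (kg_density s f)))\<^sup>2 \<le> c * pair_energy s j F"
    unfolding N(2) c_def mult.assoc using P(2) kg_const_pos[of "DIM('a)"] by (intro mult_left_mono) auto
  assume nz: "\<not> (AE x in lborel. f x = 0)"
  have "\<not> (AE \<eta> in lborel. F \<eta> = 0)"
  proof
    assume F0: "AE \<eta> in lborel. F \<eta> = 0"
    have "is_fourier_transform f (\<lambda>_. 0)"
      by (rule is_fourier_transform_cong_AE[OF fF]) (use F0 is_fourier_transformD(1)[OF fF] in auto)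
    moreover have "is_fourier_transform (\<lambda>_::'a. 0) (\<lambda>_. 0)" by (simp add: is_fourier_transform_def)
    ultimately show False using is_fourier_transform_inverse_unique nz by blast
  qed
  from P(3)[OF this] show "(L2_norm (multiplier (box_symbol \<beta>) (kg_density s f)))\<^sup>2 < c * pair_energy s j F"
    unfolding N(2) c_def mult.assoc using kg_const_pos[of "DIM('a)"] by (intro mult_strict_left_mono)
qed

section \<open>Optimality\<close>

text \<open>A single term of the exponential series gives e^m <= m! exp e; taken with m = k + N for
  N = 2 d, it leaves the decay (1 + |eta|)^(-N).\<close>

lemma energy_exp_integrable:
  fixes c :: real
  assumes s: "s > 0" and c: "c \<ge> 1"
  shows "integrable lborel (\<lambda>\<eta>::'a::euclidean_space. energy s \<eta> ^ k * exp (- c * energy s \<eta>))"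
proof (rule integrable_dominated)
  define N where "N = 2 * DIM('a)"
  define K where "K = (1 / s + 1) ^ N * fact (k + N)"
  show "integrable lborel (\<lambda>\<eta>::'a. K * (1 / (1 + norm \<eta>) ^ N))"
    unfolding N_def by (intro integrable_mult_right integrable_inverse_1_plus_norm) simp
  show "AE \<eta>::'a in lborel. norm (energy s \<eta> ^ k * exp (- c * energy s \<eta>)) \<le> norm (K * (1 / (1 + norm \<eta>) ^ N))" (is "AE \<eta> in _. ?P \<eta>")
  proof (rule AE_I2)
    fix \<eta> :: 'a
    define e where "e = energy s \<eta>"
    have e: "e > 0" "s \<le> e" "norm \<eta> \<le> e"
      using energy_pos[OF s, of \<eta>] energy_ge[OF s, of \<eta>] norm_less_energy[OF s, of \<eta>] by (auto simp: e_def)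
    have "1 + norm \<eta> \<le> (1 / s + 1) * e" using e s by (simp add: distrib_right pos_le_divide_eq add_mono)
    then have "(1 + norm \<eta>) ^ N \<le> ((1 / s + 1) * e) ^ N" by (intro power_mono) auto
    then have a: "e ^ k * (1 + norm \<eta>) ^ N \<le> (1 / s + 1) ^ N * e ^ (k + N)"
      using mult_left_mono[of "(1 + norm \<eta>) ^ N" "((1 / s + 1) * e) ^ N" "e ^ k"] e by (simp add: power_mult_distrib power_add mult_ac)
    have "e ^ (k + N) / fact (k + N) \<le> exp e"
    proof -
      have sm: "(\<lambda>n. e ^ n / fact n) sums exp e"
        using exp_converges[of e] by (simp add: divide_inverse mult.commute)
      have "(\<Sum>n\<in>{k + N}. e ^ n / fact n) \<le> (\<Sum>n. e ^ n / fact n)"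
        by (rule sum_le_suminf) (use e sums_summable[OF sm] in auto)
      then show ?thesis using sums_unique[OF sm] by simp
    qed
    then have "e ^ (k + N) \<le> fact (k + N) * exp e" by (simp add: pos_divide_le_eq mult.commute)
    also have "\<dots> \<le> fact (k + N) * exp (c * e)" using c e by (intro mult_left_mono) auto
    finally have "e ^ k * (1 + norm \<eta>) ^ N \<le> (1 / s + 1) ^ N * (fact (k + N) * exp (c * e))"
      using a s by (meson mult_left_mono order_trans zero_le_power add_nonneg_nonneg divide_nonneg_nonneg zero_le_one less_imp_le)
    then have "e ^ k * (1 + norm \<eta>) ^ N \<le> K * exp (c * e)" by (simp add: K_def mult.assoc)
    moreover have "0 < (1 + norm \<eta>) ^ N" by (intro zero_less_power add_pos_nonneg) auto
    ultimately have "e ^ k * exp (- c * e) \<le> K * (1 / (1 + norm \<eta>) ^ N)"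
      by (simp add: exp_minus field_simps)
    then show "?P \<eta>"
      using e s unfolding e_def[symmetric] by (simp add: abs_mult K_def)
  qed
qed measurable

lemma energy_le: "s > 0 \<Longrightarrow> energy s \<eta> \<le> s + norm \<eta>"
  unfolding energy_def phi_def using sqrt_sum_squares_le_sum[of s "norm \<eta>"] by simp

lemma AE_not_in_open:
  assumes "open S" "S \<noteq> {}"
  shows "\<not> (AE x in lborel. x \<notin> S)"
proof
  assume "AE x in lborel. x \<notin> S"
  then have "S \<in> null_sets lborel" using assms(1) by (subst AE_iff_null_sets) auto
  then have "negligible S" unfolding negligible_iff_null_sets by (rule null_sets_completionI)
  then show False using open_not_negligible[OF assms] by simp
qed

lemma pair_exp_integrable:
  assumes s: "s > 0" and n: "n \<ge> 1"
  shows "integrable lborel2 (\<lambda>(a::'a::euclidean_space, b). relative_momentum_sq s a b ^ j * (energy s a * energy s b) ^ p * exp (- 2 * real n * (energy s a + energy s b)))"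
proof (rule integrable_pair_bound)
  show "integrable lborel (\<lambda>\<eta>::'a. energy s \<eta> ^ (j + p) * exp (- (2 * real n) * energy s \<eta>))"
    "integrable lborel (\<lambda>\<eta>::'a. energy s \<eta> ^ (j + p) * exp (- (2 * real n) * energy s \<eta>))"
    using n by (intro energy_exp_integrable s; simp)+
  fix a b :: 'a
  have e0: "energy s \<eta> \<ge> 0" for \<eta> :: 'a using energy_pos[OF s, of \<eta>] by simp
  have R0: "relative_momentum_sq s a b \<ge> 0" by (rule relative_momentum_sq_nonneg[OF s])
  have "relative_momentum_sq s a b ^ j * (energy s a * energy s b) ^ p * exp (- 2 * real n * (energy s a + energy s b))
    \<le> (energy s a * energy s b) ^ j * (energy s a * energy s b) ^ p * exp (- 2 * real n * (energy s a + energy s b))"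
    by (intro mult_right_mono power_mono relative_momentum_sq_le R0 s mult_nonneg_nonneg zero_le_power e0) auto
  also have "\<dots> = energy s a ^ (j + p) * exp (- (2 * real n) * energy s a) * (energy s b ^ (j + p) * exp (- (2 * real n) * energy s b))"
    by (simp add: power_mult_distrib power_add distrib_left exp_diff exp_minus exp_add field_simps)
  finally show "norm (relative_momentum_sq s a b ^ j * (energy s a * energy s b) ^ p * exp (- 2 * real n * (energy s a + energy s b)))
    \<le> energy s a ^ (j + p) * exp (- (2 * real n) * energy s a) * (energy s b ^ (j + p) * exp (- (2 * real n) * energy s b))"
    using R0 by (simp add: abs_mult e0)
qed measurable

text \<open>The threshold comes from the origin, where the invariant mass is 2 s and E(a) E(b) =
  s^2: there 1/(invariant mass) exceeds c E(a) E(b) exactly if c < 1/(2 s^3). This is Laplace's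
  method by inequalities. The weight exp(-2 n x) with x = E(a) + E(b) favours points with x near its
  minimum 2 s, where the difference k of the two factors is bounded below; the region where k may be
  negative carries exponentially less mass.\<close>

lemma concentration:
  fixes s c :: real and j :: nat
  assumes s: "s > 0" and c: "c \<ge> 0" "c < 1 / (2 * s ^ 3)"
  defines "T \<equiv> \<lambda>p n (a::'a::euclidean_space, b). relative_momentum_sq s a b ^ j * (energy s a * energy s b) ^ p * exp (- 2 * real n * (energy s a + energy s b))"
  shows "\<exists>n\<ge>1. c * (LINT z|lborel2. T 1 n z) < (LINT z|lborel2. T 0 n z / invariant_mass s (fst z) (snd z))"
proof -
  let ?M = "lborel2 :: ('a \<times> 'a) measure"
  define x where "x = (\<lambda>(a::'a, b::'a). energy s a + energy s b)"
  define k where "k = (\<lambda>(a::'a, b). 1 / invariant_mass s a b - c * (energy s a * energy s b))"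
  have Tm[measurable]: "T p n \<in> borel_measurable ?M" for p n unfolding T_def by measurable
  have xm[measurable]: "x \<in> borel_measurable ?M" unfolding x_def by measurable
  have km[measurable]: "k \<in> borel_measurable ?M" unfolding k_def by measurable
  have im[measurable]: "(\<lambda>z. invariant_mass s (fst z) (snd z)) \<in> borel_measurable ?M" by measurable
  have e0: "energy s \<eta> \<ge> 0" for \<eta> :: 'a using energy_pos[OF s, of \<eta>] by simp
  have T0: "T p n z \<ge> 0" for p n z
    unfolding T_def by (auto split: prod.split intro!: mult_nonneg_nonneg zero_le_power relative_momentum_sq_nonneg s e0)
  have Ti: "n \<ge> 1 \<Longrightarrow> integrable ?M (T p n)" for p n unfolding T_def by (rule pair_exp_integrable[OF s])
  have inv: "0 < invariant_mass s (fst z) (snd z)" "1 / invariant_mass s (fst z) (snd z) \<le> 1 / (2 * s)" "1 / x z \<le> 1 / invariant_mass s (fst z) (snd z)" for z :: "'a \<times> 'a"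
    using invariant_mass_ge[OF s, of "fst z" "snd z"] invariant_mass_le[OF s, of "fst z" "snd z"] s
    by (auto simp: x_def frac_le split: prod.split)
  have Ii: "integrable ?M (\<lambda>z. T 0 n z / invariant_mass s (fst z) (snd z))" if n: "n \<ge> 1" for n
  proof (rule integrable_dominated[OF integrable_mult_right[OF Ti[OF n, of 0], of "1 / (2 * s)"]])
    show "AE z in ?M. norm (T 0 n z / invariant_mass s (fst z) (snd z)) \<le> norm (1 / (2 * s) * T 0 n z)" (is "AE z in _. ?P z")
    proof (rule AE_I2)
      fix z
      show "?P z"
        using mult_right_mono[OF inv(2) T0, of z 0 n] T0[of 0 n z] inv(1)[of z] s by (simp add: abs_mult)
    qed
  qed measurable
  have Tk: "T 0 n z / invariant_mass s (fst z) (snd z) - c * T 1 n z = T 0 n z * k z" for n z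
    by (cases z) (simp add: T_def k_def algebra_simps)
  have ki: "integrable ?M (\<lambda>z. T 0 n z * k z)" if n: "n \<ge> 1" for n
    unfolding Tk[symmetric] using Ti[OF n, of 1] Ii[OF n] by simp
  \<comment> \<open>A lower bound for k in terms of x alone: the invariant mass is at most x, and
    E(a) E(b) <= x^2/4. Both are equalities at x = 2 s, so nothing is lost at the threshold.\<close>
  define h where "h r = 1 / r - c * r\<^sup>2 / 4" for r :: real
  have kh: "k z \<ge> h (x z)" for z
  proof (cases z)
    case (Pair a b)
    have "4 * (energy s a * energy s b) \<le> (energy s a + energy s b)\<^sup>2"
      using sum_squares_bound[of "energy s a" "energy s b"] by (simp add: power2_sum)
    then have "c * (energy s a * energy s b) \<le> c * (energy s a + energy s b)\<^sup>2 / 4"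
      using mult_left_mono[OF _ c(1)] by fastforce
    then show ?thesis using inv(3)[of z] by (simp add: h_def k_def x_def Pair)
  qed
  have h2: "h (2 * s) > 0"
  proof -
    have "c * (2 * s ^ 3) < 1" using c(2) s by (simp add: pos_less_divide_eq)
    then have "c * s\<^sup>2 * (2 * s) < 1" by (simp add: power2_eq_square power3_eq_cube mult_ac)
    then have "c * s\<^sup>2 < 1 / (2 * s)" using s by (subst pos_less_divide_eq) auto
    then show ?thesis by (simp add: h_def power_mult_distrib)
  qed
  define \<kappa> where "\<kappa> = h (2 * s) / 2"
  have \<kappa>: "\<kappa> > 0" using h2 by (simp add: \<kappa>_def)
  have "isCont h (2 * s)" unfolding h_def using s by (intro continuous_intros) auto
  then have "\<forall>\<^sub>F r in at (2 * s). \<kappa> < h r"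
    unfolding isCont_def using \<kappa> by (intro order_tendstoD(1)) (auto simp: \<kappa>_def)
  then obtain e where e: "e > 0" "\<And>r. r \<noteq> 2 * s \<Longrightarrow> dist r (2 * s) < e \<Longrightarrow> \<kappa> < h r"
    unfolding eventually_at by blast
  define \<delta> where "\<delta> = e / 3"
  have \<delta>: "\<delta> > 0" using e by (simp add: \<delta>_def)
  have x2: "x z \<ge> 2 * s" for z using energy_ge[OF s, of "fst z"] energy_ge[OF s, of "snd z"] by (cases z) (simp add: x_def)
  have k\<kappa>: "k z \<ge> \<kappa>" if "x z \<le> 2 * s + 2 * \<delta>" for z
  proof -
    have "dist (x z) (2 * s) < e" using that x2[of z] e(1) by (simp add: dist_real_def \<delta>_def)
    then have "\<kappa> \<le> h (x z)" using e(2)[of "x z"] \<kappa> by (cases "x z = 2 * s") (auto simp: \<kappa>_def)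
    then show ?thesis using kh[of z] by simp
  qed
  define A where "A = {z. x z < 2 * s + \<delta>}"
  have Am[measurable]: "A \<in> sets ?M"
  proof -
    have "{z \<in> space ?M. x z < 2 * s + \<delta>} \<in> sets ?M" by measurable
    then show ?thesis by (simp add: A_def space_pair_measure)
  qed
  define I where "I = (LINT z|?M. T 0 1 z * \<bar>k z\<bar>)"
  define P where "P = (LINT z|?M. T 0 1 z * indicator A z)"
  have Ai: "integrable ?M (\<lambda>z. T 0 1 z * indicator A z)"
    by (rule integrable_dominated[OF Ti[of 1 0]]) (auto simp: indicator_def abs_mult)
  have ai: "integrable ?M (\<lambda>z. T 0 1 z * \<bar>k z\<bar>)"
    using integrable_abs[OF ki[of 1]] by (simp add: abs_mult T0)
  have P0: "P > 0"
  proof -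
    have "P \<noteq> 0"
    proof
      assume "P = 0"
      then have ae: "AE z in ?M. T 0 1 z * indicator A z = 0"
        unfolding P_def by (subst (asm) integral_nonneg_eq_0_iff_AE[OF Ai]) (auto simp: T0)
      \<comment> \<open>The diagonal is removed because for j = 1 the relative momentum, and with it
        T, vanishes there.\<close>
      define S where "S = {z::'a \<times> 'a. energy s (fst z) + energy s (snd z) < 2 * s + \<delta>} \<inter> {z. fst z \<noteq> snd z}"
      have "AE z in ?M. z \<notin> S"
        using ae
      proof eventually_elim
        case (elim z)
        show ?case
        proof
          assume z: "z \<in> S"
          obtain a b where ab: "z = (a, b)" by (cases z)
          then have "a \<noteq> b" using z by (simp add: S_def)
          then have "T 0 1 z > 0" using relative_momentum_sq_pos[OF s, of a b] by (simp add: T_def ab)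
          moreover have "z \<in> A" using z by (simp add: S_def A_def x_def ab)
          ultimately show False using elim by simp
        qed
      qed
      then have "AE z in lborel. z \<notin> S" unfolding lborel_prod .
      moreover have "open S"
        unfolding S_def
      proof (rule open_Int)
        have "continuous_on UNIV (\<lambda>z::'a \<times> 'a. energy s (fst z) + energy s (snd z))"
          unfolding energy_def phi_def by (intro continuous_intros)
        then show "open {z::'a \<times> 'a. energy s (fst z) + energy s (snd z) < 2 * s + \<delta>}"
          by (intro open_Collect_less continuous_on_const)
        show "open {z::'a \<times> 'a. fst z \<noteq> snd z}"
          by (intro open_Collect_neq continuous_intros)
      qed
      moreover have "(0, (\<delta> / 2) *\<^sub>R (SOME b. b \<in> Basis)) \<in> S"
      proof -
        define b :: 'a where "b = (SOME b. b \<in> Basis)"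
        have b: "b \<in> Basis" unfolding b_def by (rule some_in_eq[THEN iffD2, OF nonempty_Basis])
        have "energy s ((\<delta> / 2) *\<^sub>R b) \<le> s + \<delta> / 2" using energy_le[OF s, of "(\<delta> / 2) *\<^sub>R b"] b \<delta> by simp
        moreover have "energy s (0::'a) \<le> s" using energy_le[OF s, of "0::'a"] by simp
        ultimately have "energy s (0::'a) + energy s ((\<delta> / 2) *\<^sub>R b) < 2 * s + \<delta>" using \<delta> by linarith
        moreover have "(\<delta> / 2) *\<^sub>R b \<noteq> 0" using b \<delta> by (simp add: nonzero_Basis)
        ultimately show ?thesis unfolding b_def[symmetric] by (auto simp: S_def)
      qed
      ultimately show False using AE_not_in_open[of S] by blast
    qed
    moreover have "P \<ge> 0" unfolding P_def using T0 by (intro integral_nonneg_AE) auto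
    ultimately show ?thesis by simp
  qed
  have "(\<lambda>m. exp (- 2 * \<delta>) ^ m * I) \<longlonglongrightarrow> 0 * I"
    using \<delta> by (intro tendsto_intros LIMSEQ_power_zero) simp
  then have "\<forall>\<^sub>F m in sequentially. exp (- 2 * \<delta>) ^ m * I < \<kappa> * P"
    by (rule order_tendstoD(2)) (use \<kappa> P0 in simp)
  then obtain m where m: "exp (- 2 * \<delta>) ^ m * I < \<kappa> * P" by (auto simp: eventually_sequentially)
  \<comment> \<open>The value of the weight exp(-2 m x) at x = 2 s + \<delta>, the edge of
    \<open>A\<close>. On \<open>A\<close> the weight is at least g; beyond 2 s + 2 \<delta> it is at
    most g exp(-2 \<delta>)^m; in between k is positive and the contribution is dropped.\<close>
  define g where "g = exp (- 2 * real m * (2 * s + \<delta>))"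
  have g: "g > 0" by (simp add: g_def)
  have Tm1: "T 0 (m + 1) z = T 0 1 z * exp (- 2 * real m * x z)" for z
    by (cases z) (simp add: T_def x_def exp_add[symmetric] algebra_simps)
  have pw: "g * (\<kappa> * (T 0 1 z * indicator A z) - exp (- 2 * \<delta>) ^ m * (T 0 1 z * \<bar>k z\<bar>)) \<le> T 0 (m + 1) z * k z" for z
  proof -
    have nn: "0 \<le> exp (- 2 * \<delta>) ^ m * (T 0 1 z * \<bar>k z\<bar>)" by (intro mult_nonneg_nonneg T0) auto
    consider "x z < 2 * s + \<delta>" | "2 * s + \<delta> \<le> x z" "x z \<le> 2 * s + 2 * \<delta>" | "2 * s + 2 * \<delta> < x z" by linarith
    then show ?thesis
    proof cases
      case 1
      then have "g \<le> exp (- 2 * real m * x z)" unfolding g_def by (simp add: mult_left_mono)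
      moreover have "\<kappa> \<le> k z" using 1 \<delta> by (intro k\<kappa>) simp
      ultimately have "(T 0 1 z * g) * \<kappa> \<le> (T 0 1 z * exp (- 2 * real m * x z)) * k z"
        using \<kappa> g by (intro mult_mono mult_left_mono mult_nonneg_nonneg T0) auto
      moreover have "g * (\<kappa> * (T 0 1 z * indicator A z) - exp (- 2 * \<delta>) ^ m * (T 0 1 z * \<bar>k z\<bar>)) \<le> g * (\<kappa> * T 0 1 z)"
        using nn g 1 by (intro mult_left_mono) (auto simp: A_def)
      ultimately show ?thesis unfolding Tm1 by (simp only: mult_ac)
    next
      case 2
      then have "0 \<le> T 0 (m + 1) z * k z" using k\<kappa>[of z] \<kappa> by (intro mult_nonneg_nonneg T0) auto
      moreover have "g * (\<kappa> * (T 0 1 z * indicator A z) - exp (- 2 * \<delta>) ^ m * (T 0 1 z * \<bar>k z\<bar>)) \<le> g * 0"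
        using nn g 2 by (intro mult_left_mono) (auto simp: A_def)
      ultimately show ?thesis by simp
    next
      case 3
      then have "real m * (2 * s + 2 * \<delta>) \<le> real m * x z" by (intro mult_left_mono) auto
      then have "exp (- 2 * real m * x z) \<le> exp (- 2 * real m * (2 * s + 2 * \<delta>))" by simp
      also have "\<dots> = g * exp (- 2 * \<delta>) ^ m"
        unfolding g_def exp_of_nat_mult[symmetric] exp_add[symmetric] by (simp add: algebra_simps)
      finally have "(T 0 1 z * \<bar>k z\<bar>) * exp (- 2 * real m * x z) \<le> (T 0 1 z * \<bar>k z\<bar>) * (g * exp (- 2 * \<delta>) ^ m)"
        by (intro mult_left_mono mult_nonneg_nonneg T0) auto
      moreover have "- ((T 0 1 z * \<bar>k z\<bar>) * exp (- 2 * real m * x z)) \<le> T 0 (m + 1) z * k z"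
      proof -
        have "(T 0 1 z * exp (- 2 * real m * x z)) * (- \<bar>k z\<bar>) \<le> (T 0 1 z * exp (- 2 * real m * x z)) * k z"
          by (intro mult_left_mono mult_nonneg_nonneg T0) auto
        then show ?thesis unfolding Tm1 by (simp add: mult_ac)
      qed
      moreover have "indicator A z = (0::real)" using 3 \<delta> by (simp add: A_def)
      ultimately show ?thesis by (simp add: mult_ac)
    qed
  qed
  have "0 < g * (\<kappa> * P - exp (- 2 * \<delta>) ^ m * I)" using m g by simp
  also have "\<dots> = (LINT z|?M. g * (\<kappa> * (T 0 1 z * indicator A z) - exp (- 2 * \<delta>) ^ m * (T 0 1 z * \<bar>k z\<bar>)))"
  proof -
    have "(LINT z|?M. g * (\<kappa> * u z - d * v z)) = g * (\<kappa> * (LINT z|?M. u z) - d * (LINT z|?M. v z))"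
      if "integrable ?M u" "integrable ?M v" for u v :: "'a \<times> 'a \<Rightarrow> real" and d
      using that by simp
    then show ?thesis unfolding P_def I_def by (rule sym[OF _]) (rule Ai ai)+
  qed
  also have "\<dots> \<le> (LINT z|?M. T 0 (m + 1) z * k z)"
    using pw ki[of "m + 1"] Ai ai by (intro Bochner_Integration.integral_mono) auto
  also have "\<dots> = (LINT z|?M. T 0 (m + 1) z / invariant_mass s (fst z) (snd z)) - c * (LINT z|?M. T 1 (m + 1) z)"
    unfolding Tk[symmetric] using Ti[of "m + 1" 1] Ii[of "m + 1"] by simp
  finally show ?thesis by (intro exI[of _ "m + 1"]) auto
qed

text \<open>For F = exp(-n E), \<open>pair_transform_lower\<close> bounds the left-hand side from
  below by \<gamma> times the larger integral in \<open>concentration\<close>, while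
  \<open>pair_energy\<close> is the smaller one without its coefficient. The threshold 1/(2 s^3)
  there, multiplied by \<gamma>, is the sharp constant, the factor s^2 in \<gamma> being the lower
  bound for two energies. Evenness of F is recorded because it annihilates the momentum term of the
  second estimate.\<close>

lemma kg_optimal:
  fixes s m :: real
  assumes s: "s > 0" and d: "DIM('a::euclidean_space) \<ge> 2" and j: "j \<le> 1"
    and m: "m \<ge> 0" "m < kg_const DIM('a) * (collision_const DIM('a) j / (2 * s))"
  defines "\<beta> \<equiv> (2 - real DIM('a) + 2 * real j) / 4"
  shows "\<exists>(f::'a \<Rightarrow> complex) F. is_fourier_transform f F \<and> in_L2 F \<and>
    (\<forall>k. integrable lborel (\<lambda>\<eta>. energy s \<eta> ^ k * nsq (F \<eta>))) \<and>
    (\<forall>\<eta>. F (- \<eta>) = F \<eta>) \<and>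
    m * pair_energy s j F < (L2_norm (multiplier (box_symbol \<beta>) (kg_density s f)))\<^sup>2"
proof -
  let ?M = "lborel2 :: ('a \<times> 'a) measure"
  define \<gamma> where "\<gamma> = kg_const DIM('a) * s\<^sup>2 * collision_const DIM('a) j"
  have \<gamma>: "\<gamma> > 0" using kg_const_pos[of "DIM('a)"] collision_const_pos[of "DIM('a)" j] s by (simp add: \<gamma>_def)
  define T where "T p n = (\<lambda>(a::'a, b). relative_momentum_sq s a b ^ j * (energy s a * energy s b) ^ p * exp (- 2 * real n * (energy s a + energy s b)))" for p n
  have "m < \<gamma> * (1 / (2 * s ^ 3))"
    using m(2) s by (simp add: \<gamma>_def power2_eq_square power3_eq_cube)
  then have c: "m / \<gamma> \<ge> 0" "m / \<gamma> < 1 / (2 * s ^ 3)"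
    using m(1) \<gamma> by (simp_all only: pos_divide_less_eq mult.commute divide_nonneg_pos)
  obtain n where n: "n \<ge> 1" and conc: "m / \<gamma> * (LINT z|?M. T 1 n z) < (LINT z|?M. T 0 n z / invariant_mass s (fst z) (snd z))"
    using concentration[OF s c, of j, where 'a='a] unfolding T_def by blast
  define F where "F = (\<lambda>\<eta>::'a. complex_of_real (exp (- real n * energy s \<eta>)))"
  have Fm[measurable]: "borel_fun F" unfolding F_def by measurable
  have e0: "energy s \<eta> \<ge> 0" for \<eta> :: 'a using energy_pos[OF s, of \<eta>] by simp
  have F2: "nsq (F \<eta>) = exp (- (2 * real n) * energy s \<eta>)" for \<eta>
    unfolding F_def norm_of_real power2_abs by (simp add: power2_eq_square exp_add[symmetric])
  have Fi: "integrable lborel (\<lambda>\<eta>. energy s \<eta> ^ k * nsq (F \<eta>))" for k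
    unfolding F2 using n by (intro energy_exp_integrable s) simp
  have FL2: "in_L2 F" using Fi[of 0] by (simp add: in_L2_def)
  obtain f where f: "is_fourier_transform f F" using L2_fourier_inverse[OF FL2] by blast
  have i: "integrable lborel (\<lambda>\<eta>. energy s \<eta> ^ (j + 1) * nsq (F \<eta>))" by (rule Fi)
  note P = pair_transform_sharp[OF s d j Fm i, folded \<beta>_def]
  note N = kg_box_norm[OF s f FL2 P(1)]
  define Y where "Y = (\<lambda>(a, b). s\<^sup>2 * exp (- 2 * real n * (energy s a + energy s b)) * collision_density s j a (b::'a))"
  have Y: "Y z = s\<^sup>2 * collision_const DIM('a) j * (T 0 n z / invariant_mass s (fst z) (snd z))" for z
    by (cases z) (simp add: Y_def T_def collision_density_def)
  have Y0: "Y z \<ge> 0" for z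
    by (cases z) (simp add: Y_def collision_density_nonneg[OF s])
  have Ym[measurable]: "Y \<in> borel_measurable ?M" unfolding Y_def by measurable
  have Ti: "integrable ?M (T 0 n)" unfolding T_def by (rule pair_exp_integrable[OF s n])
  have Yi: "integrable ?M Y"
  proof (rule integrable_dominated[OF integrable_mult_right[OF Ti, of "s\<^sup>2 * collision_const DIM('a) j / (2 * s)"]])
    show "AE z in ?M. norm (Y z) \<le> norm (s\<^sup>2 * collision_const DIM('a) j / (2 * s) * T 0 n z)" (is "AE z in _. ?P z")
    proof (rule AE_I2)
      fix z :: "'a \<times> 'a"
      have T0: "T 0 n z \<ge> 0"
        by (cases z) (auto simp: T_def intro!: mult_nonneg_nonneg zero_le_power relative_momentum_sq_nonneg s)
      have "T 0 n z / invariant_mass s (fst z) (snd z) \<le> T 0 n z / (2 * s)"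
        using invariant_mass_ge[OF s, of "fst z" "snd z"] s T0 by (intro divide_left_mono mult_pos_pos) auto
      then have "Y z \<le> s\<^sup>2 * collision_const DIM('a) j * (T 0 n z / (2 * s))"
        unfolding Y using collision_const_pos[of "DIM('a)" j] by (intro mult_left_mono) auto
      then show "?P z"
        unfolding real_norm_def abs_of_nonneg[OF Y0] by (intro order_trans[OF _ abs_ge_self]) simp
    qed
  qed measurable
  have "ennreal (LINT z|?M. Y z) = (\<integral>\<^sup>+z. ennreal (Y z) \<partial>?M)" by (rule nn_integral_eq_integral[OF Yi, symmetric]) (simp add: Y0)
  also have "\<dots> = (NN a b. ennreal (Y (a, b)))"
    by (rule lborel.nn_integral_fst[symmetric]) measurable
  also have "\<dots> = (NN (a::'a) b. ennreal (s\<^sup>2 * exp (- 2 * real n * (energy s a + energy s b))) * ennreal (collision_density s j a b))"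
    by (simp add: Y_def ennreal_mult collision_density_nonneg[OF s])
  also have "\<dots> \<le> (L2sq (\<lambda>z. box_symbol \<beta> z * pair_transform s F z))"
    unfolding \<beta>_def by (rule pair_transform_lower[OF s d j F_def FL2])
  also have "\<dots> = ennreal (LB z. nsq (box_symbol \<beta> z * pair_transform s F z))"
    by (rule in_L2_nn_integral[OF P(1)])
  finally have low: "(LINT z|?M. Y z) \<le> (LB z. nsq (box_symbol \<beta> z * pair_transform s F z))"
    by (simp add: integral_nonneg_AE)
  have PE: "pair_energy s j F = (LINT z|?M. T 1 n z)"
    unfolding pair_energy_def F2 T_def
  proof (rule LB_cong)
    fix z :: "'a \<times> 'a"
    obtain a b where z: "z = (a, b)" by (cases z)
    have ex: "exp (- 2 * real n * (energy s a + energy s b)) = exp (- (2 * real n) * energy s a) * exp (- (2 * real n) * energy s b)"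
      unfolding exp_add[symmetric] by (simp add: distrib_left)
    show "(case z of (a, b) \<Rightarrow> energy s a * exp (- (2 * real n) * energy s a) * (energy s b * exp (- (2 * real n) * energy s b)) * relative_momentum_sq s a b ^ j)
      = (case z of (a, b) \<Rightarrow> relative_momentum_sq s a b ^ j * (energy s a * energy s b) ^ 1 * exp (- 2 * real n * (energy s a + energy s b)))"
      unfolding z prod.case power_one_right ex by (simp only: mult_ac)
  qed
  have "m * pair_energy s j F = \<gamma> * (m / \<gamma> * (LINT z|?M. T 1 n z))" using \<gamma> by (simp add: PE)
  also have "\<dots> < \<gamma> * (LINT z|?M. T 0 n z / invariant_mass s (fst z) (snd z))"
    using \<gamma> conc by (intro mult_strict_left_mono)
  also have "\<dots> = kg_const DIM('a) * (LINT z|?M. Y z)"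
    unfolding Y integral_mult_right_zero by (simp add: \<gamma>_def)
  also have "\<dots> \<le> (L2_norm (multiplier (box_symbol \<beta>) (kg_density s f)))\<^sup>2"
    unfolding N(2) using low kg_const_pos[of "DIM('a)"] by (intro mult_left_mono) auto
  finally have "m * pair_energy s j F < (L2_norm (multiplier (box_symbol \<beta>) (kg_density s f)))\<^sup>2" .
  moreover have "F (- \<eta>) = F \<eta>" for \<eta> by (simp add: F_def energy_def)
  ultimately show ?thesis using f FL2 Fi by blast
qed

section \<open>The sharp constants in closed form\<close>

lemma kg_const_value:
  assumes "n > 0"
  shows "kg_const n * ((2 * pi) ^ n)\<^sup>2 * (unit_ball_vol n * x) = 2 powr (- real n + 1) * pi powr ((- real n + 2) / 2) * x / Gamma (real n / 2 + 1)"
proof -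
  have "kg_const n * ((2 * pi) ^ n)\<^sup>2 = (2 * pi) powr (- real n + 1)"
  proof -
    have "(2 * pi) powr (- real n + 1) = (2 * pi) powr (2 - real (n + 1))" by simp
    also have "\<dots> = (2 * pi) powr real 2 / (2 * pi) powr real (n + 1)" by (simp only: powr_diff of_nat_numeral)
    also have "\<dots> = (2 * pi) ^ 2 / (2 * pi) ^ (n + 1)" by (subst (1 2) powr_realpow) auto
    finally show ?thesis by (simp add: kg_const_def)
  qed
  also have "\<dots> = 2 powr (- real n + 1) * pi powr (- real n + 1)" by (rule powr_mult)
  finally have "kg_const n * ((2 * pi) ^ n)\<^sup>2 * (unit_ball_vol n * x) = 2 powr (- real n + 1) * (pi powr (- real n + 1) * pi powr (real n / 2)) * x / Gamma (real n / 2 + 1)"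
    by (simp add: unit_ball_vol_def)
  also have "pi powr (- real n + 1) * pi powr (real n / 2) = pi powr ((- real n + 2) / 2)"
    unfolding powr_add[symmetric] by (rule arg_cong[where f="\<lambda>x. pi powr x"]) (simp add: field_simps)
  finally show ?thesis .
qed

text \<open>The factor n in \<open>collision_const n 0\<close> turns the Gamma(n/2 + 1) of the ball
  volume into Gamma(n/2).\<close>

lemma sharp_const_0:
  assumes "n > 0" "s > 0"
  shows "2 powr (- real n + 1) * pi powr ((- real n + 2) / 2) / (s * Gamma (real n / 2))
    = kg_const n * ((2 * pi) ^ n)\<^sup>2 * (collision_const n 0 / (2 * s))"
proof -
  have G: "Gamma (real n / 2 + 1) = real n / 2 * Gamma (real n / 2)" using assms by (intro Gamma_plus1) (auto elim!: nonpos_Ints_cases)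
  have "kg_const n * ((2 * pi) ^ n)\<^sup>2 * (collision_const n 0 / (2 * s)) = kg_const n * ((2 * pi) ^ n)\<^sup>2 * (unit_ball_vol n * (real n / (2 * s)))"
    by (simp add: collision_const_def)
  also have "\<dots> = 2 powr (- real n + 1) * pi powr ((- real n + 2) / 2) / (s * Gamma (real n / 2))"
    unfolding kg_const_value[OF assms(1)] G using assms by simp
  finally show ?thesis ..
qed

text \<open>The denominator is 4 s rather than 2 s because the difference of fourth powers is twice
  the \<open>pair_energy\<close> up to the momentum term. The Gamma factor is that of the ball
  volume.\<close>

lemma sharp_const_1:
  assumes "n > 0" "s > 0"
  shows "2 powr (- real n + 1) * pi powr ((- real n + 2) / 2) / (s * Gamma ((real n + 2) / 2))
    = kg_const n * ((2 * pi) ^ n)\<^sup>2 * (collision_const n 1 / (4 * s))"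
proof -
  have G: "(real n + 2) / 2 = real n / 2 + 1" by simp
  have "kg_const n * ((2 * pi) ^ n)\<^sup>2 * (collision_const n 1 / (4 * s)) = kg_const n * ((2 * pi) ^ n)\<^sup>2 * (unit_ball_vol n * (1 / s))"
    by (simp add: collision_const_def)
  also have "\<dots> = 2 powr (- real n + 1) * pi powr ((- real n + 2) / 2) / (s * Gamma ((real n + 2) / 2))"
    unfolding kg_const_value[OF assms(1)] G using assms by simp
  finally show ?thesis ..
qed

text \<open>Plancherel yields comparisons of squares; this converts them into the three claims about
  one estimate. \<open>adm\<close> is the class where the right-hand side is finite, and
  \<open>Z\<close> stands for vanishing almost everywhere.\<close>

lemma sharp_without_extremisers:
  fixes lhs rhs :: "'f \<Rightarrow> real"
  assumes C: "C > 0" and nn: "\<And>f. adm f \<Longrightarrow> rhs f \<ge> 0"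
    and le: "\<And>f. adm f \<Longrightarrow> (lhs f)\<^sup>2 \<le> C\<^sup>2 * (rhs f)\<^sup>2"
    and less: "\<And>f. adm f \<Longrightarrow> \<not> Z f \<Longrightarrow> (lhs f)\<^sup>2 < C\<^sup>2 * (rhs f)\<^sup>2"
    and opt: "\<And>\<mu>. 0 \<le> \<mu> \<Longrightarrow> \<mu> < C\<^sup>2 \<Longrightarrow> \<exists>f. adm f \<and> 0 \<le> lhs f \<and> \<mu> * (rhs f)\<^sup>2 < (lhs f)\<^sup>2"
  shows "\<And>f. adm f \<Longrightarrow> lhs f \<le> C * rhs f" and "\<And>C'. \<forall>f. adm f \<longrightarrow> lhs f \<le> C' * rhs f \<Longrightarrow> C \<le> C'"
    and "\<And>f. adm f \<Longrightarrow> \<not> Z f \<Longrightarrow> lhs f \<noteq> C * rhs f"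
proof -
  show "lhs f \<le> C * rhs f" if "adm f" for f
  proof (rule power2_le_imp_le)
    show "(lhs f)\<^sup>2 \<le> (C * rhs f)\<^sup>2" unfolding power_mult_distrib by (rule le[OF that])
    show "0 \<le> C * rhs f" using C nn[OF that] by simp
  qed
  show "lhs f \<noteq> C * rhs f" if "adm f" "\<not> Z f" for f
    using less[OF that] by (auto simp: power_mult_distrib)
  show "C \<le> C'" if C': "\<forall>f. adm f \<longrightarrow> lhs f \<le> C' * rhs f" for C'
  proof (rule ccontr)
    assume n: "\<not> C \<le> C'"
    \<comment> \<open>A competing constant C' might be negative, whereas the comparison of squares
      needs m >= 0.\<close>
    define m where "m = max C' 0"
    have m: "m \<ge> 0" "C' \<le> m" "m < C" using n C by (auto simp: m_def)
    have "m\<^sup>2 < C\<^sup>2" using m by (intro power_strict_mono) auto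
    then obtain f where f: "adm f" "0 \<le> lhs f" "m\<^sup>2 * (rhs f)\<^sup>2 < (lhs f)\<^sup>2"
      using opt[of "m\<^sup>2"] by auto
    have "lhs f \<le> m * rhs f" by (rule order_trans[OF C'[rule_format, OF f(1)] mult_right_mono[OF m(2) nn[OF f(1)]]])
    then have "(lhs f)\<^sup>2 \<le> (m * rhs f)\<^sup>2" using f(2) by (intro power_mono)
    then show False using f(3) by (simp add: power_mult_distrib)
  qed
qed

lemma L2_norm_nonneg: "L2_norm f \<ge> 0"
  by (simp add: L2_norm_def integral_nonneg_AE)

theorem corollary1p4:
  fixes s :: real
  assumes "DIM('a::euclidean_space) \<ge> 2" and "s > 0"
  shows
    "(let d = real DIM('a);
      C = sqrt (2 powr (- d + 1) * pi powr ((- d + 2) / 2) / (s * Gamma (d / 2)));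
      adm = (\<lambda>f :: 'a \<Rightarrow> complex. multiplier_dom (phi_symbol s (1/2)) f);
      lhs = (\<lambda>f :: 'a \<Rightarrow> complex.
      L2_norm (multiplier (box_symbol ((2 - d) / 4)) (kg_density s f)));
      rhs = (\<lambda>f :: 'a \<Rightarrow> complex. (L2_norm (multiplier (phi_symbol s (1/2)) f))\<^sup>2)
      in (\<forall>f. adm f \<longrightarrow>
      multiplier_dom (box_symbol ((2 - d) / 4)) (kg_density s f) \<and> lhs f \<le> C * rhs f) \<and>
      (\<forall>C'. (\<forall>f. adm f \<longrightarrow> lhs f \<le> C' * rhs f) \<longrightarrow> C \<le> C') \<and>
      \<not> (\<exists>f. adm f \<and> \<not> (AE x in lborel. f x = 0) \<and> lhs f = C * rhs f))
     \<and>
     (let d = real DIM('a);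
      C = sqrt (2 powr (- d + 1) * pi powr ((- d + 2) / 2) / (s * Gamma ((d + 2) / 2)));
      adm = (\<lambda>f :: 'a \<Rightarrow> complex.
      multiplier_dom (phi_symbol s 1) f \<and> multiplier_dom (phi_symbol s (1/2)) f);
      lhs = (\<lambda>f :: 'a \<Rightarrow> complex.
      L2_norm (multiplier (box_symbol ((4 - d) / 4)) (kg_density s f)));
      rhs = (\<lambda>f :: 'a \<Rightarrow> complex.
      sqrt (L2_norm (multiplier (phi_symbol s 1) f) ^ 4
      - s\<^sup>2 * L2_norm (multiplier (phi_symbol s (1/2)) f) ^ 4))
      in (\<forall>f. adm f \<longrightarrow>
      multiplier_dom (box_symbol ((4 - d) / 4)) (kg_density s f) \<and> lhs f \<le> C * rhs f) \<and>
      (\<forall>C'. (\<forall>f. adm f \<longrightarrow> lhs f \<le> C' * rhs f) \<longrightarrow> C \<le> C') \<and>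
      \<not> (\<exists>f. adm f \<and> \<not> (AE x in lborel. f x = 0) \<and> lhs f = C * rhs f))"
proof -
  note d = assms(1) and s = assms(2)
  \<comment> \<open>Each squared norm of f carries (2 pi)^(-d) on the Fourier side, so the fourth
    powers on the right carry 1/q.\<close>
  define q where "q = ((2 * pi) ^ DIM('a))\<^sup>2"
  have q: "q > 0" by (simp add: q_def)
  define c where "c j = kg_const DIM('a) * (collision_const DIM('a) j / (2 * s))" for j
  have c: "c j > 0" for j
    using kg_const_pos[of "DIM('a)"] collision_const_pos[of "DIM('a)" j] s by (simp add: c_def)
  have phi0: "multiplier_dom (phi_symbol s (1/2)) f \<longleftrightarrow> integrable lborel (\<lambda>\<eta>. energy s \<eta> * nsq (F \<eta>))"
    "multiplier_dom (phi_symbol s (1/2)) f \<Longrightarrow> (L2_norm (multiplier (phi_symbol s (1/2)) f))\<^sup>2 = (LB \<eta>. energy s \<eta> * nsq (F \<eta>)) / (2 * pi) ^ DIM('a)"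
    "multiplier_dom (phi_symbol s 1) f \<longleftrightarrow> integrable lborel (\<lambda>\<eta>. (energy s \<eta>)\<^sup>2 * nsq (F \<eta>))"
    "multiplier_dom (phi_symbol s 1) f \<Longrightarrow> (L2_norm (multiplier (phi_symbol s 1) f))\<^sup>2 = (LB \<eta>. (energy s \<eta>)\<^sup>2 * nsq (F \<eta>)) / (2 * pi) ^ DIM('a)"
    if fF: "is_fourier_transform f F" for f F :: "'a \<Rightarrow> complex"
    using phi_multiplier[OF s fF, of 1 "1/2"] phi_multiplier[OF s fF, of 2 1] by simp_all
  define C0 where "C0 = sqrt (2 powr (- real DIM('a) + 1) * pi powr ((- real DIM('a) + 2) / 2) / (s * Gamma (real DIM('a) / 2)))"
  define lhs0 where "lhs0 f = L2_norm (multiplier (box_symbol ((2 - real DIM('a)) / 4)) (kg_density s f))" for f :: "'a \<Rightarrow> complex"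
  define rhs0 where "rhs0 f = (L2_norm (multiplier (phi_symbol s (1/2)) f))\<^sup>2" for f :: "'a \<Rightarrow> complex"
  have C0: "C0 > 0" "C0\<^sup>2 = c 0 * q"
  proof -
    have "2 powr (- real DIM('a) + 1) * pi powr ((- real DIM('a) + 2) / 2) / (s * Gamma (real DIM('a) / 2)) = c 0 * q"
      by (subst sharp_const_0[OF _ s]) (auto simp: c_def q_def)
    then show "C0 > 0" "C0\<^sup>2 = c 0 * q" using c[of 0] q by (simp_all add: C0_def)
  qed
  have rhs0: "c 0 * pair_energy s 0 F = C0\<^sup>2 * (rhs0 f)\<^sup>2"
    if fF: "is_fourier_transform f F" and f: "multiplier_dom (phi_symbol s (1/2)) f" for f F
  proof -
    have "pair_energy s 0 F = q * (rhs0 f)\<^sup>2"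
      using pair_energy_0[of s F] phi0(1,2)[OF fF] f by (simp add: rhs0_def q_def power_divide)
    then show ?thesis by (simp add: C0)
  qed
  have E0: "multiplier_dom (box_symbol ((2 - real DIM('a)) / 4)) (kg_density s f)
    \<and> (lhs0 f)\<^sup>2 \<le> C0\<^sup>2 * (rhs0 f)\<^sup>2 \<and> (\<not> (AE x in lborel. f x = 0) \<longrightarrow> (lhs0 f)\<^sup>2 < C0\<^sup>2 * (rhs0 f)\<^sup>2)"
    if f: "multiplier_dom (phi_symbol s (1/2)) f" for f
  proof -
    obtain F where F: "is_fourier_transform f F" "in_L2 F" using phi_multiplier_fourier[OF s f] by blast
    have "integrable lborel (\<lambda>\<eta>. energy s \<eta> ^ (0 + 1) * nsq (F \<eta>))" using phi0(1)[OF F(1)] f by simp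
    from kg_sharp[OF s d _ F this] show ?thesis
      unfolding rhs0[OF F(1) f, symmetric] c_def lhs0_def by simp
  qed
  have O0: "\<exists>f. multiplier_dom (phi_symbol s (1/2)) f \<and> 0 \<le> lhs0 f \<and> \<mu> * (rhs0 f)\<^sup>2 < (lhs0 f)\<^sup>2"
    if \<mu>: "0 \<le> \<mu>" "\<mu> < C0\<^sup>2" for \<mu>
  proof -
    have "0 \<le> \<mu> / q" "\<mu> / q < kg_const DIM('a) * (collision_const DIM('a) 0 / (2 * s))"
      using \<mu> q unfolding C0(2) c_def by (simp_all only: pos_divide_less_eq divide_nonneg_pos)
    from kg_optimal[OF s d _ this] obtain f F where fF: "is_fourier_transform f F"
      and i: "\<And>k. integrable lborel (\<lambda>\<eta>. energy s \<eta> ^ k * nsq (F \<eta>))"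
      and less: "\<mu> / q * pair_energy s 0 F < (lhs0 f)\<^sup>2"
      unfolding lhs0_def by auto
    have f: "multiplier_dom (phi_symbol s (1/2)) f" using phi0(1)[OF fF] i[of 1] by simp
    have "c 0 * pair_energy s 0 F = c 0 * (q * (rhs0 f)\<^sup>2)" using rhs0[OF fF f] by (simp add: C0)
    then have "\<mu> / q * pair_energy s 0 F = \<mu> * (rhs0 f)\<^sup>2" using c[of 0] q by simp
    then show ?thesis using f less by (auto simp: lhs0_def L2_norm_nonneg)
  qed
  note S0 = sharp_without_extremisers[of C0 "multiplier_dom (phi_symbol s (1/2))" rhs0 lhs0 "\<lambda>f. AE x in lborel. f x = 0", OF C0(1)]
  have r0: "rhs0 f \<ge> 0" for f by (simp add: rhs0_def)
  have first: "(\<forall>f. multiplier_dom (phi_symbol s (1/2)) f \<longrightarrow>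
    multiplier_dom (box_symbol ((2 - real DIM('a)) / 4)) (kg_density s f) \<and> lhs0 f \<le> C0 * rhs0 f) \<and>
    (\<forall>C'. (\<forall>f. multiplier_dom (phi_symbol s (1/2)) f \<longrightarrow> lhs0 f \<le> C' * rhs0 f) \<longrightarrow> C0 \<le> C') \<and>
    \<not> (\<exists>f. multiplier_dom (phi_symbol s (1/2)) f \<and> \<not> (AE x in lborel. f x = 0) \<and> lhs0 f = C0 * rhs0 f)"
    using S0[OF r0 _ _ O0] E0 by blast
  define C1 where "C1 = sqrt (2 powr (- real DIM('a) + 1) * pi powr ((- real DIM('a) + 2) / 2) / (s * Gamma ((real DIM('a) + 2) / 2)))"
  define lhs1 where "lhs1 f = L2_norm (multiplier (box_symbol ((4 - real DIM('a)) / 4)) (kg_density s f))" for f :: "'a \<Rightarrow> complex"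
  define rhs1 where "rhs1 f = sqrt (L2_norm (multiplier (phi_symbol s 1) f) ^ 4 - s\<^sup>2 * L2_norm (multiplier (phi_symbol s (1/2)) f) ^ 4)" for f :: "'a \<Rightarrow> complex"
  define adm where "adm f \<longleftrightarrow> multiplier_dom (phi_symbol s 1) f \<and> multiplier_dom (phi_symbol s (1/2)) f" for f :: "'a \<Rightarrow> complex"
  have C1: "C1 > 0" "C1\<^sup>2 = c 1 * (q / 2)"
  proof -
    have "2 powr (- real DIM('a) + 1) * pi powr ((- real DIM('a) + 2) / 2) / (s * Gamma ((real DIM('a) + 2) / 2)) = c 1 * (q / 2)"
      by (subst sharp_const_1[OF _ s]) (auto simp: c_def q_def)
    moreover have "c 1 * (q / 2) > 0" using c[of 1] q by simp
    ultimately show "C1 > 0" "C1\<^sup>2 = c 1 * (q / 2)" unfolding C1_def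
      by (simp_all only: real_sqrt_gt_0_iff real_sqrt_pow2 less_imp_le)
  qed
  define P where "P F = (LB \<eta>. (energy s \<eta> * nsq (F \<eta>)) *\<^sub>R \<eta>)" for F :: "'a \<Rightarrow> complex"
  have pe0: "pair_energy s 1 F \<ge> 0" for F :: "'a \<Rightarrow> complex"
    unfolding pair_energy_def
    by (intro integral_nonneg_AE AE_I2)
      (auto split: prod.split intro!: mult_nonneg_nonneg zero_le_power relative_momentum_sq_nonneg s less_imp_le[OF energy_pos])
  have rhs1: "q * (rhs1 f)\<^sup>2 = 2 * pair_energy s 1 F + (norm (P F))\<^sup>2" "rhs1 f \<ge> 0"
    if fF: "is_fourier_transform f F" and f: "adm f" for f F
  proof -
    have f': "multiplier_dom (phi_symbol s 1) f" "multiplier_dom (phi_symbol s (1/2)) f" using f by (auto simp: adm_def)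
    define N2 N1 where "N2 = (LB \<eta>. (energy s \<eta>)\<^sup>2 * nsq (F \<eta>))" and "N1 = (LB \<eta>. energy s \<eta> * nsq (F \<eta>))"
    have N: "N2\<^sup>2 - s\<^sup>2 * N1\<^sup>2 = 2 * pair_energy s 1 F + (norm (P F))\<^sup>2"
      using pair_energy_1[OF s is_fourier_transformD(2)[OF fF]] phi0(1,3)[OF fF] f' unfolding N2_def N1_def P_def by blast
    have four: "x ^ 4 = (x\<^sup>2)\<^sup>2" for x :: real by (simp flip: power_mult)
    have e: "L2_norm (multiplier (phi_symbol s 1) f) ^ 4 - s\<^sup>2 * L2_norm (multiplier (phi_symbol s (1/2)) f) ^ 4 = (N2\<^sup>2 - s\<^sup>2 * N1\<^sup>2) / q"
      unfolding four phi0(2)[OF fF f'(2)] phi0(4)[OF fF f'(1)] N2_def N1_def q_def by (simp add: power_divide diff_divide_distrib)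
    have "N2\<^sup>2 - s\<^sup>2 * N1\<^sup>2 \<ge> 0" unfolding N using pe0[of F] by simp
    then show "rhs1 f \<ge> 0" "q * (rhs1 f)\<^sup>2 = 2 * pair_energy s 1 F + (norm (P F))\<^sup>2"
      unfolding rhs1_def e using q by (simp_all add: N)
  qed
  have E1: "multiplier_dom (box_symbol ((4 - real DIM('a)) / 4)) (kg_density s f)
    \<and> (lhs1 f)\<^sup>2 \<le> C1\<^sup>2 * (rhs1 f)\<^sup>2 \<and> (\<not> (AE x in lborel. f x = 0) \<longrightarrow> (lhs1 f)\<^sup>2 < C1\<^sup>2 * (rhs1 f)\<^sup>2)"
    if f: "adm f" for f
  proof -
    obtain F where F: "is_fourier_transform f F" "in_L2 F" using phi_multiplier_fourier[OF s] f unfolding adm_def by blast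
    have i: "integrable lborel (\<lambda>\<eta>. energy s \<eta> ^ (1 + 1) * nsq (F \<eta>))" using phi0(3)[OF F(1)] f by (simp add: adm_def power2_eq_square)
    have b: "(2 - real DIM('a) + 2 * real 1) / 4 = (4 - real DIM('a)) / 4" by simp
    have "C1\<^sup>2 * (rhs1 f)\<^sup>2 = c 1 / 2 * (q * (rhs1 f)\<^sup>2)" by (simp add: C1)
    also have "\<dots> = c 1 * pair_energy s 1 F + c 1 / 2 * (norm (P F))\<^sup>2" unfolding rhs1(1)[OF F(1) f] by (simp add: distrib_left)
    \<comment> \<open>The nonnegative momentum term is dropped here.\<close>
    finally have "c 1 * pair_energy s 1 F \<le> C1\<^sup>2 * (rhs1 f)\<^sup>2" using c[of 1] by simp
    with kg_sharp[OF s d order_refl F i] show ?thesis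
      unfolding lhs1_def b c_def[symmetric] by auto
  qed
  have O1: "\<exists>f. adm f \<and> 0 \<le> lhs1 f \<and> \<mu> * (rhs1 f)\<^sup>2 < (lhs1 f)\<^sup>2"
    if \<mu>: "0 \<le> \<mu>" "\<mu> < C1\<^sup>2" for \<mu>
  proof -
    have q2: "q / 2 > 0" using q by simp
    have "0 \<le> \<mu> / (q / 2)" "\<mu> / (q / 2) < kg_const DIM('a) * (collision_const DIM('a) 1 / (2 * s))"
      using \<mu> q2 unfolding C1(2) c_def by (simp_all only: pos_divide_less_eq divide_nonneg_pos)
    from kg_optimal[OF s d order_refl this] obtain f F where fF: "is_fourier_transform f F"
      and i: "\<And>k. integrable lborel (\<lambda>\<eta>. energy s \<eta> ^ k * nsq (F \<eta>))" and ev: "\<And>\<eta>. F (- \<eta>) = F \<eta>"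
      and less: "\<mu> / (q / 2) * pair_energy s 1 F < (lhs1 f)\<^sup>2"
      unfolding lhs1_def by auto
    have f: "adm f" unfolding adm_def using phi0(1,3)[OF fF] i[of 1] i[of 2] by simp
    have [measurable]: "borel_fun F" by (rule is_fourier_transformD(2)[OF fF])
    \<comment> \<open>As F is even, reflecting eta gives P F = - P F; hence for these test functions
      dropping the momentum term costs nothing.\<close>
    have "P F = (LB \<eta>. (energy s (- \<eta>) * nsq (F (- \<eta>))) *\<^sub>R (- \<eta>))"
      unfolding P_def by (rule integral_lborel_uminus[symmetric]) measurable
    also have "\<dots> = - P F" unfolding P_def by (simp add: ev energy_def)
    finally have "2 *\<^sub>R P F = 0" by (simp only: scaleR_2 eq_neg_iff_add_eq_0)
    then have "P F = 0" by simp
    then have "q * (rhs1 f)\<^sup>2 = 2 * pair_energy s 1 F" using rhs1(1)[OF fF f] by simp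
    then have "\<mu> / (q / 2) * pair_energy s 1 F = \<mu> * (rhs1 f)\<^sup>2" using q by (simp add: field_simps)
    then show ?thesis using f less by (auto simp: lhs1_def L2_norm_nonneg)
  qed
  have r1: "rhs1 f \<ge> 0" if "adm f" for f
    using rhs1(2)[OF _ that] phi_multiplier_fourier[OF s] that unfolding adm_def by blast
  note S1 = sharp_without_extremisers[of C1 adm rhs1 lhs1 "\<lambda>f. AE x in lborel. f x = 0", OF C1(1) r1]
  have second: "(\<forall>f. adm f \<longrightarrow>
    multiplier_dom (box_symbol ((4 - real DIM('a)) / 4)) (kg_density s f) \<and> lhs1 f \<le> C1 * rhs1 f) \<and>
    (\<forall>C'. (\<forall>f. adm f \<longrightarrow> lhs1 f \<le> C' * rhs1 f) \<longrightarrow> C1 \<le> C') \<and>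
    \<not> (\<exists>f. adm f \<and> \<not> (AE x in lborel. f x = 0) \<and> lhs1 f = C1 * rhs1 f)"
    using S1[OF _ _ _ O1] E1 by blast
  show ?thesis
    unfolding Let_def
    by (rule conjI[OF first[unfolded C0_def lhs0_def rhs0_def] second[unfolded C1_def lhs1_def rhs1_def adm_def]])
qed

end
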